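(* Let $T>0$, $\mu>0$, $a>0$, $\gamma>1$, $\kappa\in(0,1)$ be fixed constants, and let $p(\varrho)=a\varrho^\gamma$. For $\varepsilon>0$ let $\Omega_\varepsilon=(0,\varepsilon)^2\times(0,1)$, with points $x=(x_1,x_2,x_3)$ and volume $|\Omega_\varepsilon|=\varepsilon^2$. Let $(\overline\varrho,\overline v,\overline w)$ be a classical solution on $(0,T)\times(0,1)$ of the one-dimensional augmented compressible Navier-Stokes system (written out in the context, with periodic boundary conditions), emanating from the initial data $\overline\varrho_0,\overline v_0,\overline w_0$, and such that, with $\overline u=\overline v-\sqrt{\tfrac{\kappa}{1-\kappa}}\,\overline w$, $$\partial_y\overline u,\quad \partial_y\log\overline\varrho,\quad \partial_y^2\log\overline\varrho\ \in L^\infty((0,T)\times(0,1)).$$ Further, for each $\varepsilon>0$, let $(\varrho_\varepsilon,\mathbf v_\varepsilon,\mathbf w_\varepsilon)$ be a global weak/$\kappa$-entropy solution (defined in the context) on $(0,T)\times\Omega_\varepsilon$ of the three-dimensional augmented compressible Navier-Stokes system, emanating from the initial data $\varrho_{0,\varepsilon},\mathbf v_{0,\varepsilon},\mathbf w_{0,\varepsilon}$. Assume that, as $\varepsilon\to0$, $$\frac1{|\Omega_\varepsilon|}\int_{\Omega_\varepsilon}\frac12\varrho_{0,\varepsilon}\left(|\mathbf w_{0,\varepsilon}-\overline w_0|^2+|\mathbf v_{0,\varepsilon}-\overline v_0|^2\right)dx+\frac1{|\Omega_\varepsilon|}\int_{\Omega_\varepsilon}\left(P(\varrho_{0,\varepsilon})-P(\overline\varrho_0)-P'(\overline\varrho_0)(\varrho_{0,\varepsilon}-\overline\varrho_0)\right)dx\to0,$$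 where $P(\varrho)=\varrho\int_1^\varrho\frac{p(s)}{s^2}\,ds$. Then $(\varrho_\varepsilon,\mathbf v_\varepsilon,\mathbf w_\varepsilon)\to(\overline\varrho,\overline v,\overline w)$ as $\varepsilon\to0$ in the following sense: $$\operatorname*{ess\,sup}_{t\in(0,T)}\frac1{|\Omega_\varepsilon|}\left\|\varrho_\varepsilon(t,\cdot)-\overline\varrho(t,\cdot)\right\|_{L^{\min\{2,\gamma\}}(\Omega_\varepsilon)}^{\min\{2,\gamma\}}\to0,$$ $$\operatorname*{ess\,sup}_{t\in(0,T)}\frac1{|\Omega_\varepsilon|}\int_{\Omega_\varepsilon}\varrho_\varepsilon\left(|\mathbf w_\varepsilon-\overline w|^2+|\mathbf v_\varepsilon-\overline v|^2\right)dx\to0.$$ (Here functions of the one-dimensional variable $y\in(0,1)$ are regarded as functions on $\Omega_\varepsilon$ with $y=x_3$, and the scalar velocities $\overline v,\overline w$, and likewise $\overline v_0,\overline w_0$, are identified with the vector fields $(0,0,\overline v(t,x_3))$, $(0,0,\overline w(t,x_3))$, etc.)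
   Context: **Notation.** $(\nabla\mathbf u)_{ij}=\partial_{x_j}\mathbf u_i$; the divergence of a matrix field is taken row-wise; $D(\mathbf u)=\frac12(\nabla\mathbf u+\nabla^T\mathbf u)$ and $A(\mathbf u)=\frac12(\nabla\mathbf u-\nabla^T\mathbf u)$ are the symmetric and antisymmetric parts of the gradient. **3D compressible Navier-Stokes system.** On $(0,T)\times\Omega_\varepsilon$, with unknown density $\varrho$ and velocity $\mathbf u$, viscosity coefficients $\mu(\varrho)=\mu\varrho$ ($\mu>0$ constant) and $\lambda(\varrho)=0$: $$\partial_t\varrho+\operatorname{div}(\varrho\mathbf u)=0,$$ $$\partial_t(\varrho\mathbf u)+\operatorname{div}(\varrho\mathbf u\otimes\mathbf u)+\nabla p(\varrho)-\operatorname{div}(2\mu\varrho D(\mathbf u))=0,$$ with prescribed initial values of $\varrho$ and $\varrho\mathbf u$, and the mixed boundary conditions: on $\partial_1\Omega=((0,\varepsilon)\times\{0,\varepsilon\}\times(0,1))\cup(\{0,\varepsilon\}\times(0,\varepsilon)\times(0,1))$ one has full slip, $\mathbf u\cdot\mathbf n=0$ and $(D(\mathbf u)\mathbf n)\cdot\boldsymbol\tau=0$ ($\mathbf n$ the outer unit normal, $\boldsymbol\tau$ any tangential vector); and periodicity in $x_3$: $\mathbf u(t,x_1,x_2,0)=\mathbf u(t,x_1,x_2,1)$, $\varrho(t,x_1,x_2,0)=\varrho(t,x_1,x_2,1)$ for all $t\in(0,T)$, $(x_1,x_2)\in(0,\varepsilon)^2$. **$\kappa$-entropy solution.** For $0<\kappa<1$,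 a couple $(\varrho,\mathbf u)$ is a global $\kappa$-entropy solution of this system if: (1) for all $\xi\in C_c^\infty([0,T)\times\Omega_\varepsilon)$, $$-\int_0^T\!\!\int_{\Omega_\varepsilon}\varrho\,\partial_t\xi\,dxdt-\int_0^T\!\!\int_{\Omega_\varepsilon}\varrho\mathbf u\cdot\nabla\xi\,dxdt=\int_{\Omega_\varepsilon}\varrho(0)\xi(0)\,dx,$$ and for all $\phi\in(C_c^\infty([0,T)\times\Omega_\varepsilon))^3$, $$-\int_0^T\!\!\int_{\Omega_\varepsilon}\varrho\mathbf u\cdot\partial_t\phi\,dxdt-\int_0^T\!\!\int_{\Omega_\varepsilon}(\varrho\mathbf u\otimes\mathbf u):\nabla\phi\,dxdt+\int_0^T\!\!\int_{\Omega_\varepsilon}2\mu(\varrho)D(\mathbf u):\nabla\phi\,dxdt$$ $$+\int_0^T\!\!\int_{\Omega_\varepsilon}\lambda(\varrho)\operatorname{div}\mathbf u\,\operatorname{div}\phi\,dxdt-\int_0^T\!\!\int_{\Omega_\varepsilon}p(\varrho)\operatorname{div}\phi\,dxdt=\int_{\Omega_\varepsilon}\varrho\mathbf u(0)\cdot\phi(0)\,dx;$$ (2) the $\kappa$-entropy estimate holds: $$\sup_{t\in[0,T]}\left[\int_{\Omega_\varepsilon}\varrho\left(\frac{|\mathbf u+2\kappa\nabla\varphi(\varrho)|^2}{2}+\frac{|2\sqrt{(1-\kappa)\kappa}\,\nabla\varphi(\varrho)|^2}{2}\right)(t)\,dx+\int_{\Omega_\varepsilon}\varrho e(\varrho)(t)\,dx\right]$$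 $$+2\kappa\int_0^T\!\!\int_{\Omega_\varepsilon}\mu(\varrho)|A(\mathbf u)|^2\,dxdt+2\kappa\int_0^T\!\!\int_{\Omega_\varepsilon}\frac{\mu'(\varrho)p'(\varrho)}{\varrho}|\nabla\varrho|^2\,dxdt$$ $$+2(1-\kappa)\int_0^T\!\!\int_{\Omega_\varepsilon}\mu(\varrho)|D(\mathbf u)|^2\,dxdt+2(1-\kappa)\int_0^T\!\!\int_{\Omega_\varepsilon}(\mu'(\varrho)\varrho-\mu(\varrho))|\operatorname{div}\mathbf u|^2\,dxdt$$ $$\le\int_{\Omega_\varepsilon}\varrho\left(\frac{|\mathbf u+2\kappa\nabla\varphi(\varrho)|^2}{2}+\frac{|2\sqrt{(1-\kappa)\kappa}\,\nabla\varphi(\varrho)|^2}{2}\right)(0)\,dx+\int_{\Omega_\varepsilon}\varrho e(\varrho)(0)\,dx,$$ where $\varphi'(\varrho)=\mu(\varrho)/\varrho$ and $\varrho^2e'(\varrho)=p(\varrho)$. In the present setting $\mu(\varrho)=\mu\varrho$, $\lambda(\varrho)=0$, $\varphi(\varrho)=\mu\log\varrho$. **3D augmented system.** Setting $\mathbf v=\mathbf u+2\kappa\mu\nabla\log\varrho$ and $\mathbf w=2\sqrt{\kappa(1-\kappa)}\,\mu\nabla\log\varrho$ (so $\mathbf u=\mathbf v-\sqrt{\kappa/(1-\kappa)}\,\mathbf w$), the augmented version of the system is $$\partial_t\varrho+\operatorname{div}(\varrho\mathbf u)=0,$$ $$\partial_t(\varrho\mathbf v)+\operatorname{div}(\varrho\mathbf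 v\otimes\mathbf u)+\nabla p(\varrho)=\mu\operatorname{div}(2\varrho(1-\kappa)D(\mathbf v))+\mu\operatorname{div}(2\kappa\varrho A(\mathbf v))-\mu\operatorname{div}(2\sqrt{\kappa(1-\kappa)}\,\varrho\nabla\mathbf w),$$ $$\partial_t(\varrho\mathbf w)+\operatorname{div}(\varrho\mathbf w\otimes\mathbf u)=\mu\operatorname{div}(2\kappa\varrho\nabla\mathbf w)-\mu\operatorname{div}(2\sqrt{\kappa(1-\kappa)}\,\varrho\nabla^T\mathbf v).$$ A global weak/$\kappa$-entropy solution $(\varrho,\mathbf v,\mathbf w)$ of the augmented system is the triple obtained from a global weak/$\kappa$-entropy solution $(\varrho,\mathbf u)$ of the 3D Navier-Stokes system (with the boundary conditions above) through these formulas for $\mathbf v$ and $\mathbf w$; its initial data are $\varrho_{0},\mathbf v_{0},\mathbf w_{0}$. **1D augmented system.** On $(0,T)\times(0,1)$, with variable $y\in(0,1)$, density $\overline\varrho$ (positive) and velocity $\overline u$, where $\overline v=\overline u+2\kappa\mu\,\partial_y\log\overline\varrho$ and $\overline w=2\sqrt{\kappa(1-\kappa)}\,\mu\,\partial_y\log\overline\varrho$: $$\partial_t\overline\varrho+\partial_y(\overline\varrho\,\overline u)=0,$$ $$\partial_t(\overline\varrho\,\overline w)+\partial_y(\overline\varrho\,\overline w\,\overline u)=-2\mu\,\partial_y(\sqrt{\kappa(1-\kappa)}\,\overline\varrho\,\partial_y\overline v)+\mu\,\partial_y(2\kappa\overline\varrho\,\partial_y\overline w),$$ $$\partial_t(\overline\varrho\,\overline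 v)+\partial_y(\overline\varrho\,\overline v\,\overline u)+\partial_yp(\overline\varrho)=(1-\kappa)2\mu\,\partial_y(\overline\varrho\,\partial_y\overline v)-\sqrt{1-\kappa}\sqrt\kappa\,2\mu\,\partial_y(\overline\varrho\,\partial_y\overline w),$$ with periodic boundary conditions $\overline u(\cdot,0)=\overline u(\cdot,1)$, $\overline\varrho(\cdot,0)=\overline\varrho(\cdot,1)$. *)

theory Defs
  imports "HOL-Analysis.Analysis" "HOL-Probability.Essential_Supremum"
begin

fun Ck :: "nat \<Rightarrow> ('a::euclidean_space \<Rightarrow> 'b::real_normed_vector) \<Rightarrow> bool" where
  "Ck 0 f \<longleftrightarrow> continuous_on UNIV f"
| "Ck (Suc k) f \<longleftrightarrow> (\<forall>x. f differentiable (at x)) \<and>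
     (\<forall>b\<in>Basis. Ck k (\<lambda>x. frechet_derivative f (at x) b))"

definition Cinfty :: "('a::euclidean_space \<Rightarrow> 'b::real_normed_vector) set" where
  "Cinfty = {f. \<forall>k. Ck k f}"

text \<open>The functions in \<open>C_c^\<infinity>([0,T) \<times> \<Omega>)\<close> are used below as the restrictions of those in \<open>C_c^\<infinity>((-\<infinity>,T) \<times> \<Omega>)\<close>.\<close>

definition Cc_infty :: "'a::euclidean_space set \<Rightarrow> ('a \<Rightarrow> 'b::real_normed_vector) set" where
  "Cc_infty U = {f \<in> Cinfty. compact (closure {z. f z \<noteq> 0}) \<and> closure {z. f z \<noteq> 0} \<subseteq> U}"

text \<open>\<open>g\<close> is the derivative of \<open>f\<close> in direction \<open>b\<close> on \<open>U\<close> in the sense of integration by parts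
  against the functions in \<open>K\<close>.  For \<open>K = Cc_infty U\<close> this is the weak derivative; if \<open>K\<close>
  contains functions that do not vanish on the boundary, it says in addition that the
  corresponding boundary term in Green's formula vanishes, which is how traces are expressed
  below.\<close>

definition weak_deriv ::
  "('a::euclidean_space \<Rightarrow> real) set \<Rightarrow> 'a set \<Rightarrow> 'a \<Rightarrow> ('a \<Rightarrow> real) \<Rightarrow> ('a \<Rightarrow> real) \<Rightarrow> bool" where
  "weak_deriv K U b f g \<longleftrightarrow>
     set_integrable lborel U f \<and> set_integrable lborel U g \<and>
     (\<forall>\<psi>\<in>K. (LINT z:U|lborel. f z * frechet_derivative \<psi> (at z) b)
            = - (LINT z:U|lborel. g z * \<psi> z))"

definition Omega :: "real \<Rightarrow> (real^3) set" where
  "Omega \<epsilon> = {x. 0 < x$1 \<and> x$1 < \<epsilon> \<and> 0 < x$2 \<and> x$2 < \<epsilon> \<and> 0 < x$3 \<and> x$3 < 1}"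

abbreviation cyl :: "real \<Rightarrow> real \<Rightarrow> (real \<times> (real^3)) set" where
  "cyl T \<epsilon> \<equiv> {0<..<T} \<times> Omega \<epsilon>"

abbreviation dir :: "3 \<Rightarrow> real \<times> (real^3)" where
  "dir j \<equiv> (0, axis j 1)"

definition dt :: "(real \<times> (real^3) \<Rightarrow> 'b::real_normed_vector) \<Rightarrow> real \<times> (real^3) \<Rightarrow> 'b" where
  "dt f z = frechet_derivative f (at z) (1, 0)"

definition grad :: "(real \<times> (real^3) \<Rightarrow> real) \<Rightarrow> real \<times> (real^3) \<Rightarrow> real^3" where
  "grad f z = (\<chi> j. frechet_derivative f (at z) (dir j))"

definition Grad :: "(real \<times> (real^3) \<Rightarrow> real^3) \<Rightarrow> real \<times> (real^3) \<Rightarrow> real^3^3" where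
  "Grad f z = (\<chi> i j. frechet_derivative f (at z) (dir j) $ i)"

definition outer :: "real^3 \<Rightarrow> real^3 \<Rightarrow> real^3^3" where
  "outer a b = (\<chi> i j. a $ i * b $ j)"

definition sym_part :: "real^3^3 \<Rightarrow> real^3^3" where
  "sym_part G = (1/2) *\<^sub>R (G + transpose G)"

definition skew_part :: "real^3^3 \<Rightarrow> real^3^3" where
  "skew_part G = (1/2) *\<^sub>R (G - transpose G)"

definition per_space_tests :: "(real^3 \<Rightarrow> real) set" where
  "per_space_tests = {\<psi> \<in> Cinfty. \<forall>x. \<psi> (x + axis 3 1) = \<psi> x}"

text \<open>Smooth up to the lateral boundary, periodic in \<open>x\<^sub>3\<close>, supported away from the times
  \<open>0\<close> and \<open>T\<close>.\<close>

definition per_tests :: "real \<Rightarrow> (real \<times> (real^3) \<Rightarrow> real) set" where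
  "per_tests T = {\<psi> \<in> Cinfty. (\<forall>t x. \<psi> (t, x + axis 3 1) = \<psi> (t, x)) \<and>
     (\<exists>\<delta>>0. \<forall>t x. \<psi> (t, x) \<noteq> 0 \<longrightarrow> \<delta> \<le> t \<and> t \<le> T - \<delta>)}"

text \<open>Vector fields tangential to the lateral boundary (where the outer normal is plus or minus a
  unit vector of the \<open>x\<^sub>1\<close> or \<open>x\<^sub>2\<close> axis), periodic in \<open>x\<^sub>3\<close>, vanishing for times close to \<open>T\<close>.\<close>

definition slip_tests :: "real \<Rightarrow> real \<Rightarrow> (real \<times> (real^3) \<Rightarrow> real^3) set" where
  "slip_tests T \<epsilon> = {\<phi> \<in> Cinfty. (\<forall>t x. \<phi> (t, x + axis 3 1) = \<phi> (t, x)) \<and>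
     (\<exists>\<delta>>0. \<forall>t x. \<phi> (t, x) \<noteq> 0 \<longrightarrow> t \<le> T - \<delta>) \<and>
     (\<forall>t x. x $ 1 \<in> {0, \<epsilon>} \<longrightarrow> \<phi> (t, x) $ 1 = 0) \<and>
     (\<forall>t x. x $ 2 \<in> {0, \<epsilon>} \<longrightarrow> \<phi> (t, x) $ 2 = 0)}"

text \<open>Throughout, \<open>g\<close> stands for the gradient of the density, \<open>G\<close> for the gradient of the velocity
  and \<open>g0\<close> for the gradient of the initial density; the functions \<open>mu\<close>, \<open>lam\<close>, \<open>phi\<close>, \<open>p\<close>, \<open>e\<close> are
  functions of the density.\<close>

definition continuity_identity ::
  "real \<Rightarrow> real \<Rightarrow> (real \<times> (real^3) \<Rightarrow> real) \<Rightarrow> (real \<times> (real^3) \<Rightarrow> real^3) \<Rightarrow>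
   (real^3 \<Rightarrow> real) \<Rightarrow> (real \<times> (real^3) \<Rightarrow> real) \<Rightarrow> bool" where
  "continuity_identity T \<epsilon> rho u rho0 \<xi> \<longleftrightarrow>
     - (LINT z:cyl T \<epsilon>|lborel. rho z * dt \<xi> z)
     - (LINT z:cyl T \<epsilon>|lborel. rho z * (u z \<bullet> grad \<xi> z))
     = (LINT x:Omega \<epsilon>|lborel. rho0 x * \<xi> (0, x))"

text \<open>The inner product of matrices is the Frobenius product.\<close>

definition momentum_identity ::
  "real \<Rightarrow> real \<Rightarrow> (real \<Rightarrow> real) \<Rightarrow> (real \<Rightarrow> real) \<Rightarrow> (real \<Rightarrow> real) \<Rightarrow>
   (real \<times> (real^3) \<Rightarrow> real) \<Rightarrow> (real \<times> (real^3) \<Rightarrow> real^3) \<Rightarrow> (real \<times> (real^3) \<Rightarrow> real^3^3) \<Rightarrow>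
   (real^3 \<Rightarrow> real) \<Rightarrow> (real^3 \<Rightarrow> real^3) \<Rightarrow> (real \<times> (real^3) \<Rightarrow> real^3) \<Rightarrow> bool" where
  "momentum_identity T \<epsilon> mu lam p rho u G rho0 u0 \<phi> \<longleftrightarrow>
     - (LINT z:cyl T \<epsilon>|lborel. rho z * (u z \<bullet> dt \<phi> z))
     - (LINT z:cyl T \<epsilon>|lborel. rho z * (outer (u z) (u z) \<bullet> Grad \<phi> z))
     + (LINT z:cyl T \<epsilon>|lborel. 2 * mu (rho z) * (sym_part (G z) \<bullet> Grad \<phi> z))
     + (LINT z:cyl T \<epsilon>|lborel. lam (rho z) * trace (G z) * trace (Grad \<phi> z))
     - (LINT z:cyl T \<epsilon>|lborel. p (rho z) * trace (Grad \<phi> z))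
     = (LINT x:Omega \<epsilon>|lborel. rho0 x * (u0 x \<bullet> \<phi> (0, x)))"

text \<open>The energy bounds control neither \<open>u\<close> nor \<open>log \<rho>\<close> where the density degenerates.  As usual
  for degenerate viscosities, the gradient of \<open>u\<close> is the field \<open>G\<close> with
  \<open>\<nabla>(\<rho>u) = \<rho>G + u \<otimes> \<nabla>\<rho>\<close>, and \<open>\<nabla>\<phi>(\<rho>)\<close> is \<open>\<phi>'(\<rho>)\<nabla>\<rho>\<close>.
  The derivatives of \<open>\<rho>\<close> and \<open>\<rho>u\<close> are integrable up to the boundary, so that these two have traces.\<close>

definition momentum_gradient_entry ::
  "(real \<times> (real^3) \<Rightarrow> real) \<Rightarrow> (real \<times> (real^3) \<Rightarrow> real^3) \<Rightarrow> (real \<times> (real^3) \<Rightarrow> real^3) \<Rightarrow>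
   (real \<times> (real^3) \<Rightarrow> real^3^3) \<Rightarrow> 3 \<Rightarrow> 3 \<Rightarrow> real \<times> (real^3) \<Rightarrow> real" where
  "momentum_gradient_entry rho u g G i j z = rho z * G z $ i $ j + u z $ i * g z $ j"

definition gradients where
  "gradients T \<epsilon> rho u g G \<longleftrightarrow>
     (\<forall>j. weak_deriv (Cc_infty (cyl T \<epsilon>)) (cyl T \<epsilon>) (dir j) rho (\<lambda>z. g z $ j)) \<and>
     (\<forall>i j. weak_deriv (Cc_infty (cyl T \<epsilon>)) (cyl T \<epsilon>) (dir j)
        (\<lambda>z. rho z * u z $ i) (momentum_gradient_entry rho u g G i j))"

text \<open>In this order: equality of the traces of \<open>\<rho>\<close> and \<open>\<rho>u\<close> at \<open>x\<^sub>3 = 0\<close> and \<open>x\<^sub>3 = 1\<close>; vanishing of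
  the normal trace on the lateral boundary; and the conditions on the stress.  The latter has no
  trace, so that \<open>(D(u)n)\<cdot>\<tau> = 0\<close> (and periodicity) is the natural boundary condition of the
  momentum equation: no boundary term appears when testing with fields that are tangential on the
  lateral boundary and periodic in \<open>x\<^sub>3\<close>.\<close>

definition boundary_conditions where
  "boundary_conditions T \<epsilon> mu lam p rho u g G rho0 u0 \<longleftrightarrow>
     weak_deriv (per_tests T) (cyl T \<epsilon>) (dir 3) rho (\<lambda>z. g z $ 3) \<and>
     (\<forall>i. weak_deriv (per_tests T) (cyl T \<epsilon>) (dir 3)
        (\<lambda>z. rho z * u z $ i) (momentum_gradient_entry rho u g G i 3)) \<and>
     (\<forall>j\<in>{1, 2}. weak_deriv (per_tests T) (cyl T \<epsilon>) (dir j)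
        (\<lambda>z. rho z * u z $ j) (momentum_gradient_entry rho u g G j j)) \<and>
     (\<forall>\<phi>\<in>slip_tests T \<epsilon>. momentum_identity T \<epsilon> mu lam p rho u G rho0 u0 \<phi>)"

definition kinetic_density :: "real \<Rightarrow> (real \<Rightarrow> real) \<Rightarrow> real \<Rightarrow> real^3 \<Rightarrow> real^3 \<Rightarrow> real" where
  "kinetic_density \<kappa> phi r u g =
     r * ((norm (u + (2 * \<kappa>) *\<^sub>R (deriv phi r *\<^sub>R g)))\<^sup>2 / 2
        + (norm ((2 * sqrt ((1 - \<kappa>) * \<kappa>)) *\<^sub>R (deriv phi r *\<^sub>R g)))\<^sup>2 / 2)"

definition dissipation_density ::
  "real \<Rightarrow> (real \<Rightarrow> real) \<Rightarrow> (real \<Rightarrow> real) \<Rightarrow> real \<Rightarrow> real^3 \<Rightarrow> real^3^3 \<Rightarrow> real" where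
  "dissipation_density \<kappa> mu p r g G =
     2 * \<kappa> * (mu r * (norm (skew_part G))\<^sup>2)
     + 2 * \<kappa> * (deriv mu r * deriv p r / r * (norm g)\<^sup>2)
     + 2 * (1 - \<kappa>) * (mu r * (norm (sym_part G))\<^sup>2)
     + 2 * (1 - \<kappa>) * ((deriv mu r * r - mu r) * (trace G)\<^sup>2)"

text \<open>The estimate bounds, for almost every time, the energy at that time plus the dissipation up
  to that time.  (Adding the dissipation over all of \<open>(0,T)\<close> to the supremum of the energy
  is a stronger requirement, which only solutions without dissipation can meet.)\<close>

definition entropy_estimate where
  "entropy_estimate T \<epsilon> \<kappa> mu phi p e rho u g G rho0 u0 g0 \<longleftrightarrow>
     set_integrable lborel (Omega \<epsilon>) (\<lambda>x. kinetic_density \<kappa> phi (rho0 x) (u0 x) (g0 x)) \<and>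
     set_integrable lborel (Omega \<epsilon>) (\<lambda>x. rho0 x * e (rho0 x)) \<and>
     set_integrable lborel (cyl T \<epsilon>) (\<lambda>z. dissipation_density \<kappa> mu p (rho z) (g z) (G z)) \<and>
     (AE \<tau> in lborel. 0 < \<tau> \<and> \<tau> < T \<longrightarrow>
        set_integrable lborel (Omega \<epsilon>)
          (\<lambda>x. kinetic_density \<kappa> phi (rho (\<tau>, x)) (u (\<tau>, x)) (g (\<tau>, x))) \<and>
        set_integrable lborel (Omega \<epsilon>) (\<lambda>x. rho (\<tau>, x) * e (rho (\<tau>, x))) \<and>
        (LINT x:Omega \<epsilon>|lborel. kinetic_density \<kappa> phi (rho (\<tau>, x)) (u (\<tau>, x)) (g (\<tau>, x)))
        + (LINT x:Omega \<epsilon>|lborel. rho (\<tau>, x) * e (rho (\<tau>, x)))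
        + (LINT z:cyl \<tau> \<epsilon>|lborel. dissipation_density \<kappa> mu p (rho z) (g z) (G z))
        \<le> (LINT x:Omega \<epsilon>|lborel. kinetic_density \<kappa> phi (rho0 x) (u0 x) (g0 x))
          + (LINT x:Omega \<epsilon>|lborel. rho0 x * e (rho0 x)))"

definition initial_gradient where
  "initial_gradient \<epsilon> rho0 g0 \<longleftrightarrow>
     (\<forall>j. weak_deriv (Cc_infty (Omega \<epsilon>)) (Omega \<epsilon>) (axis j 1) rho0 (\<lambda>x. g0 x $ j)) \<and>
     weak_deriv per_space_tests (Omega \<epsilon>) (axis 3 1) rho0 (\<lambda>x. g0 x $ 3)"

definition entropy_solution where
  "entropy_solution T \<epsilon> \<kappa> mu lam phi p e rho u g G rho0 u0 g0 \<longleftrightarrow>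
     (set_borel_measurable lborel (cyl T \<epsilon>) rho \<and>
      set_borel_measurable lborel (cyl T \<epsilon>) u \<and>
      set_borel_measurable lborel (cyl T \<epsilon>) G \<and>
      set_borel_measurable lborel (Omega \<epsilon>) rho0 \<and>
      set_borel_measurable lborel (Omega \<epsilon>) u0) \<and>
     (AE z in lborel. z \<in> cyl T \<epsilon> \<longrightarrow> rho z > 0) \<and>
     (AE x in lborel. x \<in> Omega \<epsilon> \<longrightarrow> rho0 x > 0) \<and>
     gradients T \<epsilon> rho u g G \<and>
     initial_gradient \<epsilon> rho0 g0 \<and>
     (set_integrable lborel (cyl T \<epsilon>) (\<lambda>z. rho z * (norm (u z))\<^sup>2) \<and>
      set_integrable lborel (cyl T \<epsilon>) (\<lambda>z. mu (rho z) *\<^sub>R sym_part (G z)) \<and>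
      set_integrable lborel (cyl T \<epsilon>) (\<lambda>z. lam (rho z) * trace (G z)) \<and>
      set_integrable lborel (cyl T \<epsilon>) (\<lambda>z. p (rho z)) \<and>
      set_integrable lborel (Omega \<epsilon>) (\<lambda>x. rho0 x *\<^sub>R u0 x)) \<and>
     (\<forall>\<xi>\<in>Cc_infty ({..<T} \<times> Omega \<epsilon>). continuity_identity T \<epsilon> rho u rho0 \<xi>) \<and>
     (\<forall>\<phi>\<in>Cc_infty ({..<T} \<times> Omega \<epsilon>). momentum_identity T \<epsilon> mu lam p rho u G rho0 u0 \<phi>) \<and>
     boundary_conditions T \<epsilon> mu lam p rho u g G rho0 u0 \<and>
     entropy_estimate T \<epsilon> \<kappa> mu phi p e rho u g G rho0 u0 g0"

definition augmented_solution_3d ::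
  "real \<Rightarrow> real \<Rightarrow> real \<Rightarrow> real \<Rightarrow> (real \<Rightarrow> real) \<Rightarrow> (real \<Rightarrow> real) \<Rightarrow>
   (real \<times> (real^3) \<Rightarrow> real) \<Rightarrow> (real \<times> (real^3) \<Rightarrow> real^3) \<Rightarrow> (real \<times> (real^3) \<Rightarrow> real^3) \<Rightarrow>
   (real^3 \<Rightarrow> real) \<Rightarrow> (real^3 \<Rightarrow> real^3) \<Rightarrow> (real^3 \<Rightarrow> real^3) \<Rightarrow> bool" where
  "augmented_solution_3d T \<epsilon> \<kappa> \<mu> p e rho v w rho0 v0 w0 \<longleftrightarrow>
     set_borel_measurable lborel (cyl T \<epsilon>) v \<and>
     set_borel_measurable lborel (cyl T \<epsilon>) w \<and>
     set_borel_measurable lborel (Omega \<epsilon>) v0 \<and>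
     set_borel_measurable lborel (Omega \<epsilon>) w0 \<and>
     (\<exists>u g G u0 g0.
        entropy_solution T \<epsilon> \<kappa> (\<lambda>r. \<mu> * r) (\<lambda>r. 0) (\<lambda>r. \<mu> * ln r) p e rho u g G rho0 u0 g0 \<and>
        (AE z in lborel. z \<in> cyl T \<epsilon> \<longrightarrow>
           v z = u z + (2 * \<kappa> * \<mu>) *\<^sub>R ((1 / rho z) *\<^sub>R g z) \<and>
           w z = (2 * sqrt (\<kappa> * (1 - \<kappa>)) * \<mu>) *\<^sub>R ((1 / rho z) *\<^sub>R g z)) \<and>
        (AE x in lborel. x \<in> Omega \<epsilon> \<longrightarrow>
           v0 x = u0 x + (2 * \<kappa> * \<mu>) *\<^sub>R ((1 / rho0 x) *\<^sub>R g0 x) \<and>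
           w0 x = (2 * sqrt (\<kappa> * (1 - \<kappa>)) * \<mu>) *\<^sub>R ((1 / rho0 x) *\<^sub>R g0 x)))"

text \<open>Functions on \<open>(0,1)\<close> with periodic boundary conditions are taken as 1-periodic functions on
  the real line, with the regularity required on all of it.\<close>

definition classical_periodic :: "real \<Rightarrow> (real \<Rightarrow> real \<Rightarrow> real) \<Rightarrow> bool" where
  "classical_periodic T f \<longleftrightarrow>
     (\<forall>t\<in>{0..<T}. \<forall>y. f t (y + 1) = f t y) \<and>
     continuous_on ({0..<T} \<times> UNIV) (\<lambda>(t, y). f t y) \<and>
     (\<forall>t\<in>{0<..<T}. \<forall>y. (\<lambda>s. f s y) field_differentiable at t \<and>
        f t field_differentiable at y \<and> deriv (f t) field_differentiable at y) \<and>
     continuous_on ({0<..<T} \<times> UNIV) (\<lambda>(t, y). deriv (\<lambda>s. f s y) t) \<and>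
     continuous_on ({0<..<T} \<times> UNIV) (\<lambda>(t, y). deriv (f t) y) \<and>
     continuous_on ({0<..<T} \<times> UNIV) (\<lambda>(t, y). deriv (deriv (f t)) y)"

definition velocity_1d ::
  "real \<Rightarrow> (real \<Rightarrow> real \<Rightarrow> real) \<Rightarrow> (real \<Rightarrow> real \<Rightarrow> real) \<Rightarrow> real \<Rightarrow> real \<Rightarrow> real" where
  "velocity_1d \<kappa> v w t y = v t y - sqrt (\<kappa> / (1 - \<kappa>)) * w t y"

definition augmented_solution_1d ::
  "real \<Rightarrow> real \<Rightarrow> real \<Rightarrow> (real \<Rightarrow> real) \<Rightarrow>
   (real \<Rightarrow> real \<Rightarrow> real) \<Rightarrow> (real \<Rightarrow> real \<Rightarrow> real) \<Rightarrow> (real \<Rightarrow> real \<Rightarrow> real) \<Rightarrow>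
   (real \<Rightarrow> real) \<Rightarrow> (real \<Rightarrow> real) \<Rightarrow> (real \<Rightarrow> real) \<Rightarrow> bool" where
  "augmented_solution_1d T \<kappa> \<mu> p \<rho> v w \<rho>0 v0 w0 \<longleftrightarrow>
     classical_periodic T \<rho> \<and> classical_periodic T v \<and> classical_periodic T w \<and>
     (\<forall>t\<in>{0..<T}. \<forall>y. \<rho> t y > 0) \<and>
     (\<forall>y\<in>{0<..<1}. \<rho> 0 y = \<rho>0 y \<and> v 0 y = v0 y \<and> w 0 y = w0 y) \<and>
     (let u = velocity_1d \<kappa> v w in
      \<forall>t\<in>{0<..<T}. \<forall>y.
        v t y = u t y + 2 * \<kappa> * \<mu> * deriv (\<lambda>z. ln (\<rho> t z)) y \<and>
        w t y = 2 * sqrt (\<kappa> * (1 - \<kappa>)) * \<mu> * deriv (\<lambda>z. ln (\<rho> t z)) y \<and>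
        deriv (\<lambda>s. \<rho> s y) t + deriv (\<lambda>z. \<rho> t z * u t z) y = 0 \<and>
        deriv (\<lambda>s. \<rho> s y * w s y) t + deriv (\<lambda>z. \<rho> t z * w t z * u t z) y
          = - 2 * \<mu> * deriv (\<lambda>z. sqrt (\<kappa> * (1 - \<kappa>)) * \<rho> t z * deriv (v t) z) y
            + \<mu> * deriv (\<lambda>z. 2 * \<kappa> * \<rho> t z * deriv (w t) z) y \<and>
        deriv (\<lambda>s. \<rho> s y * v s y) t + deriv (\<lambda>z. \<rho> t z * v t z * u t z) y
          + deriv (\<lambda>z. p (\<rho> t z)) y
          = (1 - \<kappa>) * 2 * \<mu> * deriv (\<lambda>z. \<rho> t z * deriv (v t) z) y
            - sqrt (1 - \<kappa>) * sqrt \<kappa> * 2 * \<mu> * deriv (\<lambda>z. \<rho> t z * deriv (w t) z) y)"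

definition Linfty_on :: "'a::euclidean_space set \<Rightarrow> ('a \<Rightarrow> real) \<Rightarrow> bool" where
  "Linfty_on A f \<longleftrightarrow> set_borel_measurable lborel A f \<and>
     (\<exists>C. AE z in lborel. z \<in> A \<longrightarrow> \<bar>f z\<bar> \<le> C)"

definition pressure :: "real \<Rightarrow> real \<Rightarrow> real \<Rightarrow> real" where
  "pressure a \<gamma> r = a * r powr \<gamma>"

definition pressure_potential :: "(real \<Rightarrow> real) \<Rightarrow> real \<Rightarrow> real" where
  "pressure_potential p r = r * (LBINT s=ereal 1..ereal r. p s / s\<^sup>2)"

definition vertical :: "real \<Rightarrow> real^3" where
  "vertical s = s *\<^sub>R axis 3 1"

end

theory Submission
  imports Defs "HOL-Real_Asymp.Real_Asymp" "HOL-Library.Periodic_Fun"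
begin

text \<open>The proof is by relative entropy.  The relative energy of the three-dimensional solution with respect to the
  one-dimensional one is the energy of the \<open>\<kappa>\<close>-entropy estimate plus terms that are linear in \<open>\<rho>\<close>, \<open>\<rho>u\<^sub>3\<close> and \<open>\<partial>\<^sub>3\<rho>\<close>.
  For these, only test functions of \<open>t\<close> and \<open>x\<^sub>3\<close> are needed: the slip condition makes such vertical fields admissible, and all
  equations become one-dimensional ones.  In particular \<open>\<partial>\<^sub>3\<rho>\<close> satisfies an equation obtained by differentiating the continuity
  equation, which replaces the weak form of the equation for the drift \<open>w\<close>.  After adding terms whose integrals vanish by
  periodicity, the integrand of the balance is pointwise at most the dissipation plus a multiple \<open>C\<close> of the relative energy
  density, where \<open>C\<close> depends only on the bounds of the one-dimensional solution and not on \<open>\<epsilon>\<close>.  Gronwall's inequality then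
  bounds the relative energy at almost every time by \<open>exp (C T)\<close> times its initial value.  Integrability is uniform only away
  from the final time, since the one-dimensional solution may blow up there; so Gronwall is applied on \<open>(0,T')\<close> for all \<open>T' < T\<close>.\<close>

section \<open>Smooth functions\<close>

text \<open>The obstacle is regularity on both sides. The weak equations hold for smooth test
  functions, and localising them in time costs one null set per test function; the one-dimensional
  solution is only once continuously differentiable in time, with no control of its derivatives at t
  = 0 or t = T. Hence the balance is first derived on (\<delta>, \<tau>) with trigonometric
  approximations of the test functions, and \<delta> then tends to 0 along admissible times. This
  works because the solution, unlike its derivatives, is continuous at t = 0 and because the entropy
  estimate gives an L1 bound uniform in time. A second obstacle is that the continuity equation is
  tested only inside the domain. Cut-offs of functions of x3 have unbounded gradients, so the flux
  is first turned into a divergence, and the boundary conditions enter after the cut-off is removed.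
  The sign of the result comes from the entropy estimate: its dissipation up to time \<tau> cancels
  the dissipation that bounds the growth of the linear part.\<close>

lemma Ck_Suc_imp: "Ck (Suc k) f \<Longrightarrow> Ck k f"
proof (induction k arbitrary: f)
  case 0
  then show ?case
    by (auto intro!: differentiable_imp_continuous_on simp: differentiable_on_def)
next
  case (Suc k)
  then show ?case by (metis Ck.simps(2))
qed

lemma Ck_SucI:
  assumes "\<And>x. (f has_derivative f' x) (at x)" "\<And>b. b \<in> Basis \<Longrightarrow> Ck k (\<lambda>x. f' x b)"
  shows "Ck (Suc k) f"
proof -
  have "frechet_derivative f (at x) = f' x" for x
    using frechet_derivative_at[OF assms(1)] by simp
  then show ?thesis
    using assms by (auto simp: differentiable_def)
qed

lemma Ck_SucD:
  assumes "Ck (Suc k) f"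
  shows "(f has_derivative frechet_derivative f (at x)) (at x)"
    and "b \<in> Basis \<Longrightarrow> Ck k (\<lambda>x. frechet_derivative f (at x) b)"
  using assms by (auto simp: frechet_derivative_works)

lemma Ck_add:
  assumes "Ck k f" "Ck k g" shows "Ck k (\<lambda>x. f x + g x)"
  using assms
proof (induction k arbitrary: f g)
  case (Suc k)
  show ?case
    by (rule Ck_SucI[OF has_derivative_add[OF Ck_SucD(1)[OF Suc.prems(1)] Ck_SucD(1)[OF Suc.prems(2)]]])
       (use Suc in \<open>auto intro!: Suc.IH\<close>)
qed (auto intro: continuous_intros)

lemma Ck_mult:
  fixes f g :: "'a::euclidean_space \<Rightarrow> real"
  assumes "Ck k f" "Ck k g" shows "Ck k (\<lambda>x. f x * g x)"
  using assms
proof (induction k arbitrary: f g)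
  case (Suc k)
  show ?case
    by (rule Ck_SucI[OF has_derivative_mult[OF Ck_SucD(1)[OF Suc.prems(1)] Ck_SucD(1)[OF Suc.prems(2)]]])
       (use Suc in \<open>auto intro!: Ck_add Suc.IH Ck_Suc_imp[of k f] Ck_Suc_imp[of k g] simp del: Ck.simps intro: Ck_SucD\<close>)
qed (auto intro: continuous_intros)

lemma Ck_const: "Ck k (\<lambda>x. c)"
proof (induction k arbitrary: c)
  case (Suc k)
  show ?case by (rule Ck_SucI[where f' = "\<lambda>x h. 0"]) (auto intro: Suc)
qed auto

lemma Ck_scaleR_const:
  assumes "Ck k f" shows "Ck k (\<lambda>x. f x *\<^sub>R c)"
  using assms
proof (induction k arbitrary: f)
  case (Suc k)
  show ?case
    by (rule Ck_SucI[OF has_derivative_scaleR_left[OF Ck_SucD(1)[OF Suc.prems(1)]]])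
       (use Suc in \<open>auto intro!: Suc.IH\<close>)
qed (auto intro: continuous_intros)

lemma frechet_derivative_real:
  fixes h :: "real \<Rightarrow> real"
  assumes "Ck (Suc k) h"
  shows "frechet_derivative h (at s) r = frechet_derivative h (at s) 1 * r"
proof -
  have "linear (frechet_derivative h (at s))"
    using assms by (auto intro: linear_frechet_derivative)
  from linear_cmul[OF this, of r 1] show ?thesis by simp
qed

lemma frechet_derivative_real_DERIV:
  fixes h :: "real \<Rightarrow> real"
  assumes "Ck (Suc k) h"
  shows "(h has_real_derivative frechet_derivative h (at x) 1) (at x)"
proof -
  have "frechet_derivative h (at x) = (\<lambda>r. frechet_derivative h (at x) 1 * r)"
    by (intro ext frechet_derivative_real[OF assms])
  then show ?thesis
    using Ck_SucD(1)[OF assms, of x] unfolding has_field_derivative_def by metis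
qed

text \<open>Along a direction b the chain rule contributes only the constant factor
  \<open>l b\<close>, so the induction stays within composites with the same linear map.\<close>

lemma Ck_compose_linear:
  fixes l :: "'a::euclidean_space \<Rightarrow> real" and h :: "real \<Rightarrow> real"
  assumes "Ck k h" "bounded_linear l" shows "Ck k (\<lambda>x. h (l x))"
  using assms(1)
proof (induction k arbitrary: h)
  case 0
  then show ?case
    using continuous_on_compose2[of UNIV h UNIV l] assms(2)
    by (auto intro: linear_continuous_on)
next
  case (Suc k)
  have D: "((\<lambda>x. h (l x)) has_derivative (\<lambda>b. frechet_derivative h (at (l x)) (l b))) (at x)" for x
    using has_derivative_compose[OF bounded_linear_imp_has_derivative[OF assms(2)] Ck_SucD(1)[OF Suc.prems]] .
  have E: "frechet_derivative h (at s) r = frechet_derivative h (at s) 1 * r" for s r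
    by (rule frechet_derivative_real[OF Suc.prems])
  show ?case
  proof (rule Ck_SucI[OF D])
    fix b :: 'a assume "b \<in> Basis"
    have "Ck k (\<lambda>x. frechet_derivative h (at (l x)) 1)"
      using Suc.IH[OF Ck_SucD(2)[OF Suc.prems, of 1]] by simp
    then show "Ck k (\<lambda>x. frechet_derivative h (at (l x)) (l b))"
      by (subst E) (intro Ck_mult Ck_const)
  qed
qed

lemma Ck_real:
  assumes "\<And>x. (h has_real_derivative h' x) (at x)" "Ck k h'"
  shows "Ck (Suc k) h"
proof (rule Ck_SucI)
  show "(h has_derivative (\<lambda>y. h' x * y)) (at x)" for x
    using assms(1) by (simp add: has_field_derivative_def)
qed (use assms(2) in auto)

lemma Cinfty_real:
  assumes "\<And>x. (h has_real_derivative h' x) (at x)" "h' \<in> Cinfty"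
  shows "h \<in> Cinfty"
proof -
  have "Ck (Suc k) h" for k
    using Ck_real[OF assms(1)] assms(2) by (simp add: Cinfty_def del: Ck.simps)
  then show ?thesis
    using Ck_Suc_imp unfolding Cinfty_def by blast
qed

lemma Cinfty_add: "f \<in> Cinfty \<Longrightarrow> g \<in> Cinfty \<Longrightarrow> (\<lambda>x. f x + g x) \<in> Cinfty"
  by (auto simp: Cinfty_def intro: Ck_add)

lemma Cinfty_mult:
  fixes f g :: "'a::euclidean_space \<Rightarrow> real"
  shows "f \<in> Cinfty \<Longrightarrow> g \<in> Cinfty \<Longrightarrow> (\<lambda>x. f x * g x) \<in> Cinfty"
  by (auto simp: Cinfty_def intro: Ck_mult)

lemma Cinfty_const: "(\<lambda>x. c) \<in> Cinfty"
  by (auto simp: Cinfty_def intro: Ck_const)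

lemma Cinfty_scaleR_const: "f \<in> Cinfty \<Longrightarrow> (\<lambda>x. f x *\<^sub>R c) \<in> Cinfty"
  by (auto simp: Cinfty_def intro: Ck_scaleR_const)

lemma Cinfty_compose_linear:
  fixes l :: "'a::euclidean_space \<Rightarrow> real" and h :: "real \<Rightarrow> real"
  shows "h \<in> Cinfty \<Longrightarrow> bounded_linear l \<Longrightarrow> (\<lambda>x. h (l x)) \<in> Cinfty"
  by (auto simp: Cinfty_def intro: Ck_compose_linear)

lemma Cinfty_continuous: "f \<in> Cinfty \<Longrightarrow> continuous_on UNIV f"
  unfolding Cinfty_def using Ck.simps(1) by blast

lemma Cinfty_DERIV:
  fixes h :: "real \<Rightarrow> real"
  assumes "h \<in> Cinfty"
  shows "(h has_real_derivative deriv h x) (at x)" "deriv h \<in> Cinfty"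
proof -
  have 1: "Ck (Suc k) h" for k
    using assms by (auto simp: Cinfty_def simp del: Ck.simps)
  have 2: "(h has_real_derivative frechet_derivative h (at x) 1) (at x)" for x
    by (rule frechet_derivative_real_DERIV[OF 1])
  then have 3: "deriv h = (\<lambda>x. frechet_derivative h (at x) 1)"
    by (intro ext DERIV_imp_deriv)
  show "(h has_real_derivative deriv h x) (at x)" using 2 3 by simp
  show "deriv h \<in> Cinfty"
    using Ck_SucD(2)[OF 1, of 1] unfolding 3 Cinfty_def by (auto simp del: Ck.simps)
qed

lemma Cinfty_power:
  fixes f :: "'a::euclidean_space \<Rightarrow> real"
  shows "f \<in> Cinfty \<Longrightarrow> (\<lambda>x. f x ^ n) \<in> Cinfty"
  by (induction n) (auto intro: Cinfty_mult Cinfty_const)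

lemma Cinfty_cos_sin: "cos \<in> (Cinfty :: (real \<Rightarrow> real) set)" "sin \<in> (Cinfty :: (real \<Rightarrow> real) set)"
proof -
  have "Ck k (\<lambda>x. cos x :: real) \<and> Ck k (\<lambda>x. sin x :: real)" for k
  proof (induction k)
    case 0
    show ?case by (auto intro: continuous_intros)
  next
    case (Suc k)
    have "Ck (Suc k) (\<lambda>x. cos x :: real)"
    proof (rule Ck_real)
      show "(cos has_real_derivative (- 1) * sin x) (at x)" for x
        by (auto intro!: derivative_eq_intros)
      show "Ck k (\<lambda>x::real. (- 1) * sin x)"
        using Ck_mult[OF Ck_const[of k "-1"]] Suc by blast
    qed
    moreover have "Ck (Suc k) (\<lambda>x. sin x :: real)"
      by (rule Ck_real[where h' = cos]) (use Suc in \<open>auto intro!: derivative_eq_intros\<close>)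
    ultimately show ?case by blast
  qed
  then show "cos \<in> (Cinfty :: (real \<Rightarrow> real) set)" "sin \<in> (Cinfty :: (real \<Rightarrow> real) set)"
    by (auto simp: Cinfty_def)
qed

lemma Cinfty_affine:
  fixes h :: "real \<Rightarrow> real"
  assumes "h \<in> Cinfty" shows "(\<lambda>x. h (c * x + d)) \<in> Cinfty"
proof -
  have "Ck k (\<lambda>x. h (c * x + d))" if "Ck k h" for k and h :: "real \<Rightarrow> real"
    using that
  proof (induction k arbitrary: h)
    case 0
    then have "continuous_on UNIV h" by simp
    from continuous_on_compose2[OF this, of UNIV "\<lambda>x. c * x + d"] show ?case
      by (simp add: continuous_intros)
  next
    case (Suc k h)
    have 2: "(h has_real_derivative frechet_derivative h (at x) 1) (at x)" for x
      by (rule frechet_derivative_real_DERIV[OF Suc.prems])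
    show ?case
    proof (rule Ck_real)
      show "((\<lambda>x. h (c * x + d)) has_real_derivative frechet_derivative h (at (c * x + d)) 1 * c) (at x)" for x
        by (rule DERIV_chain2[OF 2]) (auto intro!: derivative_eq_intros)
      show "Ck k (\<lambda>x. frechet_derivative h (at (c * x + d)) 1 * c)"
        using Suc.IH[OF Ck_SucD(2)[OF Suc.prems, of 1]] by (intro Ck_mult Ck_const) auto
    qed
  qed
  then show ?thesis using assms by (auto simp: Cinfty_def)
qed

section \<open>Smooth cut-offs\<close>

definition smooth_step :: "real \<Rightarrow> real" where
  "smooth_step x = (if x > 0 then exp (- (1 / x)) else 0)"

lemma smooth_step_bounds: "0 \<le> smooth_step x" "smooth_step x \<le> 1"
  by (auto simp: smooth_step_def)

text \<open>The functions p(1/x) exp(-1/x), extended by 0 to the left half-line, are closed under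
  differentiation: the derivative belongs to the polynomial X^2 (p - p'). Continuity of the whole
  family therefore gives smoothness of each member.\<close>

lemma smooth_step_Cinfty: "smooth_step \<in> Cinfty"
proof -
  define F where "F = (\<lambda>p x. if x > 0 then poly p (1 / x) * exp (- (1 / x)) else (0::real))"
  have lim: "((\<lambda>x. poly p (1 / x) * exp (- (1 / x))) \<longlongrightarrow> 0) (at_right 0)" for p :: "real poly"
  proof -
    have "((\<lambda>y. poly p y * exp (- y)) \<longlongrightarrow> 0) at_top"
    proof -
      have "((\<lambda>y. \<Sum>i\<le>degree p. coeff p i * (y ^ i / exp y)) \<longlongrightarrow> (\<Sum>i\<le>degree p. coeff p i * 0)) at_top"
        by (intro tendsto_sum tendsto_mult tendsto_const tendsto_power_div_exp_0)
      moreover have "(\<lambda>y. \<Sum>i\<le>degree p. coeff p i * (y ^ i / exp y)) = (\<lambda>y. poly p y * exp (- y))"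
        by (simp add: fun_eq_iff poly_altdef sum_distrib_left exp_minus divide_inverse mult_ac)
      ultimately show ?thesis by simp
    qed
    from filterlim_compose[OF this filterlim_inverse_at_top_right]
    show ?thesis by (simp add: inverse_eq_divide)
  qed
  have limF: "((\<lambda>x. F p x) \<longlongrightarrow> 0) (at 0)" for p
  proof (rule filterlim_split_at)
    have "\<forall>\<^sub>F x in at_left 0. F p x = (0::real)"
      by (auto simp: eventually_at_left_field F_def intro!: exI[of _ "-1"])
    then show "(F p \<longlongrightarrow> 0) (at_left 0)" by (rule tendsto_eventually)
    have "\<forall>\<^sub>F x in at_right 0. poly p (1 / x) * exp (- (1 / x)) = F p x"
      by (auto simp: eventually_at_right_field F_def intro!: exI[of _ "1"])
    then show "(F p \<longlongrightarrow> 0) (at_right 0)" by (rule Lim_transform_eventually[OF lim])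
  qed
  have der: "(F p has_real_derivative F ([:0,0,1:] * (p - pderiv p)) x) (at x)" for p x
  proof (cases x "0::real" rule: linorder_cases)
    case greater
    have "((\<lambda>x. poly p (1 / x) * exp (- (1 / x))) has_real_derivative F ([:0,0,1:] * (p - pderiv p)) x) (at x)"
      using greater unfolding F_def
      by (auto intro!: derivative_eq_intros DERIV_chain2[OF poly_DERIV] simp: field_simps power2_eq_square)
    then show ?thesis
      by (rule has_field_derivative_transform_within_open[where S = "{0<..}"]) (use greater in \<open>auto simp: F_def\<close>)
  next
    case less
    have "((\<lambda>x. 0) has_real_derivative 0) (at x)" by simp
    then have "(F p has_real_derivative 0) (at x)"
      by (rule has_field_derivative_transform_within_open[where S = "{..<0}"]) (use less in \<open>auto simp: F_def\<close>)
    then show ?thesis using less by (simp add: F_def)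
  next
    case equal
    have "((\<lambda>h. F p h / h) \<longlongrightarrow> 0) (at 0)"
    proof -
      \<comment> \<open>The difference quotient at 0 is again a member of the family, with
        polynomial X p, so its limit is known.\<close>
      have "F p h / h = F (pCons 0 p) h" for h by (auto simp: F_def)
      then show ?thesis using limF[of "pCons 0 p"] by simp
    qed
    then show ?thesis
      using equal by (simp add: DERIV_def F_def cong: if_cong)
  qed
  have "Ck k (F p)" for k p
  proof (induction k arbitrary: p)
    case 0
    show ?case using DERIV_isCont[OF der] by (auto intro: continuous_at_imp_continuous_on)
  next
    case (Suc k)
    show ?case by (rule Ck_real[OF der Suc])
  qed
  moreover have "smooth_step = F 1" by (auto simp: smooth_step_def F_def)
  ultimately have "Ck k smooth_step" for k by metis
  then show ?thesis by (simp add: Cinfty_def)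
qed

text \<open>The height 1 is reached only in the limit of large n, where the functions converge
  pointwise to the indicator of (a, b). The shift by -1 inside the steps keeps the support in
  [a + 1/n, b - 1/n], a compact part of the open interval.\<close>

definition plateau :: "real \<Rightarrow> real \<Rightarrow> nat \<Rightarrow> real \<Rightarrow> real" where
  "plateau a b n x = smooth_step (real n * (x - a) - 1) * smooth_step (real n * (b - x) - 1)"

lemma plateau_bounds: "0 \<le> plateau a b n x" "plateau a b n x \<le> 1"
  by (auto simp: plateau_def smooth_step_bounds intro!: mult_le_one)

lemma plateau_Cinfty: "plateau a b n \<in> Cinfty"
proof -
  have "(\<lambda>x. smooth_step (real n * x + (- real n * a - 1)) * smooth_step (- real n * x + (real n * b - 1))) \<in> Cinfty"
    by (intro Cinfty_mult Cinfty_affine smooth_step_Cinfty)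
  then show ?thesis
    by (simp add: plateau_def[abs_def] algebra_simps)
qed

lemma plateau_support:
  assumes "plateau a b n x \<noteq> 0"
  shows "n > 0" "a + 1 / real n \<le> x" "x \<le> b - 1 / real n"
proof -
  from assms have *: "real n * (x - a) > 1" "real n * (b - x) > 1"
    by (auto simp: plateau_def smooth_step_def split: if_splits)
  then show n: "n > 0" by (cases n) auto
  then show "a + 1 / real n \<le> x" "x \<le> b - 1 / real n"
    using * by (auto simp: field_simps)
qed

lemma smooth_step_LIMSEQ: "c > 0 \<Longrightarrow> (\<lambda>n. smooth_step (real n * c - 1)) \<longlonglongrightarrow> 1"
proof -
  assume c: "c > 0"
  have "(\<lambda>n. exp (- (1 / (real n * c - 1)))) \<longlonglongrightarrow> 1"
    using c by real_asymp
  moreover have "\<forall>\<^sub>F n in sequentially. real n * c - 1 > 0"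
    using c by real_asymp
  ultimately show ?thesis
    by (elim Lim_transform_eventually) (auto elim!: eventually_mono simp: smooth_step_def)
qed

lemma plateau_LIMSEQ: "(\<lambda>n. plateau a b n x) \<longlonglongrightarrow> indicator {a<..<b} x"
proof (cases "a < x \<and> x < b")
  case True
  then show ?thesis
    unfolding plateau_def
    using tendsto_mult[OF smooth_step_LIMSEQ[of "x - a"] smooth_step_LIMSEQ[of "b - x"]] by auto
next
  case False
  then have "x \<le> a \<or> b \<le> x" by auto
  have "plateau a b n x = 0" for n
  proof (rule ccontr)
    assume *: "plateau a b n x \<noteq> 0"
    with plateau_support[OF this] have "n > 0" "1 / real n > 0" by auto
    with plateau_support[OF *] \<open>x \<le> a \<or> b \<le> x\<close> show False by linarith
  qed
  then show ?thesis using False by (auto simp: indicator_def)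
qed

section \<open>Du Bois-Reymond lemma\<close>

lemma set_integrable_mult_bounded:
  fixes f g :: "'a \<Rightarrow> real"
  assumes f: "set_integrable M A f" and g: "set_borel_measurable M A g"
    and b: "\<And>x. x \<in> A \<Longrightarrow> \<bar>g x\<bar> \<le> B"
  shows "set_integrable M A (\<lambda>x. f x * g x)"
  unfolding set_integrable_def
proof (rule Bochner_Integration.integrable_bound)
  show "integrable M (\<lambda>x. B *\<^sub>R (indicator A x *\<^sub>R f x))"
    using f unfolding set_integrable_def by (rule integrable_scaleR_right)
  have "(\<lambda>x. (indicator A x *\<^sub>R f x) * (indicator A x *\<^sub>R g x)) \<in> borel_measurable M"
    using f g unfolding set_integrable_def set_borel_measurable_def by measurable
  moreover have "(\<lambda>x. (indicator A x *\<^sub>R f x) * (indicator A x *\<^sub>R g x)) = (\<lambda>x. indicator A x *\<^sub>R (f x * g x))"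
    by (auto simp: indicator_def)
  ultimately show "(\<lambda>x. indicator A x *\<^sub>R (f x * g x)) \<in> borel_measurable M" by simp
  show "AE x in M. norm (indicator A x *\<^sub>R (f x * g x)) \<le> norm (B *\<^sub>R (indicator A x *\<^sub>R f x))"
  proof (intro AE_I2)
    fix x
    have "\<bar>f x\<bar> * \<bar>g x\<bar> \<le> \<bar>B\<bar> * \<bar>f x\<bar>" if "x \<in> A"
      using mult_left_mono[OF order_trans[OF b[OF that] abs_ge_self], of "\<bar>f x\<bar>"] by (simp add: mult_ac)
    then show "norm (indicator A x *\<^sub>R (f x * g x)) \<le> norm (B *\<^sub>R (indicator A x *\<^sub>R f x))"
      by (auto simp: indicator_def abs_mult)
  qed
qed

lemma set_integral_dominated_LIMSEQ:
  fixes f h :: "'a \<Rightarrow> real" and g :: "nat \<Rightarrow> 'a \<Rightarrow> real"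
  assumes f: "set_integrable M A f" and g: "\<And>n. set_borel_measurable M A (g n)"
    and b: "\<And>n x. x \<in> A \<Longrightarrow> \<bar>g n x\<bar> \<le> B"
    and l: "\<And>x. x \<in> A \<Longrightarrow> (\<lambda>n. g n x) \<longlonglongrightarrow> h x"
  shows "(\<lambda>n. LINT x:A|M. f x * g n x) \<longlonglongrightarrow> (LINT x:A|M. f x * h x)"
    and "set_integrable M A (\<lambda>x. f x * h x)"
proof -
  have m: "set_borel_measurable M A h"
    unfolding set_borel_measurable_def
  proof (rule borel_measurable_LIMSEQ_real)
    show "(\<lambda>x. indicator A x *\<^sub>R g n x) \<in> borel_measurable M" for n
      using g unfolding set_borel_measurable_def .
    show "(\<lambda>n. indicator A x *\<^sub>R g n x) \<longlonglongrightarrow> indicator A x *\<^sub>R h x" for x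
      using l by (auto simp: indicator_def)
  qed
  have hb: "\<bar>h x\<bar> \<le> B" if "x \<in> A" for x
    by (rule LIMSEQ_le_const2[OF tendsto_rabs[OF l[OF that]]]) (use b that in auto)
  show "set_integrable M A (\<lambda>x. f x * h x)"
    by (rule set_integrable_mult_bounded[OF f m hb])
  show "(\<lambda>n. LINT x:A|M. f x * g n x) \<longlonglongrightarrow> (LINT x:A|M. f x * h x)"
    unfolding set_lebesgue_integral_def
  proof (rule integral_dominated_convergence[where w = "\<lambda>x. B * \<bar>indicator A x *\<^sub>R f x\<bar>"])
    show "integrable M (\<lambda>x. B * \<bar>indicator A x *\<^sub>R f x\<bar>)"
      using f unfolding set_integrable_def by auto
    show "(\<lambda>x. indicator A x *\<^sub>R (f x * h x)) \<in> borel_measurable M"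
      using set_integrable_mult_bounded[OF f m hb] unfolding set_integrable_def by auto
    show "(\<lambda>x. indicator A x *\<^sub>R (f x * g n x)) \<in> borel_measurable M" for n
      using set_integrable_mult_bounded[OF f g b] unfolding set_integrable_def by blast
    show "AE x in M. (\<lambda>n. indicator A x *\<^sub>R (f x * g n x)) \<longlonglongrightarrow> indicator A x *\<^sub>R (f x * h x)"
      using l by (intro AE_I2) (auto simp: indicator_def intro!: tendsto_intros)
    show "AE x in M. norm (indicator A x *\<^sub>R (f x * g n x)) \<le> B * \<bar>indicator A x *\<^sub>R f x\<bar>" for n
      using b by (intro AE_I2) (auto simp: indicator_def abs_mult mult.commute[of B] intro!: mult_left_mono)
  qed
qed

text \<open>The positive and the negative part of F are densities of finite measures that agree on
  all half-lines, hence everywhere. Uniqueness of densities makes the two parts equal, which is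
  possible only for F = 0.\<close>

lemma AE_zero_of_interval_integrals:
  fixes F :: "real \<Rightarrow> real"
  assumes F: "integrable lborel F" and z: "\<And>a b. a < b \<Longrightarrow> (LINT t:{a<..<b}|lborel. F t) = 0"
  shows "AE t in lborel. F t = 0"
proof -
  have [measurable]: "F \<in> borel_measurable borel" using F by auto
  have sF: "set_integrable lborel A F" if "A \<in> sets borel" for A
    unfolding set_integrable_def by (rule integrable_mult_indicator) (use F that in auto)
  have half: "(LINT t:{a<..}|lborel. F t) = 0" for a
  proof -
    have "(\<lambda>n. LINT t:{a<..}|lborel. F t * indicator {a<..<a + real (Suc n)} t) \<longlonglongrightarrow> (LINT t:{a<..}|lborel. F t * 1)"
    proof (rule set_integral_dominated_LIMSEQ(1)[where B = 1])
      fix x assume "x \<in> {a<..}"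
      obtain N where N: "x - a < real N" using reals_Archimedean2 by blast
      have "\<forall>\<^sub>F n in sequentially. indicator {a<..<a + real (Suc n)} x = (1::real)"
        using eventually_ge_at_top[of N] by eventually_elim (use N \<open>x \<in> {a<..}\<close> in auto)
      then show "(\<lambda>n. indicator {a<..<a + real (Suc n)} x) \<longlonglongrightarrow> (1::real)"
        by (simp add: tendsto_eventually)
    qed (auto intro: sF simp: set_borel_measurable_def indicator_def)
    moreover have "(LINT t:{a<..}|lborel. F t * indicator {a<..<a + real (Suc n)} t) = 0" for n
    proof -
      have "(LINT t:{a<..}|lborel. F t * indicator {a<..<a + real (Suc n)} t) = (LINT t:{a<..<a + real (Suc n)}|lborel. F t)"
        unfolding set_lebesgue_integral_def by (intro Bochner_Integration.integral_cong) (auto simp: indicator_def)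
      then show ?thesis using z by simp
    qed
    ultimately show ?thesis by (simp add: LIMSEQ_const_iff)
  qed
  \<comment> \<open>\<open>ennreal\<close> truncates at 0, so \<open>?M\<close> and
    \<open>?N\<close> have the positive and the negative part of F as densities.\<close>
  let ?M = "density lborel (\<lambda>t. ennreal (F t))" and ?N = "density lborel (\<lambda>t. ennreal (- F t))"
  have fin: "emeasure (density lborel (\<lambda>t. ennreal (G t))) A < \<infinity>"
    if "integrable lborel G" "A \<in> sets borel" for A and G :: "real \<Rightarrow> real"
  proof -
    have "emeasure (density lborel (\<lambda>t. ennreal (G t))) A \<le> (\<integral>\<^sup>+t. ennreal (norm (G t)) \<partial>lborel)"
      using that by (subst emeasure_density) (auto intro!: nn_integral_mono ennreal_leI simp: indicator_def)
    also have "\<dots> < \<infinity>" using that(1) by (simp add: integrable_iff_bounded)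
    finally show ?thesis .
  qed
  have "?M = ?N"
  proof (rule measure_eqI_lessThan)
    fix a
    have em: "emeasure (density lborel (\<lambda>t. ennreal (G t))) {a<..} = (\<integral>\<^sup>+t. ennreal (indicator {a<..} t *\<^sub>R G t) \<partial>lborel)"
      if "G \<in> borel_measurable borel" for G :: "real \<Rightarrow> real"
      using that by (subst emeasure_density) (auto intro!: nn_integral_cong simp: indicator_def)
    have fM: "emeasure ?M {a<..} < \<infinity>" and fN: "emeasure ?N {a<..} < \<infinity>"
      using fin[OF F, of "{a<..}"] fin[OF integrable_minus[OF F], of "{a<..}"] by simp_all
    then show "emeasure ?M {a<..} < \<infinity>" by simp
    have "0 = (LINT t:{a<..}|lborel. F t)" using half by simp
    also have "\<dots> = enn2real (emeasure ?M {a<..}) - enn2real (emeasure ?N {a<..})"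
      using sF[of "{a<..}"] unfolding set_lebesgue_integral_def set_integrable_def
      by (subst real_lebesgue_integral_def) (auto simp: em)
    finally have "ennreal (enn2real (emeasure ?M {a<..})) = ennreal (enn2real (emeasure ?N {a<..}))"
      by (simp del: ennreal_enn2real)
    then show "emeasure ?M {a<..} = emeasure ?N {a<..}"
      using fM fN by (simp only: ennreal_enn2real infinity_ennreal_def)
  qed auto
  then have "AE t in lborel. ennreal (F t) = ennreal (- F t)"
    by (intro sigma_finite_measure.density_unique[OF lborel.sigma_finite_measure_axioms]) auto
  then show ?thesis
  proof eventually_elim
    case (elim t)
    then show "F t = 0"
      by (cases "F t" "0::real" rule: linorder_cases) (auto simp: ennreal_neg dest: sym)
  qed
qed

text \<open>The plateaus converge boundedly to indicators, so testing with these smooth functions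
  already yields the integrals over all subintervals.\<close>

lemma fundamental_lemma_plateau:
  fixes F :: "real \<Rightarrow> real"
  assumes F: "set_integrable lborel {0<..<T} F"
    and z: "\<And>a b n. 0 \<le> a \<Longrightarrow> a < b \<Longrightarrow> b \<le> T \<Longrightarrow> n > 0 \<Longrightarrow> (LINT t:{0<..<T}|lborel. F t * plateau a b n t) = 0"
  shows "AE t in lborel. t \<in> {0<..<T} \<longrightarrow> F t = 0"
proof -
  have 1: "(LINT t:{0<..<T}|lborel. F t * indicator {a<..<b} t) = 0" if "0 \<le> a" "a < b" "b \<le> T" for a b
  proof -
    have "(\<lambda>n. LINT t:{0<..<T}|lborel. F t * plateau a b (Suc n) t) \<longlonglongrightarrow> (LINT t:{0<..<T}|lborel. F t * indicator {a<..<b} t)"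
    proof (rule set_integral_dominated_LIMSEQ(1)[OF F, where B = 1])
      show "set_borel_measurable lborel {0<..<T} (plateau a b (Suc n))" for n
        using borel_measurable_continuous_onI[OF Cinfty_continuous[OF plateau_Cinfty[of a b "Suc n"]]]
        unfolding set_borel_measurable_def by measurable
      show "(\<lambda>n. plateau a b (Suc n) x) \<longlonglongrightarrow> indicator {a<..<b} x" for x
        using LIMSEQ_Suc[OF plateau_LIMSEQ] .
    qed (use plateau_bounds in auto)
    then show ?thesis using z[OF that] by (simp add: LIMSEQ_const_iff)
  qed
  have "AE t in lborel. indicator {0<..<T} t *\<^sub>R F t = 0"
  proof (rule AE_zero_of_interval_integrals)
    show "integrable lborel (\<lambda>t. indicator {0<..<T} t *\<^sub>R F t)" using F unfolding set_integrable_def .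
    fix a b :: real assume "a < b"
    define a' b' where "a' = max a 0" and "b' = min b T"
    have "(LINT t:{a<..<b}|lborel. indicator {0<..<T} t *\<^sub>R F t) = (LINT t:{0<..<T}|lborel. F t * indicator {a'<..<b'} t)"
      unfolding set_lebesgue_integral_def
      by (intro Bochner_Integration.integral_cong) (auto simp: indicator_def a'_def b'_def)
    also have "\<dots> = 0"
    proof (cases "a' < b'")
      case True then show ?thesis by (intro 1) (auto simp: a'_def b'_def)
    next
      case False then have "{a'<..<b'} = {}" by auto
      then show ?thesis by simp
    qed
    finally show "(LINT t:{a<..<b}|lborel. indicator {0<..<T} t *\<^sub>R F t) = 0" .
  qed
  then show ?thesis by eventually_elim (auto simp: indicator_def)
qed

text \<open>Fubini on the triangle a < t < s < b. It takes the place of integration by parts, since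
  the inner integral, as a function of its endpoint, is absolutely continuous but need not be
  differentiable everywhere.\<close>

lemma set_integral_triangle_swap:
  fixes f g :: "real \<Rightarrow> real"
  assumes f: "set_integrable lborel {a<..<b} f" and g: "set_integrable lborel {a<..<b} g"
  shows "(LINT s:{a<..<b}|lborel. g s * (LINT t:{a<..<s}|lborel. f t)) = (LINT t:{a<..<b}|lborel. f t * (LINT s:{t<..<b}|lborel. g s))"
proof -
  define f' where "f' t = indicator {a<..<b} t * f t" for t
  define g' where "g' t = indicator {a<..<b} t * g t" for t
  have f': "integrable lborel f'" and g': "integrable lborel g'"
    using f g by (auto simp: set_integrable_def f'_def[abs_def] g'_def[abs_def])
  then have [measurable]: "f' \<in> borel_measurable borel" "g' \<in> borel_measurable borel" by auto
  define K where "K = (\<lambda>(s, t). g' s * f' t * (if t < s then 1 else 0))"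
  have K: "integrable (lborel \<Otimes>\<^sub>M lborel) K"
  proof (rule Bochner_Integration.integrable_bound)
    show "integrable (lborel \<Otimes>\<^sub>M lborel) (\<lambda>(s, t). g' s * f' t)"
    proof (rule lborel_pair.Fubini_integrable)
      show "integrable lborel (\<lambda>x. LINT y|lborel. norm (case (x, y) of (s, t) \<Rightarrow> g' s * f' t))"
        using f' g' by (simp add: abs_mult)
      show "AE x in lborel. integrable lborel (\<lambda>y. case (x, y) of (s, t) \<Rightarrow> g' s * f' t)"
        using f' by simp
    qed measurable
    show "K \<in> borel_measurable (lborel \<Otimes>\<^sub>M lborel)"
      unfolding K_def by measurable
    show "AE x in lborel \<Otimes>\<^sub>M lborel. norm (K x) \<le> norm (case x of (s, t) \<Rightarrow> g' s * f' t)"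
      by (auto simp: K_def)
  qed
  have "(LINT s:{a<..<b}|lborel. g s * (LINT t:{a<..<s}|lborel. f t)) = (LINT s|lborel. LINT t|lborel. K (s, t))"
    unfolding set_lebesgue_integral_def
  proof (intro Bochner_Integration.integral_cong refl)
    fix s
    have "(LINT t|lborel. K (s, t)) = g' s * (LINT t|lborel. indicator {a<..<s} t * f t)"
      unfolding integral_mult_right_zero[symmetric] K_def
      by (intro Bochner_Integration.integral_cong) (auto simp: f'_def g'_def indicator_def)
    then show "indicator {a<..<b} s *\<^sub>R (g s * (LINT t|lborel. indicator {a<..<s} t *\<^sub>R f t)) = (LINT t|lborel. K (s, t))"
      by (simp add: g'_def)
  qed
  also have "\<dots> = (LINT t|lborel. LINT s|lborel. K (s, t))"
    using lborel_pair.Fubini_integral[of "\<lambda>s t. K (s, t)"] K by simp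
  also have "\<dots> = (LINT t:{a<..<b}|lborel. f t * (LINT s:{t<..<b}|lborel. g s))"
    unfolding set_lebesgue_integral_def
  proof (intro Bochner_Integration.integral_cong refl)
    fix t
    have "(LINT s|lborel. K (s, t)) = f' t * (LINT s|lborel. indicator {t<..<b} s * g s)"
      unfolding integral_mult_right_zero[symmetric] K_def
      by (intro Bochner_Integration.integral_cong) (auto simp: f'_def g'_def indicator_def)
    then show "(LINT s|lborel. K (s, t)) = indicator {a<..<b} t *\<^sub>R (f t * (LINT s|lborel. indicator {t<..<b} s *\<^sub>R g s))"
      by (simp add: f'_def)
  qed
  finally show ?thesis .
qed

lemma set_integral_upto:
  fixes k :: "real \<Rightarrow> real"
  assumes k: "set_integrable lborel {a<..<b} k"
  shows "set_borel_measurable lborel {a<..<b} (\<lambda>\<tau>. LINT t:{a<..<\<tau>}|lborel. k t)"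
    and "\<tau> \<in> {a<..<b} \<Longrightarrow> \<bar>LINT t:{a<..<\<tau>}|lborel. k t\<bar> \<le> (LINT t:{a<..<b}|lborel. \<bar>k t\<bar>)"
proof -
  \<comment> \<open>Writing the endpoint into the integrand fixes the domain, so measurability in
    \<tau> becomes that of a parameter integral.\<close>
  have N: "(LINT t:{a<..<\<tau>}|lborel. k t) = (LINT t|lborel. indicator {a<..<b} t * k t * (if a < t \<and> t < \<tau> then 1 else 0))"
    if "\<tau> \<in> {a<..<b}" for \<tau>
    unfolding set_lebesgue_integral_def using that
    by (intro Bochner_Integration.integral_cong) (auto simp: indicator_def)
  have [measurable]: "(\<lambda>t. indicator {a<..<b} t * k t) \<in> borel_measurable borel"
    using k by (auto simp: set_integrable_def)
  have "(\<lambda>\<tau>. indicator {a<..<b} \<tau> *\<^sub>R (LINT t|lborel. indicator {a<..<b} t * k t * (if a < t \<and> t < \<tau> then 1 else 0))) \<in> borel_measurable lborel"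
    by measurable
  moreover have "(\<lambda>\<tau>. indicator {a<..<b} \<tau> *\<^sub>R (LINT t|lborel. indicator {a<..<b} t * k t * (if a < t \<and> t < \<tau> then 1 else 0)))
    = (\<lambda>\<tau>. indicator {a<..<b} \<tau> *\<^sub>R (LINT t:{a<..<\<tau>}|lborel. k t))"
    using N by (auto simp: indicator_def)
  ultimately show "set_borel_measurable lborel {a<..<b} (\<lambda>\<tau>. LINT t:{a<..<\<tau>}|lborel. k t)"
    unfolding set_borel_measurable_def by (simp only:)
  assume \<tau>: "\<tau> \<in> {a<..<b}"
  have "norm (LINT t|lborel. indicator {a<..<\<tau>} t *\<^sub>R k t) \<le> (LINT t|lborel. indicator {a<..<b} t *\<^sub>R \<bar>k t\<bar>)"
  proof (rule Bochner_Integration.integral_norm_bound_integral)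
    have "set_integrable lborel {a<..<\<tau>} k" using k by (rule set_integrable_subset) (use \<tau> in auto)
    then show "integrable lborel (\<lambda>t. indicator {a<..<\<tau>} t *\<^sub>R k t)" by (simp add: set_integrable_def)
    show "integrable lborel (\<lambda>t. indicator {a<..<b} t *\<^sub>R \<bar>k t\<bar>)"
      using set_integrable_abs[OF k] by (simp add: set_integrable_def)
  qed (use \<tau> in \<open>auto simp: indicator_def\<close>)
  then show "\<bar>LINT t:{a<..<\<tau>}|lborel. k t\<bar> \<le> (LINT t:{a<..<b}|lborel. \<bar>k t\<bar>)" by (simp add: set_lebesgue_integral_def)
qed

text \<open>On [0, T) these are the compactly supported functions that may be nonzero at t = 0,
  which makes the initial value visible. The bound -1 is an arbitrary place to the left of
  0.\<close>

definition time_test :: "real \<Rightarrow> (real \<Rightarrow> real) \<Rightarrow> bool" where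
  "time_test T \<theta> \<longleftrightarrow> \<theta> \<in> Cinfty \<and> (\<forall>t\<le>-1. \<theta> t = 0) \<and> (\<exists>\<delta>>0. \<forall>t\<ge>T - \<delta>. \<theta> t = 0)"

lemma plateau_integral:
  assumes "a \<le> b"
  shows "(plateau a b n has_integral integral {a..b} (plateau a b n)) {a..b}"
  by (intro integrable_integral integrable_continuous_interval continuous_on_subset[OF Cinfty_continuous[OF plateau_Cinfty]]) auto

text \<open>With n = 3 both factors have the argument 3/2 - 1 = 1/2 > 0 at the midpoint of (-1, 0),
  so the bump does not vanish identically.\<close>

lemma plateau_integral_pos: "integral {-1..0} (plateau (-1) 0 3) > 0"
proof -
  have "integral {-1..0} (plateau (-1) 0 3) \<noteq> 0"
  proof
    assume "integral {-1..0} (plateau (-1) 0 3) = 0"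
    then have "plateau (-1) 0 3 (-1/2) = 0"
      using integral_eq_0_iff[of "-1" 0 "plateau (-1) 0 3"] plateau_bounds(1)
        continuous_on_subset[OF Cinfty_continuous[OF plateau_Cinfty], of "{-1..0}"] by auto
    then show False by (simp add: plateau_def smooth_step_def)
  qed
  moreover have "integral {-1..0} (plateau (-1) 0 3) \<ge> 0"
    by (intro Henstock_Kurzweil_Integration.integral_nonneg integrable_continuous_interval
        continuous_on_subset[OF Cinfty_continuous[OF plateau_Cinfty]]) (auto simp: plateau_bounds)
  ultimately show ?thesis by simp
qed

text \<open>Subtracting a bump supported in \<open>(-1,0)\<close> before integrating makes the primitive compactly supported.\<close>

lemma plateau_primitive:
  assumes ab: "0 \<le> a" "a < b" "b \<le> T" and n: "n > 0"
  obtains \<theta> where "time_test T \<theta>" "\<And>t. t \<ge> 0 \<Longrightarrow> (\<theta> has_real_derivative - plateau a b n t) (at t)"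
proof -
  \<comment> \<open>The ratio of the two masses, so that \<eta> has total integral zero and its
    primitive vanishes on the right.\<close>
  define c where "c = integral {a..b} (plateau a b n) / integral {-1..0} (plateau (-1) 0 3)"
  define \<eta> where "\<eta> t = plateau a b n t + (- c) * plateau (-1) 0 3 t" for t
  have \<eta>C: "\<eta> \<in> Cinfty"
    unfolding \<eta>_def[abs_def] by (intro Cinfty_add Cinfty_mult Cinfty_const plateau_Cinfty)
  then have \<eta>c: "continuous_on S \<eta>" for S
    using Cinfty_continuous continuous_on_subset by blast
  then have \<eta>i: "\<eta> integrable_on {u..v}" for u v
    by (rule integrable_continuous_interval)
  \<comment> \<open>The maximum covers the case b < 1/n, in which the plateau vanishes
    identically.\<close>
  define \<beta> where "\<beta> = max (b - 1 / real n) 0"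
  have \<beta>: "0 \<le> \<beta>" "\<beta> < b" using ab n by (auto simp: \<beta>_def)
  have z1: "plateau (-1) 0 3 t = 0" if "t \<le> -1 \<or> 0 \<le> t" for t
    using plateau_support[of "-1" 0 3 t] that by force
  have z2: "plateau a b n t = 0" if "t \<le> 0 \<or> \<beta> \<le> t" for t
  proof (rule ccontr)
    assume nz: "plateau a b n t \<noteq> 0"
    have "1 / real n > 0" using n by simp
    with plateau_support(2,3)[OF nz] that ab have "t = b - 1 / real n" by (auto simp: \<beta>_def)
    then show False using nz n by (simp add: plateau_def smooth_step_def)
  qed
  have z: "\<eta> t = 0" if "t \<le> -1 \<or> \<beta> \<le> t" for t
    using z1[of t] z2[of t] that \<beta> by (auto simp: \<eta>_def)
  \<comment> \<open>The lower limit -2 lies to the left of the support of \<eta>: the fundamental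
    theorem of calculus applies at every point above -2, and below -1 the primitive is
    constant.\<close>
  define \<theta> where "\<theta> t = - integral {-2..t} \<eta>" for t
  have low: "\<theta> t = 0" if "t \<le> -1" for t
  proof -
    have "integral {-2..t} \<eta> = integral {-2..t} (\<lambda>t. 0)"
      by (rule Henstock_Kurzweil_Integration.integral_cong) (use z that in auto)
    then show ?thesis by (simp add: \<theta>_def)
  qed
  have D: "(\<theta> has_real_derivative - \<eta> t) (at t)" for t
  proof (cases "t > -2")
    case True
    have "((\<lambda>x. integral {-2..x} \<eta>) has_real_derivative \<eta> t) (at t within {-2..t + 1})"
      using True by (intro integral_has_real_derivative \<eta>c) auto
    then have "((\<lambda>x. integral {-2..x} \<eta>) has_real_derivative \<eta> t) (at t)"
      using True at_within_interior[of t "{-2..t + 1}"] by (simp add: interior_atLeastAtMost_real)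
    then show ?thesis
      unfolding \<theta>_def[abs_def] by (rule DERIV_minus)
  next
    case False
    have "((\<lambda>t. 0) has_real_derivative 0) (at t)" by simp
    then have "(\<theta> has_real_derivative 0) (at t)"
      by (rule has_field_derivative_transform_within_open[where S = "{..<-1}"]) (use False low in auto)
    then show ?thesis using z[of t] False by simp
  qed
  have tot: "\<theta> b = 0"
  proof -
    have z3: "plateau a b n t = 0" if "t \<notin> {a..b}" for t
    proof (rule ccontr)
      assume nz: "plateau a b n t \<noteq> 0"
      have "1 / real n > 0" using n by simp
      with plateau_support(2,3)[OF nz] that show False by auto
    qed
    have "(plateau a b n has_integral integral {a..b} (plateau a b n)) {-2..b}"
      by (rule has_integral_on_superset[OF plateau_integral]) (use ab z2 z3 \<beta> in auto)
    moreover have "(plateau (-1) 0 3 has_integral integral {-1..0} (plateau (-1) 0 3)) {-2..b}"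
      by (rule has_integral_on_superset[OF plateau_integral]) (use ab z1 in auto)
    ultimately have "(\<eta> has_integral integral {a..b} (plateau a b n) + (- c) * integral {-1..0} (plateau (-1) 0 3)) {-2..b}"
      unfolding \<eta>_def[abs_def] by (intro has_integral_add has_integral_mult_right)
    moreover have "integral {a..b} (plateau a b n) + (- c) * integral {-1..0} (plateau (-1) 0 3) = 0"
      using plateau_integral_pos by (simp add: c_def)
    ultimately show ?thesis by (simp add: \<theta>_def integral_unique)
  qed
  have high: "\<theta> t = 0" if "t \<ge> \<beta>" for t
  proof -
    have "\<exists>c. \<forall>x\<in>{\<beta>..}. \<theta> x = c"
    proof (rule has_field_derivative_zero_constant)
      show "(\<theta> has_field_derivative 0) (at x within {\<beta>..})" if "x \<in> {\<beta>..}" for x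
        using has_field_derivative_at_within[OF D[of x]] z[of x] that by simp
    qed (auto simp: convex_real_interval)
    then show ?thesis using that tot \<beta> by fastforce
  qed
  show thesis
  proof
    have "\<theta> \<in> Cinfty"
    proof (rule Cinfty_real)
      show "(\<theta> has_real_derivative (- 1) * \<eta> x) (at x)" for x using D[of x] by simp
      show "(\<lambda>x. (- 1) * \<eta> x) \<in> Cinfty" by (intro Cinfty_mult Cinfty_const \<eta>C)
    qed
    moreover have "T - \<beta> > 0" using \<beta> ab by simp
    ultimately show "time_test T \<theta>"
      unfolding time_test_def using low high by (auto intro!: exI[of _ "T - \<beta>"])
    show "(\<theta> has_real_derivative - plateau a b n t) (at t)" if "t \<ge> 0" for t
      using D[of t] z1[of t] that by (simp add: \<eta>_def)
  qed
qed

text \<open>The hypothesis is the weak form of m' = k with m(0) = m0. If the derivative of \<theta>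
  is minus a plateau, the first term tests m with that plateau. Exchanging the order of integration
  turns the second term into a test of the primitive of k, so m minus m0 minus this primitive is
  annihilated by all plateaus.\<close>

lemma du_Bois_Reymond:
  fixes m k :: "real \<Rightarrow> real"
  assumes T: "T > 0" and m: "set_integrable lborel {0<..<T} m" and k: "set_integrable lborel {0<..<T} k"
    and H: "\<And>\<theta>. time_test T \<theta> \<Longrightarrow>
      - (LINT t:{0<..<T}|lborel. m t * deriv \<theta> t) - (LINT t:{0<..<T}|lborel. k t * \<theta> t) = \<theta> 0 * m0"
  shows "AE \<tau> in lborel. \<tau> \<in> {0<..<T} \<longrightarrow> m \<tau> = m0 + (LINT t:{0<..<\<tau>}|lborel. k t)"
proof -
  define N where "N \<tau> = (LINT t:{0<..<\<tau>}|lborel. k t)" for \<tau>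
  have one: "set_integrable lborel {0<..<T} (\<lambda>t. c)" for c :: real
    using T by (auto simp: set_integrable_def intro!: integrable_real_indicator)
  have Ni: "set_integrable lborel {0<..<T} N"
    unfolding N_def
    using set_integrable_mult_bounded[OF one[of 1] set_integral_upto(1)[OF k] set_integral_upto(2)[OF k]] by auto
  have Fi: "set_integrable lborel {0<..<T} (\<lambda>t. m t - m0 - N t)"
    by (intro set_integral_diff m one Ni)
  have "AE t in lborel. t \<in> {0<..<T} \<longrightarrow> m t - m0 - N t = 0"
  proof (rule fundamental_lemma_plateau[OF Fi])
    fix a b :: real and n :: nat
    assume ab: "0 \<le> a" "a < b" "b \<le> T" and n: "n > 0"
    obtain \<theta> where \<theta>: "time_test T \<theta>" and D: "\<And>t. t \<ge> 0 \<Longrightarrow> (\<theta> has_real_derivative - plateau a b n t) (at t)"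
      using plateau_primitive[OF ab n] by blast
    have pc: "continuous_on S (plateau a b n)" for S
      using Cinfty_continuous[OF plateau_Cinfty] continuous_on_subset by blast
    have pm: "set_borel_measurable lborel {0<..<T} (plateau a b n)"
      using borel_measurable_continuous_onI[OF pc] unfolding set_borel_measurable_def by measurable
    have pb: "\<bar>plateau a b n t\<bar> \<le> 1" for t using plateau_bounds[of a b n t] by simp
    have pi: "set_integrable lborel {u<..<v} (plateau a b n)" for u v
      using borel_integrable_atLeastAtMost'[OF pc, of u v] by (rule set_integrable_subset) auto
    have \<theta>T: "\<theta> T = 0" using \<theta> by (auto simp: time_test_def)
    have tail: "(LINT s:{t<..<T}|lborel. plateau a b n s) = \<theta> t" if "0 \<le> t" "t \<le> T" for t
    proof -
      have "((\<lambda>s. - (- plateau a b n s)) has_integral - \<theta> T - - \<theta> t) {t..T}"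
        using that by (intro fundamental_theorem_of_calculus has_real_derivative_iff_has_vector_derivative[THEN iffD1]
            DERIV_minus has_field_derivative_at_within[OF D]) auto
      then have "integral {t..T} (plateau a b n) = \<theta> t"
        using \<theta>T by (simp add: integral_unique)
      then show ?thesis
        using set_borel_integral_eq_integral(2)[OF pi] integral_open_interval_real by metis
    qed
    let ?p = "plateau a b n"
    have i1: "set_integrable lborel {0<..<T} (\<lambda>t. m t * ?p t)" and i2: "set_integrable lborel {0<..<T} (\<lambda>t. m0 * ?p t)"
      and i3: "set_integrable lborel {0<..<T} (\<lambda>t. N t * ?p t)"
      by (intro set_integrable_mult_bounded[OF _ pm pb] m one Ni)+
    have "(LINT t:{0<..<T}|lborel. (m t - m0 - N t) * ?p t)
      = (LINT t:{0<..<T}|lborel. m t * ?p t) - (LINT t:{0<..<T}|lborel. m0 * ?p t) - (LINT t:{0<..<T}|lborel. N t * ?p t)"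
      using i1 i2 i3 by (simp add: left_diff_distrib set_integral_diff)
    also have "(LINT t:{0<..<T}|lborel. m t * ?p t) = - (LINT t:{0<..<T}|lborel. m t * deriv \<theta> t)"
      unfolding set_lebesgue_integral_def using DERIV_imp_deriv[OF D]
      by (subst integral_minus[symmetric]) (intro Bochner_Integration.integral_cong, auto simp: indicator_def)
    also have "(LINT t:{0<..<T}|lborel. m0 * ?p t) = m0 * \<theta> 0"
      using tail[of 0] T by simp
    also have "(LINT t:{0<..<T}|lborel. N t * ?p t) = (LINT s:{0<..<T}|lborel. ?p s * (LINT t:{0<..<s}|lborel. k t))"
      by (intro set_lebesgue_integral_cong) (auto simp: N_def)
    also have "\<dots> = (LINT t:{0<..<T}|lborel. k t * (LINT s:{t<..<T}|lborel. ?p s))"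
      by (rule set_integral_triangle_swap[OF k pi])
    also have "\<dots> = (LINT t:{0<..<T}|lborel. k t * \<theta> t)"
      using tail by (intro set_lebesgue_integral_cong) auto
    finally show "(LINT t:{0<..<T}|lborel. (m t - m0 - N t) * ?p t) = 0"
      using H[OF \<theta>] by (simp add: mult.commute)
  qed
  then show ?thesis by eventually_elim (auto simp: N_def)
qed

section \<open>Trigonometric approximation\<close>

text \<open>Monomials in the cosine and sine of one fixed frequency, rather than multiples of the
  frequency: they are what the binomial theorem produces from the kernel below.\<close>

definition trig :: "nat \<Rightarrow> nat \<Rightarrow> real \<Rightarrow> real" where
  "trig i j y = cos (2 * pi * y) ^ i * sin (2 * pi * y) ^ j"

lemma trig_Cinfty: "trig i j \<in> Cinfty"
proof -
  have "(\<lambda>y. cos (2 * pi * y + 0)) \<in> (Cinfty :: (real \<Rightarrow> real) set)" "(\<lambda>y. sin (2 * pi * y + 0)) \<in> (Cinfty :: (real \<Rightarrow> real) set)"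
    by (intro Cinfty_affine Cinfty_cos_sin)+
  then show ?thesis
    unfolding trig_def[abs_def] by (intro Cinfty_mult Cinfty_power) auto
qed

lemma trig_periodic: "trig i j (y + 1) = trig i j y"
proof -
  have "cos (2 * pi * (y + 1)) = cos (2 * pi * y)" "sin (2 * pi * (y + 1)) = sin (2 * pi * y)"
    using cos_periodic[of "2 * pi * y"] sin_periodic[of "2 * pi * y"] by (simp_all add: distrib_left)
  then show ?thesis by (simp add: trig_def)
qed

text \<open>The powers of \<open>1 + cos\<close> concentrate at the integers and expand into finitely many products of sines and cosines.
  Convolution with them therefore reduces arbitrary periodic test functions to countably many smooth ones, which is what allows
  a single null set of exceptional times.\<close>

definition trig_kernel :: "nat \<Rightarrow> real \<Rightarrow> real" where
  "trig_kernel n y = (1 + cos (2 * pi * y)) ^ n"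

text \<open>Convolution over one period with the normalised kernel, which is the kernel of de la
  Vallee Poussin.\<close>

definition trig_conv :: "nat \<Rightarrow> (real \<Rightarrow> real) \<Rightarrow> real \<Rightarrow> real" where
  "trig_conv n \<phi> y = integral {0..1} (\<lambda>s. \<phi> s * trig_kernel n (y - s)) / integral {0..1} (trig_kernel n)"

definition trig_coeff :: "nat \<Rightarrow> nat \<Rightarrow> nat \<Rightarrow> real" where
  "trig_coeff n k i = real (n choose k) * real (k choose i) / integral {0..1} (trig_kernel n)"

text \<open>The binomial theorem twice: for the power of 1 + cos, and for the powers of cos (A - B)
  = cos A cos B + sin A sin B. The variables separate, with the same function of s and of y in each
  summand.\<close>

lemma trig_kernel_expand:
  "trig_kernel n (y - s) = (\<Sum>k\<le>n. \<Sum>i\<le>k. real (n choose k) * real (k choose i) * (trig i (k - i) s * trig i (k - i) y))"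
proof -
  have "trig_kernel n (y - s) = (cos (2 * pi * y - 2 * pi * s) + 1) ^ n"
    by (simp add: trig_kernel_def right_diff_distrib add.commute)
  also have "\<dots> = (\<Sum>k\<le>n. real (n choose k) * cos (2 * pi * y - 2 * pi * s) ^ k)"
    by (subst binomial_ring) simp
  also have "\<dots> = (\<Sum>k\<le>n. real (n choose k) * (\<Sum>i\<le>k. real (k choose i) * (trig i (k - i) s * trig i (k - i) y)))"
  proof (intro sum.cong refl)
    fix k
    have "cos (2 * pi * y - 2 * pi * s) ^ k
      = (cos (2 * pi * y) * cos (2 * pi * s) + sin (2 * pi * y) * sin (2 * pi * s)) ^ k"
      by (simp add: cos_diff)
    also have "\<dots> = (\<Sum>i\<le>k. real (k choose i) * (trig i (k - i) s * trig i (k - i) y))"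
      by (subst binomial_ring) (simp add: trig_def power_mult_distrib mult_ac)
    finally show "real (n choose k) * cos (2 * pi * y - 2 * pi * s) ^ k = real (n choose k) * (\<Sum>i\<le>k. real (k choose i) * (trig i (k - i) s * trig i (k - i) y))" by simp
  qed
  finally show ?thesis by (simp add: sum_distrib_left mult.assoc)
qed

lemma trig_conv_expand:
  assumes "continuous_on UNIV \<phi>"
  shows "trig_conv n \<phi> y = (\<Sum>k\<le>n. \<Sum>i\<le>k. trig_coeff n k i * integral {0..1} (\<lambda>s. \<phi> s * trig i (k - i) s) * trig i (k - i) y)"
proof -
  have c: "continuous_on S \<phi>" "continuous_on S (trig i j)" for S i j
    using assms Cinfty_continuous[OF trig_Cinfty] continuous_on_subset by blast+
  have "integral {0..1} (\<lambda>s. \<phi> s * trig_kernel n (y - s))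
    = integral {0..1} (\<lambda>s. \<Sum>k\<le>n. \<Sum>i\<le>k. (real (n choose k) * real (k choose i) * trig i (k - i) y) * (\<phi> s * trig i (k - i) s))"
    by (simp add: trig_kernel_expand sum_distrib_left mult_ac)
  also have "\<dots> = (\<Sum>k\<le>n. \<Sum>i\<le>k. (real (n choose k) * real (k choose i) * trig i (k - i) y) * integral {0..1} (\<lambda>s. \<phi> s * trig i (k - i) s))"
    by (simp add: Henstock_Kurzweil_Integration.integral_sum integrable_continuous_interval continuous_intros c)
  finally show ?thesis
    by (simp add: trig_conv_def trig_coeff_def sum_divide_distrib mult_ac)
qed

lemma trig_kernel_continuous: "continuous_on S (trig_kernel n)"
  unfolding trig_kernel_def[abs_def] by (intro continuous_intros)

lemma trig_kernel_nonneg: "trig_kernel n y \<ge> 0"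
  unfolding trig_kernel_def using cos_ge_minus_one[of "2 * pi * y"] by (intro zero_le_power) linarith

text \<open>On [0, \<eta>/2] the angle 2 pi s is at most pi \<eta>, in the range where the cosine
  decreases; the rest of the period only adds to the integral.\<close>

lemma trig_kernel_integral_ge:
  assumes \<eta>: "0 < \<eta>" "\<eta> \<le> 1/2"
  shows "integral {0..1} (trig_kernel n) \<ge> \<eta> / 2 * (1 + cos (pi * \<eta>)) ^ n"
proof -
  have "integral {0..\<eta>/2} (\<lambda>s. (1 + cos (pi * \<eta>)) ^ n) \<le> integral {0..\<eta>/2} (trig_kernel n)"
  proof (rule integral_le)
    fix s assume s: "s \<in> {0..\<eta>/2}"
    have "pi * \<eta> \<le> pi * 1" using \<eta> by (intro mult_left_mono) auto
    then have "cos (pi * \<eta>) \<le> cos (2 * pi * s)"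
      using s \<eta> mult_left_mono[of "2 * s" \<eta> pi] by (intro cos_monotone_0_pi_le) auto
    then show "(1 + cos (pi * \<eta>)) ^ n \<le> trig_kernel n s"
      unfolding trig_kernel_def using cos_ge_minus_one[of "pi * \<eta>"] by (intro power_mono) linarith+
  qed (auto intro!: integrable_continuous_interval trig_kernel_continuous)
  also have "\<dots> \<le> integral {0..1} (trig_kernel n)"
    by (intro integral_subset_le integrable_continuous_interval trig_kernel_continuous) (use \<eta> trig_kernel_nonneg in auto)
  finally show ?thesis using \<eta> by simp
qed

lemma trig_kernel_integral_pos: "integral {0..1} (trig_kernel n) > 0"
proof -
  have "0 < (1/2) / 2 * (1 + cos (pi * (1/2))) ^ n" by simp
  also have "\<dots> \<le> integral {0..1} (trig_kernel n)" by (intro trig_kernel_integral_ge) auto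
  finally show ?thesis .
qed

text \<open>The numerator bounds the kernel at distance at least \<eta> from the integers. Comparing
  it with the mass within half that distance of 0 gives a geometric factor q < 1, which beats the
  constant 2 / \<eta>.\<close>

lemma trig_kernel_tail:
  assumes \<eta>: "0 < \<eta>" "\<eta> < 1/2"
  shows "(\<lambda>n. (1 + cos (2 * pi * \<eta>)) ^ n / integral {0..1} (trig_kernel n)) \<longlonglongrightarrow> 0"
proof -
  define q where "q = (1 + cos (2 * pi * \<eta>)) / (1 + cos (pi * \<eta>))"
  have le: "pi * \<eta> < pi * (1/2)" using \<eta> by (intro mult_strict_left_mono) auto
  have c0: "cos (pi * \<eta>) > 0" using \<eta> le by (intro cos_gt_zero) auto
  have "cos (2 * pi * \<eta>) < cos (pi * \<eta>)"
    using \<eta> le by (intro cos_monotone_0_pi) auto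
  then have q: "0 \<le> q" "q < 1" using c0 cos_ge_minus_one[of "2 * pi * \<eta>"]
    by (simp_all add: q_def del: cos_ge_minus_one)
  have L: "(\<lambda>n. 2 / \<eta> * q ^ n) \<longlonglongrightarrow> 2 / \<eta> * 0"
    by (intro tendsto_intros LIMSEQ_realpow_zero q)
  have A: "(1 + cos (2 * pi * \<eta>)) ^ n / integral {0..1} (trig_kernel n) \<le> 2 / \<eta> * q ^ n" for n
  proof -
    have "(1 + cos (2 * pi * \<eta>)) ^ n / integral {0..1} (trig_kernel n)
      \<le> (1 + cos (2 * pi * \<eta>)) ^ n / (\<eta> / 2 * (1 + cos (pi * \<eta>)) ^ n)"
    proof (rule divide_left_mono)
      show "0 \<le> (1 + cos (2 * pi * \<eta>)) ^ n" using cos_ge_minus_one[of "2 * pi * \<eta>"] by (intro zero_le_power) linarith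
      show "\<eta> / 2 * (1 + cos (pi * \<eta>)) ^ n \<le> integral {0..1} (trig_kernel n)"
        using \<eta> by (intro trig_kernel_integral_ge) auto
      show "0 < integral {0..1} (trig_kernel n) * (\<eta> / 2 * (1 + cos (pi * \<eta>)) ^ n)"
        using \<eta> c0 trig_kernel_integral_pos[of n] zero_less_power[of "1 + cos (pi * \<eta>)" n]
        by (intro mult_pos_pos) simp_all
    qed
    also have "\<dots> = 2 / \<eta> * q ^ n"
      using \<eta> by (simp add: q_def power_divide)
    finally show ?thesis .
  qed
  have B: "0 \<le> (1 + cos (2 * pi * \<eta>)) ^ n / integral {0..1} (trig_kernel n)" for n
  proof (rule divide_nonneg_pos[OF zero_le_power trig_kernel_integral_pos])
    show "0 \<le> 1 + cos (2 * pi * \<eta>)" using cos_ge_minus_one[of "2 * pi * \<eta>"] by linarith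
  qed
  show ?thesis
  proof (rule tendsto_sandwich[OF _ _ tendsto_const])
    show "(\<lambda>n. 2 / \<eta> * q ^ n) \<longlonglongrightarrow> 0" using L by (simp only: mult_zero_right)
  qed (use A B in \<open>simp_all only: always_eventually simp_thms\<close>)
qed

text \<open>The derivative of u(x + 1) - u(x) is f(x + 1) - f(x) = 0. The size of N leaves room for
  both periods inside the interval on which u is a primitive.\<close>

lemma periodic_integral_shift:
  fixes f :: "real \<Rightarrow> real"
  assumes c: "continuous_on UNIV f" and p: "\<And>y. f (y + 1) = f y"
  shows "integral {c..c+1} f = integral {0..1} f"
proof -
  define N where "N = \<bar>c\<bar> + 2"
  define u where "u x = integral {-N..x} f" for x
  have cf: "continuous_on S f" for S using c continuous_on_subset by blast
  have D: "(u has_real_derivative f x) (at x)" if "-N < x" "x < N" for x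
  proof -
    have "(u has_real_derivative f x) (at x within {-N..N})"
      unfolding u_def[abs_def] using that by (intro integral_has_real_derivative cf) auto
    then show ?thesis using that at_within_interior[of x "{-N..N}"] by (simp add: interior_atLeastAtMost_real)
  qed
  have H: "integral {x..x+1} f = u (x + 1) - u x" if "-N \<le> x" for x
  proof -
    have "integral {-N..x} f + integral {x..x+1} f = integral {-N..x+1} f"
      using that by (intro Henstock_Kurzweil_Integration.integral_combine integrable_continuous_interval cf) auto
    then show ?thesis by (simp add: u_def)
  qed
  have "\<exists>k. \<forall>x\<in>{-(N-1)..N-2}. u (x + 1) - u x = k"
  proof (rule has_field_derivative_zero_constant)
    fix x assume x: "x \<in> {-(N-1)..N-2}"
    have "((\<lambda>x. u (x + 1)) has_real_derivative f (x + 1) * 1) (at x)"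
      by (rule DERIV_chain2[OF D]) (use x in \<open>auto intro!: derivative_eq_intros\<close>)
    from DERIV_diff[OF this D[of x]] x p
    show "((\<lambda>x. u (x + 1) - u x) has_field_derivative 0) (at x within {-(N-1)..N-2})"
      by (auto intro: has_field_derivative_at_within)
  qed auto
  then obtain k where k: "\<And>x. x \<in> {-(N-1)..N-2} \<Longrightarrow> u (x + 1) - u x = k" by blast
  have "-N \<le> c" "c \<in> {-(N-1)..N-2}" by (simp_all add: N_def) linarith+
  then have "integral {c..c+1} f = k" using H[of c] k[of c] by simp
  moreover have "integral {0..0+1} f = k" using H[of 0] k[of 0] by (auto simp: N_def)
  ultimately show ?thesis by simp
qed

text \<open>Substitution and periodicity move y from the kernel to \<phi>; in this form the
  convolution can be compared with \<phi> and differentiated under the integral.\<close>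

lemma trig_conv_flip:
  assumes c: "continuous_on UNIV \<phi>" and p: "\<And>y. \<phi> (y + 1) = \<phi> y"
  shows "trig_conv n \<phi> y = integral {0..1} (\<lambda>s. \<phi> (y - s) * trig_kernel n s) / integral {0..1} (trig_kernel n)"
proof -
  have p': "\<phi> (x - 1) = \<phi> x" for x using p[of "x - 1"] by simp
  have kp: "trig_kernel n (x + 1) = trig_kernel n x" for x
    using cos_periodic[of "2 * pi * x"] by (simp add: trig_kernel_def distrib_left)
  let ?g = "\<lambda>s. \<phi> (y - s) * trig_kernel n s"
  have gc: "continuous_on S ?g" for S
    by (intro continuous_intros trig_kernel_continuous continuous_on_compose2[OF c]) auto
  have "(?g has_integral integral {y-1..y} ?g) (cbox (y - 1) y)"
    using integrable_continuous_interval[OF gc, of "y - 1" y] by (simp add: has_integral_integral)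
  from has_integral_affinity[OF this, of "-1" y]
  have "((\<lambda>s. \<phi> s * trig_kernel n (y - s)) has_integral integral {y-1..y} ?g) ((\<lambda>x. - x + y) ` {y - 1..y})"
    by simp
  moreover have "(\<lambda>x. - x + y) ` {y - 1..y} = {0..1}"
    by (auto simp: image_iff intro!: bexI[of _ "y - x" for x])
  ultimately have "integral {0..1} (\<lambda>s. \<phi> s * trig_kernel n (y - s)) = integral {y-1..y-1+1} ?g"
    by (simp add: integral_unique)
  also have "\<dots> = integral {0..1} ?g"
    using kp p' by (intro periodic_integral_shift gc) (simp add: algebra_simps flip: diff_diff_eq)
  finally show ?thesis by (simp add: trig_conv_def)
qed

text \<open>A nonnegative kernel of mass one does not increase bounds; its mass is read off from the
  convolution of the constant 1.\<close>

lemma trig_conv_bound: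
  assumes c: "continuous_on UNIV \<phi>" and b: "\<And>y. \<bar>\<phi> y\<bar> \<le> B"
  shows "\<bar>trig_conv n \<phi> y\<bar> \<le> B"
proof -
  have kc: "continuous_on S (\<lambda>s. trig_kernel n (y - s))" for S
    by (intro continuous_on_compose2[OF trig_kernel_continuous[of UNIV]] continuous_intros) auto
  have "norm (integral {0..1} (\<lambda>s. \<phi> s * trig_kernel n (y - s))) \<le> integral {0..1} (\<lambda>s. B * trig_kernel n (y - s))"
    using b trig_kernel_nonneg
    by (intro Henstock_Kurzweil_Integration.integral_norm_bound_integral integrable_continuous_interval continuous_intros kc continuous_on_subset[OF c])
       (auto simp: abs_mult intro!: mult_right_mono)
  also have "\<dots> = B * (trig_conv n (\<lambda>_. 1) y * integral {0..1} (trig_kernel n))"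
    using trig_kernel_integral_pos[of n] by (simp add: trig_conv_def)
  also have "trig_conv n (\<lambda>_. 1) y = 1"
    using trig_kernel_integral_pos[of n] by (subst trig_conv_flip) auto
  finally show ?thesis
    using trig_kernel_integral_pos[of n] by (simp add: trig_conv_def abs_divide divide_le_eq)
qed

lemma periodic_frac:
  fixes f :: "real \<Rightarrow> 'a"
  assumes "\<And>y. f (y + 1) = f y" shows "f (frac y) = f y"
proof -
  interpret periodic_fun_simple' f by unfold_locales (rule assms)
  show ?thesis by (simp add: frac_def minus_of_int)
qed

lemma periodic_uniform:
  fixes \<phi> :: "real \<Rightarrow> real"
  assumes c: "continuous_on UNIV \<phi>" and p: "\<And>y. \<phi> (y + 1) = \<phi> y" and e: "e > 0"
  shows "\<exists>\<eta>>0. \<eta> < 1/2 \<and> (\<forall>y s. \<bar>s\<bar> \<le> \<eta> \<longrightarrow> \<bar>\<phi> (y - s) - \<phi> y\<bar> \<le> e)"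
proof -
  have "uniformly_continuous_on {-1..2} \<phi>"
    by (intro compact_uniformly_continuous continuous_on_subset[OF c]) auto
  then obtain d where d: "d > 0" "\<And>x y. x \<in> {-1..2} \<Longrightarrow> y \<in> {-1..2} \<Longrightarrow> dist y x < d \<Longrightarrow> dist (\<phi> y) (\<phi> x) < e"
    using e unfolding uniformly_continuous_on_def by metis
  \<comment> \<open>The bound 1/3 keeps frac y - s inside [-1, 2] and \<eta> below 1/2.\<close>
  define \<eta> where "\<eta> = min (d / 2) (1/3)"
  have "\<bar>\<phi> (y - s) - \<phi> y\<bar> \<le> e" if "\<bar>s\<bar> \<le> \<eta>" for y s
  proof -
    have *: "\<phi> (frac y - s) = \<phi> (y - s)"
      using periodic_frac[of "\<lambda>y. \<phi> (y - s)" y] p by (simp add: algebra_simps flip: diff_diff_eq add_diff_eq)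
        (metis add.commute add_diff_eq p diff_add_eq)
    have "dist (\<phi> (frac y - s)) (\<phi> (frac y)) < e"
      using that d(1) frac_lt_1[of y] frac_ge_0[of y] by (intro d(2)) (auto simp: \<eta>_def dist_real_def simp del: frac_ge_0)
    then show ?thesis using periodic_frac[of \<phi> y, OF p] * by (simp add: dist_real_def)
  qed
  then show ?thesis using d(1) by (intro exI[of _ \<eta>]) (auto simp: \<eta>_def)
qed

lemma periodic_bounded:
  fixes \<phi> :: "real \<Rightarrow> real"
  assumes c: "continuous_on UNIV \<phi>" and p: "\<And>y. \<phi> (y + 1) = \<phi> y"
  shows "\<exists>B. \<forall>y. \<bar>\<phi> y\<bar> \<le> B"
proof -
  have "bounded (\<phi> ` {0..1})"
    by (intro compact_imp_bounded compact_continuous_image continuous_on_subset[OF c]) auto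
  then obtain B where B: "\<And>y. y \<in> {0..1} \<Longrightarrow> \<bar>\<phi> y\<bar> \<le> B" unfolding bounded_iff by force
  have "\<bar>\<phi> y\<bar> \<le> B" for y
    using B[of "frac y"] periodic_frac[of \<phi> y, OF p] frac_lt_1[of y] frac_ge_0[of y] by (simp add: less_imp_le del: frac_ge_0)
  then show ?thesis by blast
qed

lemma trig_conv_uniform:
  assumes c: "continuous_on UNIV \<phi>" and p: "\<And>y. \<phi> (y + 1) = \<phi> y" and e: "e > 0"
  shows "\<exists>N. \<forall>n\<ge>N. \<forall>y. \<bar>trig_conv n \<phi> y - \<phi> y\<bar> \<le> e"
proof -
  obtain B where B: "\<And>y. \<bar>\<phi> y\<bar> \<le> B" using periodic_bounded[OF c p] by blast
  have B0: "B \<ge> 0" using B[of 0] by linarith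
  obtain \<eta> where \<eta>: "\<eta> > 0" "\<eta> < 1/2" and u: "\<And>y s. \<bar>s\<bar> \<le> \<eta> \<Longrightarrow> \<bar>\<phi> (y - s) - \<phi> y\<bar> \<le> e / 2"
    using periodic_uniform[OF c p, of "e / 2"] e by auto
  let ?q = "\<lambda>n. (1 + cos (2 * pi * \<eta>)) ^ n" and ?I = "\<lambda>n. integral {0..1} (trig_kernel n)"
  have "(\<lambda>n. 2 * B * (?q n / ?I n)) \<longlonglongrightarrow> 2 * B * 0"
    by (intro tendsto_intros trig_kernel_tail \<eta>)
  then have "\<forall>\<^sub>F n in sequentially. 2 * B * (?q n / ?I n) < e / 2"
    using e by (auto dest!: order_tendstoD(2)[of _ _ _ "e / 2"])
  then obtain N where N: "\<And>n. n \<ge> N \<Longrightarrow> 2 * B * (?q n / ?I n) < e / 2"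
    by (auto simp: eventually_sequentially)
  have "\<bar>trig_conv n \<phi> y - \<phi> y\<bar> \<le> e" if n: "n \<ge> N" for n y
  proof -
    have I: "?I n > 0" by (rule trig_kernel_integral_pos)
    have ci: "continuous_on {0..1} (\<lambda>s. (\<phi> (y - s) - \<phi> y) * trig_kernel n s)"
      by (intro continuous_intros trig_kernel_continuous continuous_on_compose2[OF c]) auto
    have ci2: "continuous_on {0..1} (\<lambda>s. \<phi> (y - s) * trig_kernel n s)"
      by (intro continuous_intros trig_kernel_continuous continuous_on_compose2[OF c]) auto
    have "norm (integral {0..1} (\<lambda>s. (\<phi> (y - s) - \<phi> y) * trig_kernel n s)) \<le> integral {0..1} (\<lambda>s. e / 2 * trig_kernel n s + 2 * B * ?q n)"
    proof (rule Henstock_Kurzweil_Integration.integral_norm_bound_integral)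
      fix s :: real assume s: "s \<in> {0..1}"
      have k: "trig_kernel n s \<ge> 0" by (rule trig_kernel_nonneg)
      have q0: "?q n \<ge> 0" using cos_ge_minus_one[of "2 * pi * \<eta>"] by (intro zero_le_power) linarith
      \<comment> \<open>Over one period the kernel peaks at both ends; near 1 the periodicity of
        \<phi> replaces s by s - 1. In the middle the kernel is at most \<open>?q n\<close> while
        \<phi> varies by at most 2 B.\<close>
      consider "s \<le> \<eta>" | "1 - \<eta> \<le> s" | "\<eta> \<le> s" "s \<le> 1 - \<eta>" by linarith
      then show "norm ((\<phi> (y - s) - \<phi> y) * trig_kernel n s) \<le> e / 2 * trig_kernel n s + 2 * B * ?q n"
      proof cases
        case 1
        then have "\<bar>\<phi> (y - s) - \<phi> y\<bar> * trig_kernel n s \<le> e / 2 * trig_kernel n s"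
          using s k u[of s y] by (intro mult_right_mono) auto
        moreover have "0 \<le> 2 * B * ?q n" using B0 q0 by simp
        ultimately show ?thesis using k by (simp add: abs_mult)
      next
        case 2
        have "\<phi> (y - s) = \<phi> (y - (s - 1))" using p[of "y - s"] by (simp add: algebra_simps)
        then have "\<bar>\<phi> (y - s) - \<phi> y\<bar> * trig_kernel n s \<le> e / 2 * trig_kernel n s"
          using 2 s k u[of "s - 1" y] by (intro mult_right_mono) auto
        moreover have "0 \<le> 2 * B * ?q n" using B0 q0 by simp
        ultimately show ?thesis using k by (simp add: abs_mult)
      next
        case 3
        have "cos (2 * pi * s) \<le> cos (2 * pi * \<eta>)"
        proof (cases "s \<le> 1/2")
          case True
          then show ?thesis using 3 \<eta> mult_left_mono[of s "1/2" "2 * pi"] mult_left_mono[of \<eta> s "2 * pi"]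
            by (intro cos_monotone_0_pi_le) auto
        next
          case False
          have "cos (2 * pi * s) = cos (2 * pi * (1 - s))"
            using cos_minus[of "2 * pi * s"] cos_periodic[of "- (2 * pi * s)"] by (simp add: algebra_simps)
          also have "\<dots> \<le> cos (2 * pi * \<eta>)"
            using False 3 \<eta> mult_left_mono[of "1 - s" "1/2" "2 * pi"] mult_left_mono[of \<eta> "1 - s" "2 * pi"]
            by (intro cos_monotone_0_pi_le) auto
          finally show ?thesis .
        qed
        then have "trig_kernel n s \<le> ?q n"
          unfolding trig_kernel_def using cos_ge_minus_one[of "2 * pi * s"] by (intro power_mono) linarith+
        moreover have "\<bar>\<phi> (y - s) - \<phi> y\<bar> \<le> 2 * B" using B[of "y - s"] B[of y] by linarith
        ultimately have "\<bar>\<phi> (y - s) - \<phi> y\<bar> * trig_kernel n s \<le> 2 * B * ?q n"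
          using k B0 by (intro mult_mono) auto
        moreover have "0 \<le> e / 2 * trig_kernel n s" using e k by simp
        ultimately show ?thesis using k by (simp add: abs_mult)
      qed
    qed (auto intro!: integrable_continuous_interval ci continuous_intros trig_kernel_continuous)
    also have "\<dots> = e / 2 * ?I n + 2 * B * ?q n"
      by (subst Henstock_Kurzweil_Integration.integral_add) (auto intro!: integrable_continuous_interval continuous_intros trig_kernel_continuous)
    finally have *: "\<bar>integral {0..1} (\<lambda>s. (\<phi> (y - s) - \<phi> y) * trig_kernel n s)\<bar> \<le> e / 2 * ?I n + 2 * B * ?q n" by simp
    have "integral {0..1} (\<lambda>s. (\<phi> (y - s) - \<phi> y) * trig_kernel n s) = integral {0..1} (\<lambda>s. \<phi> (y - s) * trig_kernel n s) - \<phi> y * ?I n"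
      unfolding left_diff_distrib
      by (subst Henstock_Kurzweil_Integration.integral_diff)
         (auto intro!: integrable_continuous_interval continuous_intros trig_kernel_continuous ci2)
    then have "trig_conv n \<phi> y - \<phi> y = integral {0..1} (\<lambda>s. (\<phi> (y - s) - \<phi> y) * trig_kernel n s) / ?I n"
      using I by (simp add: trig_conv_flip[OF c p] field_simps)
    then have "\<bar>trig_conv n \<phi> y - \<phi> y\<bar> \<le> (e / 2 * ?I n + 2 * B * ?q n) / ?I n"
      using * I by (simp add: abs_divide divide_right_mono)
    also have "\<dots> = e / 2 + 2 * B * (?q n / ?I n)" using I by (simp add: field_simps)
    also have "\<dots> \<le> e" using N[OF n] by simp
    finally show ?thesis .
  qed
  then show ?thesis by blast
qed

lemma trig_conv_LIMSEQ:
  assumes "continuous_on UNIV \<phi>" "\<And>y. \<phi> (y + 1) = \<phi> y"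
  shows "(\<lambda>n. trig_conv n \<phi> y) \<longlonglongrightarrow> \<phi> y"
proof (rule LIMSEQ_I)
  fix e :: real assume "e > 0"
  then obtain N where N: "\<And>n y. n \<ge> N \<Longrightarrow> \<bar>trig_conv n \<phi> y - \<phi> y\<bar> \<le> e / 2"
    using trig_conv_uniform[OF assms, of "e / 2"] by auto
  show "\<exists>no. \<forall>n\<ge>no. norm (trig_conv n \<phi> y - \<phi> y) < e"
  proof (intro exI allI impI)
    fix n assume "n \<ge> N" then show "norm (trig_conv n \<phi> y - \<phi> y) < e" using N[of n y] \<open>e > 0\<close> by simp
  qed
qed

text \<open>The convolution is differentiated in two ways, term by term in its expansion and under
  the integral after \<open>trig_conv_flip\<close>. Consequently one set of coefficients
  approximates \<phi> and its derivative together.\<close>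

lemma trig_conv_deriv:
  assumes D: "\<And>y. (\<phi> has_real_derivative \<phi>' y) (at y)" and c': "continuous_on UNIV \<phi>'"
    and p: "\<And>y. \<phi> (y + 1) = \<phi> y"
  shows "(\<Sum>k\<le>n. \<Sum>i\<le>k. trig_coeff n k i * integral {0..1} (\<lambda>s. \<phi> s * trig i (k - i) s) * deriv (trig i (k - i)) y)
    = trig_conv n \<phi>' y"
proof -
  have c: "continuous_on UNIV \<phi>" using DERIV_isCont[OF D] by (auto intro: continuous_at_imp_continuous_on)
  have p': "\<phi>' (y + 1) = \<phi>' y" for y
  proof -
    have "((\<lambda>y. \<phi> (y + 1)) has_real_derivative \<phi>' (y + 1) * 1) (at y)"
      by (rule DERIV_chain2[OF D]) (auto intro!: derivative_eq_intros)
    then have "(\<phi> has_real_derivative \<phi>' (y + 1)) (at y)" using p by simp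
    then show ?thesis using D DERIV_unique by blast
  qed
  have "((\<lambda>y. trig_conv n \<phi> y) has_real_derivative
     (\<Sum>k\<le>n. \<Sum>i\<le>k. trig_coeff n k i * integral {0..1} (\<lambda>s. \<phi> s * trig i (k - i) s) * deriv (trig i (k - i)) y)) (at y)"
    unfolding trig_conv_expand[OF c]
    by (intro DERIV_sum DERIV_cmult Cinfty_DERIV(1) trig_Cinfty)
  moreover have "((\<lambda>y. trig_conv n \<phi> y) has_real_derivative trig_conv n \<phi>' y) (at y)"
  proof -
    have "((\<lambda>y. integral (cbox 0 1) (\<lambda>s. \<phi> (y - s) * trig_kernel n s)) has_field_derivative
       integral (cbox 0 1) (\<lambda>s. \<phi>' (y - s) * trig_kernel n s)) (at y within UNIV)"
    proof (rule leibniz_rule_field_derivative)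
      fix x t :: real
      have "((\<lambda>y. \<phi> (y - t)) has_real_derivative \<phi>' (x - t) * 1) (at x)"
        by (rule DERIV_chain2[OF D]) (auto intro!: derivative_eq_intros)
      then show "((\<lambda>x. \<phi> (x - t) * trig_kernel n t) has_field_derivative \<phi>' (x - t) * trig_kernel n t) (at x within UNIV)"
        using DERIV_cmult_right by fastforce
    next
      fix x :: real
      have "continuous_on {0..1} (\<lambda>t. \<phi> (x - t) * trig_kernel n t)"
        by (intro continuous_intros trig_kernel_continuous continuous_on_compose2[OF c]) auto
      then show "(\<lambda>t. \<phi> (x - t) * trig_kernel n t) integrable_on cbox 0 1"
        by (simp add: integrable_continuous_interval)
    next
      show "continuous_on (UNIV \<times> cbox 0 1) (\<lambda>(x, t). \<phi>' (x - t) * trig_kernel n t)"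
        unfolding split_beta
        by (intro continuous_intros continuous_on_compose2[OF c'] continuous_on_compose2[OF trig_kernel_continuous[of UNIV]]) auto
    qed auto
    then show ?thesis
      unfolding trig_conv_flip[OF c p] trig_conv_flip[OF c' p'] by (auto intro: DERIV_cdivide)
  qed
  ultimately show ?thesis using DERIV_unique by blast
qed

section \<open>Relative pressure\<close>

text \<open>The Bregman divergence of the power function with exponent \<gamma> at the point
  1.\<close>

definition relpow :: "real \<Rightarrow> real \<Rightarrow> real" where
  "relpow \<gamma> s = s powr \<gamma> - 1 - \<gamma> * (s - 1)"

lemma DERIV_mono_from:
  fixes f f' :: "real \<Rightarrow> real"
  assumes c: "c > 0" and D: "\<And>x. x > 0 \<Longrightarrow> (f has_real_derivative f' x) (at x)"
    and neg: "\<And>x. 0 < x \<Longrightarrow> x \<le> c \<Longrightarrow> f' x \<le> 0" and pos: "\<And>x. c \<le> x \<Longrightarrow> f' x \<ge> 0"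
    and s: "s > 0"
  shows "f c \<le> f s"
proof (cases "c \<le> s")
  case True
  show ?thesis
    by (rule DERIV_nonneg_imp_nondecreasing[OF True]) (use D pos c in \<open>metis order_less_le_trans\<close>)
next
  case False
  show ?thesis
    by (rule DERIV_nonpos_imp_nonincreasing[of s c]) (use False D neg s in \<open>auto, metis order_less_le_trans\<close>)
qed

lemma powr_gamma_1_cmp:
  fixes x :: real
  assumes "\<gamma> > 1"
  shows "0 < x \<Longrightarrow> x \<le> 1 \<Longrightarrow> x powr (\<gamma> - 1) \<le> 1" "1 \<le> x \<Longrightarrow> 1 \<le> x powr (\<gamma> - 1)"
  using assms powr_mono2[of "\<gamma> - 1" x 1] powr_mono2[of "\<gamma> - 1" 1 x] by auto

lemma relpow_deriv:
  "s > 0 \<Longrightarrow> (relpow \<gamma> has_real_derivative \<gamma> * (s powr (\<gamma> - 1) - 1)) (at s)"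
  unfolding relpow_def[abs_def] by (auto intro!: derivative_eq_intros simp: algebra_simps)

lemma relpow_nonneg:
  assumes "\<gamma> > 1" "s > 0" shows "relpow \<gamma> s \<ge> 0"
proof -
  have "relpow \<gamma> 1 \<le> relpow \<gamma> s"
    by (rule DERIV_mono_from[where f = "relpow \<gamma>" and c = 1 and f' = "\<lambda>s. \<gamma> * (s powr (\<gamma> - 1) - 1)"])
       (use assms powr_gamma_1_cmp[OF assms(1)] in \<open>auto intro!: relpow_deriv mult_nonneg_nonneg mult_nonneg_nonpos\<close>)
  then show ?thesis by (simp add: relpow_def)
qed

text \<open>The difference of the two sides vanishes at s = 1, and its derivative has the sign of X
  - 1 for X = s^(\<gamma>-1). The weight 1 / (1 + X) makes the bound valid from vacuum to large
  densities, which closes the estimate of the pressure cross term for every \<gamma> > 1.\<close>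

lemma relpow_weighted_square:
  assumes \<gamma>: "\<gamma> > 1" and s: "s > 0"
  shows "s * (s powr (\<gamma> - 1) - 1)\<^sup>2 / (1 + s powr (\<gamma> - 1)) \<le> 2 * relpow \<gamma> s"
proof -
  define X where "X s = s powr (\<gamma> - 1)" for s
  define F where "F s = 2 * relpow \<gamma> s - s * (X s - 1)\<^sup>2 / (1 + X s)" for s
  \<comment> \<open>\<open>(X s - 1) * B s\<close> is the derivative of the quotient subtracted in
    F.\<close>
  define B where "B s = (X s - 1) / (1 + X s) + (\<gamma> - 1) * X s * (X s + 3) / (1 + X s)\<^sup>2" for s
  have X: "X s > 0" if "s > 0" for s using that by (simp add: X_def)
  have "F 1 \<le> F s"
  proof (rule DERIV_mono_from[where f = F and c = 1 and f' = "\<lambda>s. (X s - 1) * (2 * \<gamma> - B s)"])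
    have dX: "(X has_real_derivative (\<gamma> - 1) * X s / s) (at s)" if "s > 0" for s
    proof -
      have "s powr (\<gamma> - 1 - 1) = X s / s" using that powr_diff[of s "\<gamma> - 1" 1] by (simp add: X_def)
      then show ?thesis
        using has_real_derivative_powr[OF that, of "\<gamma> - 1"] by (simp add: X_def[abs_def])
    qed
    show "(F has_real_derivative (X x - 1) * (2 * \<gamma> - B x)) (at x)" if x: "x > 0" for x
    proof -
      have nz: "1 + X x \<noteq> 0" using X[OF x] by simp
      have "((\<lambda>s. s * (X s - 1)\<^sup>2 / (1 + X s)) has_real_derivative
         (((X x - 1)\<^sup>2 + x * (2 * (X x - 1) * ((\<gamma> - 1) * X x / x))) * (1 + X x) - x * (X x - 1)\<^sup>2 * ((\<gamma> - 1) * X x / x)) / ((1 + X x) * (1 + X x))) (at x)"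
        using DERIV_divide[OF DERIV_mult[OF DERIV_ident DERIV_power[OF DERIV_diff[OF dX[OF x] DERIV_const[of 1]], of 2]] DERIV_add[OF DERIV_const[of 1] dX[OF x]] nz]
        by (rule DERIV_cong) (simp add: mult_ac)
      moreover have "(((X x - 1)\<^sup>2 + x * (2 * (X x - 1) * ((\<gamma> - 1) * X x / x))) * (1 + X x) - x * (X x - 1)\<^sup>2 * ((\<gamma> - 1) * X x / x)) / ((1 + X x) * (1 + X x))
          = (X x - 1) * B x"
      proof -
        have "(((X x - 1)\<^sup>2 + x * (2 * (X x - 1) * ((\<gamma> - 1) * X x / x))) * (1 + X x) - x * (X x - 1)\<^sup>2 * ((\<gamma> - 1) * X x / x))
           = (((X x - 1)\<^sup>2 + (2 * (X x - 1) * ((\<gamma> - 1) * X x))) * (1 + X x) - (X x - 1)\<^sup>2 * ((\<gamma> - 1) * X x))"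
          using x by simp
        also have "\<dots> / ((1 + X x) * (1 + X x)) = (X x - 1) * B x"
          using nz unfolding B_def by (simp add: divide_simps power2_eq_square) (simp add: algebra_simps)
        finally show ?thesis .
      qed
      ultimately have "((\<lambda>s. s * (X s - 1)\<^sup>2 / (1 + X s)) has_real_derivative (X x - 1) * B x) (at x)" by simp
      from DERIV_diff[OF DERIV_cmult[OF relpow_deriv[OF x, of \<gamma>], of 2] this]
      show ?thesis by (simp add: F_def[abs_def] X_def algebra_simps)
    qed
    \<comment> \<open>In fact B is at most 1 + 2 (\<gamma> - 1), because X (X + 3) \<le> 2 (1 +
      X)^2.\<close>
    have B: "B x \<le> 2 * \<gamma>" if x: "x > 0" for x
    proof -
      have "(X x - 1) / (1 + X x) \<le> 1" using X[OF x] by simp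
      moreover have "X x * (X x + 3) / (1 + X x)\<^sup>2 \<le> 2"
        using X[OF x] by (simp add: divide_simps power2_eq_square) (simp add: algebra_simps)
      then have "(\<gamma> - 1) * (X x * (X x + 3) / (1 + X x)\<^sup>2) \<le> (\<gamma> - 1) * 2"
        using \<gamma> by (intro mult_left_mono) auto
      ultimately show ?thesis by (simp add: B_def mult.assoc)
    qed
    show "(X x - 1) * (2 * \<gamma> - B x) \<le> 0" if "0 < x" "x \<le> 1" for x
      using B[OF that(1)] powr_gamma_1_cmp[OF \<gamma>, of x] that by (auto simp: X_def intro!: mult_nonpos_nonneg)
    show "(X x - 1) * (2 * \<gamma> - B x) \<ge> 0" if "1 \<le> x" for x
      using B[of x] powr_gamma_1_cmp[OF \<gamma>, of x] that by (auto simp: X_def intro!: mult_nonneg_nonneg)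
  qed (use s in auto)
  moreover have "F 1 = 0" by (simp add: F_def relpow_def X_def)
  ultimately show ?thesis by (simp add: F_def X_def)
qed

lemma relpow_strict:
  assumes \<gamma>: "\<gamma> > 1" and s: "s > 0" "s \<noteq> 1" shows "relpow \<gamma> s > 0"
proof -
  have "s powr (\<gamma> - 1) \<noteq> 1"
    using \<gamma> s by (metis powr_eq_one_iff_gen diff_gt_0_iff_gt less_irrefl)
  then have "s * (s powr (\<gamma> - 1) - 1)\<^sup>2 / (1 + s powr (\<gamma> - 1)) > 0"
    using s by (intro divide_pos_pos mult_pos_pos) (auto intro: add_pos_pos)
  then show ?thesis using relpow_weighted_square[OF \<gamma> s(1)] by linarith
qed

lemma relpow_antimono:
  assumes "\<gamma> > 1" "0 < s" "s \<le> t" "t \<le> 1" shows "relpow \<gamma> t \<le> relpow \<gamma> s"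
proof (rule DERIV_nonpos_imp_nonincreasing[OF assms(3)])
  fix x assume "s \<le> x" "x \<le> t"
  then show "\<exists>y. (relpow \<gamma> has_real_derivative y) (at x) \<and> y \<le> 0"
    using assms powr_gamma_1_cmp(1)[OF assms(1), of x] relpow_deriv[of x \<gamma>]
    by (intro exI[of _ "\<gamma> * (x powr (\<gamma> - 1) - 1)"]) (auto intro: mult_nonneg_nonpos)
qed

lemma relpow_mono:
  assumes "\<gamma> > 1" "1 \<le> s" "s \<le> t" shows "relpow \<gamma> s \<le> relpow \<gamma> t"
proof (rule DERIV_nonneg_imp_nondecreasing[OF assms(3)])
  fix x assume "s \<le> x" "x \<le> t"
  then show "\<exists>y. (relpow \<gamma> has_real_derivative y) (at x) \<and> 0 \<le> y"
    using assms powr_gamma_1_cmp(2)[OF assms(1), of x] relpow_deriv[of x \<gamma>]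
    by (intro exI[of _ "\<gamma> * (x powr (\<gamma> - 1) - 1)"]) auto
qed

lemma relpow_superlinear:
  assumes \<gamma>: "\<gamma> > 1" shows "\<exists>C>0. \<forall>s\<ge>2. s powr \<gamma> \<le> C * relpow \<gamma> s"
proof -
  define x where "x = 2 powr (\<gamma> - 1)"
  have x: "x > 1" using \<gamma> by (simp add: x_def)
  \<comment> \<open>The first entry makes the derivative of the difference below nonnegative for s
    \<ge> 2, the second its value at s = 2.\<close>
  define C where "C = max (x / (x - 1)) (2 powr \<gamma> / relpow \<gamma> 2)"
  have h2: "relpow \<gamma> 2 > 0" using relpow_strict[OF \<gamma>] by simp
  have "C * relpow \<gamma> s - s powr \<gamma> \<ge> 0" if s: "s \<ge> 2" for s
  proof -
    have "0 \<le> C * relpow \<gamma> 2 - 2 powr \<gamma>"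
      using h2 by (auto simp: C_def max_def field_simps)
    also have "\<dots> \<le> C * relpow \<gamma> s - s powr \<gamma>"
    proof (rule DERIV_nonneg_imp_nondecreasing[OF s], intro exI conjI)
      fix y :: real assume y: "2 \<le> y"
      show "((\<lambda>s. C * relpow \<gamma> s - s powr \<gamma>) has_real_derivative C * (\<gamma> * (y powr (\<gamma> - 1) - 1)) - \<gamma> * y powr (\<gamma> - 1)) (at y)"
        using y by (auto intro!: derivative_eq_intros relpow_deriv)
      have xy: "x \<le> y powr (\<gamma> - 1)" unfolding x_def using y \<gamma> by (intro powr_mono2) auto
      have "x / (x - 1) * (y powr (\<gamma> - 1) - 1) \<le> C * (y powr (\<gamma> - 1) - 1)"
        using xy x by (intro mult_right_mono) (auto simp: C_def)
      moreover have "y powr (\<gamma> - 1) \<le> x / (x - 1) * (y powr (\<gamma> - 1) - 1)"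
        using x xy by (simp add: field_simps)
      ultimately have "\<gamma> * (y powr (\<gamma> - 1)) \<le> \<gamma> * (C * (y powr (\<gamma> - 1) - 1))"
        using \<gamma> by (intro mult_left_mono) auto
      then show "0 \<le> C * (\<gamma> * (y powr (\<gamma> - 1) - 1)) - \<gamma> * y powr (\<gamma> - 1)" by (simp add: mult_ac)
    qed
    finally show ?thesis .
  qed
  moreover have "C > 0" using x by (simp add: C_def less_max_iff_disj)
  ultimately show ?thesis by (intro exI[of _ C]) auto
qed

text \<open>Within \<delta> of 1 the additive error suffices; beyond it, up to distance 1,
  monotonicity bounds \<open>relpow\<close> from below by its value at distance \<delta>; for s
  \<ge> 2 its growth dominates. Allowing the additive error avoids an expansion of
  \<open>relpow\<close> at its minimum.\<close>

lemma relpow_distance: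
  assumes \<gamma>: "\<gamma> > 1" and \<delta>: "0 < \<delta>" "\<delta> < 1" and m: "0 < m" "m \<le> \<gamma>"
  shows "\<exists>C>0. \<forall>s>0. \<bar>s - 1\<bar> powr m \<le> \<delta> powr m + C * relpow \<gamma> s"
proof -
  obtain C1 where C1: "C1 > 0" "\<And>s. s \<ge> 2 \<Longrightarrow> s powr \<gamma> \<le> C1 * relpow \<gamma> s"
    using relpow_superlinear[OF \<gamma>] by blast
  have p: "relpow \<gamma> (1 - \<delta>) > 0" "relpow \<gamma> (1 + \<delta>) > 0" using relpow_strict[OF \<gamma>] \<delta> by auto
  define C where "C = C1 + 1 / relpow \<gamma> (1 - \<delta>) + 1 / relpow \<gamma> (1 + \<delta>)"
  have C: "C1 \<le> C" "1 / relpow \<gamma> (1 - \<delta>) \<le> C" "1 / relpow \<gamma> (1 + \<delta>) \<le> C"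
    using C1 p by (auto simp: C_def)
  have "\<bar>s - 1\<bar> powr m \<le> \<delta> powr m + C * relpow \<gamma> s" if s: "s > 0" for s
  proof -
    have h: "relpow \<gamma> s \<ge> 0" using relpow_nonneg[OF \<gamma> s] .
    have one: "1 \<le> C * relpow \<gamma> s" if "c > 0" "c \<le> relpow \<gamma> s" "1 / c \<le> C" for c
    proof -
      have "1 \<le> (1 / c) * relpow \<gamma> s" using that by (simp add: field_simps)
      also have "\<dots> \<le> C * relpow \<gamma> s" using that h by (intro mult_right_mono) auto
      finally show ?thesis .
    qed
    consider "\<bar>s - 1\<bar> \<le> \<delta>" | "s \<le> 1 - \<delta>" | "1 + \<delta> \<le> s" "s \<le> 2" | "2 \<le> s" by linarith
    then show ?thesis
    proof cases
      case 1
      then have "\<bar>s - 1\<bar> powr m \<le> \<delta> powr m" using m by (intro powr_mono2) auto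
      then show ?thesis using C h C1 by (simp add: add_increasing2)
    next
      case 2
      have "1 \<le> C * relpow \<gamma> s" by (rule one[OF p(1) relpow_antimono]) (use 2 \<delta> \<gamma> s C in auto)
      moreover have "\<bar>s - 1\<bar> powr m \<le> 1 powr m" using 2 \<delta> m s by (intro powr_mono2) auto
      ultimately show ?thesis by (simp add: add_increasing)
    next
      case 3
      have "1 \<le> C * relpow \<gamma> s" by (rule one[OF p(2) relpow_mono]) (use 3 \<delta> \<gamma> s C in auto)
      moreover have "\<bar>s - 1\<bar> powr m \<le> 1 powr m" using 3 \<delta> m s by (intro powr_mono2) auto
      ultimately show ?thesis by (simp add: add_increasing)
    next
      case 4
      have "\<bar>s - 1\<bar> powr m \<le> s powr m" using 4 m by (intro powr_mono2) auto
      also have "\<dots> \<le> s powr \<gamma>" using 4 m by (intro powr_mono) auto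
      also have "\<dots> \<le> C1 * relpow \<gamma> s" using C1 4 by simp
      also have "\<dots> \<le> C * relpow \<gamma> s" using C h by (intro mult_right_mono) auto
      finally show ?thesis by (simp add: add_increasing)
    qed
  qed
  moreover have "C > 0" using C C1 by simp
  ultimately show ?thesis by blast
qed

text \<open>The relative pressure potential \<open>P(\<rho>) - P(r) - P'(r)(\<rho> - r)\<close>.\<close>

definition relpot :: "real \<Rightarrow> real \<Rightarrow> real \<Rightarrow> real \<Rightarrow> real" where
  "relpot a \<gamma> \<rho> r = a / (\<gamma> - 1) * (\<rho> powr \<gamma> - r powr \<gamma> - \<gamma> * r powr (\<gamma> - 1) * (\<rho> - r))"

text \<open>Homogeneity of degree \<gamma>: the function of two variables reduces to
  \<open>relpow\<close> of the ratio.\<close>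

lemma relpot_scaling:
  assumes "\<rho> > 0" "r > 0"
  shows "relpot a \<gamma> \<rho> r = a / (\<gamma> - 1) * r powr \<gamma> * relpow \<gamma> (\<rho> / r)"
proof -
  have "r powr \<gamma> * relpow \<gamma> (\<rho> / r) = \<rho> powr \<gamma> - r powr \<gamma> - \<gamma> * (r powr \<gamma> / r) * (\<rho> - r)"
    using assms by (simp add: relpow_def powr_divide field_simps)
  also have "r powr \<gamma> / r = r powr (\<gamma> - 1)" using assms by (simp add: powr_diff)
  finally show ?thesis by (simp add: relpot_def mult.assoc)
qed

lemma relpot_nonneg:
  assumes "a > 0" "\<gamma> > 1" "\<rho> > 0" "r > 0" shows "relpot a \<gamma> \<rho> r \<ge> 0"
  using assms by (simp add: relpot_scaling relpow_nonneg)

lemma relpot_distance: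
  assumes a: "a > 0" and \<gamma>: "\<gamma> > 1" and c: "0 < c" "c \<le> C" and m: "0 < m" "m \<le> \<gamma>" and \<delta>: "\<delta> > 0"
  shows "\<exists>K>0. \<forall>\<rho>>0. \<forall>r\<in>{c..C}. \<bar>\<rho> - r\<bar> powr m \<le> \<delta> + K * relpot a \<gamma> \<rho> r"
proof -
  \<comment> \<open>Chosen so that C^m d^m \<le> \<delta>; the entry 1/2 keeps d below 1.\<close>
  define d where "d = min (1/2) ((\<delta> / C powr m) powr (1 / m))"
  have d: "0 < d" "d < 1" using c \<delta> by (auto simp: d_def)
  have "d powr m \<le> ((\<delta> / C powr m) powr (1 / m)) powr m"
    using d m by (intro powr_mono2) (auto simp: d_def)
  also have "\<dots> = \<delta> / C powr m" using m c \<delta> by (simp add: powr_powr)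
  finally have dm: "d powr m * C powr m \<le> \<delta>" using c by (simp add: field_simps)
  obtain K1 where K1: "K1 > 0" "\<And>s. s > 0 \<Longrightarrow> \<bar>s - 1\<bar> powr m \<le> d powr m + K1 * relpow \<gamma> s"
    using relpow_distance[OF \<gamma> d m] by blast
  define K where "K = C powr m * K1 * (\<gamma> - 1) / (a * c powr \<gamma>)"
  have "\<bar>\<rho> - r\<bar> powr m \<le> \<delta> + K * relpot a \<gamma> \<rho> r" if "\<rho> > 0" "r \<in> {c..C}" for \<rho> r
  proof -
    have r: "r > 0" using that c by auto
    have h: "relpow \<gamma> (\<rho> / r) \<ge> 0" using relpow_nonneg[OF \<gamma>] that r by simp
    have "\<rho> - r = r * (\<rho> / r - 1)" using r by (simp add: field_simps)
    then have "\<bar>\<rho> - r\<bar> = r * \<bar>\<rho> / r - 1\<bar>" using r by (metis abs_mult abs_of_pos)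
    then have "\<bar>\<rho> - r\<bar> powr m = r powr m * \<bar>\<rho> / r - 1\<bar> powr m" using r by (simp add: powr_mult)
    also have "\<dots> \<le> C powr m * (d powr m + K1 * relpow \<gamma> (\<rho> / r))"
      using that r K1(2)[of "\<rho> / r"] m by (intro mult_mono powr_mono2) auto
    also have "\<dots> \<le> \<delta> + C powr m * K1 * relpow \<gamma> (\<rho> / r)"
      using dm by (simp add: algebra_simps)
    also have "C powr m * K1 * relpow \<gamma> (\<rho> / r) \<le> K * relpot a \<gamma> \<rho> r"
    proof -
      have "K * relpot a \<gamma> \<rho> r = C powr m * K1 * (r powr \<gamma> / c powr \<gamma>) * relpow \<gamma> (\<rho> / r)"
        using a \<gamma> that r by (simp add: K_def relpot_scaling)
      moreover have "1 \<le> r powr \<gamma> / c powr \<gamma>"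
        using c \<gamma> that by (simp add: powr_mono2)
      then have "C powr m * K1 * relpow \<gamma> (\<rho> / r) * 1 \<le> C powr m * K1 * relpow \<gamma> (\<rho> / r) * (r powr \<gamma> / c powr \<gamma>)"
        using h K1 by (intro mult_left_mono) auto
      ultimately show ?thesis by (simp add: mult_ac)
    qed
    finally show ?thesis by simp
  qed
  moreover have "K > 0" using K1 a \<gamma> c by (simp add: K_def)
  ultimately show ?thesis by blast
qed

text \<open>In terms of s = \<rho> / r the left side is r^\<gamma> times a quadratic polynomial in
  Z. With x = s^(\<gamma>-1), completing the square with weight s (1 + x) leaves an excess s Z^2 and
  the quotient of \<open>relpow_weighted_square\<close>. The excess is acceptable because Z will be
  a multiple of the drift error.\<close>

lemma relpot_cross_term:
  assumes a: "a > 0" and \<gamma>: "\<gamma> > 1" and \<rho>: "\<rho> > 0" and r: "r > 0" and q: "\<bar>q\<bar> \<le> L"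
  shows "- (2 * q * Z * \<rho> * (\<rho> powr (\<gamma> - 1) - r powr (\<gamma> - 1)) + \<rho> powr \<gamma> * Z\<^sup>2)
     \<le> r powr (\<gamma> - 1) * \<rho> * Z\<^sup>2 + 2 * L\<^sup>2 * ((\<gamma> - 1) / a) * relpot a \<gamma> \<rho> r"
proof -
  define s x where "s = \<rho> / r" and "x = s powr (\<gamma> - 1)"
  have s: "s > 0" and x: "x > 0" and \<rho>s: "\<rho> = r * s" using \<rho> r by (auto simp: s_def x_def)
  have e1: "\<rho> powr (\<gamma> - 1) = r powr (\<gamma> - 1) * x" using r s by (simp add: \<rho>s powr_mult x_def)
  have e2: "r powr \<gamma> = r * r powr (\<gamma> - 1)" "\<rho> powr \<gamma> = r * r powr (\<gamma> - 1) * s * x"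
  proof -
    show "r powr \<gamma> = r * r powr (\<gamma> - 1)" using powr_mult_base[of r "\<gamma> - 1"] r by simp
    have "\<rho> powr \<gamma> = \<rho> * \<rho> powr (\<gamma> - 1)" using powr_mult_base[of \<rho> "\<gamma> - 1"] \<rho> by simp
    then show "\<rho> powr \<gamma> = r * r powr (\<gamma> - 1) * s * x" unfolding e1 by (simp add: \<rho>s)
  qed
  have "- (2 * q * Z * (s * (x - 1))) \<le> s * (1 + x) * Z\<^sup>2 + q\<^sup>2 * (s * (x - 1)\<^sup>2 / (1 + x))"
  proof -
    have "0 \<le> s * (1 + x) * (Z + q * (x - 1) / (1 + x))\<^sup>2" using s x by simp
    also have "\<dots> = s * (1 + x) * Z\<^sup>2 + 2 * q * Z * (s * (x - 1)) + q\<^sup>2 * (s * (x - 1)\<^sup>2 / (1 + x))"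
      using x by (simp add: divide_simps power2_eq_square) (simp add: algebra_simps)
    finally show ?thesis by simp
  qed
  also have "q\<^sup>2 * (s * (x - 1)\<^sup>2 / (1 + x)) \<le> L\<^sup>2 * (2 * relpow \<gamma> s)"
    using relpow_weighted_square[OF \<gamma> s] q s x power_mono[OF q, of 2] relpow_nonneg[OF \<gamma> s]
    by (intro mult_mono) (auto simp: x_def)
  finally have "- (2 * q * Z * (s * (x - 1)) + s * x * Z\<^sup>2) \<le> s * Z\<^sup>2 + L\<^sup>2 * (2 * relpow \<gamma> s)"
    by (simp add: algebra_simps)
  then have "(r * r powr (\<gamma> - 1)) * - (2 * q * Z * (s * (x - 1)) + s * x * Z\<^sup>2) \<le> (r * r powr (\<gamma> - 1)) * (s * Z\<^sup>2 + L\<^sup>2 * (2 * relpow \<gamma> s))"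
    using r by (intro mult_left_mono) auto
  moreover have "((\<gamma> - 1) / a) * relpot a \<gamma> \<rho> r = (r * r powr (\<gamma> - 1)) * relpow \<gamma> s"
    using a \<gamma> \<rho> r by (simp add: relpot_scaling s_def e2(1))
  then have "2 * L\<^sup>2 * ((\<gamma> - 1) / a) * relpot a \<gamma> \<rho> r = (r * r powr (\<gamma> - 1)) * (L\<^sup>2 * (2 * relpow \<gamma> s))"
    by (metis (no_types, opaque_lifting) mult.assoc mult.commute)
  moreover have "r powr (\<gamma> - 1) * \<rho> * Z\<^sup>2 = (r * r powr (\<gamma> - 1)) * (s * Z\<^sup>2)"
    by (simp add: \<rho>s)
  moreover have "- (2 * q * Z * \<rho> * (\<rho> powr (\<gamma> - 1) - r powr (\<gamma> - 1)) + \<rho> powr \<gamma> * Z\<^sup>2) = (r * r powr (\<gamma> - 1)) * - (2 * q * Z * (s * (x - 1)) + s * x * Z\<^sup>2)"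
    unfolding e1 e2 by (simp add: \<rho>s algebra_simps)
  ultimately show ?thesis by (simp only: distrib_left)
qed

section \<open>The integrand of the relative entropy balance\<close>

text \<open>Here \<open>n\<close> and \<open>q1\<close> stand for the vertical derivatives of the logarithms of the densities \<open>\<rho>\<close> and \<open>r\<close>, and
  \<open>X\<close>, \<open>Y\<close> for \<open>\<rho> powr (\<gamma> - 1)\<close>, \<open>r powr (\<gamma> - 1)\<close>.  The last group of terms on the left consists of
  expressions whose integrals vanish by periodicity.  The bracket with the factor \<open>2 * k * \<mu> * a * \<gamma>\<close> is the
  remainder of \<open>p'(\<rho>) \<bar>\<nabla>\<rho>\<bar>\<^sup>2 / \<rho>\<close> with respect to its tangent plane at \<open>(r, r q1)\<close>; expanding around this plane
  avoids the chain rule for \<open>p(\<rho>)\<close>.\<close>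

lemma balance_integrand_identity:
  fixes s k :: real
  assumes ss: "s * s = k * (1 - k)"
    and V: "V = U + 2 * k * \<mu> * q1" and W: "W = 2 * s * \<mu> * q1"
    and Vy: "Vy = Uy + 2 * k * \<mu> * q2" and Wy: "Wy = 2 * s * \<mu> * q2"
    and Vt: "Vt = - U * Vy - a * \<gamma> * Y * q1 + 2 * (1 - k) * \<mu> * (Uyy + q1 * Uy)"
    and Wt: "Wt = - U * Wy - 2 * s * \<mu> * (Uyy + q1 * Uy)"
    and v: "v = u + 2 * k * \<mu> * n" and w: "w = 2 * s * \<mu> * n" and h: "h = \<rho> * G + u * (\<rho> * n)"
    and pt: "pt = - a * \<gamma> * Y * r * (U * q1 + Uy)"
    and xit: "xit = V * Vt + W * Wt + a * \<gamma> * Y * (U * q1 + Uy)" and xiy: "xiy = V * Vy + W * Wy - a * \<gamma> * Y * q1"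
    and prel: "prel = a * (\<rho> * X - r * Y - \<gamma> * Y * (\<rho> - r))"
  shows "- (\<rho> * v * Vt + (\<rho> * u * v - 2 * (1 - k) * \<mu> * \<rho> * G + a * \<rho> * X) * Vy)
     - (\<rho> * w * Wt + (\<rho> * u * w + 2 * s * \<mu> * \<rho> * G) * Wy) + \<rho> * xit + \<rho> * u * xiy + pt
     - (2 * k * \<mu> * a * \<gamma> * X * \<rho> * n\<^sup>2 + 2 * (1 - k) * \<mu> * \<rho> * G\<^sup>2)
     + (2 * (1 - k) * \<mu> * ((\<rho> * u * Uyy + h * Uy) - (\<rho> * (Uy\<^sup>2 + U * Uyy) + \<rho> * n * (U * Uy)))
     + (a * \<gamma> * Y * r * q1 * U + a * r * Y * Uy)
     + 2 * k * \<mu> * (\<rho> * ((\<gamma> - 1) * a * \<gamma> * Y * q1\<^sup>2 + a * \<gamma> * Y * q2) + \<rho> * n * (a * \<gamma> * Y * q1))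
     - 2 * k * \<mu> * (\<gamma> - 1) * (a * \<gamma> * Y * r * q1\<^sup>2 + a * r * Y * q2))
   = - \<rho> * (v - V) * (u - U) * Vy - \<rho> * (w - W) * (u - U) * Wy - 2 * (1 - k) * \<mu> * \<rho> * (G - Uy)\<^sup>2
     + 2 * (1 - k) * \<mu> * \<rho> * (u - U) * (n - q1) * Uy - prel * Uy - 2 * k * \<mu> * prel * q2
     - 2 * k * \<mu> * \<gamma> * (q1\<^sup>2 * prel + a * (2 * q1 * (n - q1) * \<rho> * (X - Y) + \<rho> * X * (n - q1)\<^sup>2))"
proof -
  \<comment> \<open>Once the squares of s are eliminated, both sides are the same polynomial in the
    remaining quantities.\<close>
  have ss': "s * (s * x) = k * x - k * (k * x)" for x
    using arg_cong[OF ss, of "\<lambda>z. z * x"] by (simp add: algebra_simps)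
  show ?thesis
    unfolding V W Vy Wy Vt Wt v w h pt xit xiy prel power2_eq_square
    by (simp add: algebra_simps ss')
qed

text \<open>Both u - U and n - q1 are linear combinations of v - V and w - W with coefficients
  depending only on k and \<mu>, so the quadratic terms are controlled by the kinetic part and the
  bound L. The pressure terms are multiples of \<open>relpot\<close> or handled by
  \<open>relpot_cross_term\<close>, and those with (G - Uy)^2 and q1^2 have a good sign.\<close>

lemma balance_integrand_bound:
  fixes \<gamma> a k \<mu> L R :: real
  assumes \<gamma>: "\<gamma> > 1" and a: "a > 0" and k: "0 < k" "k < 1" and \<mu>: "\<mu> > 0" and R: "R > 0"
  defines "s \<equiv> sqrt (k * (1 - k))"
  shows "\<exists>C\<ge>0. \<forall>\<rho> r u U G Uy n q1 q2 V W Vy Wy v w prel X Y.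
    \<rho> > 0 \<longrightarrow> 0 < r \<longrightarrow> r \<le> R \<longrightarrow> \<bar>Uy\<bar> \<le> L \<longrightarrow> \<bar>q1\<bar> \<le> L \<longrightarrow> \<bar>q2\<bar> \<le> L \<longrightarrow>
    V = U + 2 * k * \<mu> * q1 \<longrightarrow> W = 2 * s * \<mu> * q1 \<longrightarrow> Vy = Uy + 2 * k * \<mu> * q2 \<longrightarrow> Wy = 2 * s * \<mu> * q2 \<longrightarrow>
    v = u + 2 * k * \<mu> * n \<longrightarrow> w = 2 * s * \<mu> * n \<longrightarrow> X = \<rho> powr (\<gamma> - 1) \<longrightarrow> Y = r powr (\<gamma> - 1) \<longrightarrow>
    prel = a * (\<rho> * X - r * Y - \<gamma> * Y * (\<rho> - r)) \<longrightarrow>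
    - \<rho> * (v - V) * (u - U) * Vy - \<rho> * (w - W) * (u - U) * Wy - 2 * (1 - k) * \<mu> * \<rho> * (G - Uy)\<^sup>2
     + 2 * (1 - k) * \<mu> * \<rho> * (u - U) * (n - q1) * Uy - prel * Uy - 2 * k * \<mu> * prel * q2
     - 2 * k * \<mu> * \<gamma> * (q1\<^sup>2 * prel + a * (2 * q1 * (n - q1) * \<rho> * (X - Y) + \<rho> * X * (n - q1)\<^sup>2))
    \<le> C * (\<rho> * ((w - W)\<^sup>2 + (v - V)\<^sup>2) / 2 + relpot a \<gamma> \<rho> r)"
proof -
  have s: "s > 0" using k by (simp add: s_def)
  \<comment> \<open>c is the factor in u - U = A - c Z. C1 collects the coefficients of \<rho> Q,
    and C2 those of the relative pressure.\<close>
  define c where "c = k / s"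
  define L' where "L' = \<bar>L\<bar>"
  define C1 where "C1 = (L' + 2 * k * \<mu> * L' + 2 * s * \<mu> * L' + 2 * (1 - k) * \<mu> * L' / (2 * s * \<mu>)) * (1 + c)
     + 2 * k * \<mu> * \<gamma> * a * R powr (\<gamma> - 1) / (4 * s\<^sup>2 * \<mu>\<^sup>2)"
  define C2 where "C2 = (\<gamma> - 1) * L' + 2 * k * \<mu> * ((\<gamma> - 1) * L') + 2 * k * \<mu> * \<gamma> * a * (2 * L'\<^sup>2 * ((\<gamma> - 1) / a))"
  have c: "c > 0" and L': "L' \<ge> 0" using k s by (auto simp: c_def L'_def)
  have C1: "C1 \<ge> 0" and C2: "C2 \<ge> 0"
    using c L' k \<mu> s \<gamma> a by (auto simp: C1_def C2_def)
  show ?thesis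
  proof (intro exI[of _ "2 * C1 + C2"] conjI allI impI)
    show "0 \<le> 2 * C1 + C2" using C1 C2 by simp
  next
    fix \<rho> r u U G Uy n q1 q2 V W Vy Wy v w prel X Y :: real
    assume \<rho>: "\<rho> > 0" and r: "0 < r" "r \<le> R" and "\<bar>Uy\<bar> \<le> L" "\<bar>q1\<bar> \<le> L" "\<bar>q2\<bar> \<le> L"
      and V: "V = U + 2 * k * \<mu> * q1" and W: "W = 2 * s * \<mu> * q1"
      and Vy: "Vy = Uy + 2 * k * \<mu> * q2" and Wy: "Wy = 2 * s * \<mu> * q2"
      and v: "v = u + 2 * k * \<mu> * n" and w: "w = 2 * s * \<mu> * n" and X: "X = \<rho> powr (\<gamma> - 1)" and Y: "Y = r powr (\<gamma> - 1)"
      and prel: "prel = a * (\<rho> * X - r * Y - \<gamma> * Y * (\<rho> - r))"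
    then have B: "\<bar>Uy\<bar> \<le> L'" "\<bar>q1\<bar> \<le> L'" "\<bar>q2\<bar> \<le> L'" by (auto simp: L'_def)
    define A Z Q H where "A = v - V" and "Z = w - W" and "Q = A\<^sup>2 + Z\<^sup>2" and "H = relpot a \<gamma> \<rho> r"
    have H: "H \<ge> 0" unfolding H_def by (rule relpot_nonneg[OF a \<gamma> \<rho> r(1)])
    have prelH: "prel = (\<gamma> - 1) * H"
      using \<gamma> \<rho> r powr_mult_base[of r "\<gamma> - 1"] powr_mult_base[of \<rho> "\<gamma> - 1"]
      by (simp add: prel H_def relpot_def X Y)
    have nq: "n - q1 = Z / (2 * s * \<mu>)" using s \<mu> by (simp add: Z_def w W field_simps)
    have "A = (u - U) + 2 * k * \<mu> * (n - q1)" by (simp add: A_def v V algebra_simps)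
    then have uU: "u - U = A - c * Z" using s \<mu> by (simp add: nq c_def)
    have AZ: "\<bar>A * Z\<bar> \<le> Q / 2"
      using sum_squares_bound[of "\<bar>A\<bar>" "\<bar>Z\<bar>"] by (simp add: Q_def abs_mult)
    have Q0: "0 \<le> A\<^sup>2" "0 \<le> Z\<^sup>2" by auto
    have cQ: "c * \<bar>A * Z\<bar> \<le> c * Q" "c * Z\<^sup>2 \<le> c * Q"
      using c AZ Q0 by (auto intro!: mult_left_mono simp: Q_def)
    have AU: "\<bar>A * (u - U)\<bar> \<le> (1 + c) * Q"
    proof -
      have "\<bar>A * (u - U)\<bar> \<le> A\<^sup>2 + c * \<bar>A * Z\<bar>"
        unfolding uU using abs_triangle_ineq4[of "A\<^sup>2" "c * (A * Z)"] c by (simp add: power2_eq_square algebra_simps abs_mult)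
      moreover have "A\<^sup>2 \<le> Q" using Q0 by (simp add: Q_def)
      ultimately show ?thesis using cQ by (simp add: distrib_right)
    qed
    have ZU: "\<bar>Z * (u - U)\<bar> \<le> (1 + c) * Q"
    proof -
      have "\<bar>Z * (u - U)\<bar> \<le> \<bar>A * Z\<bar> + c * Z\<^sup>2"
        unfolding uU using abs_triangle_ineq4[of "A * Z" "c * (Z * Z)"] c by (simp add: power2_eq_square algebra_simps abs_mult)
      moreover have "\<bar>A * Z\<bar> \<le> Q" using AZ Q0 by (simp add: Q_def)
      ultimately show ?thesis using cQ by (simp add: distrib_right)
    qed
    have Vy': "\<bar>Vy\<bar> \<le> L' + 2 * k * \<mu> * L'"
    proof -
      have "2 * k * \<mu> * \<bar>q2\<bar> \<le> 2 * k * \<mu> * L'" using B k \<mu> by (intro mult_left_mono) auto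
      moreover have "\<bar>2 * k * \<mu> * q2\<bar> = 2 * k * \<mu> * \<bar>q2\<bar>" using k \<mu> by (simp add: abs_mult)
      ultimately show ?thesis using B(1) unfolding Vy by linarith
    qed
    have Wy': "\<bar>Wy\<bar> \<le> 2 * s * \<mu> * L'"
      using s \<mu> mult_left_mono[OF B(3), of "2 * s * \<mu>"] by (simp add: Wy abs_mult)
    have Q: "Q \<ge> 0" by (simp add: Q_def)
    have 1: "- (A * (u - U)) * Vy \<le> (1 + c) * Q * (L' + 2 * k * \<mu> * L')"
      using mult_mono[OF AU Vy'] c Q abs_ge_minus_self[of "A * (u - U) * Vy"] by (simp add: abs_mult)
    have 2: "- (Z * (u - U)) * Wy \<le> (1 + c) * Q * (2 * s * \<mu> * L')"
      using mult_mono[OF ZU Wy'] c Q abs_ge_minus_self[of "Z * (u - U) * Wy"] by (simp add: abs_mult)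
    have 3: "2 * (1 - k) * \<mu> * ((u - U) * (n - q1) * Uy) \<le> (1 + c) * Q * (2 * (1 - k) * \<mu> * L' / (2 * s * \<mu>))"
    proof -
      have e: "(u - U) * (n - q1) * Uy = (Z * (u - U) * Uy) / (2 * s * \<mu>)" by (simp add: nq)
      have "Z * (u - U) * Uy \<le> (1 + c) * Q * L'"
        using mult_mono[OF ZU B(1)] c Q abs_ge_self[of "Z * (u - U) * Uy"] by (simp add: abs_mult)
      then have "2 * (1 - k) * \<mu> * ((Z * (u - U) * Uy) / (2 * s * \<mu>)) \<le> 2 * (1 - k) * \<mu> * (((1 + c) * Q * L') / (2 * s * \<mu>))"
        using k \<mu> s by (intro mult_left_mono divide_right_mono) auto
      then show ?thesis unfolding e by (simp only: times_divide_eq_right mult_ac)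
    qed
    have 4: "- prel * Uy \<le> (\<gamma> - 1) * L' * H"
      using mult_mono[OF order_refl[of "\<bar>prel\<bar>"] B(1)] abs_ge_minus_self[of "prel * Uy"] H \<gamma> by (simp add: prelH abs_mult mult_ac)
    have "- prel * q2 \<le> (\<gamma> - 1) * L' * H"
      using mult_mono[OF order_refl[of "\<bar>prel\<bar>"] B(3)] abs_ge_minus_self[of "prel * q2"] H \<gamma> by (simp add: prelH abs_mult mult_ac)
    then have 5: "2 * k * \<mu> * (- prel * q2) \<le> 2 * k * \<mu> * ((\<gamma> - 1) * L' * H)"
      using k \<mu> by (intro mult_left_mono) auto
    have 6: "- (2 * q1 * (n - q1) * \<rho> * (X - Y) + \<rho> * X * (n - q1)\<^sup>2) \<le> R powr (\<gamma> - 1) / (4 * s\<^sup>2 * \<mu>\<^sup>2) * (\<rho> * Q) + 2 * L'\<^sup>2 * ((\<gamma> - 1) / a) * H"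
    proof -
      have "\<rho> * X = \<rho> powr \<gamma>" using \<rho> powr_mult_base[of \<rho> "\<gamma> - 1"] by (simp add: X)
      then have "- (2 * q1 * (n - q1) * \<rho> * (X - Y) + \<rho> * X * (n - q1)\<^sup>2)
         \<le> Y * \<rho> * (n - q1)\<^sup>2 + 2 * L'\<^sup>2 * ((\<gamma> - 1) / a) * H"
        using relpot_cross_term[OF a \<gamma> \<rho> r(1) B(2), of "n - q1"] by (simp add: X Y H_def)
      moreover have "Y * (\<rho> * (n - q1)\<^sup>2) \<le> R powr (\<gamma> - 1) * (\<rho> * (Q / (4 * s\<^sup>2 * \<mu>\<^sup>2)))"
      proof (intro mult_mono)
        show "Y \<le> R powr (\<gamma> - 1)" unfolding Y using r \<gamma> by (intro powr_mono2) auto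
        show "(n - q1)\<^sup>2 \<le> Q / (4 * s\<^sup>2 * \<mu>\<^sup>2)"
          unfolding nq using s \<mu> by (simp add: power_divide power_mult_distrib Q_def divide_right_mono)
      qed (use \<rho> in auto)
      ultimately show ?thesis by (simp add: mult_ac)
    qed
    have 7: "2 * (1 - k) * \<mu> * \<rho> * (G - Uy)\<^sup>2 \<ge> 0" "2 * k * \<mu> * \<gamma> * (q1\<^sup>2 * prel) \<ge> 0"
      using k \<mu> \<rho> \<gamma> H by (auto simp: prelH)
    have 8: "2 * k * \<mu> * \<gamma> * a * - (2 * q1 * (n - q1) * \<rho> * (X - Y) + \<rho> * X * (n - q1)\<^sup>2)
       \<le> 2 * k * \<mu> * \<gamma> * a * (R powr (\<gamma> - 1) / (4 * s\<^sup>2 * \<mu>\<^sup>2) * (\<rho> * Q) + 2 * L'\<^sup>2 * ((\<gamma> - 1) / a) * H)"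
      using 6 k \<mu> \<gamma> a by (intro mult_left_mono) auto
    have 9: "\<rho> * (- (A * (u - U)) * Vy + - (Z * (u - U)) * Wy + 2 * (1 - k) * \<mu> * ((u - U) * (n - q1) * Uy))
      \<le> \<rho> * ((1 + c) * Q * (L' + 2 * k * \<mu> * L') + (1 + c) * Q * (2 * s * \<mu> * L') + (1 + c) * Q * (2 * (1 - k) * \<mu> * L' / (2 * s * \<mu>)))"
      using 1 2 3 \<rho> by (intro mult_left_mono add_mono) auto
    have "- \<rho> * (v - V) * (u - U) * Vy - \<rho> * (w - W) * (u - U) * Wy - 2 * (1 - k) * \<mu> * \<rho> * (G - Uy)\<^sup>2
     + 2 * (1 - k) * \<mu> * \<rho> * (u - U) * (n - q1) * Uy - prel * Uy - 2 * k * \<mu> * prel * q2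
     - 2 * k * \<mu> * \<gamma> * (q1\<^sup>2 * prel + a * (2 * q1 * (n - q1) * \<rho> * (X - Y) + \<rho> * X * (n - q1)\<^sup>2))
     = \<rho> * (- (A * (u - U)) * Vy + - (Z * (u - U)) * Wy + 2 * (1 - k) * \<mu> * ((u - U) * (n - q1) * Uy))
      - 2 * (1 - k) * \<mu> * \<rho> * (G - Uy)\<^sup>2 + (- prel * Uy) + 2 * k * \<mu> * (- prel * q2) - 2 * k * \<mu> * \<gamma> * (q1\<^sup>2 * prel)
      + 2 * k * \<mu> * \<gamma> * a * - (2 * q1 * (n - q1) * \<rho> * (X - Y) + \<rho> * X * (n - q1)\<^sup>2)"
      by (simp add: A_def[symmetric] Z_def[symmetric]) (simp add: algebra_simps)
    also have "\<dots> \<le> C1 * (\<rho> * Q) + C2 * H"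
    proof -
      have "C1 * (\<rho> * Q) + C2 * H = \<rho> * ((1 + c) * Q * (L' + 2 * k * \<mu> * L') + (1 + c) * Q * (2 * s * \<mu> * L') + (1 + c) * Q * (2 * (1 - k) * \<mu> * L' / (2 * s * \<mu>)))
        + (\<gamma> - 1) * L' * H + 2 * k * \<mu> * ((\<gamma> - 1) * L' * H)
        + 2 * k * \<mu> * \<gamma> * a * (R powr (\<gamma> - 1) / (4 * s\<^sup>2 * \<mu>\<^sup>2) * (\<rho> * Q) + 2 * L'\<^sup>2 * ((\<gamma> - 1) / a) * H)"
        unfolding C1_def C2_def by (simp only: distrib_left distrib_right times_divide_eq_left times_divide_eq_right mult_ac add_ac)
      then show ?thesis using 4 5 7 8 9 by linarith
    qed
    \<comment> \<open>C1 is doubled because the energy density contains Q / 2.\<close>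
    also have "\<dots> \<le> (2 * C1 + C2) * (\<rho> * Q / 2 + H)"
    proof -
      have "(2 * C1 + C2) * (\<rho> * Q / 2 + H) = C1 * (\<rho> * Q) + C2 * H + (2 * C1 * H + C2 * (\<rho> * Q) / 2)" by (simp add: algebra_simps)
      moreover have "2 * C1 * H + C2 * (\<rho> * Q) / 2 \<ge> 0" using C1 C2 H Q \<rho> by simp
      ultimately show ?thesis by linarith
    qed
    finally show "- \<rho> * (v - V) * (u - U) * Vy - \<rho> * (w - W) * (u - U) * Wy - 2 * (1 - k) * \<mu> * \<rho> * (G - Uy)\<^sup>2
     + 2 * (1 - k) * \<mu> * \<rho> * (u - U) * (n - q1) * Uy - prel * Uy - 2 * k * \<mu> * prel * q2
     - 2 * k * \<mu> * \<gamma> * (q1\<^sup>2 * prel + a * (2 * q1 * (n - q1) * \<rho> * (X - Y) + \<rho> * X * (n - q1)\<^sup>2))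
    \<le> (2 * C1 + C2) * (\<rho> * ((w - W)\<^sup>2 + (v - V)\<^sup>2) / 2 + relpot a \<gamma> \<rho> r)"
      by (simp add: Q_def A_def Z_def H_def add.commute)
  qed
qed

section \<open>Gronwall inequality\<close>

lemma set_integral_FTC_open:
  fixes f F :: "real \<Rightarrow> real"
  assumes ab: "a \<le> b" and D: "\<And>x. a \<le> x \<Longrightarrow> x \<le> b \<Longrightarrow> (F has_real_derivative f x) (at x)" and c: "continuous_on {a..b} f"
  shows "set_integrable lborel {a<..<b} f" "(LINT x:{a<..<b}|lborel. f x) = F b - F a"
proof -
  show i: "set_integrable lborel {a<..<b} f"
    using borel_integrable_atLeastAtMost'[OF c] by (rule set_integrable_subset) auto
  have "(f has_integral F b - F a) {a..b}"
    using ab by (intro fundamental_theorem_of_calculus has_real_derivative_iff_has_vector_derivative[THEN iffD1]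
        has_field_derivative_at_within[OF D]) auto
  then show "(LINT x:{a<..<b}|lborel. f x) = F b - F a"
    using set_borel_integral_eq_integral(2)[OF i] integral_open_interval_real[of a b f] by (simp add: integral_unique)
qed

text \<open>The integral of \<open>y\<close> need not be differentiated: swapping the order of integration gives
  \<open>exp (- C t) \<integral>\<^sub>0\<^sup>t y = \<integral>\<^sub>0\<^sup>t exp (- C s) (y s - C \<integral>\<^sub>0\<^sup>s y) ds\<close>.\<close>

lemma gronwall_integrable:
  fixes y :: "real \<Rightarrow> real"
  assumes y: "set_integrable lborel {0<..<T} y" and C: "C \<ge> 0"
    and le: "AE t in lborel. t \<in> {0<..<T} \<longrightarrow> y t \<le> y0 + C * (LINT s:{0<..<t}|lborel. y s)"
  shows "AE t in lborel. t \<in> {0<..<T} \<longrightarrow> y t \<le> y0 * exp (C * t)"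
proof -
  \<comment> \<open>The bound is obtained for the right-hand side, which is defined at every t; the
    almost-everywhere hypothesis enters it only under an integral.\<close>
  have Yb: "y0 + C * (LINT s:{0<..<t}|lborel. y s) \<le> y0 * exp (C * t)" if t: "0 < t" "t < T" for t
  proof -
    have yt: "set_integrable lborel {0<..<t} y" using y by (rule set_integrable_subset) (use t in auto)
    define e where "e s = exp (- C * s)" for s
    define g where "g s = C * e s" for s
    have gD: "((\<lambda>s. - e s) has_real_derivative g s) (at s)" for s
      unfolding g_def e_def by (auto intro!: derivative_eq_intros)
    have ec: "continuous_on S e" and gc: "continuous_on S g" for S
      unfolding g_def[abs_def] e_def[abs_def] by (intro continuous_intros)+
    have gi: "(LINT s:{r<..<t}|lborel. g s) = e r - e t" and gI: "set_integrable lborel {r<..<t} g" if "r \<le> t" for r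
      using set_integral_FTC_open[OF that gD gc] by simp_all
    have eI: "set_integrable lborel {0<..<t} e"
      using borel_integrable_atLeastAtMost'[OF ec, of 0 t] by (rule set_integrable_subset) auto
    define Y where "Y s = (LINT r:{0<..<s}|lborel. y r)" for s
    have ye: "set_integrable lborel {0<..<t} (\<lambda>r. y r * e r)"
    proof (rule set_integrable_mult_bounded[OF yt])
      show "set_borel_measurable lborel {0<..<t} e"
        unfolding set_borel_measurable_def e_def[abs_def] by measurable
      show "\<bar>e r\<bar> \<le> 1" if "r \<in> {0<..<t}" for r using that C by (auto simp: e_def)
    qed
    have gY: "set_integrable lborel {0<..<t} (\<lambda>s. g s * Y s)"
      unfolding Y_def by (rule set_integrable_mult_bounded[OF gI[of 0] set_integral_upto(1)[OF yt] set_integral_upto(2)[OF yt]]) (use t in auto)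
    have "(LINT s:{0<..<t}|lborel. g s * Y s) = (LINT r:{0<..<t}|lborel. y r * (e r - e t))"
      unfolding Y_def set_integral_triangle_swap[OF yt gI[of 0, OF less_imp_le[OF t(1)]]]
      by (intro set_lebesgue_integral_cong) (auto simp: gi)
    also have "\<dots> = (LINT r:{0<..<t}|lborel. y r * e r) - Y t * e t"
      using ye yt unfolding right_diff_distrib by (subst set_integral_diff(2)) (auto simp: Y_def)
    finally have "Y t * e t = (LINT r:{0<..<t}|lborel. y r * e r - g r * Y r)"
      using ye gY by (simp add: set_integral_diff)
    also have "\<dots> \<le> (LINT r:{0<..<t}|lborel. y0 * e r)"
    proof (rule set_integral_mono_AE)
      show "set_integrable lborel {0<..<t} (\<lambda>r. y r * e r - g r * Y r)" using ye gY by (rule set_integral_diff)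
      show "set_integrable lborel {0<..<t} (\<lambda>r. y0 * e r)" using eI by simp
      show "AE r\<in>{0<..<t} in lborel. y r * e r - g r * Y r \<le> y0 * e r"
        using le
      proof eventually_elim
        case (elim r)
        have "(y r - C * Y r) * e r \<le> y0 * e r" if "r \<in> {0<..<t}"
          using elim that t by (intro mult_right_mono) (auto simp: Y_def e_def)
        then show ?case by (auto simp: g_def algebra_simps)
      qed
    qed
    finally have "C * (Y t * e t) \<le> C * (LINT r:{0<..<t}|lborel. y0 * e r)"
      using C by (rule mult_left_mono)
    also have "\<dots> = y0 * (LINT r:{0<..<t}|lborel. g r)" by (simp add: g_def)
    also have "\<dots> = y0 * (1 - e t)" using gi[of 0] t by (simp add: e_def)
    finally have "(y0 + C * Y t) * e t \<le> y0" by (simp add: algebra_simps)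
    then have "(y0 + C * Y t) * e t * exp (C * t) \<le> y0 * exp (C * t)" by (rule mult_right_mono) simp
    then show ?thesis by (simp add: e_def Y_def mult.assoc flip: exp_add)
  qed
  show ?thesis using le by eventually_elim (use Yb in force)
qed

section \<open>Integrals over space-time cylinders\<close>

lemma set_integrable_mult_continuous:
  fixes f h :: "'a::euclidean_space \<Rightarrow> real"
  assumes "set_integrable lborel A f" "A \<in> sets borel" "continuous_on A h" "\<And>x. x \<in> A \<Longrightarrow> \<bar>h x\<bar> \<le> B"
  shows "set_integrable lborel A (\<lambda>x. f x * h x)"
  using assms borel_measurable_continuous_on_indicator[of A h]
  by (intro set_integrable_mult_bounded[where B = B]) (auto simp: set_borel_measurable_def)

lemma set_integral_Fubini:
  fixes F :: "'a::euclidean_space \<times> 'b::euclidean_space \<Rightarrow> real"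
  assumes F: "set_integrable lborel (A \<times> B) F"
  shows "AE t in lborel. t \<in> A \<longrightarrow> set_integrable lborel B (\<lambda>x. F (t, x))"
    and "set_integrable lborel A (\<lambda>t. LINT x:B|lborel. F (t, x))"
    and "(LINT z:A \<times> B|lborel. F z) = (LINT t:A|lborel. LINT x:B|lborel. F (t, x))"
proof -
  define f where "f z = indicator (A \<times> B) z *\<^sub>R F z" for z
  have f: "integrable (lborel \<Otimes>\<^sub>M lborel) f"
    using F unfolding set_integrable_def f_def[abs_def] lborel_prod .
  have fi: "f (t, x) = indicator A t * (indicator B x * F (t, x))" for t x
    by (auto simp: f_def indicator_def)
  show "AE t in lborel. t \<in> A \<longrightarrow> set_integrable lborel B (\<lambda>x. F (t, x))"
    using lborel_pair.AE_integrable_fst'[OF f]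
    by eventually_elim (auto simp: fi set_integrable_def)
  show "set_integrable lborel A (\<lambda>t. LINT x:B|lborel. F (t, x))"
    using lborel_pair.integrable_fst'[OF f] by (simp add: fi set_integrable_def set_lebesgue_integral_def)
  have "(LINT z:A \<times> B|lborel. F z) = integral\<^sup>L (lborel \<Otimes>\<^sub>M lborel) f"
    unfolding set_lebesgue_integral_def f_def[abs_def] lborel_prod ..
  also have "\<dots> = (LINT t:A|lborel. LINT x:B|lborel. F (t, x))"
    by (subst lborel_pair.integral_fst'[OF f, symmetric]) (simp add: fi set_lebesgue_integral_def)
  finally show "(LINT z:A \<times> B|lborel. F z) = (LINT t:A|lborel. LINT x:B|lborel. F (t, x))" .
qed

lemma set_integral_uminus_real: "(LINT x:A|M. - f x) = - (LINT x:A|M. f x :: real)"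
  unfolding set_lebesgue_integral_def by simp

lemma set_integral_cong_AE_integrable:
  fixes f g :: "'a \<Rightarrow> real"
  assumes "set_integrable M A f" "set_integrable M A g" "AE x\<in>A in M. f x = g x"
  shows "(LINT x:A|M. f x) = (LINT x:A|M. g x)"
  unfolding set_lebesgue_integral_def using assms
  by (intro integral_cong_AE) (auto simp: set_integrable_def)

lemma open_Omega: "open (Omega \<epsilon>)"
proof -
  have "Omega \<epsilon> = box 0 (\<chi> i. if i = 3 then 1 else \<epsilon>)"
    by (auto simp: Omega_def mem_box_cart forall_3)
  then show ?thesis by (simp add: open_box)
qed

lemma Omega_borel[measurable]: "Omega \<epsilon> \<in> sets borel"
  using open_Omega by (rule borel_open)

lemma cyl_borel[measurable]: "{a<..<b::real} \<times> Omega \<epsilon> \<in> sets (borel :: (real \<times> (real^3)) measure)"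
  by (intro borel_open open_Times open_Omega) auto

lemma emeasure_Omega:
  assumes "\<epsilon> > 0" shows "emeasure lborel (Omega \<epsilon>) < \<infinity>" "emeasure lborel (Omega \<epsilon>) > 0" "measure lborel (Omega \<epsilon>) > 0"
proof -
  have eq: "Omega \<epsilon> = box 0 (\<chi> i. if i = 3 then 1 else \<epsilon>)"
    by (auto simp: Omega_def mem_box_cart forall_3)
  show fin: "emeasure lborel (Omega \<epsilon>) < \<infinity>"
    unfolding eq by (simp add: emeasure_lborel_box_eq less_top)
  have "(\<chi> i. if i = 3 then 1/2 else \<epsilon>/2) \<in> Omega \<epsilon>" using assms by (simp add: Omega_def)
  then have "Omega \<epsilon> \<noteq> {}" by auto
  then have "\<not> negligible (Omega \<epsilon>)" using open_Omega open_not_negligible by blast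
  then have "emeasure lborel (Omega \<epsilon>) \<noteq> 0"
    using open_Omega by (metis Omega_borel emeasure_lborel_countable null_setsI null_sets_completionI negligible_iff_null_sets sets_lborel)
  then show pos: "emeasure lborel (Omega \<epsilon>) > 0" by (simp add: zero_less_iff_neq_zero)
  show "measure lborel (Omega \<epsilon>) > 0"
    using fin pos by (simp add: measure_def enn2real_positive_iff)
qed

lemma set_integrable_const_Omega: "\<epsilon> > 0 \<Longrightarrow> set_integrable lborel (Omega \<epsilon>) (\<lambda>x. c :: real)"
  using emeasure_Omega(1)[of \<epsilon>] by (auto simp: set_integrable_def intro!: integrable_real_indicator)

lemma set_integrable_const_cyl:
  fixes a b :: real
  assumes "\<epsilon> > 0" shows "set_integrable lborel ({a<..<b} \<times> Omega \<epsilon>) (\<lambda>x. c :: real)"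
proof -
  have "emeasure lborel ({a<..<b} \<times> Omega \<epsilon>) = emeasure lborel {a<..<b} * emeasure lborel (Omega \<epsilon>)"
    unfolding lborel_prod[symmetric] by (rule lborel.emeasure_pair_measure_Times) auto
  also have "\<dots> < \<infinity>"
    using emeasure_Omega(1)[OF assms] by (cases "a \<le> b") (auto simp: ennreal_mult_less_top)
  finally show ?thesis by (auto simp: set_integrable_def intro!: integrable_real_indicator)
qed

section \<open>Products of smooth functions of the coordinates\<close>

text \<open>All test functions of the proof are products of functions of single coordinates: their
  derivatives are explicit, and their smoothness is that of composites with the coordinate
  maps.\<close>

definition spatial_prod :: "(real \<Rightarrow> real) \<Rightarrow> (real \<Rightarrow> real) \<Rightarrow> (real \<Rightarrow> real) \<Rightarrow> real^3 \<Rightarrow> real" where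
  "spatial_prod b1 b2 b3 x = b1 (x $ 1) * b2 (x $ 2) * b3 (x $ 3)"

definition tensor :: "(real \<Rightarrow> real) \<Rightarrow> (real^3 \<Rightarrow> real) \<Rightarrow> real \<times> (real^3) \<Rightarrow> real" where
  "tensor \<theta> \<psi> z = \<theta> (fst z) * \<psi> (snd z)"

definition spatial_deriv :: "(real \<Rightarrow> real) \<Rightarrow> (real \<Rightarrow> real) \<Rightarrow> (real \<Rightarrow> real) \<Rightarrow> 3 \<Rightarrow> real^3 \<Rightarrow> real" where
  "spatial_deriv b1 b2 b3 j = (if j = 1 then spatial_prod (deriv b1) b2 b3
     else if j = 2 then spatial_prod b1 (deriv b2) b3 else spatial_prod b1 b2 (deriv b3))"

lemma spatial_prod_Cinfty:
  assumes "b1 \<in> Cinfty" "b2 \<in> Cinfty" "b3 \<in> Cinfty" shows "spatial_prod b1 b2 b3 \<in> Cinfty"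
  unfolding spatial_prod_def[abs_def]
  by (intro Cinfty_mult Cinfty_compose_linear[OF assms(1)] Cinfty_compose_linear[OF assms(2)] Cinfty_compose_linear[OF assms(3)]
      bounded_linear_vec_nth)

lemma tensor_spatial_prod_Cinfty:
  assumes "\<theta> \<in> Cinfty" "b1 \<in> Cinfty" "b2 \<in> Cinfty" "b3 \<in> Cinfty" shows "tensor \<theta> (spatial_prod b1 b2 b3) \<in> Cinfty"
  unfolding tensor_def[abs_def] spatial_prod_def[abs_def]
  by (intro Cinfty_mult Cinfty_compose_linear[OF assms(1)] Cinfty_compose_linear[OF assms(2)] Cinfty_compose_linear[OF assms(3)]
      Cinfty_compose_linear[OF assms(4)] bounded_linear_fst bounded_linear_compose[OF bounded_linear_vec_nth bounded_linear_snd])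

lemma tensor_has_derivative:
  assumes "\<theta> \<in> Cinfty" "b1 \<in> Cinfty" "b2 \<in> Cinfty" "b3 \<in> Cinfty"
  shows "(tensor \<theta> (spatial_prod b1 b2 b3) has_derivative
    (\<lambda>h. fst h * (deriv \<theta> (fst z) * spatial_prod b1 b2 b3 (snd z))
       + \<theta> (fst z) * (\<Sum>j\<in>UNIV. (snd h $ j) * spatial_deriv b1 b2 b3 j (snd z)))) (at z)"
proof -
  have D: "((\<lambda>z. b (l z)) has_derivative (\<lambda>h. deriv b (l z) * l h)) (at z)"
    if "b \<in> Cinfty" "bounded_linear l" for b and l :: "real \<times> (real^3) \<Rightarrow> real"
    using has_derivative_compose[OF bounded_linear_imp_has_derivative[OF that(2)]
        Cinfty_DERIV(1)[OF that(1), of "l z", unfolded has_field_derivative_def]] .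
  have l: "bounded_linear (\<lambda>z::real \<times> (real^3). snd z $ j)" for j
    by (intro bounded_linear_compose[OF bounded_linear_vec_nth bounded_linear_snd])
  have "((\<lambda>z. \<theta> (fst z) * (b1 (snd z $ 1) * b2 (snd z $ 2) * b3 (snd z $ 3))) has_derivative
    (\<lambda>h. fst h * (deriv \<theta> (fst z) * spatial_prod b1 b2 b3 (snd z))
       + \<theta> (fst z) * (\<Sum>j\<in>UNIV. (snd h $ j) * spatial_deriv b1 b2 b3 j (snd z)))) (at z)"
    by (rule has_derivative_eq_rhs, (rule has_derivative_mult D assms bounded_linear_fst l)+)
       (simp add: fun_eq_iff spatial_prod_def spatial_deriv_def sum_3 algebra_simps)
  then show ?thesis by (simp add: tensor_def[abs_def] spatial_prod_def[abs_def])
qed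

lemma tensor_derivs:
  assumes "\<theta> \<in> Cinfty" "b1 \<in> Cinfty" "b2 \<in> Cinfty" "b3 \<in> Cinfty"
  shows "frechet_derivative (tensor \<theta> (spatial_prod b1 b2 b3)) (at z) (1, 0) = deriv \<theta> (fst z) * spatial_prod b1 b2 b3 (snd z)"
    and "frechet_derivative (tensor \<theta> (spatial_prod b1 b2 b3)) (at z) (dir j) = \<theta> (fst z) * spatial_deriv b1 b2 b3 j (snd z)"
  unfolding frechet_derivative_at[OF tensor_has_derivative[OF assms], symmetric]
  using exhaust_3[of j] by (auto simp: sum_3 axis_def)

lemma spatial_prod_has_derivative:
  assumes "b1 \<in> Cinfty" "b2 \<in> Cinfty" "b3 \<in> Cinfty"
  shows "frechet_derivative (spatial_prod b1 b2 b3) (at x) (axis j 1) = spatial_deriv b1 b2 b3 j x"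
proof -
  have D: "((\<lambda>z. b (z $ i)) has_derivative (\<lambda>h. deriv b (x $ i) * h $ i)) (at x)"
    if "b \<in> Cinfty" for b and i :: 3
    using has_derivative_compose[OF bounded_linear_imp_has_derivative[OF bounded_linear_vec_nth]
        Cinfty_DERIV(1)[OF that, of "x $ i", unfolded has_field_derivative_def]] .
  have "((\<lambda>x. b1 (x $ 1) * b2 (x $ 2) * b3 (x $ 3)) has_derivative
    (\<lambda>h. \<Sum>j\<in>UNIV. (h $ j) * spatial_deriv b1 b2 b3 j x)) (at x)"
    by (rule has_derivative_eq_rhs, (rule has_derivative_mult D assms)+)
       (simp add: fun_eq_iff spatial_prod_def spatial_deriv_def sum_3 algebra_simps)
  then have "frechet_derivative (spatial_prod b1 b2 b3) (at x) = (\<lambda>h. \<Sum>j\<in>UNIV. (h $ j) * spatial_deriv b1 b2 b3 j x)"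
    using frechet_derivative_at by (metis (no_types, lifting) ext spatial_prod_def)
  then show ?thesis using exhaust_3[of j] by (auto simp: sum_3 axis_def)
qed

lemma continuous_bounded_on_Omega:
  fixes h :: "real^3 \<Rightarrow> real"
  assumes "continuous_on UNIV h" shows "\<exists>B. \<forall>x\<in>Omega \<epsilon>. \<bar>h x\<bar> \<le> B"
proof -
  have "bounded (h ` cbox 0 (\<chi> i. if i = 3 then 1 else \<epsilon>))"
    by (intro compact_imp_bounded compact_continuous_image continuous_on_subset[OF assms]) auto
  then obtain B where "\<And>x. x \<in> cbox 0 (\<chi> i. if i = 3 then 1 else \<epsilon>) \<Longrightarrow> \<bar>h x\<bar> \<le> B" unfolding bounded_iff by force
  moreover have "Omega \<epsilon> \<subseteq> cbox 0 (\<chi> i. if i = 3 then 1 else \<epsilon>)"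
    by (auto simp: Omega_def mem_box_cart forall_3)
  ultimately show ?thesis by blast
qed

lemma spatial_deriv_continuous:
  assumes "b1 \<in> Cinfty" "b2 \<in> Cinfty" "b3 \<in> Cinfty" shows "continuous_on UNIV (spatial_deriv b1 b2 b3 j)"
  unfolding spatial_deriv_def using assms
  by (auto intro!: Cinfty_continuous spatial_prod_Cinfty Cinfty_DERIV(2))

lemma set_integrable_mult_space:
  fixes f :: "real \<times> (real^3) \<Rightarrow> real" and h :: "real^3 \<Rightarrow> real"
  assumes f: "set_integrable lborel ({a<..<b} \<times> Omega \<epsilon>) f" and h: "continuous_on UNIV h"
  shows "set_integrable lborel ({a<..<b} \<times> Omega \<epsilon>) (\<lambda>z. f z * h (snd z))"
proof -
  obtain B where "\<And>x. x \<in> Omega \<epsilon> \<Longrightarrow> \<bar>h x\<bar> \<le> B" using continuous_bounded_on_Omega[OF h] by blast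
  then show ?thesis
    by (intro set_integrable_mult_continuous[OF f, where B = B] cyl_borel continuous_on_compose2[OF h] continuous_intros) auto
qed

lemma set_integrable_mult_time:
  fixes f :: "real \<times> (real^3) \<Rightarrow> real" and h :: "real \<Rightarrow> real"
  assumes f: "set_integrable lborel ({a<..<b} \<times> Omega \<epsilon>) f" and h: "continuous_on UNIV h"
  shows "set_integrable lborel ({a<..<b} \<times> Omega \<epsilon>) (\<lambda>z. f z * h (fst z))"
proof -
  have "bounded (h ` {a..b})" by (intro compact_imp_bounded compact_continuous_image continuous_on_subset[OF h]) auto
  then obtain B where "\<And>x. x \<in> {a..b} \<Longrightarrow> \<bar>h x\<bar> \<le> B" unfolding bounded_iff by force
  then show ?thesis
    by (intro set_integrable_mult_continuous[OF f, where B = B] cyl_borel continuous_on_compose2[OF h] continuous_intros) auto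
qed

lemma slice_pairing_integrable:
  fixes f :: "real \<times> (real^3) \<Rightarrow> real"
  assumes f: "set_integrable lborel ({0<..<T} \<times> Omega \<epsilon>) f" and \<psi>: "continuous_on UNIV \<psi>"
  shows "set_integrable lborel {0<..<T} (\<lambda>t. LINT x:Omega \<epsilon>|lborel. f (t, x) * \<psi> x)"
  using set_integral_Fubini(2)[OF set_integrable_mult_space[OF f \<psi>]] by simp

lemma tensor_pairing:
  fixes f :: "real \<times> (real^3) \<Rightarrow> real"
  assumes f: "set_integrable lborel ({0<..<T} \<times> Omega \<epsilon>) f" and \<theta>: "continuous_on UNIV \<theta>" and \<psi>: "continuous_on UNIV \<psi>"
  shows "set_integrable lborel ({0<..<T} \<times> Omega \<epsilon>) (\<lambda>z. f z * (\<theta> (fst z) * \<psi> (snd z)))"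
    and "(LINT z:{0<..<T} \<times> Omega \<epsilon>|lborel. f z * (\<theta> (fst z) * \<psi> (snd z)))
       = (LINT t:{0<..<T}|lborel. (LINT x:Omega \<epsilon>|lborel. f (t, x) * \<psi> x) * \<theta> t)"
    and "set_integrable lborel {0<..<T} (\<lambda>t. (LINT x:Omega \<epsilon>|lborel. f (t, x) * \<psi> x) * \<theta> t)"
proof -
  have i: "set_integrable lborel ({0<..<T} \<times> Omega \<epsilon>) (\<lambda>z. (f z * \<psi> (snd z)) * \<theta> (fst z))"
    by (rule set_integrable_mult_time[OF set_integrable_mult_space[OF f \<psi>] \<theta>])
  have eq: "(\<lambda>z. f z * (\<theta> (fst z) * \<psi> (snd z))) = (\<lambda>z. (f z * \<psi> (snd z)) * \<theta> (fst z))" by (simp add: mult_ac)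
  show "set_integrable lborel ({0<..<T} \<times> Omega \<epsilon>) (\<lambda>z. f z * (\<theta> (fst z) * \<psi> (snd z)))" using i unfolding eq .
  show "(LINT z:{0<..<T} \<times> Omega \<epsilon>|lborel. f z * (\<theta> (fst z) * \<psi> (snd z)))
       = (LINT t:{0<..<T}|lborel. (LINT x:Omega \<epsilon>|lborel. f (t, x) * \<psi> x) * \<theta> t)"
    unfolding eq set_integral_Fubini(3)[OF i] by simp
  show "set_integrable lborel {0<..<T} (\<lambda>t. (LINT x:Omega \<epsilon>|lborel. f (t, x) * \<psi> x) * \<theta> t)"
    using set_integral_Fubini(2)[OF i] by simp
qed

text \<open>Testing with plateaus in time multiplied by one fixed spatial function localises the
  weak derivative to almost every time. The null set depends on the spatial function.\<close>

lemma weak_deriv_slice: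
  assumes wd: "weak_deriv K ({0<..<T} \<times> Omega \<epsilon>) (dir j) f g"
    and b: "b1 \<in> Cinfty" "b2 \<in> Cinfty" "b3 \<in> Cinfty"
    and K: "\<And>a b n. 0 \<le> a \<Longrightarrow> a < b \<Longrightarrow> b \<le> T \<Longrightarrow> n > 0 \<Longrightarrow> tensor (plateau a b n) (spatial_prod b1 b2 b3) \<in> K"
  shows "AE t in lborel. t \<in> {0<..<T} \<longrightarrow>
    (LINT x:Omega \<epsilon>|lborel. f (t, x) * spatial_deriv b1 b2 b3 j x) = - (LINT x:Omega \<epsilon>|lborel. g (t, x) * spatial_prod b1 b2 b3 x)"
proof -
  have f: "set_integrable lborel ({0<..<T} \<times> Omega \<epsilon>) f" and g: "set_integrable lborel ({0<..<T} \<times> Omega \<epsilon>) g"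
    using wd by (auto simp: weak_deriv_def)
  have cd: "continuous_on UNIV (spatial_deriv b1 b2 b3 j)" and cp: "continuous_on UNIV (spatial_prod b1 b2 b3)"
    by (rule spatial_deriv_continuous[OF b], rule Cinfty_continuous[OF spatial_prod_Cinfty[OF b]])
  let ?F = "\<lambda>t. (LINT x:Omega \<epsilon>|lborel. f (t, x) * spatial_deriv b1 b2 b3 j x) + (LINT x:Omega \<epsilon>|lborel. g (t, x) * spatial_prod b1 b2 b3 x)"
  have "AE t in lborel. t \<in> {0<..<T} \<longrightarrow> ?F t = 0"
  proof (rule fundamental_lemma_plateau)
    show "set_integrable lborel {0<..<T} ?F"
      by (intro set_integral_add slice_pairing_integrable f g cd cp)
    fix a b :: real and n :: nat assume *: "0 \<le> a" "a < b" "b \<le> T" "n > 0"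
    have pc: "continuous_on UNIV (plateau a b n)" by (intro Cinfty_continuous plateau_Cinfty)
    note fp = tensor_pairing[OF f pc cd] and gp = tensor_pairing[OF g pc cp]
    have "(LINT t:{0<..<T}|lborel. ?F t * plateau a b n t) =
      (LINT z:{0<..<T} \<times> Omega \<epsilon>|lborel. f z * (plateau a b n (fst z) * spatial_deriv b1 b2 b3 j (snd z)))
      + (LINT z:{0<..<T} \<times> Omega \<epsilon>|lborel. g z * (plateau a b n (fst z) * spatial_prod b1 b2 b3 (snd z)))"
      unfolding fp(2) gp(2) using fp(3) gp(3) by (simp add: distrib_right set_integral_add)
    also have "\<dots> = 0"
    proof -
      have "(LINT z:{0<..<T} \<times> Omega \<epsilon>|lborel. f z * frechet_derivative (tensor (plateau a b n) (spatial_prod b1 b2 b3)) (at z) (dir j))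
        = - (LINT z:{0<..<T} \<times> Omega \<epsilon>|lborel. g z * tensor (plateau a b n) (spatial_prod b1 b2 b3) z)"
        using wd K[OF *] unfolding weak_deriv_def by blast
      then show ?thesis
        unfolding tensor_derivs(2)[OF plateau_Cinfty[of a b n] b] by (simp add: tensor_def)
    qed
    finally show "(LINT t:{0<..<T}|lborel. ?F t * plateau a b n t) = 0" .
  qed
  then show ?thesis by eventually_elim auto
qed

section \<open>Admissible test functions\<close>

abbreviation vprod :: "(real \<Rightarrow> real) \<Rightarrow> real^3 \<Rightarrow> real" where
  "vprod \<beta> \<equiv> spatial_prod (\<lambda>_. 1) (\<lambda>_. 1) \<beta>"

lemma vprod_simp: "vprod \<beta> x = \<beta> (x $ 3)" by (simp add: spatial_prod_def)

lemma vprod_deriv: "spatial_deriv (\<lambda>_. 1) (\<lambda>_. 1) \<beta> j x = (if j = 3 then deriv \<beta> (x $ 3) else 0)"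
  using exhaust_3[of j] by (auto simp: spatial_deriv_def spatial_prod_def)

lemma per_tests_tensor:
  assumes "0 \<le> a" "a < b" "b \<le> T" "n > 0" and \<beta>: "\<beta> \<in> Cinfty" "\<And>y. \<beta> (y + 1) = \<beta> y"
  shows "tensor (plateau a b n) (vprod \<beta>) \<in> per_tests T"
proof -
  have "\<exists>\<delta>>0. \<forall>t x. tensor (plateau a b n) (vprod \<beta>) (t, x) \<noteq> 0 \<longrightarrow> \<delta> \<le> t \<and> t \<le> T - \<delta>"
    using assms plateau_support(2,3)[of a b n] by (intro exI[of _ "1 / real n"]) (force simp: tensor_def)
  moreover have "\<forall>t x. tensor (plateau a b n) (vprod \<beta>) (t, x + axis 3 1) = tensor (plateau a b n) (vprod \<beta>) (t, x)"
    using \<beta>(2) by (simp add: tensor_def vprod_simp axis_def)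
  ultimately show ?thesis
    unfolding per_tests_def using \<beta>(1) by (auto intro!: tensor_spatial_prod_Cinfty plateau_Cinfty Cinfty_const)
qed

lemma per_space_tests_vprod:
  assumes "\<beta> \<in> Cinfty" "\<And>y. \<beta> (y + 1) = \<beta> y" shows "vprod \<beta> \<in> per_space_tests"
  using assms by (auto simp: per_space_tests_def vprod_simp axis_def intro!: spatial_prod_Cinfty Cinfty_const)

text \<open>A vertical field has no horizontal components, so it is tangential on the lateral
  boundary whatever its values there.\<close>

lemma slip_tests_tensor:
  assumes \<theta>: "time_test T \<theta>" and \<beta>: "\<beta> \<in> Cinfty" "\<And>y. \<beta> (y + 1) = \<beta> y"
  shows "(\<lambda>z. tensor \<theta> (vprod \<beta>) z *\<^sub>R axis 3 1) \<in> slip_tests T \<epsilon>"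
proof -
  obtain \<delta> where \<delta>: "\<delta> > 0" "\<And>t. t \<ge> T - \<delta> \<Longrightarrow> \<theta> t = 0" using \<theta> by (auto simp: time_test_def)
  have "\<exists>\<delta>>0. \<forall>t x. tensor \<theta> (vprod \<beta>) (t, x) *\<^sub>R axis 3 1 \<noteq> (0 :: real^3) \<longrightarrow> t \<le> T - \<delta>"
  proof (intro exI conjI allI impI)
    fix t x assume "tensor \<theta> (vprod \<beta>) (t, x) *\<^sub>R axis 3 1 \<noteq> (0 :: real^3)"
    then have "\<theta> t \<noteq> 0" by (auto simp: tensor_def)
    then show "t \<le> T - \<delta>" using \<delta>(2)[of t] by linarith
  qed (rule \<delta>(1))
  moreover have "(\<lambda>z. tensor \<theta> (vprod \<beta>) z *\<^sub>R (axis 3 1 :: real^3)) \<in> Cinfty"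
    using \<theta> \<beta> by (intro Cinfty_scaleR_const tensor_spatial_prod_Cinfty Cinfty_const) (auto simp: time_test_def)
  ultimately show ?thesis
    using \<beta>(2) by (auto simp: slip_tests_def tensor_def vprod_simp axis_def)
qed

text \<open>Compactly supported approximations of \<beta>(x3), for the equation that is tested only
  inside the domain. They converge boundedly, but their gradients are not bounded in m.\<close>

abbreviation cutoff :: "real \<Rightarrow> (real \<Rightarrow> real) \<Rightarrow> nat \<Rightarrow> real^3 \<Rightarrow> real" where
  "cutoff \<epsilon> \<beta> m \<equiv> spatial_prod (plateau 0 \<epsilon> m) (plateau 0 \<epsilon> m) (\<lambda>y. plateau 0 1 m y * \<beta> y)"

lemma cutoff_support:
  assumes "cutoff \<epsilon> \<beta> m x \<noteq> 0"
  shows "x \<in> cbox (\<chi> i. 1 / real m) (\<chi> i. if i = 3 then 1 - 1 / real m else \<epsilon> - 1 / real m)"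
  using assms plateau_support(2,3)[of 0 \<epsilon> m "x $ 1"] plateau_support(2,3)[of 0 \<epsilon> m "x $ 2"] plateau_support(2,3)[of 0 1 m "x $ 3"]
  by (auto simp: spatial_prod_def mem_box_cart forall_3)

lemma cutoff_Cinfty: "\<beta> \<in> Cinfty \<Longrightarrow> (\<lambda>y. plateau 0 1 m y * \<beta> y) \<in> Cinfty"
  by (intro Cinfty_mult plateau_Cinfty)

lemma Cc_infty_tensor_cutoff:
  assumes \<theta>: "\<theta> \<in> Cinfty" "\<And>t. \<theta> t \<noteq> 0 \<Longrightarrow> t \<in> {c..d}" "{c..d} \<subseteq> S" and \<beta>: "\<beta> \<in> Cinfty" and m: "m > 0"
  shows "tensor \<theta> (cutoff \<epsilon> \<beta> m) \<in> Cc_infty (S \<times> Omega \<epsilon>)"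
proof -
  define B :: "(real^3) set" where "B = cbox (\<chi> i. 1 / real m) (\<chi> i. if i = 3 then 1 - 1 / real m else \<epsilon> - 1 / real m)"
  have sub: "{z. tensor \<theta> (cutoff \<epsilon> \<beta> m) z \<noteq> 0} \<subseteq> {c..d} \<times> B"
    using \<theta>(2) cutoff_support unfolding B_def tensor_def by (fastforce simp del: mem_box_cart)
  have K: "compact ({c..d} \<times> B)" unfolding B_def by (intro compact_Times) auto
  then have cl: "closure {z. tensor \<theta> (cutoff \<epsilon> \<beta> m) z \<noteq> 0} \<subseteq> {c..d} \<times> B"
    using sub by (intro closure_minimal compact_imp_closed)
  then have "compact (closure {z. tensor \<theta> (cutoff \<epsilon> \<beta> m) z \<noteq> 0})"
    using compact_Int_closed[OF K closed_closure[of "{z. tensor \<theta> (cutoff \<epsilon> \<beta> m) z \<noteq> 0}"]] by (simp only: Int_absorb1[OF cl])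
  moreover have "B \<subseteq> Omega \<epsilon>"
  proof
    fix x assume x: "x \<in> B"
    define c where "c = 1 / real m"
    have "c > 0" using m by (simp add: c_def)
    then show "x \<in> Omega \<epsilon>" using x unfolding B_def c_def[symmetric] by (auto simp: Omega_def mem_box_cart forall_3)
  qed
  ultimately show ?thesis
    unfolding Cc_infty_def using cl \<theta>(1,3) \<beta>
    by (auto intro!: tensor_spatial_prod_Cinfty plateau_Cinfty cutoff_Cinfty)
qed

lemma cutoff_LIMSEQ:
  assumes "x \<in> Omega \<epsilon>" shows "(\<lambda>m. cutoff \<epsilon> \<beta> (Suc m) x) \<longlonglongrightarrow> \<beta> (x $ 3)"
proof -
  have "(\<lambda>m. cutoff \<epsilon> \<beta> (Suc m) x) \<longlonglongrightarrow>
    indicator {0<..<\<epsilon>} (x $ 1) * indicator {0<..<\<epsilon>} (x $ 2) * (indicator {0<..<1} (x $ 3) * \<beta> (x $ 3))"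
    unfolding spatial_prod_def by (intro tendsto_intros LIMSEQ_Suc[OF plateau_LIMSEQ])
  then show ?thesis using assms by (simp add: Omega_def)
qed

lemma cutoff_bound: "\<bar>\<beta> (x $ 3)\<bar> \<le> B \<Longrightarrow> \<bar>cutoff \<epsilon> \<beta> m x\<bar> \<le> B"
proof -
  assume B: "\<bar>\<beta> (x $ 3)\<bar> \<le> B"
  define p where "p = plateau 0 \<epsilon> m (x $ 1) * plateau 0 \<epsilon> m (x $ 2) * plateau 0 1 m (x $ 3)"
  have p: "0 \<le> p" "p \<le> 1" unfolding p_def by (auto intro!: mult_le_one mult_nonneg_nonneg simp: plateau_bounds)
  have "cutoff \<epsilon> \<beta> m x = p * \<beta> (x $ 3)" by (simp add: spatial_prod_def p_def)
  then have "\<bar>cutoff \<epsilon> \<beta> m x\<bar> = p * \<bar>\<beta> (x $ 3)\<bar>" using p by (simp add: abs_mult)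
  also have "\<dots> \<le> 1 * B" using p B by (intro mult_mono) auto
  finally show ?thesis by simp
qed

section \<open>Weak equations in the vertical variable\<close>

definition smooth_periodic :: "(real \<Rightarrow> real) \<Rightarrow> bool" where
  "smooth_periodic \<beta> \<longleftrightarrow> \<beta> \<in> Cinfty \<and> (\<forall>y. \<beta> (y + 1) = \<beta> y)"

lemma smooth_periodic_trig: "smooth_periodic (trig i j)"
  by (simp add: smooth_periodic_def trig_Cinfty trig_periodic)

lemma smooth_periodic_deriv:
  assumes "smooth_periodic \<beta>" shows "smooth_periodic (deriv \<beta>)"
proof -
  have D: "(\<beta> has_real_derivative deriv \<beta> y) (at y)" for y
    using assms by (auto simp: smooth_periodic_def intro: Cinfty_DERIV)
  have "deriv \<beta> (y + 1) = deriv \<beta> y" for y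
  proof -
    have "((\<lambda>y. \<beta> (y + 1)) has_real_derivative deriv \<beta> (y + 1) * 1) (at y)"
      by (rule DERIV_chain2[OF D]) (auto intro!: derivative_eq_intros)
    then have "(\<beta> has_real_derivative deriv \<beta> (y + 1)) (at y)" using assms by (simp add: smooth_periodic_def)
    then show ?thesis using D DERIV_unique by blast
  qed
  then show ?thesis using assms by (auto simp: smooth_periodic_def intro: Cinfty_DERIV)
qed

text \<open>The time-integrated weak form of \<partial>t f + \<partial>3 k = 0 with initial value
  f0, averaged over the cross-section and periodic in x3.\<close>

definition evolves :: "real \<Rightarrow> real \<Rightarrow> (real \<times> (real^3) \<Rightarrow> real) \<Rightarrow> (real^3 \<Rightarrow> real) \<Rightarrow> (real \<times> (real^3) \<Rightarrow> real) \<Rightarrow> bool" where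
  "evolves T \<epsilon> f f0 k \<longleftrightarrow> set_integrable lborel (cyl T \<epsilon>) f \<and> set_integrable lborel (cyl T \<epsilon>) k \<and> set_integrable lborel (Omega \<epsilon>) f0 \<and>
    (\<forall>\<beta>. smooth_periodic \<beta> \<longrightarrow> (AE \<tau> in lborel. \<tau> \<in> {0<..<T} \<longrightarrow> (LINT x:Omega \<epsilon>|lborel. f (\<tau>, x) * \<beta> (x $ 3))
      = (LINT x:Omega \<epsilon>|lborel. f0 x * \<beta> (x $ 3)) + (LINT z:cyl \<tau> \<epsilon>|lborel. k z * deriv \<beta> (snd z $ 3))))"

text \<open>As only functions of x3 are tested, g has to be the vertical derivative of f merely
  after integration over the cross-section. Periodicity of f is included, since \<beta> need not
  vanish at the ends.\<close>

definition vertical_deriv :: "real \<Rightarrow> real \<Rightarrow> (real \<times> (real^3) \<Rightarrow> real) \<Rightarrow> (real \<times> (real^3) \<Rightarrow> real) \<Rightarrow> bool" where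
  "vertical_deriv T \<epsilon> f g \<longleftrightarrow> set_integrable lborel (cyl T \<epsilon>) f \<and> set_integrable lborel (cyl T \<epsilon>) g \<and>
    (\<forall>\<beta>. smooth_periodic \<beta> \<longrightarrow> (AE t in lborel. t \<in> {0<..<T} \<longrightarrow>
      (LINT x:Omega \<epsilon>|lborel. f (t, x) * deriv \<beta> (x $ 3)) = - (LINT x:Omega \<epsilon>|lborel. g (t, x) * \<beta> (x $ 3))))"

lemma evolvesD:
  assumes "evolves T \<epsilon> f f0 k"
  shows "set_integrable lborel (cyl T \<epsilon>) f" "set_integrable lborel (cyl T \<epsilon>) k" "set_integrable lborel (Omega \<epsilon>) f0"
    and "smooth_periodic \<beta> \<Longrightarrow> AE \<tau> in lborel. \<tau> \<in> {0<..<T} \<longrightarrow> (LINT x:Omega \<epsilon>|lborel. f (\<tau>, x) * \<beta> (x $ 3))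
      = (LINT x:Omega \<epsilon>|lborel. f0 x * \<beta> (x $ 3)) + (LINT z:cyl \<tau> \<epsilon>|lborel. k z * deriv \<beta> (snd z $ 3))"
  using assms unfolding evolves_def by blast+

lemma vertical_derivD:
  assumes "vertical_deriv T \<epsilon> f g"
  shows "set_integrable lborel (cyl T \<epsilon>) f" "set_integrable lborel (cyl T \<epsilon>) g"
    and "smooth_periodic \<beta> \<Longrightarrow> AE t in lborel. t \<in> {0<..<T} \<longrightarrow>
      (LINT x:Omega \<epsilon>|lborel. f (t, x) * deriv \<beta> (x $ 3)) = - (LINT x:Omega \<epsilon>|lborel. g (t, x) * \<beta> (x $ 3))"
  using assms unfolding vertical_deriv_def by blast+

lemma weak_deriv_per_slice:
  assumes wd: "weak_deriv (per_tests T) (cyl T \<epsilon>) (dir j) f g"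
    and \<beta>: "\<beta> \<in> Cinfty" "\<And>y. \<beta> (y + 1) = \<beta> y"
  shows "AE t in lborel. t \<in> {0<..<T} \<longrightarrow>
    (LINT x:Omega \<epsilon>|lborel. f (t, x) * (if j = 3 then deriv \<beta> (x $ 3) else 0)) = - (LINT x:Omega \<epsilon>|lborel. g (t, x) * \<beta> (x $ 3))"
  using weak_deriv_slice[OF wd Cinfty_const[of 1] Cinfty_const[of 1] \<beta>(1) per_tests_tensor] \<beta>
  by (simp add: vprod_simp vprod_deriv)

lemma weak_deriv_vertical_deriv:
  assumes "weak_deriv (per_tests T) (cyl T \<epsilon>) (dir 3) f g" shows "vertical_deriv T \<epsilon> f g"
  using assms weak_deriv_per_slice[OF assms]
  by (auto simp: vertical_deriv_def weak_deriv_def smooth_periodic_def)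

lemma trig_continuous: "continuous_on S (trig i j)" "continuous_on S (deriv (trig i j))"
  using Cinfty_continuous[OF trig_Cinfty] Cinfty_continuous[OF Cinfty_DERIV(2)[OF trig_Cinfty]] continuous_on_subset by blast+

lemma vertical_continuous: "continuous_on UNIV \<beta> \<Longrightarrow> continuous_on S (\<lambda>x::real^3. \<beta> (x $ 3))"
  by (rule continuous_on_compose2[of UNIV \<beta>]) (auto intro: continuous_intros)

lemma Cinfty_vertical_continuous:
  assumes "\<beta> \<in> Cinfty"
  shows "continuous_on S (\<lambda>x::real^3. \<beta> (x $ 3))" "continuous_on S (\<lambda>x::real^3. deriv \<beta> (x $ 3))"
  by (rule vertical_continuous[OF Cinfty_continuous[OF assms]],
      rule vertical_continuous[OF Cinfty_continuous[OF Cinfty_DERIV(2)[OF assms]]])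

lemma cyl_mono:
  fixes f :: "real \<times> (real^3) \<Rightarrow> real"
  shows "t \<le> T \<Longrightarrow> set_integrable lborel (cyl T \<epsilon>) f \<Longrightarrow> set_integrable lborel (cyl t \<epsilon>) f"
  by (rule set_integrable_subset[of lborel "cyl T \<epsilon>"]) (auto simp: cyl_borel)

lemma vertical_deriv_integrated:
  assumes v: "vertical_deriv T \<epsilon> f g" and \<tau>: "\<tau> \<le> T" and \<beta>: "smooth_periodic \<beta>"
  shows "(LINT z:cyl \<tau> \<epsilon>|lborel. f z * deriv \<beta> (snd z $ 3)) = - (LINT z:cyl \<tau> \<epsilon>|lborel. g z * \<beta> (snd z $ 3))"
proof -
  have f: "set_integrable lborel (cyl \<tau> \<epsilon>) f" and g: "set_integrable lborel (cyl \<tau> \<epsilon>) g"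
    using v cyl_mono[OF \<tau>] by (auto simp: vertical_deriv_def)
  have c: "continuous_on UNIV (\<lambda>x::real^3. \<beta> (x $ 3))" "continuous_on UNIV (\<lambda>x::real^3. deriv \<beta> (x $ 3))"
    using \<beta> by (auto intro: Cinfty_vertical_continuous simp: smooth_periodic_def)
  have i: "set_integrable lborel {0<..<\<tau>} (\<lambda>t. (-1) * (LINT x:Omega \<epsilon>|lborel. g (t, x) * \<beta> (x $ 3)))"
    by (intro set_integrable_mult_right slice_pairing_integrable[OF g c(1)])
  have "(LINT z:cyl \<tau> \<epsilon>|lborel. f z * deriv \<beta> (snd z $ 3)) = (LINT t:{0<..<\<tau>}|lborel. LINT x:Omega \<epsilon>|lborel. f (t, x) * deriv \<beta> (x $ 3))"
    using set_integral_Fubini(3)[OF set_integrable_mult_space[OF f c(2)]] by simp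
  also have "\<dots> = (LINT t:{0<..<\<tau>}|lborel. - (LINT x:Omega \<epsilon>|lborel. g (t, x) * \<beta> (x $ 3)))"
  proof (rule set_integral_cong_AE_integrable[OF slice_pairing_integrable[OF f c(2)]])
    have "AE t in lborel. t \<in> {0<..<T} \<longrightarrow>
      (LINT x:Omega \<epsilon>|lborel. f (t, x) * deriv \<beta> (x $ 3)) = - (LINT x:Omega \<epsilon>|lborel. g (t, x) * \<beta> (x $ 3))"
      using v \<beta> by (auto simp: vertical_deriv_def)
    then show "AE t\<in>{0<..<\<tau>} in lborel. (LINT x:Omega \<epsilon>|lborel. f (t, x) * deriv \<beta> (x $ 3)) = - (LINT x:Omega \<epsilon>|lborel. g (t, x) * \<beta> (x $ 3))"
      by eventually_elim (use \<tau> in auto)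
  qed (use i in simp)
  also have "\<dots> = - (LINT z:cyl \<tau> \<epsilon>|lborel. g z * \<beta> (snd z $ 3))"
    using set_integral_Fubini(3)[OF set_integrable_mult_space[OF g c(1)]] by (simp add: set_integral_uminus_real)
  finally show ?thesis .
qed

text \<open>The test field \<theta>(t) \<beta>(x3) e3 sees only the 33 entries of the matrices, and
  its divergence is the factor \<theta> \<beta>' common to all flux terms.
  \<open>du_Bois_Reymond\<close> then integrates the equation in time.\<close>

lemma momentum_evolves:
  fixes rho :: "real \<times> (real^3) \<Rightarrow> real" and u :: "real \<times> (real^3) \<Rightarrow> real^3" and rho0 :: "real^3 \<Rightarrow> real"
    and G :: "real \<times> (real^3) \<Rightarrow> real^3^3" and u0 :: "real^3 \<Rightarrow> real^3"
  assumes T: "T > 0"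
    and id: "\<And>\<phi>. \<phi> \<in> slip_tests T \<epsilon> \<Longrightarrow> momentum_identity T \<epsilon> (\<lambda>r. \<mu> * r) (\<lambda>r. 0) p rho u G rho0 u0 \<phi>"
    and i1: "set_integrable lborel (cyl T \<epsilon>) (\<lambda>z. rho z * u z $ 3)"
    and i2: "set_integrable lborel (cyl T \<epsilon>) (\<lambda>z. rho z * (u z $ 3)\<^sup>2)"
    and i3: "set_integrable lborel (cyl T \<epsilon>) (\<lambda>z. \<mu> * rho z * G z $ 3 $ 3)"
    and i4: "set_integrable lborel (cyl T \<epsilon>) (\<lambda>z. p (rho z))"
    and i0: "set_integrable lborel (Omega \<epsilon>) (\<lambda>x. rho0 x * u0 x $ 3)"
  shows "evolves T \<epsilon> (\<lambda>z. rho z * u z $ 3) (\<lambda>x. rho0 x * u0 x $ 3)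
     (\<lambda>z. rho z * (u z $ 3)\<^sup>2 - 2 * (\<mu> * rho z * G z $ 3 $ 3) + p (rho z))" (is "evolves T \<epsilon> ?f ?init ?k")
proof -
  have k: "set_integrable lborel (cyl T \<epsilon>) ?k"
    using i2 i3 i4 by (intro set_integral_add(1) set_integral_diff(1)) auto
  have "AE \<tau> in lborel. \<tau> \<in> {0<..<T} \<longrightarrow> (LINT x:Omega \<epsilon>|lborel. ?f (\<tau>, x) * \<beta> (x $ 3))
      = (LINT x:Omega \<epsilon>|lborel. ?init x * \<beta> (x $ 3)) + (LINT z:cyl \<tau> \<epsilon>|lborel. ?k z * deriv \<beta> (snd z $ 3))"
    if \<beta>: "\<beta> \<in> Cinfty" "\<And>y. \<beta> (y + 1) = \<beta> y" for \<beta>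
  proof -
    have c: "continuous_on UNIV (\<lambda>x::real^3. \<beta> (x $ 3))" "continuous_on UNIV (\<lambda>x::real^3. deriv \<beta> (x $ 3))"
      using \<beta> by (auto intro: Cinfty_vertical_continuous)
    have "AE \<tau> in lborel. \<tau> \<in> {0<..<T} \<longrightarrow> (LINT x:Omega \<epsilon>|lborel. ?f (\<tau>, x) * \<beta> (x $ 3))
      = (LINT x:Omega \<epsilon>|lborel. ?init x * \<beta> (x $ 3)) + (LINT t:{0<..<\<tau>}|lborel. LINT x:Omega \<epsilon>|lborel. ?k (t, x) * deriv \<beta> (x $ 3))"
    proof (rule du_Bois_Reymond[OF T slice_pairing_integrable[OF i1 c(1)] slice_pairing_integrable[OF k c(2)]])
      fix \<theta> assume \<theta>: "time_test T \<theta>"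
      then have \<theta>C: "\<theta> \<in> Cinfty" by (simp add: time_test_def)
      have c\<theta>: "continuous_on UNIV \<theta>" "continuous_on UNIV (deriv \<theta>)"
        using \<theta>C by (auto intro!: Cinfty_continuous Cinfty_DERIV(2))
      define \<phi> where "\<phi> z = tensor \<theta> (vprod \<beta>) z *\<^sub>R (axis 3 1 :: real^3)" for z
      have "(\<phi> has_derivative (\<lambda>h. (fst h * (deriv \<theta> (fst z) * vprod \<beta> (snd z))
         + \<theta> (fst z) * (\<Sum>j\<in>UNIV. (snd h $ j) * spatial_deriv (\<lambda>_. 1) (\<lambda>_. 1) \<beta> j (snd z))) *\<^sub>R axis 3 1)) (at z)" for z
        unfolding \<phi>_def[abs_def] by (intro has_derivative_scaleR_left tensor_has_derivative \<theta>C \<beta>(1) Cinfty_const)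
      then have F: "frechet_derivative \<phi> (at z) = (\<lambda>h. (fst h * (deriv \<theta> (fst z) * \<beta> (snd z $ 3))
         + \<theta> (fst z) * (snd h $ 3 * deriv \<beta> (snd z $ 3))) *\<^sub>R axis 3 1)" for z
        by (subst frechet_derivative_at[symmetric]) (simp_all add: vprod_simp vprod_deriv if_distrib[of "\<lambda>x. _ * x"] cong: if_cong)
      have dt: "dt \<phi> z = (deriv \<theta> (fst z) * \<beta> (snd z $ 3)) *\<^sub>R axis 3 1" for z
        by (simp add: dt_def F)
      have Gr: "Grad \<phi> z $ i $ j = (if i = 3 \<and> j = 3 then \<theta> (fst z) * deriv \<beta> (snd z $ 3) else 0)" for z i j
        by (auto simp: Grad_def F axis_def)
      have "momentum_identity T \<epsilon> (\<lambda>r. \<mu> * r) (\<lambda>r. 0) p rho u G rho0 u0 \<phi>"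
        unfolding \<phi>_def[abs_def] by (intro id slip_tests_tensor \<theta> \<beta>)
      then have *: "- (LINT z:cyl T \<epsilon>|lborel. ?f z * (deriv \<theta> (fst z) * \<beta> (snd z $ 3)))
         - (LINT z:cyl T \<epsilon>|lborel. (rho z * (u z $ 3)\<^sup>2) * (\<theta> (fst z) * deriv \<beta> (snd z $ 3)))
         + (LINT z:cyl T \<epsilon>|lborel. 2 * (\<mu> * rho z * G z $ 3 $ 3) * (\<theta> (fst z) * deriv \<beta> (snd z $ 3)))
         - (LINT z:cyl T \<epsilon>|lborel. p (rho z) * (\<theta> (fst z) * deriv \<beta> (snd z $ 3)))
         = (LINT x:Omega \<epsilon>|lborel. \<theta> 0 * (?init x * \<beta> (x $ 3)))"
        unfolding momentum_identity_def dt
        by (simp add: inner_vec_def sum_3 Gr trace_def outer_def sym_part_def transpose_def power2_eq_square inner_axis \<phi>_def tensor_def vprod_simp mult_ac axis_def)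
      have "(LINT z:cyl T \<epsilon>|lborel. ?k z * (\<theta> (fst z) * deriv \<beta> (snd z $ 3)))
        = (LINT z:cyl T \<epsilon>|lborel. (rho z * (u z $ 3)\<^sup>2) * (\<theta> (fst z) * deriv \<beta> (snd z $ 3)))
        - (LINT z:cyl T \<epsilon>|lborel. 2 * (\<mu> * rho z * G z $ 3 $ 3) * (\<theta> (fst z) * deriv \<beta> (snd z $ 3)))
        + (LINT z:cyl T \<epsilon>|lborel. p (rho z) * (\<theta> (fst z) * deriv \<beta> (snd z $ 3)))"
        using tensor_pairing(1)[OF i2 c\<theta>(1) c(2)] tensor_pairing(1)[OF i4 c\<theta>(1) c(2)]
          tensor_pairing(1)[OF set_integrable_mult_right[of 2, OF i3] c\<theta>(1) c(2)]
        by (simp add: distrib_right left_diff_distrib set_integral_add set_integral_diff)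
      with * have "- (LINT z:cyl T \<epsilon>|lborel. ?f z * (deriv \<theta> (fst z) * \<beta> (snd z $ 3)))
         - (LINT z:cyl T \<epsilon>|lborel. ?k z * (\<theta> (fst z) * deriv \<beta> (snd z $ 3))) = \<theta> 0 * (LINT x:Omega \<epsilon>|lborel. ?init x * \<beta> (x $ 3))"
        by simp
      then show "- (LINT t:{0<..<T}|lborel. (LINT x:Omega \<epsilon>|lborel. ?f (t, x) * \<beta> (x $ 3)) * deriv \<theta> t)
        - (LINT t:{0<..<T}|lborel. (LINT x:Omega \<epsilon>|lborel. ?k (t, x) * deriv \<beta> (x $ 3)) * \<theta> t)
        = \<theta> 0 * (LINT x:Omega \<epsilon>|lborel. ?init x * \<beta> (x $ 3))"
        unfolding tensor_pairing(2)[OF i1 c\<theta>(2) c(1)] tensor_pairing(2)[OF k c\<theta>(1) c(2)] .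
    qed
    then show ?thesis
    proof eventually_elim
      case (elim \<tau>)
      have "(LINT z:cyl \<tau> \<epsilon>|lborel. ?k z * deriv \<beta> (snd z $ 3)) = (LINT t:{0<..<\<tau>}|lborel. LINT x:Omega \<epsilon>|lborel. ?k (t, x) * deriv \<beta> (x $ 3))"
        if "\<tau> < T"
        using set_integral_Fubini(3)[OF set_integrable_mult_space[OF cyl_mono[OF _ k] c(2)]] that by simp
      then show ?case using elim by auto
    qed
  qed
  then show ?thesis
    unfolding evolves_def smooth_periodic_def using i1 k i0 by blast
qed

text \<open>The continuity equation admits only test functions supported inside the domain, and
  gradients of cut-offs are unbounded. Therefore the flux term is first rewritten with the
  divergence of \<rho>u, using interior weak derivatives; the cut-off is then removed; finally the
  boundary conditions, encoded as weak derivatives against \<open>per_tests\<close>, move the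
  derivative back onto \<beta>.\<close>

lemma mass_evolves:
  fixes rho :: "real \<times> (real^3) \<Rightarrow> real" and u :: "real \<times> (real^3) \<Rightarrow> real^3" and rho0 :: "real^3 \<Rightarrow> real"
  assumes T: "T > 0" and \<epsilon>: "\<epsilon> > 0"
    and id: "\<And>\<xi>. \<xi> \<in> Cc_infty ({..<T} \<times> Omega \<epsilon>) \<Longrightarrow> continuity_identity T \<epsilon> rho u rho0 \<xi>"
    and r: "set_integrable lborel (cyl T \<epsilon>) rho" and r0: "set_integrable lborel (Omega \<epsilon>) rho0"
    and wd: "\<And>j. weak_deriv (Cc_infty (cyl T \<epsilon>)) (cyl T \<epsilon>) (dir j) (\<lambda>z. rho z * u z $ j) (E j)"
    and wd': "\<And>j. weak_deriv (per_tests T) (cyl T \<epsilon>) (dir j) (\<lambda>z. rho z * u z $ j) (E j)"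
  shows "evolves T \<epsilon> rho rho0 (\<lambda>z. rho z * u z $ 3)"
proof -
  have J: "set_integrable lborel (cyl T \<epsilon>) (\<lambda>z. rho z * u z $ j)" and E: "set_integrable lborel (cyl T \<epsilon>) (E j)" for j
    using wd[of j] by (auto simp: weak_deriv_def)
  define dv where "dv z = (\<Sum>j\<in>UNIV. E j z)" for z
  have dv: "set_integrable lborel (cyl T \<epsilon>) dv"
    unfolding dv_def[abs_def] sum_3 by (intro set_integral_add(1) E)
  have dvs: "(LINT z:cyl \<tau> \<epsilon>|lborel. dv z * h (snd z)) = (LINT t:{0<..<\<tau>}|lborel. \<Sum>j\<in>UNIV. LINT x:Omega \<epsilon>|lborel. E j (t, x) * h x)"
    if "continuous_on UNIV h" "\<tau> \<le> T" for h \<tau>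
  proof -
    have *: "set_integrable lborel (cyl \<tau> \<epsilon>) (\<lambda>z. E j z * h (snd z))" for j
      by (intro set_integrable_mult_space cyl_mono[OF that(2) E] that(1))
    have **: "set_integrable lborel {0<..<\<tau>} (\<lambda>t. LINT x:Omega \<epsilon>|lborel. E j (t, x) * h x)" for j
      using set_integral_Fubini(2)[OF *[of j]] by simp
    show ?thesis
      unfolding dv_def[abs_def] sum_3 distrib_right
      using * ** set_integral_Fubini(3)[OF *] by (simp add: set_integral_add)
  qed
  have cut: "AE \<tau> in lborel. \<tau> \<in> {0<..<T} \<longrightarrow> (LINT x:Omega \<epsilon>|lborel. rho (\<tau>, x) * cutoff \<epsilon> \<beta> (Suc m) x)
      = (LINT x:Omega \<epsilon>|lborel. rho0 x * cutoff \<epsilon> \<beta> (Suc m) x) - (LINT z:cyl \<tau> \<epsilon>|lborel. dv z * cutoff \<epsilon> \<beta> (Suc m) (snd z))"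
    if \<beta>: "\<beta> \<in> Cinfty" for \<beta> m
  proof -
    let ?b = "plateau 0 \<epsilon> (Suc m)" and ?b3 = "\<lambda>y. plateau 0 1 (Suc m) y * \<beta> y"
    let ?\<psi> = "cutoff \<epsilon> \<beta> (Suc m)" and ?d = "spatial_deriv ?b ?b ?b3"
    have bC: "?b \<in> Cinfty" "?b3 \<in> Cinfty" using \<beta> by (auto intro!: plateau_Cinfty cutoff_Cinfty)
    have c\<psi>: "continuous_on UNIV ?\<psi>" by (intro Cinfty_continuous spatial_prod_Cinfty bC)
    have cd: "continuous_on UNIV (?d j)" for j by (intro spatial_deriv_continuous bC)
    have sl: "AE t in lborel. t \<in> {0<..<T} \<longrightarrow>
       (LINT x:Omega \<epsilon>|lborel. (rho (t, x) * u (t, x) $ j) * ?d j x) = - (LINT x:Omega \<epsilon>|lborel. E j (t, x) * ?\<psi> x)" for j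
    proof (rule weak_deriv_slice[OF wd bC(1) bC])
      fix a b :: real and n :: nat assume *: "0 \<le> a" "a < b" "b \<le> T" "n > 0"
      show "tensor (plateau a b n) ?\<psi> \<in> Cc_infty (cyl T \<epsilon>)"
      proof (rule Cc_infty_tensor_cutoff[OF plateau_Cinfty _ _ \<beta>])
        show "t \<in> {a + 1 / real n..b - 1 / real n}" if "plateau a b n t \<noteq> 0" for t
          using plateau_support[OF that] by auto
        have "1 / real n > 0" using * by simp
        then show "{a + 1 / real n..b - 1 / real n} \<subseteq> {0<..<T}" using * by (intro subsetI) (simp only: atLeastAtMost_iff greaterThanLessThan_iff, linarith)
      qed simp
    qed
    let ?k = "\<lambda>t. \<Sum>j\<in>UNIV. LINT x:Omega \<epsilon>|lborel. (rho (t, x) * u (t, x) $ j) * ?d j x"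
    have "AE \<tau> in lborel. \<tau> \<in> {0<..<T} \<longrightarrow> (LINT x:Omega \<epsilon>|lborel. rho (\<tau>, x) * ?\<psi> x)
      = (LINT x:Omega \<epsilon>|lborel. rho0 x * ?\<psi> x) + (LINT t:{0<..<\<tau>}|lborel. ?k t)"
    proof (rule du_Bois_Reymond[OF T slice_pairing_integrable[OF r c\<psi>]])
      show "set_integrable lborel {0<..<T} ?k"
        unfolding sum_3 by (intro set_integral_add(1) slice_pairing_integrable[OF J cd])
      fix \<theta> assume \<theta>: "time_test T \<theta>"
      then have \<theta>C: "\<theta> \<in> Cinfty" by (simp add: time_test_def)
      have c\<theta>: "continuous_on UNIV \<theta>" "continuous_on UNIV (deriv \<theta>)"
        using \<theta>C by (auto intro!: Cinfty_continuous Cinfty_DERIV(2))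
      obtain \<delta> where \<delta>: "\<delta> > 0" "\<And>t. t \<ge> T - \<delta> \<Longrightarrow> \<theta> t = 0" "\<And>t. t \<le> -1 \<Longrightarrow> \<theta> t = 0"
        using \<theta> by (auto simp: time_test_def)
      have "tensor \<theta> ?\<psi> \<in> Cc_infty ({..<T} \<times> Omega \<epsilon>)"
      proof (rule Cc_infty_tensor_cutoff[OF \<theta>C _ _ \<beta>])
        show "t \<in> {-1..T - \<delta>}" if "\<theta> t \<noteq> 0" for t
          using that \<delta>(2)[of t] \<delta>(3)[of t] by force
      qed (use \<delta> in auto)
      from id[OF this]
      have *: "- (LINT z:cyl T \<epsilon>|lborel. rho z * (deriv \<theta> (fst z) * ?\<psi> (snd z)))
        - (LINT z:cyl T \<epsilon>|lborel. \<Sum>j\<in>UNIV. (rho z * u z $ j) * (\<theta> (fst z) * ?d j (snd z)))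
        = (LINT x:Omega \<epsilon>|lborel. \<theta> 0 * (rho0 x * ?\<psi> x))"
        unfolding continuity_identity_def dt_def grad_def inner_vec_def tensor_derivs[OF \<theta>C bC(1) bC]
        by (simp add: tensor_def mult_ac sum_distrib_left)
      have "(LINT z:cyl T \<epsilon>|lborel. \<Sum>j\<in>UNIV. (rho z * u z $ j) * (\<theta> (fst z) * ?d j (snd z))) = (LINT t:{0<..<T}|lborel. ?k t * \<theta> t)"
        unfolding sum_3 distrib_right
        using tensor_pairing(1)[OF J c\<theta>(1) cd] tensor_pairing(2)[OF J c\<theta>(1) cd] tensor_pairing(3)[OF J c\<theta>(1) cd] by (simp add: set_integral_add)
      then show "- (LINT t:{0<..<T}|lborel. (LINT x:Omega \<epsilon>|lborel. rho (t, x) * ?\<psi> x) * deriv \<theta> t) - (LINT t:{0<..<T}|lborel. ?k t * \<theta> t)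
        = \<theta> 0 * (LINT x:Omega \<epsilon>|lborel. rho0 x * ?\<psi> x)"
        using * unfolding tensor_pairing(2)[OF r c\<theta>(2) c\<psi>] by simp
    qed
    then show ?thesis
    proof eventually_elim
      case (elim \<tau>)
      have "(LINT t:{0<..<\<tau>}|lborel. ?k t) = - (LINT z:cyl \<tau> \<epsilon>|lborel. dv z * ?\<psi> (snd z))" if "\<tau> < T"
      proof -
        have "(LINT t:{0<..<\<tau>}|lborel. ?k t) = (LINT t:{0<..<\<tau>}|lborel. - (\<Sum>j\<in>UNIV. LINT x:Omega \<epsilon>|lborel. E j (t, x) * ?\<psi> x))"
        proof (rule set_integral_cong_AE_integrable)
          show "AE t\<in>{0<..<\<tau>} in lborel. ?k t = - (\<Sum>j\<in>UNIV. LINT x:Omega \<epsilon>|lborel. E j (t, x) * ?\<psi> x)"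
            using sl[of 1] sl[of 2] sl[of 3] by eventually_elim (use that in \<open>auto simp: sum_3\<close>)
          have "set_integrable lborel {0<..<\<tau>} ?k"
            unfolding sum_3 using that by (intro set_integral_add(1) slice_pairing_integrable[OF cyl_mono[OF _ J] cd]) auto
          then show "set_integrable lborel {0<..<\<tau>} ?k" by simp
          have "set_integrable lborel {0<..<\<tau>} (\<lambda>t. (-1) * (\<Sum>j\<in>UNIV. LINT x:Omega \<epsilon>|lborel. E j (t, x) * ?\<psi> x))"
            unfolding sum_3 using that by (intro set_integrable_mult_right set_integral_add(1) slice_pairing_integrable[OF cyl_mono[OF _ E] c\<psi>]) auto
          then show "set_integrable lborel {0<..<\<tau>} (\<lambda>t. - (\<Sum>j\<in>UNIV. LINT x:Omega \<epsilon>|lborel. E j (t, x) * ?\<psi> x))" by simp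
        qed
        then show ?thesis using that dvs[OF c\<psi>, of \<tau>] by (simp add: set_integral_uminus_real)
      qed
      then show ?case using elim by auto
    qed
  qed
  have "AE \<tau> in lborel. \<tau> \<in> {0<..<T} \<longrightarrow> (LINT x:Omega \<epsilon>|lborel. rho (\<tau>, x) * \<beta> (x $ 3))
      = (LINT x:Omega \<epsilon>|lborel. rho0 x * \<beta> (x $ 3)) + (LINT z:cyl \<tau> \<epsilon>|lborel. (rho z * u z $ 3) * deriv \<beta> (snd z $ 3))"
    if \<beta>: "\<beta> \<in> Cinfty" "\<And>y. \<beta> (y + 1) = \<beta> y" for \<beta>
  proof -
    have c: "continuous_on UNIV (\<lambda>x::real^3. \<beta> (x $ 3))" "continuous_on UNIV (\<lambda>x::real^3. deriv \<beta> (x $ 3))"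
      using \<beta> by (auto intro: Cinfty_vertical_continuous)
    obtain B where B: "\<And>y. \<bar>\<beta> y\<bar> \<le> B" using periodic_bounded[OF Cinfty_continuous[OF \<beta>(1)] \<beta>(2)] by blast
    have m: "set_borel_measurable lborel S (\<lambda>z. cutoff \<epsilon> \<beta> (Suc n) (h z))"
      if "S \<in> sets borel" "continuous_on UNIV h" for S :: "'a::euclidean_space set" and h n
    proof -
      have "continuous_on UNIV (cutoff \<epsilon> \<beta> (Suc n))"
        by (intro Cinfty_continuous spatial_prod_Cinfty plateau_Cinfty cutoff_Cinfty \<beta>(1))
      then have "continuous_on S (\<lambda>z. cutoff \<epsilon> \<beta> (Suc n) (h z))"
        using continuous_on_subset[OF that(2), of S] by (rule continuous_on_compose2) auto
      from borel_measurable_continuous_on_indicator[OF that(1) this] show ?thesis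
        by (simp add: set_borel_measurable_def)
    qed
    have lim: "(\<lambda>n. LINT z:S|lborel. F z * cutoff \<epsilon> \<beta> (Suc n) (h z)) \<longlonglongrightarrow> (LINT z:S|lborel. F z * \<beta> (h z $ 3))"
      if "set_integrable lborel S F" "S \<in> sets borel" "continuous_on UNIV h" "\<And>z. z \<in> S \<Longrightarrow> h z \<in> Omega \<epsilon>"
      for S :: "'a::euclidean_space set" and F h
    proof (rule set_integral_dominated_LIMSEQ(1)[OF that(1) m[OF that(2,3)], where B = B])
      show "\<bar>cutoff \<epsilon> \<beta> (Suc n) (h z)\<bar> \<le> B" for n z by (rule cutoff_bound[OF B])
      show "(\<lambda>n. cutoff \<epsilon> \<beta> (Suc n) (h z)) \<longlonglongrightarrow> \<beta> (h z $ 3)" if "z \<in> S" for z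
        by (rule cutoff_LIMSEQ) (rule \<open>\<And>z. z \<in> S \<Longrightarrow> h z \<in> Omega \<epsilon>\<close>[OF that])
    qed
    \<comment> \<open>Countably many cut-offs leave one common null set, outside of which the limit
      can be taken at a fixed time.\<close>
    have "AE \<tau> in lborel. \<forall>m. \<tau> \<in> {0<..<T} \<longrightarrow> (LINT x:Omega \<epsilon>|lborel. rho (\<tau>, x) * cutoff \<epsilon> \<beta> (Suc m) x)
      = (LINT x:Omega \<epsilon>|lborel. rho0 x * cutoff \<epsilon> \<beta> (Suc m) x) - (LINT z:cyl \<tau> \<epsilon>|lborel. dv z * cutoff \<epsilon> \<beta> (Suc m) (snd z))"
      unfolding AE_all_countable by (intro allI cut \<beta>(1))
    then show ?thesis using set_integral_Fubini(1)[OF r]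
    proof eventually_elim
      case (elim \<tau>)
      show ?case
      proof
        assume \<tau>: "\<tau> \<in> {0<..<T}"
        have L1: "(\<lambda>m. LINT x:Omega \<epsilon>|lborel. rho (\<tau>, x) * cutoff \<epsilon> \<beta> (Suc m) x) \<longlonglongrightarrow> (LINT x:Omega \<epsilon>|lborel. rho (\<tau>, x) * \<beta> (x $ 3))"
          using elim \<tau> by (intro lim[of "Omega \<epsilon>" _ "\<lambda>x. x"]) auto
        have L2: "(\<lambda>m. (LINT x:Omega \<epsilon>|lborel. rho0 x * cutoff \<epsilon> \<beta> (Suc m) x) - (LINT z:cyl \<tau> \<epsilon>|lborel. dv z * cutoff \<epsilon> \<beta> (Suc m) (snd z)))
          \<longlonglongrightarrow> (LINT x:Omega \<epsilon>|lborel. rho0 x * \<beta> (x $ 3)) - (LINT z:cyl \<tau> \<epsilon>|lborel. dv z * \<beta> (snd z $ 3))"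
          using \<tau> by (intro tendsto_diff lim[of "Omega \<epsilon>" _ "\<lambda>x. x"] lim[of "cyl \<tau> \<epsilon>" _ snd] r0 cyl_mono[OF _ dv] cyl_borel) (auto intro: continuous_intros)
        have eq: "(\<lambda>m. LINT x:Omega \<epsilon>|lborel. rho (\<tau>, x) * cutoff \<epsilon> \<beta> (Suc m) x) =
          (\<lambda>m. (LINT x:Omega \<epsilon>|lborel. rho0 x * cutoff \<epsilon> \<beta> (Suc m) x) - (LINT z:cyl \<tau> \<epsilon>|lborel. dv z * cutoff \<epsilon> \<beta> (Suc m) (snd z)))"
          using elim \<tau> by blast
        have 1: "(LINT x:Omega \<epsilon>|lborel. rho (\<tau>, x) * \<beta> (x $ 3)) = (LINT x:Omega \<epsilon>|lborel. rho0 x * \<beta> (x $ 3)) - (LINT z:cyl \<tau> \<epsilon>|lborel. dv z * \<beta> (snd z $ 3))"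
          by (rule LIMSEQ_unique[OF L1[unfolded eq] L2])
        have "(LINT z:cyl \<tau> \<epsilon>|lborel. dv z * \<beta> (snd z $ 3)) = (LINT t:{0<..<\<tau>}|lborel. \<Sum>j\<in>UNIV. LINT x:Omega \<epsilon>|lborel. E j (t, x) * \<beta> (x $ 3))"
          using \<tau> by (intro dvs c) auto
        \<comment> \<open>For j = 1 and j = 2 the test function does not depend on the j-th
          coordinate, so these terms vanish: no flux crosses the lateral boundary.\<close>
        also have "\<dots> = (LINT t:{0<..<\<tau>}|lborel. - (LINT x:Omega \<epsilon>|lborel. (rho (t, x) * u (t, x) $ 3) * deriv \<beta> (x $ 3)))"
        proof (rule set_integral_cong_AE_integrable)
          show "AE t\<in>{0<..<\<tau>} in lborel. (\<Sum>j\<in>UNIV. LINT x:Omega \<epsilon>|lborel. E j (t, x) * \<beta> (x $ 3))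
             = - (LINT x:Omega \<epsilon>|lborel. (rho (t, x) * u (t, x) $ 3) * deriv \<beta> (x $ 3))"
            using weak_deriv_per_slice[OF wd'[of 1] \<beta>] weak_deriv_per_slice[OF wd'[of 2] \<beta>] weak_deriv_per_slice[OF wd'[of 3] \<beta>]
            by eventually_elim (use \<tau> in \<open>auto simp: sum_3\<close>)
          have "set_integrable lborel {0<..<\<tau>} (\<lambda>t. \<Sum>j\<in>UNIV. LINT x:Omega \<epsilon>|lborel. E j (t, x) * \<beta> (x $ 3))"
            unfolding sum_3 using \<tau> by (intro set_integral_add(1) slice_pairing_integrable[OF cyl_mono[OF _ E] c(1)]) auto
          then show "set_integrable lborel {0<..<\<tau>} (\<lambda>t. \<Sum>j\<in>UNIV. LINT x:Omega \<epsilon>|lborel. E j (t, x) * \<beta> (x $ 3))" by simp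
          have "set_integrable lborel {0<..<\<tau>} (\<lambda>t. (-1) * (LINT x:Omega \<epsilon>|lborel. (rho (t, x) * u (t, x) $ 3) * deriv \<beta> (x $ 3)))"
            using \<tau> by (intro set_integrable_mult_right slice_pairing_integrable[OF cyl_mono[OF _ J] c(2)]) auto
          then show "set_integrable lborel {0<..<\<tau>} (\<lambda>t. - (LINT x:Omega \<epsilon>|lborel. (rho (t, x) * u (t, x) $ 3) * deriv \<beta> (x $ 3)))" by simp
        qed
        also have "\<dots> = - (LINT z:cyl \<tau> \<epsilon>|lborel. (rho z * u z $ 3) * deriv \<beta> (snd z $ 3))"
          using set_integral_Fubini(3)[OF set_integrable_mult_space[OF cyl_mono[OF _ J[of 3]] c(2)], of \<tau>] \<tau> by (simp add: set_integral_uminus_real)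
        finally show "(LINT x:Omega \<epsilon>|lborel. rho (\<tau>, x) * \<beta> (x $ 3))
      = (LINT x:Omega \<epsilon>|lborel. rho0 x * \<beta> (x $ 3)) + (LINT z:cyl \<tau> \<epsilon>|lborel. (rho z * u z $ 3) * deriv \<beta> (snd z $ 3))"
          using 1 by simp
      qed
    qed
  qed
  then show ?thesis
    unfolding evolves_def smooth_periodic_def by (intro conjI allI impI r r0 J) simp_all
qed

text \<open>The mass equation is tested with the derivative of \<beta>, and an integration by parts
  in x3 is carried out in each of its terms: at time \<tau>, at time 0 and in the flux.\<close>

lemma density_gradient_evolves:
  assumes ev: "evolves T \<epsilon> rho rho0 J" and vr: "vertical_deriv T \<epsilon> rho g" and vJ: "vertical_deriv T \<epsilon> J h"
    and w0: "weak_deriv per_space_tests (Omega \<epsilon>) (axis 3 1) rho0 g0"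
  shows "evolves T \<epsilon> g g0 h"
proof -
  have J: "set_integrable lborel (cyl T \<epsilon>) J" and h: "set_integrable lborel (cyl T \<epsilon>) h" and g: "set_integrable lborel (cyl T \<epsilon>) g"
    and g0: "set_integrable lborel (Omega \<epsilon>) g0"
    using vr vJ w0 by (auto simp: vertical_deriv_def weak_deriv_def)
  have "AE \<tau> in lborel. \<tau> \<in> {0<..<T} \<longrightarrow> (LINT x:Omega \<epsilon>|lborel. g (\<tau>, x) * \<beta> (x $ 3))
      = (LINT x:Omega \<epsilon>|lborel. g0 x * \<beta> (x $ 3)) + (LINT z:cyl \<tau> \<epsilon>|lborel. h z * deriv \<beta> (snd z $ 3))"
    if \<beta>: "smooth_periodic \<beta>" for \<beta>
  proof -
    have \<beta>': "smooth_periodic (deriv \<beta>)" by (rule smooth_periodic_deriv[OF \<beta>])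
    have \<beta>C: "\<beta> \<in> Cinfty" "\<And>y. \<beta> (y + 1) = \<beta> y" using \<beta> by (auto simp: smooth_periodic_def)
    have 0: "(LINT x:Omega \<epsilon>|lborel. rho0 x * deriv \<beta> (x $ 3)) = - (LINT x:Omega \<epsilon>|lborel. g0 x * \<beta> (x $ 3))"
      using w0 per_space_tests_vprod[OF \<beta>C] spatial_prod_has_derivative[OF Cinfty_const[of 1] Cinfty_const[of 1] \<beta>C(1)]
      unfolding weak_deriv_def by (auto simp: vprod_simp vprod_deriv)
    show ?thesis
      using vertical_derivD(3)[OF vr \<beta>] evolvesD(4)[OF ev \<beta>']
    proof eventually_elim
      case (elim \<tau>)
      then show ?case using 0 vertical_deriv_integrated[OF vJ _ \<beta>', of \<tau>] by auto
    qed
  qed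
  then show ?thesis
    unfolding evolves_def by (intro conjI allI impI g g0 h) simp_all
qed

section \<open>Continuously differentiable test functions\<close>

text \<open>The time interval is open because the derivatives of a classical solution need not
  extend to t = 0; bounds are available only on compact time intervals.\<close>

definition periodic_slab :: "real \<Rightarrow> (real \<Rightarrow> real \<Rightarrow> real) \<Rightarrow> bool" where
  "periodic_slab T \<phi> \<longleftrightarrow> continuous_on ({0<..<T} \<times> UNIV) (\<lambda>(t, y). \<phi> t y) \<and> (\<forall>t\<in>{0<..<T}. \<forall>y. \<phi> t (y + 1) = \<phi> t y)"

lemma periodic_slab_bounded:
  assumes "periodic_slab T \<phi>" "0 < \<delta>" "\<tau> < T"
  shows "\<exists>B. \<forall>t\<in>{\<delta>..\<tau>}. \<forall>y. \<bar>\<phi> t y\<bar> \<le> B"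
proof -
  have "bounded ((\<lambda>(t, y). \<phi> t y) ` ({\<delta>..\<tau>} \<times> {0..1}))"
    using assms by (intro compact_imp_bounded compact_continuous_image compact_Times)
      (auto simp: periodic_slab_def elim!: continuous_on_subset)
  then obtain B where B: "\<And>t y. t \<in> {\<delta>..\<tau>} \<Longrightarrow> y \<in> {0..1} \<Longrightarrow> \<bar>\<phi> t y\<bar> \<le> B" unfolding bounded_iff by force
  have "\<bar>\<phi> t y\<bar> \<le> B" if "t \<in> {\<delta>..\<tau>}" for t y
    using B[OF that, of "frac y"] periodic_frac[of "\<phi> t" y] that assms frac_lt_1[of y]
    by (simp add: periodic_slab_def less_imp_le)
  then show ?thesis by blast
qed

lemma periodic_slab_slice:
  assumes "periodic_slab T \<phi>" "t \<in> {0<..<T}"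
  shows "continuous_on S (\<phi> t)" "\<phi> t (y + 1) = \<phi> t y"
proof -
  have "continuous_on S ((\<lambda>(t, y). \<phi> t y) \<circ> (\<lambda>y. (t, y)))"
    using assms by (intro continuous_on_compose continuous_intros) (auto simp: periodic_slab_def elim!: continuous_on_subset)
  then show "continuous_on S (\<phi> t)" by (simp add: o_def)
  show "\<phi> t (y + 1) = \<phi> t y" using assms by (simp add: periodic_slab_def)
qed

abbreviation vfun :: "(real \<Rightarrow> real \<Rightarrow> real) \<Rightarrow> real \<times> (real^3) \<Rightarrow> real" where
  "vfun \<phi> z \<equiv> \<phi> (fst z) (snd z $ 3)"

lemma vfun_continuous:
  assumes "periodic_slab T \<phi>" "S \<subseteq> {0<..<T} \<times> UNIV"
  shows "continuous_on S (vfun \<phi>)"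
proof -
  have "continuous_on S ((\<lambda>(t, y). \<phi> t y) \<circ> (\<lambda>z. (fst z, snd z $ 3)))"
    using assms by (intro continuous_on_compose continuous_intros) (auto simp: periodic_slab_def elim!: continuous_on_subset)
  then show ?thesis by (simp add: o_def)
qed

abbreviation scyl :: "real \<Rightarrow> real \<Rightarrow> real \<Rightarrow> (real \<times> (real^3)) set" where
  "scyl \<delta> \<tau> \<epsilon> \<equiv> {\<delta><..<\<tau>} \<times> Omega \<epsilon>"

lemma set_integrable_mult_vfun:
  assumes f: "set_integrable lborel (cyl T \<epsilon>) f" and \<phi>: "periodic_slab T \<phi>" and d: "0 < \<delta>" "\<tau> < T"
  shows "set_integrable lborel (scyl \<delta> \<tau> \<epsilon>) (\<lambda>z. f z * vfun \<phi> z)"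
proof -
  obtain B where B: "\<And>t y. t \<in> {\<delta>..\<tau>} \<Longrightarrow> \<bar>\<phi> t y\<bar> \<le> B" using periodic_slab_bounded[OF \<phi> d] by blast
  have "set_integrable lborel (scyl \<delta> \<tau> \<epsilon>) f"
    using f by (rule set_integrable_subset) (use d in \<open>auto simp: cyl_borel\<close>)
  then show ?thesis
    using B d by (intro set_integrable_mult_continuous[where B = B] cyl_borel vfun_continuous[OF \<phi>]) auto
qed

lemma slice_integrable_mult:
  fixes f :: "real^3 \<Rightarrow> real"
  assumes f: "set_integrable lborel (Omega \<epsilon>) f" and h: "continuous_on UNIV h"
  shows "set_integrable lborel (Omega \<epsilon>) (\<lambda>x. f x * h (x $ 3))"
proof -
  obtain B where "\<And>x. x \<in> Omega \<epsilon> \<Longrightarrow> \<bar>h (x $ 3)\<bar> \<le> B"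
    using continuous_bounded_on_Omega[OF vertical_continuous[OF h]] by blast
  then show ?thesis
    by (intro set_integrable_mult_continuous[OF f, where B = B] vertical_continuous[OF h]) auto
qed

lemma slice_integral_sum:
  fixes f :: "real^3 \<Rightarrow> real"
  assumes f: "set_integrable lborel (Omega \<epsilon>) f" and h: "\<And>i. i \<in> I \<Longrightarrow> continuous_on UNIV (h i)"
  shows "(LINT x:Omega \<epsilon>|lborel. f x * (\<Sum>i\<in>I. c i * h i (x $ 3))) = (\<Sum>i\<in>I. c i * (LINT x:Omega \<epsilon>|lborel. f x * h i (x $ 3)))"
proof -
  have "(LINT x:Omega \<epsilon>|lborel. f x * (\<Sum>i\<in>I. c i * h i (x $ 3))) = (LINT x|lborel. (\<Sum>i\<in>I. c i * (indicator (Omega \<epsilon>) x *\<^sub>R (f x * h i (x $ 3)))))"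
    unfolding set_lebesgue_integral_def by (intro Bochner_Integration.integral_cong) (auto simp: sum_distrib_left mult_ac)
  also have "\<dots> = (\<Sum>i\<in>I. c i * (LINT x:Omega \<epsilon>|lborel. f x * h i (x $ 3)))"
    using slice_integrable_mult[OF f h] unfolding set_lebesgue_integral_def set_integrable_def
    by (subst Bochner_Integration.integral_sum) auto
  finally show ?thesis .
qed

text \<open>Pairs of indices turn the double sums of the expansion into sums over one finite
  set.\<close>

abbreviation trig_index :: "nat \<Rightarrow> (nat \<times> nat) set" where
  "trig_index n \<equiv> Sigma {..n} (\<lambda>k. {..k})"

abbreviation trig_at :: "nat \<times> nat \<Rightarrow> real \<Rightarrow> real" where
  "trig_at q \<equiv> trig (snd q) (fst q - snd q)"

abbreviation fcoeff :: "nat \<Rightarrow> (real \<Rightarrow> real) \<Rightarrow> nat \<times> nat \<Rightarrow> real" where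
  "fcoeff n \<phi> q \<equiv> trig_coeff n (fst q) (snd q) * integral {0..1} (\<lambda>s. \<phi> s * trig_at q s)"

lemma trig_conv_sum:
  assumes "continuous_on UNIV \<phi>"
  shows "trig_conv n \<phi> y = (\<Sum>q\<in>trig_index n. fcoeff n \<phi> q * trig_at q y)"
  unfolding trig_conv_expand[OF assms] by (subst sum.Sigma) (auto simp: split_beta)

lemma trig_conv_deriv_sum:
  assumes "\<And>y. (\<phi> has_real_derivative \<phi>' y) (at y)" "continuous_on UNIV \<phi>'" "\<And>y. \<phi> (y + 1) = \<phi> y"
  shows "trig_conv n \<phi>' y = (\<Sum>q\<in>trig_index n. fcoeff n \<phi> q * deriv (trig_at q) y)"
  unfolding trig_conv_deriv[OF assms, symmetric] by (subst sum.Sigma) (auto simp: split_beta)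

lemma trig_conv_continuous:
  assumes "continuous_on UNIV \<phi>" shows "continuous_on S (trig_conv n \<phi>)"
  unfolding trig_conv_sum[OF assms, abs_def] by (intro continuous_intros trig_continuous)

lemma slice_trig_conv_LIMSEQ:
  fixes f :: "real^3 \<Rightarrow> real"
  assumes f: "set_integrable lborel (Omega \<epsilon>) f" and \<phi>: "continuous_on UNIV \<phi>" "\<And>y. \<phi> (y + 1) = \<phi> y"
  shows "(\<lambda>n. LINT x:Omega \<epsilon>|lborel. f x * trig_conv n \<phi> (x $ 3)) \<longlonglongrightarrow> (LINT x:Omega \<epsilon>|lborel. f x * \<phi> (x $ 3))"
proof -
  obtain B where B: "\<And>y. \<bar>\<phi> y\<bar> \<le> B" using periodic_bounded[OF \<phi>] by blast
  have "set_borel_measurable lborel (Omega \<epsilon>) (\<lambda>x. trig_conv n \<phi> (x $ 3))" for n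
    unfolding set_borel_measurable_def
    using borel_measurable_continuous_on_indicator[of "Omega \<epsilon>" "\<lambda>x. trig_conv n \<phi> (x $ 3)"]
      vertical_continuous[OF trig_conv_continuous[OF \<phi>(1)]] by simp
  then show ?thesis
    by (rule set_integral_dominated_LIMSEQ(1)[OF f]) (auto intro: trig_conv_bound[OF \<phi>(1) B] trig_conv_LIMSEQ[OF \<phi>])
qed

text \<open>At a time outside the common null set of all \<open>trig i j\<close> the identity
  extends to finite sums. The same coefficients approximate \<phi> and its derivative, so both sides
  converge to those for \<phi>.\<close>

lemma vertical_deriv_test:
  assumes v: "vertical_deriv T \<epsilon> f g" and \<phi>: "periodic_slab T \<phi>" and \<phi>y: "periodic_slab T \<phi>y"
    and D: "\<And>t y. t \<in> {0<..<T} \<Longrightarrow> (\<phi> t has_real_derivative \<phi>y t y) (at y)"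
    and d: "0 < \<delta>" "\<tau> < T"
  shows "(LINT z:scyl \<delta> \<tau> \<epsilon>|lborel. f z * vfun \<phi>y z) = - (LINT z:scyl \<delta> \<tau> \<epsilon>|lborel. g z * vfun \<phi> z)"
proof -
  have f: "set_integrable lborel (cyl T \<epsilon>) f" and g: "set_integrable lborel (cyl T \<epsilon>) g" using v by (auto simp: vertical_deriv_def)
  have "AE t in lborel. \<forall>i j. t \<in> {0<..<T} \<longrightarrow>
      (LINT x:Omega \<epsilon>|lborel. f (t, x) * deriv (trig i j) (x $ 3)) = - (LINT x:Omega \<epsilon>|lborel. g (t, x) * trig i j (x $ 3))"
    unfolding AE_all_countable by (intro allI vertical_derivD(3)[OF v] smooth_periodic_trig)
  then have slice: "AE t in lborel. t \<in> {0<..<T} \<longrightarrow>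
      (LINT x:Omega \<epsilon>|lborel. f (t, x) * \<phi>y t (x $ 3)) = - (LINT x:Omega \<epsilon>|lborel. g (t, x) * \<phi> t (x $ 3))"
    using set_integral_Fubini(1)[OF f] set_integral_Fubini(1)[OF g]
  proof eventually_elim
    case (elim t)
    show ?case
    proof
      assume t: "t \<in> {0<..<T}"
      note \<phi>s = periodic_slab_slice[OF \<phi> t] and \<phi>ys = periodic_slab_slice[OF \<phi>y t]
      have ft: "set_integrable lborel (Omega \<epsilon>) (\<lambda>x. f (t, x))" and gt: "set_integrable lborel (Omega \<epsilon>) (\<lambda>x. g (t, x))"
        using elim t by auto
      have eq: "(LINT x:Omega \<epsilon>|lborel. f (t, x) * trig_conv n (\<phi>y t) (x $ 3)) = - (LINT x:Omega \<epsilon>|lborel. g (t, x) * trig_conv n (\<phi> t) (x $ 3))" for n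
        unfolding trig_conv_deriv_sum[OF D[OF t] \<phi>ys(1) \<phi>s(2)] trig_conv_sum[OF \<phi>s(1)]
        using elim t by (simp add: slice_integral_sum[OF ft trig_continuous(2)] slice_integral_sum[OF gt trig_continuous(1)] sum_negf)
      show "(LINT x:Omega \<epsilon>|lborel. f (t, x) * \<phi>y t (x $ 3)) = - (LINT x:Omega \<epsilon>|lborel. g (t, x) * \<phi> t (x $ 3))"
        by (rule LIMSEQ_unique[OF slice_trig_conv_LIMSEQ[OF ft \<phi>ys, unfolded eq] tendsto_minus[OF slice_trig_conv_LIMSEQ[OF gt \<phi>s]]])
    qed
  qed
  note i = set_integrable_mult_vfun[OF f \<phi>y d] set_integrable_mult_vfun[OF g \<phi> d]
  have "(LINT z:scyl \<delta> \<tau> \<epsilon>|lborel. f z * vfun \<phi>y z) = (LINT t:{\<delta><..<\<tau>}|lborel. - (LINT x:Omega \<epsilon>|lborel. g (t, x) * \<phi> t (x $ 3)))"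
    unfolding set_integral_Fubini(3)[OF i(1)]
  proof (rule set_integral_cong_AE_integrable)
    show "set_integrable lborel {\<delta><..<\<tau>} (\<lambda>t. LINT x:Omega \<epsilon>|lborel. f (t, x) * vfun \<phi>y (t, x))"
      by (rule set_integral_Fubini(2)[OF i(1)])
    show "set_integrable lborel {\<delta><..<\<tau>} (\<lambda>t. - (LINT x:Omega \<epsilon>|lborel. g (t, x) * \<phi> t (x $ 3)))"
      using set_integrable_mult_right[OF set_integral_Fubini(2)[OF i(2)], of "-1"] by simp
    show "AE t\<in>{\<delta><..<\<tau>} in lborel. (LINT x:Omega \<epsilon>|lborel. f (t, x) * vfun \<phi>y (t, x)) = - (LINT x:Omega \<epsilon>|lborel. g (t, x) * \<phi> t (x $ 3))"
      using slice by eventually_elim (use d in auto)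
  qed
  also have "\<dots> = - (LINT z:scyl \<delta> \<tau> \<epsilon>|lborel. g z * vfun \<phi> z)"
    unfolding set_integral_Fubini(3)[OF i(2)] by (simp add: set_integral_uminus_real)
  finally show ?thesis .
qed

lemma set_integral_split_open:
  fixes f :: "real \<Rightarrow> real"
  assumes "set_integrable lborel {a<..<c} f" "a < b" "b < c"
  shows "(LINT t:{a<..<c}|lborel. f t) = (LINT t:{a<..<b}|lborel. f t) + (LINT t:{b<..<c}|lborel. f t)"
proof -
  have i: "set_integrable lborel {a<..<b} f" "set_integrable lborel {b<..<c} f"
    using assms by (auto elim!: set_integrable_subset)
  have "(LINT t:{a<..<c}|lborel. f t) = (LINT t|lborel. indicator {a<..<b} t *\<^sub>R f t + indicator {b<..<c} t *\<^sub>R f t)"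
    unfolding set_lebesgue_integral_def
  proof (rule integral_cong_AE)
    show "AE t in lborel. indicator {a<..<c} t *\<^sub>R f t = indicator {a<..<b} t *\<^sub>R f t + indicator {b<..<c} t *\<^sub>R f t"
      using AE_lborel_singleton[of b] by eventually_elim (use assms in \<open>auto simp: indicator_def\<close>)
  qed (use assms(1) i in \<open>auto simp: set_integrable_def intro!: borel_measurable_add borel_measurable_integrable\<close>)
  then show ?thesis
    using i by (simp add: set_lebesgue_integral_def set_integrable_def)
qed

text \<open>The product rule for the absolutely continuous representative of m, integrated over
  (\<delta>, \<tau>). As m equals this representative only almost everywhere, the endpoints are
  required to be times at which it does.\<close>

lemma product_rule_primitive:
  fixes m N \<alpha> \<alpha>' :: "real \<Rightarrow> real"
  assumes N: "set_integrable lborel {0<..<T} N" and mi: "set_integrable lborel {0<..<T} m"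
    and m: "AE t in lborel. t \<in> {0<..<T} \<longrightarrow> m t = m0 + (LINT s:{0<..<t}|lborel. N s)"
    and m\<delta>: "m \<delta> = m0 + (LINT s:{0<..<\<delta>}|lborel. N s)" and m\<tau>: "m \<tau> = m0 + (LINT s:{0<..<\<tau>}|lborel. N s)"
    and D: "\<And>t. t \<in> {0<..<T} \<Longrightarrow> (\<alpha> has_real_derivative \<alpha>' t) (at t)" and c: "continuous_on {0<..<T} \<alpha>'"
    and d: "0 < \<delta>" "\<delta> < \<tau>" "\<tau> < T"
  shows "\<alpha> \<tau> * m \<tau> - \<alpha> \<delta> * m \<delta> = (LINT t:{\<delta><..<\<tau>}|lborel. m t * \<alpha>' t + N t * \<alpha> t)"
    and "set_integrable lborel {\<delta><..<\<tau>} (\<lambda>t. m t * \<alpha>' t)" "set_integrable lborel {\<delta><..<\<tau>} (\<lambda>t. N t * \<alpha> t)"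
proof -
  have sub: "{\<delta>..\<tau>} \<subseteq> {0<..<T}" and sub': "{\<delta><..<\<tau>} \<subseteq> {0<..<T}" using d by auto
  have ca: "continuous_on {0<..<T} \<alpha>" using DERIV_isCont[OF D] by (auto intro: continuous_at_imp_continuous_on)
  have bd: "\<exists>B. \<forall>t\<in>{\<delta><..<\<tau>}. \<bar>h t\<bar> \<le> B" if "continuous_on {0<..<T} h" for h :: "real \<Rightarrow> real"
  proof -
    have "bounded (h ` {\<delta>..\<tau>})" by (intro compact_imp_bounded compact_continuous_image continuous_on_subset[OF that sub]) auto
    then obtain B where "\<And>t. t \<in> {\<delta>..\<tau>} \<Longrightarrow> \<bar>h t\<bar> \<le> B" unfolding bounded_iff by force
    then show ?thesis by (intro exI[of _ B]) auto
  qed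
  have mult: "set_integrable lborel {\<delta><..<\<tau>} (\<lambda>t. f t * h t)"
    if "set_integrable lborel {0<..<T} f" "continuous_on {0<..<T} h" for f h :: "real \<Rightarrow> real"
  proof -
    have "set_integrable lborel {\<delta><..<\<tau>} f" using that(1) by (rule set_integrable_subset) (use d in auto)
    then show ?thesis
      using bd[OF that(2)] continuous_on_subset[OF that(2) sub']
      by (auto intro!: set_integrable_mult_continuous)
  qed
  show i1: "set_integrable lborel {\<delta><..<\<tau>} (\<lambda>t. m t * \<alpha>' t)" by (rule mult[OF mi c])
  show i2: "set_integrable lborel {\<delta><..<\<tau>} (\<lambda>t. N t * \<alpha> t)" by (rule mult[OF N ca])
  have N\<tau>: "set_integrable lborel {\<delta><..<\<tau>} N" using N by (rule set_integrable_subset) (use d in auto)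
  have ftc: "set_integrable lborel {s<..<\<tau>} \<alpha>'" "(LINT t:{s<..<\<tau>}|lborel. \<alpha>' t) = \<alpha> \<tau> - \<alpha> s" if "s \<in> {\<delta>..\<tau>}" for s
    using that d by (auto intro!: set_integral_FTC_open D continuous_on_subset[OF c])
  have inc: "(LINT s:{0<..<t}|lborel. N s) = (LINT s:{0<..<\<delta>}|lborel. N s) + (LINT s:{\<delta><..<t}|lborel. N s)" if "t \<in> {\<delta><..\<tau>}" for t
    using that d by (intro set_integral_split_open set_integrable_subset[OF N]) auto
  have sw: "(LINT t:{\<delta><..<\<tau>}|lborel. \<alpha>' t * (LINT s:{\<delta><..<t}|lborel. N s)) = (LINT s:{\<delta><..<\<tau>}|lborel. N s * \<alpha> \<tau> - N s * \<alpha> s)"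
  proof -
    have "(LINT t:{\<delta><..<\<tau>}|lborel. \<alpha>' t * (LINT s:{\<delta><..<t}|lborel. N s)) = (LINT s:{\<delta><..<\<tau>}|lborel. N s * (LINT t:{s<..<\<tau>}|lborel. \<alpha>' t))"
      using ftc(1)[of \<delta>] d by (intro set_integral_triangle_swap N\<tau>) auto
    also have "\<dots> = (LINT s:{\<delta><..<\<tau>}|lborel. N s * \<alpha> \<tau> - N s * \<alpha> s)"
      using ftc(2) by (intro set_lebesgue_integral_cong) (auto simp: right_diff_distrib)
    finally show ?thesis .
  qed
  have i3: "set_integrable lborel {\<delta><..<\<tau>} (\<lambda>t. \<alpha>' t * (LINT s:{\<delta><..<t}|lborel. N s))"
    by (rule set_integrable_mult_bounded[OF _ set_integral_upto(1)[OF N\<tau>] set_integral_upto(2)[OF N\<tau>]]) (use ftc(1)[of \<delta>] d in auto)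
  have "(LINT t:{\<delta><..<\<tau>}|lborel. m t * \<alpha>' t) = (LINT t:{\<delta><..<\<tau>}|lborel. m \<delta> * \<alpha>' t + \<alpha>' t * (LINT s:{\<delta><..<t}|lborel. N s))"
  proof (rule set_integral_cong_AE_integrable[OF i1])
    show "set_integrable lborel {\<delta><..<\<tau>} (\<lambda>t. m \<delta> * \<alpha>' t + \<alpha>' t * (LINT s:{\<delta><..<t}|lborel. N s))"
      using ftc(1)[of \<delta>] d i3 by (intro set_integral_add(1) set_integrable_mult_right) auto
    show "AE t\<in>{\<delta><..<\<tau>} in lborel. m t * \<alpha>' t = m \<delta> * \<alpha>' t + \<alpha>' t * (LINT s:{\<delta><..<t}|lborel. N s)"
      using m by eventually_elim (use inc m\<delta> d in \<open>auto simp: algebra_simps\<close>)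
  qed
  also have "\<dots> = m \<delta> * (\<alpha> \<tau> - \<alpha> \<delta>) + (LINT s:{\<delta><..<\<tau>}|lborel. N s * \<alpha> \<tau> - N s * \<alpha> s)"
    unfolding sw[symmetric] using ftc[of \<delta>] d i3 by (subst set_integral_add(2)) auto
  also have "(LINT s:{\<delta><..<\<tau>}|lborel. N s * \<alpha> \<tau> - N s * \<alpha> s) = (m \<tau> - m \<delta>) * \<alpha> \<tau> - (LINT s:{\<delta><..<\<tau>}|lborel. N s * \<alpha> s)"
    using i2 N\<tau> inc[of \<tau>] d m\<delta> m\<tau> by (subst set_integral_diff(2)) auto
  finally show "\<alpha> \<tau> * m \<tau> - \<alpha> \<delta> * m \<delta> = (LINT t:{\<delta><..<\<tau>}|lborel. m t * \<alpha>' t + N t * \<alpha> t)"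
    using i1 i2 by (simp add: set_integral_add(2) algebra_simps)
qed

definition C1_slab :: "real \<Rightarrow> (real \<Rightarrow> real \<Rightarrow> real) \<Rightarrow> (real \<Rightarrow> real \<Rightarrow> real) \<Rightarrow> (real \<Rightarrow> real \<Rightarrow> real) \<Rightarrow> bool" where
  "C1_slab T \<phi> \<phi>t \<phi>y \<longleftrightarrow> periodic_slab T \<phi> \<and> periodic_slab T \<phi>t \<and> periodic_slab T \<phi>y \<and>
    (\<forall>t\<in>{0<..<T}. \<forall>y. ((\<lambda>s. \<phi> s y) has_real_derivative \<phi>t t y) (at t) \<and> (\<phi> t has_real_derivative \<phi>y t y) (at y))"

lemma fourier_coeff_has_derivative:
  assumes \<phi>: "C1_slab T \<phi> \<phi>t \<phi>y" and t: "t \<in> {0<..<T}"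
  shows "((\<lambda>t. integral {0..1} (\<lambda>s. \<phi> t s * trig i j s)) has_real_derivative integral {0..1} (\<lambda>s. \<phi>t t s * trig i j s)) (at t)"
proof -
  have "((\<lambda>t. integral (cbox 0 1) (\<lambda>s. \<phi> t s * trig i j s)) has_field_derivative integral (cbox 0 1) (\<lambda>s. \<phi>t t s * trig i j s)) (at t within {0<..<T})"
  proof (rule leibniz_rule_field_derivative)
    fix x s assume "x \<in> {0<..<T}"
    then have "((\<lambda>x. \<phi> x s) has_real_derivative \<phi>t x s) (at x)" using \<phi> by (simp add: C1_slab_def)
    from DERIV_cmult_right[OF this, of "trig i j s"]
    show "((\<lambda>x. \<phi> x s * trig i j s) has_field_derivative \<phi>t x s * trig i j s) (at x within {0<..<T})"
      by (auto intro: has_field_derivative_at_within simp: mult.commute)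
  next
    fix x assume "x \<in> {0<..<T}"
    then show "(\<lambda>s. \<phi> x s * trig i j s) integrable_on cbox 0 1"
      using periodic_slab_slice(1)[of T \<phi> x] \<phi>
      by (auto intro!: integrable_continuous_interval continuous_intros trig_continuous simp: C1_slab_def)
  next
    have "continuous_on ({0<..<T} \<times> cbox 0 1) (\<lambda>z. (\<lambda>(t, y). \<phi>t t y) z * trig i j (snd z))"
      using \<phi> by (intro continuous_intros continuous_on_compose2[OF trig_continuous(1)[of UNIV]])
        (auto simp: C1_slab_def periodic_slab_def elim!: continuous_on_subset)
    then show "continuous_on ({0<..<T} \<times> cbox 0 1) (\<lambda>(x, s). \<phi>t x s * trig i j s)" by (simp add: split_beta)
  qed (use t in auto)
  then show ?thesis using t by (simp add: at_within_open[OF t])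
qed

lemma fourier_coeff_continuous:
  assumes "periodic_slab T \<phi>"
  shows "continuous_on {0<..<T} (\<lambda>t. integral {0..1} (\<lambda>s. \<phi> t s * trig i j s))"
proof -
  have "continuous_on ({0<..<T} \<times> cbox 0 1) (\<lambda>z. (\<lambda>(t, y). \<phi> t y) z * trig i j (snd z))"
    using assms by (intro continuous_intros continuous_on_compose2[OF trig_continuous(1)[of UNIV]])
      (auto simp: periodic_slab_def elim!: continuous_on_subset)
  then have "continuous_on ({0<..<T} \<times> cbox 0 1) (\<lambda>(x, s). \<phi> x s * trig i j s)" by (simp add: split_beta)
  from integral_continuous_on_param[OF this] show ?thesis by simp
qed

lemma vfun_trig_conv_LIMSEQ:
  assumes f: "set_integrable lborel (cyl T \<epsilon>) f" and \<phi>: "periodic_slab T \<phi>" and d: "0 < \<delta>" "\<tau> < T"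
  shows "(\<lambda>n. LINT z:scyl \<delta> \<tau> \<epsilon>|lborel. f z * trig_conv n (\<phi> (fst z)) (snd z $ 3)) \<longlonglongrightarrow> (LINT z:scyl \<delta> \<tau> \<epsilon>|lborel. f z * vfun \<phi> z)"
    and "set_integrable lborel (scyl \<delta> \<tau> \<epsilon>) (\<lambda>z. f z * trig_conv n (\<phi> (fst z)) (snd z $ 3))"
proof -
  obtain B where B: "\<And>t y. t \<in> {\<delta>..\<tau>} \<Longrightarrow> \<bar>\<phi> t y\<bar> \<le> B" using periodic_slab_bounded[OF \<phi> d] by blast
  have f': "set_integrable lborel (scyl \<delta> \<tau> \<epsilon>) f"
    using f by (rule set_integrable_subset) (use d in \<open>auto simp: cyl_borel\<close>)
  have c: "continuous_on (scyl \<delta> \<tau> \<epsilon>) (\<lambda>z. trig_conv n (\<phi> (fst z)) (snd z $ 3))" for n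
  proof -
    have "continuous_on (scyl \<delta> \<tau> \<epsilon>) (\<lambda>z. \<Sum>q\<in>trig_index n. fcoeff n (\<phi> (fst z)) q * trig_at q (snd z $ 3))"
      using d by (intro continuous_intros continuous_on_compose2[OF fourier_coeff_continuous[OF \<phi>]]
          continuous_on_compose2[OF trig_continuous(1)[of UNIV]]) auto
    then show ?thesis
      using d by (subst continuous_on_cong[OF refl trig_conv_sum]) (auto intro: periodic_slab_slice[OF \<phi>])
  qed
  have b: "\<bar>trig_conv n (\<phi> (fst z)) (snd z $ 3)\<bar> \<le> B" if "z \<in> scyl \<delta> \<tau> \<epsilon>" for n z
    using that d by (intro trig_conv_bound B periodic_slab_slice[OF \<phi>]) auto
  have m: "set_borel_measurable lborel (scyl \<delta> \<tau> \<epsilon>) (\<lambda>z. trig_conv n (\<phi> (fst z)) (snd z $ 3))" for n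
    unfolding set_borel_measurable_def using borel_measurable_continuous_on_indicator[OF cyl_borel c] by simp
  show "set_integrable lborel (scyl \<delta> \<tau> \<epsilon>) (\<lambda>z. f z * trig_conv n (\<phi> (fst z)) (snd z $ 3))"
    by (rule set_integrable_mult_bounded[OF f' m b])
  show "(\<lambda>n. LINT z:scyl \<delta> \<tau> \<epsilon>|lborel. f z * trig_conv n (\<phi> (fst z)) (snd z $ 3)) \<longlonglongrightarrow> (LINT z:scyl \<delta> \<tau> \<epsilon>|lborel. f z * vfun \<phi> z)"
    by (rule set_integral_dominated_LIMSEQ(1)[OF f' m b]) (use d in \<open>auto intro!: trig_conv_LIMSEQ periodic_slab_slice[OF \<phi>]\<close>)
qed

text \<open>Requiring the equation for all \<open>trig i j\<close> costs only one null set, as they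
  are countably many; \<open>evolves_test\<close> recovers the other test functions from
  them.\<close>

definition good_times :: "real \<Rightarrow> real \<Rightarrow> (real \<times> (real^3) \<Rightarrow> real) \<Rightarrow> (real^3 \<Rightarrow> real) \<Rightarrow> (real \<times> (real^3) \<Rightarrow> real) \<Rightarrow> real set" where
  "good_times T \<epsilon> f f0 k = {\<tau>\<in>{0<..<T}. set_integrable lborel (Omega \<epsilon>) (\<lambda>x. f (\<tau>, x)) \<and>
     (\<forall>i j. (LINT x:Omega \<epsilon>|lborel. f (\<tau>, x) * trig i j (x $ 3))
      = (LINT x:Omega \<epsilon>|lborel. f0 x * trig i j (x $ 3)) + (LINT z:cyl \<tau> \<epsilon>|lborel. k z * deriv (trig i j) (snd z $ 3)))}"

lemma AE_good_times:
  assumes "evolves T \<epsilon> f f0 k" shows "AE \<tau> in lborel. \<tau> \<in> {0<..<T} \<longrightarrow> \<tau> \<in> good_times T \<epsilon> f f0 k"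
proof -
  have f: "set_integrable lborel (cyl T \<epsilon>) f" using assms by (simp add: evolves_def)
  have "AE \<tau> in lborel. \<forall>i j. \<tau> \<in> {0<..<T} \<longrightarrow> (LINT x:Omega \<epsilon>|lborel. f (\<tau>, x) * trig i j (x $ 3))
      = (LINT x:Omega \<epsilon>|lborel. f0 x * trig i j (x $ 3)) + (LINT z:cyl \<tau> \<epsilon>|lborel. k z * deriv (trig i j) (snd z $ 3))"
    unfolding AE_all_countable by (intro allI evolvesD(4)[OF assms] smooth_periodic_trig)
  then show ?thesis using set_integral_Fubini(1)[OF f]
    by eventually_elim (auto simp: good_times_def)
qed

text \<open>The coefficients of \<phi>(t, .) are continuously differentiable in t, so for each
  monomial the product rule applies to the coefficient times the pairing. Summation gives the
  equation with \<open>trig_conv n\<close> applied to \<phi> and to both its derivatives, and n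
  tends to infinity.\<close>

lemma evolves_test:
  assumes ev: "evolves T \<epsilon> f f0 k" and \<phi>: "C1_slab T \<phi> \<phi>t \<phi>y"
    and good: "\<delta> \<in> good_times T \<epsilon> f f0 k" "\<tau> \<in> good_times T \<epsilon> f f0 k" and d: "\<delta> < \<tau>"
  shows "(LINT x:Omega \<epsilon>|lborel. f (\<tau>, x) * \<phi> \<tau> (x $ 3)) - (LINT x:Omega \<epsilon>|lborel. f (\<delta>, x) * \<phi> \<delta> (x $ 3))
    = (LINT z:scyl \<delta> \<tau> \<epsilon>|lborel. f z * vfun \<phi>t z) + (LINT z:scyl \<delta> \<tau> \<epsilon>|lborel. k z * vfun \<phi>y z)"
proof -
  have f: "set_integrable lborel (cyl T \<epsilon>) f" and k: "set_integrable lborel (cyl T \<epsilon>) k"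
    using ev by (auto simp: evolves_def)
  have dT: "0 < \<delta>" "\<tau> < T" "\<delta> \<in> {0<..<T}" "\<tau> \<in> {0<..<T}" using good by (auto simp: good_times_def)
  have ft: "set_integrable lborel (Omega \<epsilon>) (\<lambda>x. f (t, x))" if "t \<in> good_times T \<epsilon> f f0 k" for t
    using that by (simp add: good_times_def)
  have p: "periodic_slab T \<phi>" "periodic_slab T \<phi>t" "periodic_slab T \<phi>y" and
    D: "\<And>t y. t \<in> {0<..<T} \<Longrightarrow> (\<phi> t has_real_derivative \<phi>y t y) (at y)" using \<phi> by (auto simp: C1_slab_def)
  define m where "m q t = (LINT x:Omega \<epsilon>|lborel. f (t, x) * trig_at q (x $ 3))" for q t
  define N where "N q t = (LINT x:Omega \<epsilon>|lborel. k (t, x) * deriv (trig_at q) (x $ 3))" for q t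
  define a where "a q t = integral {0..1} (\<lambda>s. \<phi> t s * trig_at q s)" for q t
  define a' where "a' q t = integral {0..1} (\<lambda>s. \<phi>t t s * trig_at q s)" for q t
  have vc: "continuous_on UNIV (\<lambda>x::real^3. trig_at q (x $ 3))" "continuous_on UNIV (\<lambda>x::real^3. deriv (trig_at q) (x $ 3))" for q
    by (intro vertical_continuous trig_continuous)+
  have mi: "set_integrable lborel {0<..<T} (m q)" and Ni: "set_integrable lborel {0<..<T} (N q)" for q
    unfolding m_def N_def by (intro slice_pairing_integrable f k vc)+
  have mN: "m q t = (LINT x:Omega \<epsilon>|lborel. f0 x * trig_at q (x $ 3)) + (LINT s:{0<..<t}|lborel. N q s)"
    if "t \<in> good_times T \<epsilon> f f0 k" for q t
  proof -
    have "set_integrable lborel (cyl t \<epsilon>) (\<lambda>z. k z * deriv (trig_at q) (snd z $ 3))"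
      using that by (intro set_integrable_mult_space[OF cyl_mono[OF _ k] vc(2)]) (auto simp: good_times_def)
    from set_integral_Fubini(3)[OF this] that show ?thesis by (simp add: good_times_def m_def N_def)
  qed
  have aD: "(a q has_real_derivative a' q t) (at t)" if "t \<in> {0<..<T}" for q t
    unfolding a_def a'_def by (rule fourier_coeff_has_derivative[OF \<phi> that])
  have a'c: "continuous_on {0<..<T} (a' q)" for q
    unfolding a'_def[abs_def] by (rule fourier_coeff_continuous[OF p(2)])
  have prod: "a q \<tau> * m q \<tau> - a q \<delta> * m q \<delta> = (LINT t:{\<delta><..<\<tau>}|lborel. m q t * a' q t + N q t * a q t)"
    "set_integrable lborel {\<delta><..<\<tau>} (\<lambda>t. m q t * a' q t)" "set_integrable lborel {\<delta><..<\<tau>} (\<lambda>t. N q t * a q t)" for q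
  proof -
    have "AE t in lborel. t \<in> {0<..<T} \<longrightarrow> m q t = (LINT x:Omega \<epsilon>|lborel. f0 x * trig_at q (x $ 3)) + (LINT s:{0<..<t}|lborel. N q s)"
      using AE_good_times[OF ev] by eventually_elim (use mN in auto)
    note pr = product_rule_primitive[OF Ni mi this mN[OF good(1)] mN[OF good(2)] aD a'c dT(1) d dT(2)]
    show "a q \<tau> * m q \<tau> - a q \<delta> * m q \<delta> = (LINT t:{\<delta><..<\<tau>}|lborel. m q t * a' q t + N q t * a q t)"
      "set_integrable lborel {\<delta><..<\<tau>} (\<lambda>t. m q t * a' q t)" "set_integrable lborel {\<delta><..<\<tau>} (\<lambda>t. N q t * a q t)"
      using pr by auto
  qed
  have fin: "(LINT x:Omega \<epsilon>|lborel. f (\<tau>, x) * trig_conv n (\<phi> \<tau>) (x $ 3)) - (LINT x:Omega \<epsilon>|lborel. f (\<delta>, x) * trig_conv n (\<phi> \<delta>) (x $ 3))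
    = (LINT z:scyl \<delta> \<tau> \<epsilon>|lborel. f z * trig_conv n (\<phi>t (fst z)) (snd z $ 3)) + (LINT z:scyl \<delta> \<tau> \<epsilon>|lborel. k z * trig_conv n (\<phi>y (fst z)) (snd z $ 3))" for n
  proof -
    let ?c = "\<lambda>q. trig_coeff n (fst q) (snd q)"
    have L: "(LINT x:Omega \<epsilon>|lborel. f (t, x) * trig_conv n (\<phi> t) (x $ 3)) = (\<Sum>q\<in>trig_index n. ?c q * (a q t * m q t))"
      if "t \<in> good_times T \<epsilon> f f0 k" for t
    proof -
      have t: "t \<in> {0<..<T}" using that by (simp add: good_times_def)
      show ?thesis
        unfolding trig_conv_sum[OF periodic_slab_slice(1)[OF p(1) t]] slice_integral_sum[OF ft[OF that] trig_continuous(1)]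
        by (simp add: a_def m_def mult.assoc)
    qed
    have e: "indicator {\<delta><..<\<tau>} t *\<^sub>R (\<Sum>q\<in>trig_index n. ?c q * h q t) = (\<Sum>q\<in>trig_index n. ?c q * (indicator {\<delta><..<\<tau>} t *\<^sub>R h q t))"
      for h :: "nat \<times> nat \<Rightarrow> real \<Rightarrow> real" and t
      unfolding scaleR_sum_right by (simp add: mult.left_commute)
    have i: "set_integrable lborel {\<delta><..<\<tau>} (\<lambda>t. \<Sum>q\<in>trig_index n. ?c q * h q t)" if "\<And>q. set_integrable lborel {\<delta><..<\<tau>} (h q)" for h
      using that unfolding set_integrable_def e by (intro Bochner_Integration.integrable_sum integrable_mult_right) auto
    have s: "(LINT t:{\<delta><..<\<tau>}|lborel. \<Sum>q\<in>trig_index n. ?c q * h q t) = (\<Sum>q\<in>trig_index n. ?c q * (LINT t:{\<delta><..<\<tau>}|lborel. h q t))"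
      if "\<And>q. set_integrable lborel {\<delta><..<\<tau>} (h q)" for h
      using that unfolding set_integrable_def set_lebesgue_integral_def e by (subst Bochner_Integration.integral_sum) auto
    have F1: "(LINT z:scyl \<delta> \<tau> \<epsilon>|lborel. f z * trig_conv n (\<phi>t (fst z)) (snd z $ 3)) = (LINT t:{\<delta><..<\<tau>}|lborel. \<Sum>q\<in>trig_index n. ?c q * (m q t * a' q t))"
      unfolding set_integral_Fubini(3)[OF vfun_trig_conv_LIMSEQ(2)[OF f p(2) dT(1,2)]]
    proof (rule set_integral_cong_AE_integrable[OF set_integral_Fubini(2)[OF vfun_trig_conv_LIMSEQ(2)[OF f p(2) dT(1,2)]] i[OF prod(2)]])
      show "AE t\<in>{\<delta><..<\<tau>} in lborel. (LINT x:Omega \<epsilon>|lborel. f (t, x) * trig_conv n (\<phi>t (fst (t, x))) (snd (t, x) $ 3)) = (\<Sum>q\<in>trig_index n. ?c q * (m q t * a' q t))"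
        using set_integral_Fubini(1)[OF f]
      proof eventually_elim
        case (elim t)
        show ?case
        proof
          assume "t \<in> {\<delta><..<\<tau>}"
          then have t: "t \<in> {0<..<T}" using dT by auto
          show "(LINT x:Omega \<epsilon>|lborel. f (t, x) * trig_conv n (\<phi>t (fst (t, x))) (snd (t, x) $ 3)) = (\<Sum>q\<in>trig_index n. ?c q * (m q t * a' q t))"
            unfolding fst_conv snd_conv trig_conv_sum[OF periodic_slab_slice(1)[OF p(2) t]] slice_integral_sum[OF elim[rule_format, OF t] trig_continuous(1)]
            by (simp add: a'_def m_def mult_ac)
        qed
      qed
    qed
    have F2: "(LINT z:scyl \<delta> \<tau> \<epsilon>|lborel. k z * trig_conv n (\<phi>y (fst z)) (snd z $ 3)) = (LINT t:{\<delta><..<\<tau>}|lborel. \<Sum>q\<in>trig_index n. ?c q * (N q t * a q t))"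
      unfolding set_integral_Fubini(3)[OF vfun_trig_conv_LIMSEQ(2)[OF k p(3) dT(1,2)]]
    proof (rule set_integral_cong_AE_integrable[OF set_integral_Fubini(2)[OF vfun_trig_conv_LIMSEQ(2)[OF k p(3) dT(1,2)]] i[OF prod(3)]])
      show "AE t\<in>{\<delta><..<\<tau>} in lborel. (LINT x:Omega \<epsilon>|lborel. k (t, x) * trig_conv n (\<phi>y (fst (t, x))) (snd (t, x) $ 3)) = (\<Sum>q\<in>trig_index n. ?c q * (N q t * a q t))"
        using set_integral_Fubini(1)[OF k]
      proof eventually_elim
        case (elim t)
        show ?case
        proof
          assume "t \<in> {\<delta><..<\<tau>}"
          then have t: "t \<in> {0<..<T}" using dT by auto
          show "(LINT x:Omega \<epsilon>|lborel. k (t, x) * trig_conv n (\<phi>y (fst (t, x))) (snd (t, x) $ 3)) = (\<Sum>q\<in>trig_index n. ?c q * (N q t * a q t))"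
            unfolding fst_conv snd_conv trig_conv_deriv_sum[OF D[OF t] periodic_slab_slice(1)[OF p(3) t] periodic_slab_slice(2)[OF p(1) t]]
              slice_integral_sum[OF elim[rule_format, OF t] trig_continuous(2)]
            by (simp add: a_def N_def mult_ac)
        qed
      qed
    qed
    have "(\<Sum>q\<in>trig_index n. ?c q * (a q \<tau> * m q \<tau>)) - (\<Sum>q\<in>trig_index n. ?c q * (a q \<delta> * m q \<delta>))
      = (\<Sum>q\<in>trig_index n. ?c q * (LINT t:{\<delta><..<\<tau>}|lborel. m q t * a' q t)) + (\<Sum>q\<in>trig_index n. ?c q * (LINT t:{\<delta><..<\<tau>}|lborel. N q t * a q t))"
      unfolding sum_subtractf[symmetric] sum.distrib[symmetric] right_diff_distrib[symmetric] distrib_left[symmetric] prod(1)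
      using prod(2,3) by (simp add: set_integral_add)
    then show ?thesis unfolding L[OF good(1)] L[OF good(2)] F1 F2 s[OF prod(2)] s[OF prod(3)] .
  qed
  have L1: "(\<lambda>n. (LINT x:Omega \<epsilon>|lborel. f (\<tau>, x) * trig_conv n (\<phi> \<tau>) (x $ 3)) - (LINT x:Omega \<epsilon>|lborel. f (\<delta>, x) * trig_conv n (\<phi> \<delta>) (x $ 3)))
    \<longlonglongrightarrow> (LINT x:Omega \<epsilon>|lborel. f (\<tau>, x) * \<phi> \<tau> (x $ 3)) - (LINT x:Omega \<epsilon>|lborel. f (\<delta>, x) * \<phi> \<delta> (x $ 3))"
    using dT by (intro tendsto_diff slice_trig_conv_LIMSEQ ft good periodic_slab_slice[OF p(1)])
  have L2: "(\<lambda>n. (LINT z:scyl \<delta> \<tau> \<epsilon>|lborel. f z * trig_conv n (\<phi>t (fst z)) (snd z $ 3)) + (LINT z:scyl \<delta> \<tau> \<epsilon>|lborel. k z * trig_conv n (\<phi>y (fst z)) (snd z $ 3)))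
    \<longlonglongrightarrow> (LINT z:scyl \<delta> \<tau> \<epsilon>|lborel. f z * vfun \<phi>t z) + (LINT z:scyl \<delta> \<tau> \<epsilon>|lborel. k z * vfun \<phi>y z)"
    using dT by (intro tendsto_add vfun_trig_conv_LIMSEQ(1)[OF f p(2)] vfun_trig_conv_LIMSEQ(1)[OF k p(3)])
  show ?thesis by (rule LIMSEQ_unique[OF L1[unfolded fin] L2])
qed

section \<open>Constant densities and the passage to the initial time\<close>

lemma set_integral_Omega_vertical:
  fixes h :: "real \<Rightarrow> real"
  assumes \<epsilon>: "\<epsilon> > 0" and h: "continuous_on UNIV h" and nn: "\<And>y. h y \<ge> 0"
  shows "(LINT x:Omega \<epsilon>|lborel. h (x $ 3)) = \<epsilon>\<^sup>2 * integral {0..1} h"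
proof -
  define f :: "real^3 \<Rightarrow> real \<Rightarrow> ennreal" where
    "f b = (if b = axis 3 1 then (\<lambda>y. ennreal (indicator {0<..<1} y * h y)) else indicator {0<..<\<epsilon>})" for b
  have [measurable]: "h \<in> borel_measurable borel" by (rule borel_measurable_continuous_onI[OF h])
  have bas: "(Basis :: (real^3) set) = {axis 1 1, axis 2 1, axis 3 1}"
    unfolding Basis_vec_def by (auto simp: UNIV_3)
  have ne: "axis 1 1 \<noteq> (axis 2 1 :: real^3)" "axis 1 1 \<noteq> (axis 3 1 :: real^3)" "axis 2 1 \<noteq> (axis 3 1 :: real^3)"
    by (auto simp: axis_eq_axis)
  have pr: "(\<Prod>b\<in>Basis. F b) = F (axis 1 1) * F (axis 2 1) * F (axis 3 1)" for F :: "real^3 \<Rightarrow> ennreal"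
    unfolding bas using ne by (simp add: mult.assoc)
  have "(\<integral>\<^sup>+x. (\<Prod>b\<in>Basis. f b (x \<bullet> b)) \<partial>(lborel :: (real^3) measure)) = (\<Prod>b\<in>Basis. \<integral>\<^sup>+x. f b x \<partial>lborel)"
    by (rule nn_integral_lborel_prod) (auto simp: f_def)
  moreover have "(\<Prod>b\<in>Basis. f b (x \<bullet> b)) = ennreal (indicator (Omega \<epsilon>) x *\<^sub>R h (x $ 3))" for x
  proof -
    have "x \<bullet> axis j 1 = x $ j" for j by (simp add: inner_axis)
    then have "(\<Prod>b\<in>Basis. f b (x \<bullet> b)) = indicator {0<..<\<epsilon>} (x $ 1) * indicator {0<..<\<epsilon>} (x $ 2) * ennreal (indicator {0<..<1} (x $ 3) * h (x $ 3))"
      unfolding pr using ne by (simp add: f_def)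
    also have "\<dots> = ennreal (indicator (Omega \<epsilon>) x *\<^sub>R h (x $ 3))"
      by (auto simp: Omega_def indicator_def)
    finally show ?thesis .
  qed
  moreover have "(\<integral>\<^sup>+y. ennreal (indicator {0<..<1} y * h y) \<partial>lborel) = ennreal (integral {0..1} h)"
  proof -
    have i: "set_integrable lborel {0<..<1} h"
      using borel_integrable_atLeastAtMost'[OF continuous_on_subset[OF h], of 0 1] by (rule set_integrable_subset) auto
    have "(\<integral>\<^sup>+y. ennreal (indicator {0<..<1} y * h y) \<partial>lborel) = ennreal (LINT y:{0<..<1}|lborel. h y)"
      unfolding set_lebesgue_integral_def using i nn by (subst nn_integral_eq_integral) (auto simp: set_integrable_def)
    also have "(LINT y:{0<..<1}|lborel. h y) = integral {0..1} h"
      using set_borel_integral_eq_integral(2)[OF i] integral_open_interval_real[of 0 1 h] by simp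
    finally show ?thesis .
  qed
  ultimately have e: "(\<integral>\<^sup>+x. ennreal (indicator (Omega \<epsilon>) x *\<^sub>R h (x $ 3)) \<partial>lborel) = ennreal \<epsilon> * ennreal \<epsilon> * ennreal (integral {0..1} h)"
    using \<epsilon> ne by (simp add: pr f_def)
  have "integral {0..1} h \<ge> 0"
    by (intro Henstock_Kurzweil_Integration.integral_nonneg integrable_continuous_interval continuous_on_subset[OF h]) (auto simp: nn)
  then have "ennreal \<epsilon> * ennreal \<epsilon> * ennreal (integral {0..1} h) = ennreal (\<epsilon>\<^sup>2 * integral {0..1} h)"
    using \<epsilon> by (simp add: ennreal_mult power2_eq_square)
  moreover have "integrable lborel (\<lambda>x. indicator (Omega \<epsilon>) x *\<^sub>R h (x $ 3))"
    using slice_integrable_mult[OF set_integrable_const_Omega[OF \<epsilon>, of 1] h] by (simp add: set_integrable_def)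
  ultimately show ?thesis
    unfolding set_lebesgue_integral_def using e \<open>integral {0..1} h \<ge> 0\<close> nn
    by (subst integral_eq_nn_integral) auto
qed

text \<open>With f = 1, the terms containing only the one-dimensional solution undergo the same
  integration by parts as all others.\<close>

lemma vertical_deriv_one:
  assumes \<epsilon>: "\<epsilon> > 0" shows "vertical_deriv T \<epsilon> (\<lambda>_. 1) (\<lambda>_. 0)"
proof -
  have "(LINT x:Omega \<epsilon>|lborel. deriv \<beta> (x $ 3)) = 0" if \<beta>: "smooth_periodic \<beta>" for \<beta>
  proof -
    have \<beta>C: "\<beta> \<in> Cinfty" "\<And>y. \<beta> (y + 1) = \<beta> y" using \<beta> by (auto simp: smooth_periodic_def)
    have c: "continuous_on UNIV (deriv \<beta>)" by (intro Cinfty_continuous Cinfty_DERIV(2) \<beta>C)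
    have "deriv \<beta> (y + 1) = deriv \<beta> y" for y
      using smooth_periodic_deriv[OF \<beta>] by (simp add: smooth_periodic_def)
    then obtain B where B: "\<And>y. \<bar>deriv \<beta> y\<bar> \<le> B"
      using periodic_bounded[OF c] by blast
    have B0: "B \<ge> 0" using B[of 0] by linarith
    have "(deriv \<beta> has_integral \<beta> 1 - \<beta> 0) {0..1}"
      by (intro fundamental_theorem_of_calculus has_real_derivative_iff_has_vector_derivative[THEN iffD1]
          has_field_derivative_at_within[OF Cinfty_DERIV(1)[OF \<beta>C(1)]]) auto
    \<comment> \<open>Adding B makes the integrand nonnegative, as the product formula for the
      volume integral requires; the contribution of B is subtracted at the end.\<close>
    then have "((\<lambda>y. deriv \<beta> y + B) has_integral 0 + B) {0..1}"
      using \<beta>C(2)[of 0] has_integral_const_real[of B 0 1] by (intro has_integral_add) auto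
    then have I: "integral {0..1} (\<lambda>y. deriv \<beta> y + B) = B" by (simp add: integral_unique)
    have "deriv \<beta> y + B \<ge> 0" for y using B[of y] by linarith
    then have "(LINT x:Omega \<epsilon>|lborel. deriv \<beta> (x $ 3) + B) = \<epsilon>\<^sup>2 * B"
      using set_integral_Omega_vertical[OF \<epsilon>, of "\<lambda>y. deriv \<beta> y + B"] c by (simp add: I continuous_on_add)
    moreover have "(LINT x:Omega \<epsilon>|lborel. B) = \<epsilon>\<^sup>2 * B"
      using set_integral_Omega_vertical[OF \<epsilon> continuous_on_const[of UNIV B]] B0 by simp
    moreover have "set_integrable lborel (Omega \<epsilon>) (\<lambda>x. deriv \<beta> (x $ 3))"
      using slice_integrable_mult[OF set_integrable_const_Omega[OF \<epsilon>, of 1] c] by simp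
    ultimately show ?thesis
      using set_integrable_const_Omega[OF \<epsilon>, of B] by (simp add: set_integral_add)
  qed
  then show ?thesis
    unfolding vertical_deriv_def using set_integrable_const_cyl[OF \<epsilon>] by simp
qed

lemma evolves_one: "\<epsilon> > 0 \<Longrightarrow> evolves T \<epsilon> (\<lambda>_. 1) (\<lambda>_. 1) (\<lambda>_. 0)"
  unfolding evolves_def using set_integrable_const_cyl set_integrable_const_Omega by simp

text \<open>Each interval (0, T / (n + 1)) has positive measure and so contains a time outside the
  null set.\<close>

lemma AE_sequence_to_0:
  assumes T: "T > 0" and P: "AE t in lborel. t \<in> {0<..<T} \<longrightarrow> P t"
  shows "\<exists>\<delta>::nat \<Rightarrow> real. (\<forall>n. 0 < \<delta> n \<and> \<delta> n < T \<and> P (\<delta> n)) \<and> \<delta> \<longlonglongrightarrow> 0"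
proof -
  have "\<exists>t. 0 < t \<and> t < T / real (Suc n) \<and> P t" for n
  proof (rule ccontr)
    assume *: "\<nexists>t. 0 < t \<and> t < T / real (Suc n) \<and> P t"
    have le: "T / real (Suc n) \<le> T" using T by (simp add: field_simps)
    have "AE t in lborel. t \<notin> {0<..<T / real (Suc n)}"
      using P by eventually_elim (use * le in auto)
    then have "{0<..<T / real (Suc n)} \<in> null_sets lborel"
      by (subst (asm) AE_iff_null_sets[symmetric]) auto
    then show False using T by (auto simp: null_sets_def)
  qed
  then obtain \<delta> where \<delta>: "\<And>n. 0 < \<delta> n \<and> \<delta> n < T / real (Suc n) \<and> P (\<delta> n)" by metis
  have "\<delta> n < T" for n
  proof -
    have "T / real (Suc n) \<le> T" using T by (simp add: field_simps)
    then show ?thesis using \<delta>[of n] by linarith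
  qed
  moreover have "\<delta> \<longlonglongrightarrow> 0"
  proof (rule tendsto_sandwich[OF _ _ tendsto_const])
    show "(\<lambda>n. T / real (Suc n)) \<longlonglongrightarrow> 0" by real_asymp
    show "\<forall>\<^sub>F n in sequentially. 0 \<le> \<delta> n" using \<delta> by (auto intro!: always_eventually less_imp_le)
    show "\<forall>\<^sub>F n in sequentially. \<delta> n \<le> T / real (Suc n)" using \<delta> by (auto intro!: always_eventually less_imp_le)
  qed
  ultimately show ?thesis using \<delta> by blast
qed

text \<open>Continuity up to t = 0 identifies the initial values; it is assumed of the solution but
  not of its derivatives.\<close>

definition periodic_slab0 :: "real \<Rightarrow> (real \<Rightarrow> real \<Rightarrow> real) \<Rightarrow> bool" where
  "periodic_slab0 T \<phi> \<longleftrightarrow> continuous_on ({0..<T} \<times> UNIV) (\<lambda>(t, y). \<phi> t y) \<and> (\<forall>t\<in>{0..<T}. \<forall>y. \<phi> t (y + 1) = \<phi> t y)"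

lemma periodic_slab0_slice:
  assumes "periodic_slab0 T \<phi>" "t \<in> {0..<T}"
  shows "continuous_on S (\<phi> t)" "\<phi> t (y + 1) = \<phi> t y"
proof -
  have "continuous_on S ((\<lambda>(t, y). \<phi> t y) \<circ> (\<lambda>y. (t, y)))"
    using assms by (intro continuous_on_compose continuous_intros) (auto simp: periodic_slab0_def elim!: continuous_on_subset)
  then show "continuous_on S (\<phi> t)" by (simp add: o_def)
  show "\<phi> t (y + 1) = \<phi> t y" using assms by (simp add: periodic_slab0_def)
qed

lemma periodic_slab0_uniform:
  assumes \<phi>: "periodic_slab0 T \<phi>" and T: "T > 0" and e: "e > 0"
  shows "\<exists>\<eta>>0. \<eta> < T \<and> (\<forall>t\<in>{0..\<eta>}. \<forall>y. \<bar>\<phi> t y - \<phi> 0 y\<bar> \<le> e)"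
proof -
  have "uniformly_continuous_on ({0..T/2} \<times> {0..1}) (\<lambda>(t, y). \<phi> t y)"
    using \<phi> T by (intro compact_uniformly_continuous compact_Times)
      (auto simp: periodic_slab0_def elim!: continuous_on_subset)
  then obtain d where d: "d > 0" and D: "\<And>x y. x \<in> {0..T/2} \<times> {0..1} \<Longrightarrow> y \<in> {0..T/2} \<times> {0..1} \<Longrightarrow> dist y x < d
      \<Longrightarrow> dist ((\<lambda>(t, y). \<phi> t y) y) ((\<lambda>(t, y). \<phi> t y) x) < e"
    using e unfolding uniformly_continuous_on_def by metis
  define \<eta> where "\<eta> = min (d / 2) (T / 2)"
  have "\<bar>\<phi> t y - \<phi> 0 y\<bar> \<le> e" if t: "t \<in> {0..\<eta>}" for t y
  proof -
    have fr: "frac y \<in> {0..1}" using frac_lt_1[of y] by (simp add: less_imp_le)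
    have "dist (\<phi> t (frac y)) (\<phi> 0 (frac y)) < e"
      using D[of "(0, frac y)" "(t, frac y)"] t fr d T by (auto simp: \<eta>_def dist_Pair_Pair dist_real_def)
    moreover have "\<phi> t (frac y) = \<phi> t y" "\<phi> 0 (frac y) = \<phi> 0 y"
      using t T periodic_slab0_slice(2)[OF \<phi>] by (auto intro!: periodic_frac simp: \<eta>_def)
    ultimately show ?thesis by (simp add: dist_real_def)
  qed
  then show ?thesis using d T by (intro exI[of _ \<eta>]) (auto simp: \<eta>_def)
qed

lemma set_integral_abs_le:
  fixes f g :: "'a::euclidean_space \<Rightarrow> real"
  assumes f: "set_integrable M A f" and fg: "set_integrable M A (\<lambda>x. f x * g x)" and g: "\<And>x. x \<in> A \<Longrightarrow> \<bar>g x\<bar> \<le> e"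
  shows "\<bar>LINT x:A|M. f x * g x\<bar> \<le> e * (LINT x:A|M. \<bar>f x\<bar>)"
proof -
  have "norm (LINT x:A|M. f x * g x) \<le> (LINT x:A|M. e * \<bar>f x\<bar>)"
    unfolding set_lebesgue_integral_def
  proof (rule Bochner_Integration.integral_norm_bound_integral)
    show "integrable M (\<lambda>x. indicator A x *\<^sub>R (f x * g x))" using fg by (simp add: set_integrable_def)
    show "integrable M (\<lambda>x. indicator A x *\<^sub>R (e * \<bar>f x\<bar>))"
      using set_integrable_mult_right[OF set_integrable_abs[OF f], of e] by (simp add: set_integrable_def)
    show "norm (indicator A x *\<^sub>R (f x * g x)) \<le> indicator A x *\<^sub>R (e * \<bar>f x\<bar>)" for x
      using g[of x] by (auto simp: indicator_def abs_mult mult.commute[of "\<bar>f x\<bar>"] intro!: mult_right_mono)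
  qed
  then show ?thesis by simp
qed

text \<open>For a fixed trigonometric function the flux contributes an integral over a cylinder that
  shrinks to nothing. The L1 bound transfers the limit to \<phi>, which near t = 0 is uniformly
  close to one trigonometric sum.\<close>

lemma evolves_initial:
  assumes ev: "evolves T \<epsilon> f f0 k" and \<phi>: "periodic_slab0 T \<phi>" and T: "T > 0"
    and \<delta>: "\<And>n. \<delta> n \<in> good_times T \<epsilon> f f0 k" "\<delta> \<longlonglongrightarrow> 0"
    and B: "\<And>n. (LINT x:Omega \<epsilon>|lborel. \<bar>f (\<delta> n, x)\<bar>) \<le> B"
  shows "(\<lambda>n. LINT x:Omega \<epsilon>|lborel. f (\<delta> n, x) * \<phi> (\<delta> n) (x $ 3)) \<longlonglongrightarrow> (LINT x:Omega \<epsilon>|lborel. f0 x * \<phi> 0 (x $ 3))"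
proof (rule LIMSEQ_I)
  fix r :: real assume r: "r > 0"
  note evD = evolvesD[OF ev]
  have ft: "set_integrable lborel (Omega \<epsilon>) (\<lambda>x. f (\<delta> n, x))" and \<delta>T: "0 < \<delta> n" "\<delta> n < T" for n
    using \<delta>(1)[of n] by (auto simp: good_times_def)
  define B0 where "B0 = (LINT x:Omega \<epsilon>|lborel. \<bar>f0 x\<bar>)"
  have B0: "B0 \<ge> 0" unfolding B0_def set_lebesgue_integral_def by (intro integral_nonneg_AE) auto
  have Bnn: "B \<ge> 0"
  proof -
    have "0 \<le> (LINT x:Omega \<epsilon>|lborel. \<bar>f (\<delta> 0, x)\<bar>)" unfolding set_lebesgue_integral_def by (intro integral_nonneg_AE) auto
    then show ?thesis using B[of 0] by linarith
  qed
  \<comment> \<open>The two approximation errors add up to at most 2 e K = r / 2, which leaves room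
    for r / 4 from the trigonometric sum. The summand 1 keeps K positive.\<close>
  define K where "K = B + B0 + 1"
  define e where "e = r / (4 * K)"
  have K: "K > 0" using B0 Bnn by (simp add: K_def)
  have e: "e > 0" using r K by (simp add: e_def)
  have c0: "continuous_on UNIV (\<phi> 0)" "\<And>y. \<phi> 0 (y + 1) = \<phi> 0 y"
    using periodic_slab0_slice[OF \<phi>, of 0] T by auto
  obtain N where N: "\<And>y. \<bar>trig_conv N (\<phi> 0) y - \<phi> 0 y\<bar> \<le> e"
    using trig_conv_uniform[OF c0 e] by blast
  obtain \<eta> where \<eta>: "\<eta> > 0" "\<And>t y. t \<in> {0..\<eta>} \<Longrightarrow> \<bar>\<phi> t y - \<phi> 0 y\<bar> \<le> e"
    using periodic_slab0_uniform[OF \<phi> T e] by blast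
  let ?c = "trig_conv N (\<phi> 0)"
  have cc: "continuous_on UNIV ?c" by (rule trig_conv_continuous[OF c0(1)])
  have tr: "(\<lambda>n. (LINT x:Omega \<epsilon>|lborel. f (\<delta> n, x) * trig i j (x $ 3))) \<longlonglongrightarrow> (LINT x:Omega \<epsilon>|lborel. f0 x * trig i j (x $ 3))" for i j
  proof -
    let ?K = "\<lambda>z. k z * deriv (trig i j) (snd z $ 3)"
    have K: "set_integrable lborel (cyl T \<epsilon>) ?K"
      by (rule set_integrable_mult_space[OF evD(2) vertical_continuous[OF trig_continuous(2)]])
    have "(\<lambda>n. LINT z:cyl T \<epsilon>|lborel. ?K z * indicator (cyl (\<delta> n) \<epsilon>) z) \<longlonglongrightarrow> (LINT z:cyl T \<epsilon>|lborel. ?K z * 0)"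
    proof (rule set_integral_dominated_LIMSEQ(1)[OF K, where B = 1])
      show "set_borel_measurable lborel (cyl T \<epsilon>) (indicator (cyl (\<delta> n) \<epsilon>) :: _ \<Rightarrow> real)" for n
      proof -
        have "(indicator (cyl T \<epsilon>) :: _ \<Rightarrow> real) \<in> borel_measurable lborel" "(indicator (cyl (\<delta> n) \<epsilon>) :: _ \<Rightarrow> real) \<in> borel_measurable lborel"
          using cyl_borel by (auto intro!: borel_measurable_indicator)
        then show ?thesis unfolding set_borel_measurable_def by (rule borel_measurable_scaleR)
      qed
      fix z :: "real \<times> (real^3)" assume "z \<in> cyl T \<epsilon>"
      then have "0 < fst z" by auto
      with \<delta>(2) have "\<forall>\<^sub>F n in sequentially. \<delta> n < fst z" by (rule order_tendstoD)
      then have "\<forall>\<^sub>F n in sequentially. indicator (cyl (\<delta> n) \<epsilon>) z = (0::real)"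
        by eventually_elim (auto simp: indicator_def)
      then show "(\<lambda>n. indicator (cyl (\<delta> n) \<epsilon>) z) \<longlonglongrightarrow> (0::real)" by (rule tendsto_eventually)
    qed (auto simp: indicator_def)
    moreover have "(LINT z:cyl T \<epsilon>|lborel. ?K z * indicator (cyl (\<delta> n) \<epsilon>) z) = (LINT z:cyl (\<delta> n) \<epsilon>|lborel. ?K z)" for n
      unfolding set_lebesgue_integral_def using \<delta>T[of n] by (intro Bochner_Integration.integral_cong) (auto simp: indicator_def)
    ultimately have "(\<lambda>n. LINT z:cyl (\<delta> n) \<epsilon>|lborel. ?K z) \<longlonglongrightarrow> 0" by simp
    from tendsto_add[OF tendsto_const[of "LINT x:Omega \<epsilon>|lborel. f0 x * trig i j (x $ 3)"] this]
    show ?thesis using \<delta>(1) by (simp add: good_times_def)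
  qed
  have "(\<lambda>n. LINT x:Omega \<epsilon>|lborel. f (\<delta> n, x) * ?c (x $ 3)) \<longlonglongrightarrow> (LINT x:Omega \<epsilon>|lborel. f0 x * ?c (x $ 3))"
    unfolding trig_conv_sum[OF c0(1)] slice_integral_sum[OF ft trig_continuous(1)] slice_integral_sum[OF evD(3) trig_continuous(1)]
    by (intro tendsto_intros tr)
  from LIMSEQ_D[OF this, of "r / 4"] obtain n1 where n1: "\<And>n. n \<ge> n1 \<Longrightarrow> \<bar>(LINT x:Omega \<epsilon>|lborel. f (\<delta> n, x) * ?c (x $ 3)) - (LINT x:Omega \<epsilon>|lborel. f0 x * ?c (x $ 3))\<bar> < r / 4"
    using r by auto
  have "\<forall>\<^sub>F n in sequentially. \<delta> n < \<eta>" using \<delta>(2) \<eta>(1) by (rule order_tendstoD)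
  then obtain n2 where n2: "\<And>n. n \<ge> n2 \<Longrightarrow> \<delta> n < \<eta>" by (auto simp: eventually_sequentially)
  show "\<exists>no. \<forall>n\<ge>no. norm ((LINT x:Omega \<epsilon>|lborel. f (\<delta> n, x) * \<phi> (\<delta> n) (x $ 3)) - (LINT x:Omega \<epsilon>|lborel. f0 x * \<phi> 0 (x $ 3))) < r"
  proof (intro exI[of _ "max n1 n2"] allI impI)
    fix n assume n: "n \<ge> max n1 n2"
    have c\<delta>: "continuous_on UNIV (\<phi> (\<delta> n))" using periodic_slab0_slice(1)[OF \<phi>, of "\<delta> n"] \<delta>T[of n] by auto
    note i1 = slice_integrable_mult[OF ft c\<delta>] slice_integrable_mult[OF ft cc, of n]
    note i2 = slice_integrable_mult[OF evD(3) c0(1)] slice_integrable_mult[OF evD(3) cc]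
    have i1': "set_integrable lborel (Omega \<epsilon>) (\<lambda>x. f (\<delta> n, x) * (\<phi> (\<delta> n) (x $ 3) - ?c (x $ 3)))"
      using set_integral_diff(1)[OF i1] by (simp add: right_diff_distrib)
    have i2': "set_integrable lborel (Omega \<epsilon>) (\<lambda>x. f0 x * (?c (x $ 3) - \<phi> 0 (x $ 3)))"
      using set_integral_diff(1)[OF i2(2,1)] by (simp add: right_diff_distrib)
    have "\<bar>LINT x:Omega \<epsilon>|lborel. f (\<delta> n, x) * (\<phi> (\<delta> n) (x $ 3) - ?c (x $ 3))\<bar> \<le> (2 * e) * (LINT x:Omega \<epsilon>|lborel. \<bar>f (\<delta> n, x)\<bar>)"
    proof (rule set_integral_abs_le[OF ft i1'])
      fix x :: "real^3"
      show "\<bar>\<phi> (\<delta> n) (x $ 3) - ?c (x $ 3)\<bar> \<le> 2 * e"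
        using N[of "x $ 3"] \<eta>(2)[of "\<delta> n" "x $ 3"] n2[of n] n \<delta>T[of n] by simp
    qed
    also have "\<dots> \<le> 2 * e * B" using B[of n] e by (intro mult_left_mono) auto
    finally have A1: "\<bar>(LINT x:Omega \<epsilon>|lborel. f (\<delta> n, x) * \<phi> (\<delta> n) (x $ 3)) - (LINT x:Omega \<epsilon>|lborel. f (\<delta> n, x) * ?c (x $ 3))\<bar> \<le> 2 * e * B"
      using i1 by (simp add: right_diff_distrib set_integral_diff)
    have "\<bar>LINT x:Omega \<epsilon>|lborel. f0 x * (?c (x $ 3) - \<phi> 0 (x $ 3))\<bar> \<le> e * B0"
      unfolding B0_def by (rule set_integral_abs_le[OF evD(3) i2']) (rule N)
    then have A2: "\<bar>(LINT x:Omega \<epsilon>|lborel. f0 x * ?c (x $ 3)) - (LINT x:Omega \<epsilon>|lborel. f0 x * \<phi> 0 (x $ 3))\<bar> \<le> e * B0"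
      using i2 by (simp add: right_diff_distrib set_integral_diff)
    have "2 * e * B + e * B0 \<le> 2 * (e * K)" using e B0 Bnn by (simp add: K_def algebra_simps)
    also have "\<dots> = r / 2" using K by (simp add: e_def)
    finally have A3: "2 * e * B + e * B0 \<le> r / 2" .
    have A4: "\<bar>(LINT x:Omega \<epsilon>|lborel. f (\<delta> n, x) * ?c (x $ 3)) - (LINT x:Omega \<epsilon>|lborel. f0 x * ?c (x $ 3))\<bar> < r / 4"
      using n by (intro n1) simp
    show "norm ((LINT x:Omega \<epsilon>|lborel. f (\<delta> n, x) * \<phi> (\<delta> n) (x $ 3)) - (LINT x:Omega \<epsilon>|lborel. f0 x * \<phi> 0 (x $ 3))) < r"
      unfolding real_norm_def using A1 A2 A3 A4 r by linarith
  qed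
qed

section \<open>The one-dimensional solution\<close>

lemma periodic_slab_const: "periodic_slab T (\<lambda>_ _. c)"
  by (simp add: periodic_slab_def split_beta)

lemma periodic_slab_add: "periodic_slab T \<phi> \<Longrightarrow> periodic_slab T \<psi> \<Longrightarrow> periodic_slab T (\<lambda>t y. \<phi> t y + \<psi> t y)"
  by (simp add: periodic_slab_def split_beta continuous_on_add)

lemma periodic_slab_diff: "periodic_slab T \<phi> \<Longrightarrow> periodic_slab T \<psi> \<Longrightarrow> periodic_slab T (\<lambda>t y. \<phi> t y - \<psi> t y)"
  by (simp add: periodic_slab_def split_beta continuous_on_diff)

lemma periodic_slab_mult: "periodic_slab T \<phi> \<Longrightarrow> periodic_slab T \<psi> \<Longrightarrow> periodic_slab T (\<lambda>t y. \<phi> t y * \<psi> t y)"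
  by (simp add: periodic_slab_def split_beta continuous_on_mult)

lemma periodic_slab_powr:
  assumes "periodic_slab T \<phi>" "\<And>t y. t \<in> {0<..<T} \<Longrightarrow> \<phi> t y > 0" shows "periodic_slab T (\<lambda>t y. \<phi> t y powr c)"
proof -
  have "continuous_on ({0<..<T} \<times> UNIV) (\<lambda>z. \<phi> (fst z) (snd z) powr c)"
    using assms by (intro continuous_on_powr continuous_on_const) (auto simp: periodic_slab_def split_beta less_imp_neq[symmetric])
  then show ?thesis using assms by (simp add: periodic_slab_def split_beta)
qed

lemmas periodic_slab_intros = periodic_slab_const periodic_slab_add periodic_slab_diff periodic_slab_mult

lemma periodic_slab0_ops:
  "periodic_slab0 T (\<lambda>_ _. c)"
  "periodic_slab0 T \<phi> \<Longrightarrow> periodic_slab0 T \<psi> \<Longrightarrow> periodic_slab0 T (\<lambda>t y. \<phi> t y + \<psi> t y)"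
  "periodic_slab0 T \<phi> \<Longrightarrow> periodic_slab0 T \<psi> \<Longrightarrow> periodic_slab0 T (\<lambda>t y. \<phi> t y - \<psi> t y)"
  "periodic_slab0 T \<phi> \<Longrightarrow> periodic_slab0 T \<psi> \<Longrightarrow> periodic_slab0 T (\<lambda>t y. \<phi> t y * \<psi> t y)"
  by (simp_all add: periodic_slab0_def split_beta continuous_on_add continuous_on_diff continuous_on_mult)

lemma periodic_slab0_powr:
  assumes "periodic_slab0 T \<phi>" "\<And>t y. t \<in> {0..<T} \<Longrightarrow> \<phi> t y > 0" shows "periodic_slab0 T (\<lambda>t y. \<phi> t y powr c)"
proof -
  have "continuous_on ({0..<T} \<times> UNIV) (\<lambda>z. \<phi> (fst z) (snd z) powr c)"
    using assms by (intro continuous_on_powr continuous_on_const) (auto simp: periodic_slab0_def split_beta less_imp_neq[symmetric])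
  then show ?thesis using assms by (simp add: periodic_slab0_def split_beta)
qed

lemma periodic_slab0_imp: "periodic_slab0 T \<phi> \<Longrightarrow> periodic_slab T \<phi>"
  by (auto simp: periodic_slab0_def periodic_slab_def elim!: continuous_on_subset)

lemma deriv_periodic:
  fixes g :: "real \<Rightarrow> real"
  assumes "\<And>y. g (y + 1) = g y" shows "deriv g (y + 1) = deriv g y"
proof -
  have "(g has_field_derivative D) (at (y + 1)) \<longleftrightarrow> (g has_field_derivative D) (at y)" for D
    using DERIV_shift[of g D y 1] assms by simp
  then show ?thesis by (simp add: deriv_def)
qed

lemma classical_periodicD:
  assumes "classical_periodic T f"
  shows "periodic_slab0 T f"
    and "t \<in> {0<..<T} \<Longrightarrow> ((\<lambda>s. f s y) has_real_derivative deriv (\<lambda>s. f s y) t) (at t)"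
    and "t \<in> {0<..<T} \<Longrightarrow> (f t has_real_derivative deriv (f t) y) (at y)"
    and "t \<in> {0<..<T} \<Longrightarrow> (deriv (f t) has_real_derivative deriv (deriv (f t)) y) (at y)"
    and "periodic_slab T (\<lambda>t y. deriv (\<lambda>s. f s y) t)" "periodic_slab T (\<lambda>t. deriv (f t))" "periodic_slab T (\<lambda>t. deriv (deriv (f t)))"
proof -
  have p: "f t (y + 1) = f t y" if "t \<in> {0..<T}" for t y using assms that unfolding classical_periodic_def by blast
  show "periodic_slab0 T f" using assms by (auto simp: classical_periodic_def periodic_slab0_def)
  show "t \<in> {0<..<T} \<Longrightarrow> ((\<lambda>s. f s y) has_real_derivative deriv (\<lambda>s. f s y) t) (at t)"
    "t \<in> {0<..<T} \<Longrightarrow> (f t has_real_derivative deriv (f t) y) (at y)"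
    "t \<in> {0<..<T} \<Longrightarrow> (deriv (f t) has_real_derivative deriv (deriv (f t)) y) (at y)"
    using assms unfolding classical_periodic_def DERIV_deriv_iff_field_differentiable by blast+
  have "deriv (\<lambda>s. f s (y + 1)) t = deriv (\<lambda>s. f s y) t" if "t \<in> {0<..<T}" for t y
  proof (rule deriv_cong_ev)
    have "\<forall>\<^sub>F s in nhds t. s \<in> {0<..<T}" using that by (intro eventually_nhds_in_open) auto
    then show "\<forall>\<^sub>F s in nhds t. f s (y + 1) = f s y" by eventually_elim (auto intro: p)
  qed simp
  then show "periodic_slab T (\<lambda>t y. deriv (\<lambda>s. f s y) t)"
    using assms by (auto simp: classical_periodic_def periodic_slab_def)
  have d: "deriv (f t) (y + 1) = deriv (f t) y" if "t \<in> {0<..<T}" for t y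
    using that by (intro deriv_periodic p) auto
  then show "periodic_slab T (\<lambda>t. deriv (f t))"
    using assms by (auto simp: classical_periodic_def periodic_slab_def)
  have "deriv (deriv (f t)) (y + 1) = deriv (deriv (f t)) y" if "t \<in> {0<..<T}" for t y
    using that by (intro deriv_periodic d) auto
  then show "periodic_slab T (\<lambda>t. deriv (deriv (f t)))"
    using assms by (auto simp: classical_periodic_def periodic_slab_def)
qed

text \<open>The set where the bound fails is open and null, hence empty.\<close>

lemma AE_bound_imp_bound:
  fixes f :: "real \<times> real \<Rightarrow> real"
  assumes A: "open A" and f: "continuous_on A f" and b: "AE z in lborel. z \<in> A \<longrightarrow> \<bar>f z\<bar> \<le> C" and z: "z \<in> A"
  shows "\<bar>f z\<bar> \<le> C"
proof (rule ccontr)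
  assume *: "\<not> \<bar>f z\<bar> \<le> C"
  define S where "S = A \<inter> (\<lambda>z. \<bar>f z\<bar>) -` {C<..}"
  have S: "open S" unfolding S_def by (intro continuous_open_preimage continuous_intros f A)
  have "z \<in> S" using z * by (simp add: S_def)
  have "AE z in lborel. z \<notin> S" using b by eventually_elim (auto simp: S_def)
  then have "S \<in> null_sets lborel" using S by (subst AE_iff_null_sets) auto
  then have "negligible S" by (simp add: negligible_iff_null_sets null_sets_completionI)
  then show False using open_not_negligible[OF S] \<open>z \<in> S\<close> by auto
qed

locale one_dim_solution =
  fixes T \<mu> a \<gamma> \<kappa> :: real and rb vb wb :: "real \<Rightarrow> real \<Rightarrow> real" and rb0 vb0 wb0 :: "real \<Rightarrow> real"
  assumes T: "T > 0" and \<mu>: "\<mu> > 0" and a: "a > 0" and \<gamma>: "\<gamma> > 1" and \<kappa>: "0 < \<kappa>" "\<kappa> < 1"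
    and sol: "augmented_solution_1d T \<kappa> \<mu> (pressure a \<gamma>) rb vb wb rb0 vb0 wb0"
    and reg_u: "Linfty_on ({0<..<T} \<times> {0<..<1}) (\<lambda>(t, y). deriv (velocity_1d \<kappa> vb wb t) y)"
    and reg_rho1: "Linfty_on ({0<..<T} \<times> {0<..<1}) (\<lambda>(t, y). deriv (\<lambda>z. ln (rb t z)) y)"
    and reg_rho2: "Linfty_on ({0<..<T} \<times> {0<..<1}) (\<lambda>(t, y). deriv (deriv (\<lambda>z. ln (rb t z))) y)"
begin

definition s :: real where "s = sqrt (\<kappa> * (1 - \<kappa>))"
definition c :: real where "c = sqrt (\<kappa> / (1 - \<kappa>))"
definition U :: "real \<Rightarrow> real \<Rightarrow> real" where "U t y = vb t y - c * wb t y"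
text \<open>The derivative of ln rb, see \<open>ln_deriv\<close>. Defining it through wb derives its
  continuity and differentiability from those of wb.\<close>

definition q1 :: "real \<Rightarrow> real \<Rightarrow> real" where "q1 t y = 1 / (2 * s * \<mu>) * wb t y"
definition q2 :: "real \<Rightarrow> real \<Rightarrow> real" where "q2 t y = 1 / (2 * s * \<mu>) * deriv (wb t) y"
definition Uy :: "real \<Rightarrow> real \<Rightarrow> real" where "Uy t y = deriv (vb t) y - c * deriv (wb t) y"
definition Uyy :: "real \<Rightarrow> real \<Rightarrow> real" where "Uyy t y = deriv (deriv (vb t)) y - c * deriv (deriv (wb t)) y"
definition Vt :: "real \<Rightarrow> real \<Rightarrow> real" where "Vt t y = deriv (\<lambda>s. vb s y) t"
definition Wt :: "real \<Rightarrow> real \<Rightarrow> real" where "Wt t y = deriv (\<lambda>s. wb s y) t"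
definition Y :: "real \<Rightarrow> real \<Rightarrow> real" where "Y t y = rb t y powr (\<gamma> - 1)"

lemma s: "s > 0" "s * s = \<kappa> * (1 - \<kappa>)"
  using \<kappa> by (auto simp: s_def)

lemma c: "c > 0" "s * c = \<kappa>" "(1 - \<kappa>) * c = s"
proof -
  show "c > 0" using \<kappa> by (simp add: c_def)
  have c: "c = s / (1 - \<kappa>)"
  proof -
    have "c = sqrt (\<kappa> * (1 - \<kappa>) / (1 - \<kappa>)\<^sup>2)" using \<kappa> by (simp add: c_def power2_eq_square)
    then show ?thesis using \<kappa> by (simp add: s_def real_sqrt_divide)
  qed
  show "(1 - \<kappa>) * c = s" "s * c = \<kappa>" using \<kappa> s(2) by (simp_all add: c field_simps)
qed

lemma classical: "classical_periodic T rb" "classical_periodic T vb" "classical_periodic T wb"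
  using sol by (auto simp: augmented_solution_1d_def)

lemma rb_pos: "t \<in> {0..<T} \<Longrightarrow> rb t y > 0"
  using sol by (auto simp: augmented_solution_1d_def)

lemma init: "y \<in> {0<..<1} \<Longrightarrow> rb0 y = rb 0 y \<and> vb0 y = vb 0 y \<and> wb0 y = wb 0 y"
  using sol by (auto simp: augmented_solution_1d_def)

lemma U_eq: "velocity_1d \<kappa> vb wb t y = U t y"
  by (simp add: velocity_1d_def U_def c_def)

lemma equations:
  assumes "t \<in> {0<..<T}"
  shows "wb t y = 2 * s * \<mu> * deriv (\<lambda>z. ln (rb t z)) y"
    and "deriv (\<lambda>s. rb s y) t + deriv (\<lambda>z. rb t z * U t z) y = 0"
    and "deriv (\<lambda>s. rb s y * wb s y) t + deriv (\<lambda>z. rb t z * wb t z * U t z) y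
          = - 2 * \<mu> * deriv (\<lambda>z. s * rb t z * deriv (vb t) z) y + \<mu> * deriv (\<lambda>z. 2 * \<kappa> * rb t z * deriv (wb t) z) y"
    and "deriv (\<lambda>s. rb s y * vb s y) t + deriv (\<lambda>z. rb t z * vb t z * U t z) y + deriv (\<lambda>z. pressure a \<gamma> (rb t z)) y
          = (1 - \<kappa>) * 2 * \<mu> * deriv (\<lambda>z. rb t z * deriv (vb t) z) y - s * 2 * \<mu> * deriv (\<lambda>z. rb t z * deriv (wb t) z) y"
proof -
  have v: "velocity_1d \<kappa> vb wb = U" by (intro ext U_eq)
  have ss: "sqrt (1 - \<kappa>) * sqrt \<kappa> = s" by (simp add: s_def real_sqrt_mult mult.commute)
  show "wb t y = 2 * s * \<mu> * deriv (\<lambda>z. ln (rb t z)) y"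
    "deriv (\<lambda>s. rb s y) t + deriv (\<lambda>z. rb t z * U t z) y = 0"
    "deriv (\<lambda>s. rb s y * wb s y) t + deriv (\<lambda>z. rb t z * wb t z * U t z) y
          = - 2 * \<mu> * deriv (\<lambda>z. s * rb t z * deriv (vb t) z) y + \<mu> * deriv (\<lambda>z. 2 * \<kappa> * rb t z * deriv (wb t) z) y"
    "deriv (\<lambda>s. rb s y * vb s y) t + deriv (\<lambda>z. rb t z * vb t z * U t z) y + deriv (\<lambda>z. pressure a \<gamma> (rb t z)) y
          = (1 - \<kappa>) * 2 * \<mu> * deriv (\<lambda>z. rb t z * deriv (vb t) z) y - s * 2 * \<mu> * deriv (\<lambda>z. rb t z * deriv (wb t) z) y"
    using sol assms unfolding augmented_solution_1d_def Let_def v ss s_def[symmetric] by blast+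
qed

lemmas v_facts = classical_periodicD[OF classical(2)]
lemmas w_facts = classical_periodicD[OF classical(3)]
lemmas r_facts = classical_periodicD[OF classical(1)]

lemma ln_deriv: "t \<in> {0<..<T} \<Longrightarrow> deriv (\<lambda>z. ln (rb t z)) y = q1 t y"
  using equations(1)[of t y] s \<mu> by (simp add: q1_def)

lemma rb_y: "t \<in> {0<..<T} \<Longrightarrow> (rb t has_real_derivative rb t y * q1 t y) (at y)"
proof -
  assume t: "t \<in> {0<..<T}"
  have r: "rb t y > 0" using t rb_pos[of t y] by auto
  have "((\<lambda>z. ln (rb t z)) has_real_derivative inverse (rb t y) * deriv (rb t) y) (at y)"
    using DERIV_chain2[OF DERIV_ln[OF r] r_facts(3)[OF t]] .
  then have "inverse (rb t y) * deriv (rb t) y = q1 t y"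
    using DERIV_imp_deriv ln_deriv[OF t] by metis
  then have "deriv (rb t) y = rb t y * q1 t y" using r by (simp add: field_simps)
  then show ?thesis using r_facts(3)[OF t, of y] by simp
qed

lemma y_derivs:
  assumes t: "t \<in> {0<..<T}"
  shows "(U t has_real_derivative Uy t y) (at y)" "(Uy t has_real_derivative Uyy t y) (at y)" "(q1 t has_real_derivative q2 t y) (at y)"
    "(Y t has_real_derivative (\<gamma> - 1) * Y t y * q1 t y) (at y)"
proof -
  have r: "rb t y > 0" using t rb_pos[of t y] by auto
  show "(U t has_real_derivative Uy t y) (at y)"
    unfolding U_def[abs_def] Uy_def by (intro DERIV_diff DERIV_cmult v_facts(3) w_facts(3) t)
  show "(Uy t has_real_derivative Uyy t y) (at y)"
    unfolding Uy_def[abs_def] Uyy_def by (intro DERIV_diff DERIV_cmult v_facts(4) w_facts(4) t)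
  show "(q1 t has_real_derivative q2 t y) (at y)"
    unfolding q1_def[abs_def] q2_def by (intro DERIV_cmult w_facts(3) t)
  have "((\<lambda>y. rb t y powr (\<gamma> - 1)) has_real_derivative ((\<gamma> - 1) * rb t y powr (\<gamma> - 1 - 1)) * (rb t y * q1 t y)) (at y)"
    by (rule DERIV_chain2[OF has_real_derivative_powr[OF r] rb_y[OF t]])
  moreover have "rb t y powr (\<gamma> - 1) = rb t y * rb t y powr (\<gamma> - 1 - 1)"
    using powr_mult_base[of "rb t y" "\<gamma> - 1 - 1"] r by simp
  ultimately show "(Y t has_real_derivative (\<gamma> - 1) * Y t y * q1 t y) (at y)"
    unfolding Y_def[abs_def] by (simp add: mult_ac)
qed

lemma augmented_eqs:
  "vb t y = U t y + 2 * \<kappa> * \<mu> * q1 t y" "wb t y = 2 * s * \<mu> * q1 t y"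
  "deriv (vb t) y = Uy t y + 2 * \<kappa> * \<mu> * q2 t y" "deriv (wb t) y = 2 * s * \<mu> * q2 t y"
proof -
  have "2 * \<kappa> * \<mu> / (2 * s * \<mu>) = c" using s(1) \<mu> c(2) by (simp add: field_simps)
  then have k: "2 * \<kappa> * \<mu> * (1 / (2 * s * \<mu>) * x) = c * x" for x
    by (metis (no_types, opaque_lifting) mult.assoc times_divide_eq_right mult.right_neutral)
  show "vb t y = U t y + 2 * \<kappa> * \<mu> * q1 t y" unfolding q1_def k by (simp add: U_def)
  show "deriv (vb t) y = Uy t y + 2 * \<kappa> * \<mu> * q2 t y" unfolding q2_def k by (simp add: Uy_def)
  show "wb t y = 2 * s * \<mu> * q1 t y" "deriv (wb t) y = 2 * s * \<mu> * q2 t y"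
    using s(1) \<mu> by (simp_all add: q1_def q2_def)
qed

lemma rb_t: "t \<in> {0<..<T} \<Longrightarrow> ((\<lambda>s. rb s y) has_real_derivative - (rb t y * (U t y * q1 t y + Uy t y))) (at t)"
proof -
  assume t: "t \<in> {0<..<T}"
  have "deriv (\<lambda>z. rb t z * U t z) y = rb t y * q1 t y * U t y + Uy t y * rb t y"
    by (rule DERIV_imp_deriv[OF DERIV_mult[OF rb_y[OF t] y_derivs(1)[OF t]]])
  then have "deriv (\<lambda>s. rb s y) t = - (rb t y * (U t y * q1 t y + Uy t y))"
    using equations(2)[OF t, of y] by (simp add: algebra_simps)
  then show ?thesis using r_facts(2)[OF t, of y] by simp
qed

text \<open>The mass equation removes the time derivative of the density, and division by the
  density removes the divergence form. After substituting vb = U + c wb, the second derivatives of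
  wb cancel because s c = \<kappa> and (1 - \<kappa>) c = s.\<close>

lemma momentum_1d:
  assumes t: "t \<in> {0<..<T}"
  shows "Wt t y = - U t y * deriv (wb t) y - 2 * s * \<mu> * (Uyy t y + q1 t y * Uy t y)"
    and "Vt t y = - U t y * deriv (vb t) y - a * \<gamma> * Y t y * q1 t y + 2 * (1 - \<kappa>) * \<mu> * (Uyy t y + q1 t y * Uy t y)"
proof -
  define r where "r = rb t y"
  have r: "r > 0" using t rb_pos[of t y] by (auto simp: r_def)
  have dt: "deriv (\<lambda>s. rb s y * f s y) t = - (r * (U t y * q1 t y + Uy t y)) * f t y + deriv (\<lambda>s. f s y) t * r"
    if "classical_periodic T f" for f
    unfolding r_def by (rule DERIV_imp_deriv[OF DERIV_mult[OF rb_t[OF t] classical_periodicD(2)[OF that t]]])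
  have dy: "deriv (\<lambda>z. rb t z * f t z * U t z) y = (r * q1 t y * f t y + deriv (f t) y * r) * U t y + Uy t y * (r * f t y)"
    if "classical_periodic T f" for f
    unfolding r_def by (rule DERIV_imp_deriv[OF DERIV_mult[OF DERIV_mult[OF rb_y[OF t] classical_periodicD(3)[OF that t]] y_derivs(1)[OF t]]])
  have dyy: "((\<lambda>z. rb t z * deriv (f t) z) has_real_derivative r * q1 t y * deriv (f t) y + deriv (deriv (f t)) y * r) (at y)"
    if "classical_periodic T f" for f
    unfolding r_def by (rule DERIV_mult[OF rb_y[OF t] classical_periodicD(4)[OF that t]])
  have dyyc: "deriv (\<lambda>z. k * rb t z * deriv (f t) z) y = k * (r * q1 t y * deriv (f t) y + deriv (deriv (f t)) y * r)"
    if "classical_periodic T f" for f k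
    using DERIV_imp_deriv[OF DERIV_cmult[OF dyy[OF that], of k]] by (simp add: mult.assoc)
  have Vyy: "deriv (deriv (vb t)) y = Uyy t y + c * deriv (deriv (wb t)) y" and Vy: "deriv (vb t) y = Uy t y + c * deriv (wb t) y"
    by (simp_all add: Uyy_def Uy_def)
  let ?Wy = "deriv (wb t) y" and ?Wyy = "deriv (deriv (wb t)) y"
  have "r * (Wt t y + U t y * ?Wy) = - 2 * \<mu> * (s * (r * q1 t y * deriv (vb t) y + deriv (deriv (vb t)) y * r))
     + \<mu> * (2 * \<kappa> * (r * q1 t y * ?Wy + ?Wyy * r))"
    using equations(3)[OF t, of y] unfolding dt[OF classical(3)] dy[OF classical(3)] dyyc[OF classical(2)] dyyc[OF classical(3)]
    by (simp add: Wt_def algebra_simps)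
  also have "\<dots> = r * (- 2 * \<mu> * s * (q1 t y * Uy t y + Uyy t y) - 2 * \<mu> * (s * c - \<kappa>) * (q1 t y * ?Wy + ?Wyy))"
    unfolding Vy Vyy by (simp add: algebra_simps)
  finally have "r * (Wt t y + U t y * ?Wy) = r * (- 2 * \<mu> * s * (q1 t y * Uy t y + Uyy t y))" by (simp only: c(2) diff_self mult_zero_right mult_zero_left diff_zero)
  then have "Wt t y + U t y * ?Wy = - 2 * \<mu> * s * (q1 t y * Uy t y + Uyy t y)"
    by (rule mult_left_cancel[THEN iffD1, OF less_imp_neq[OF r, symmetric]])
  then show "Wt t y = - U t y * deriv (wb t) y - 2 * s * \<mu> * (Uyy t y + q1 t y * Uy t y)" by (simp add: algebra_simps)
  have "((\<lambda>x. a * x powr \<gamma>) has_real_derivative a * (\<gamma> * rb t y powr (\<gamma> - 1))) (at (rb t y))"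
    using r by (intro DERIV_cmult has_real_derivative_powr) (simp add: r_def)
  from DERIV_imp_deriv[OF DERIV_chain2[OF this rb_y[OF t]]]
  have dp: "deriv (\<lambda>z. pressure a \<gamma> (rb t z)) y = a * \<gamma> * Y t y * (r * q1 t y)"
    by (simp add: pressure_def Y_def r_def mult.assoc)
  have "r * (Vt t y + U t y * deriv (vb t) y + a * \<gamma> * Y t y * q1 t y) = (1 - \<kappa>) * 2 * \<mu> * (r * q1 t y * deriv (vb t) y + deriv (deriv (vb t)) y * r)
     - s * 2 * \<mu> * (r * q1 t y * ?Wy + ?Wyy * r)"
    using equations(4)[OF t, of y] unfolding dt[OF classical(2)] dy[OF classical(2)] dp DERIV_imp_deriv[OF dyy[OF classical(2)]] DERIV_imp_deriv[OF dyy[OF classical(3)]]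
    by (simp add: Vt_def algebra_simps)
  also have "\<dots> = r * (2 * (1 - \<kappa>) * \<mu> * (q1 t y * Uy t y + Uyy t y) + 2 * \<mu> * ((1 - \<kappa>) * c - s) * (q1 t y * ?Wy + ?Wyy))"
    unfolding Vy Vyy by (simp add: algebra_simps)
  finally have "r * (Vt t y + U t y * deriv (vb t) y + a * \<gamma> * Y t y * q1 t y) = r * (2 * (1 - \<kappa>) * \<mu> * (q1 t y * Uy t y + Uyy t y))"
    by (simp only: c(3) diff_self mult_zero_right mult_zero_left add_0_right)
  then have "Vt t y + U t y * deriv (vb t) y + a * \<gamma> * Y t y * q1 t y = 2 * (1 - \<kappa>) * \<mu> * (q1 t y * Uy t y + Uyy t y)"
    by (rule mult_left_cancel[THEN iffD1, OF less_imp_neq[OF r, symmetric]])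
  then show "Vt t y = - U t y * deriv (vb t) y - a * \<gamma> * Y t y * q1 t y + 2 * (1 - \<kappa>) * \<mu> * (Uyy t y + q1 t y * Uy t y)"
    by (simp add: algebra_simps)
qed

lemma slabs:
  "periodic_slab T vb" "periodic_slab T wb" "periodic_slab T rb" "periodic_slab T Vt" "periodic_slab T Wt"
  "periodic_slab T (\<lambda>t. deriv (vb t))" "periodic_slab T (\<lambda>t. deriv (wb t))"
  "periodic_slab T U" "periodic_slab T Uy" "periodic_slab T Uyy" "periodic_slab T q1" "periodic_slab T q2" "periodic_slab T Y"
proof -
  show *: "periodic_slab T vb" "periodic_slab T wb" "periodic_slab T rb"
    by (intro periodic_slab0_imp v_facts(1) w_facts(1) r_facts(1))+
  show "periodic_slab T Vt" "periodic_slab T Wt" unfolding Vt_def[abs_def] Wt_def[abs_def] by (rule v_facts(5), rule w_facts(5))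
  show d: "periodic_slab T (\<lambda>t. deriv (vb t))" "periodic_slab T (\<lambda>t. deriv (wb t))" by (rule v_facts(6), rule w_facts(6))
  show "periodic_slab T U" "periodic_slab T Uy" "periodic_slab T Uyy" "periodic_slab T q1" "periodic_slab T q2"
    unfolding U_def[abs_def] Uy_def[abs_def] Uyy_def[abs_def] q1_def[abs_def] q2_def[abs_def]
    by (intro periodic_slab_intros * d v_facts(7) w_facts(7))+
  show "periodic_slab T Y" unfolding Y_def[abs_def] by (rule periodic_slab_powr[OF *(3)]) (use rb_pos in auto)
qed

lemma C1_vb: "C1_slab T vb Vt (\<lambda>t. deriv (vb t))" and C1_wb: "C1_slab T wb Wt (\<lambda>t. deriv (wb t))"
  using slabs v_facts(2,3) w_facts(2,3) by (auto simp: C1_slab_def Vt_def Wt_def)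

text \<open>This is p(rb) = rb P'(rb) - P(rb), the part of the relative energy that contains none of
  the unknowns.\<close>

definition pr :: "real \<Rightarrow> real \<Rightarrow> real" where "pr t y = a * (rb t y * Y t y)"
definition prt :: "real \<Rightarrow> real \<Rightarrow> real" where "prt t y = - a * \<gamma> * Y t y * rb t y * (U t y * q1 t y + Uy t y)"
definition pry :: "real \<Rightarrow> real \<Rightarrow> real" where "pry t y = a * \<gamma> * Y t y * rb t y * q1 t y"
text \<open>The coefficient of \<rho> in the relative energy: half the squares of the velocities
  minus P'(rb). The number e1 will be e(1), the free constant of the internal energy.\<close>

definition xi :: "real \<Rightarrow> real \<Rightarrow> real \<Rightarrow> real" where
  "xi e1 t y = 1 / 2 * (vb t y * vb t y + wb t y * wb t y) - a / (\<gamma> - 1) * (\<gamma> * Y t y - 1) - e1"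
definition xit :: "real \<Rightarrow> real \<Rightarrow> real" where
  "xit t y = vb t y * Vt t y + wb t y * Wt t y + a * \<gamma> * Y t y * (U t y * q1 t y + Uy t y)"
definition xiy :: "real \<Rightarrow> real \<Rightarrow> real" where
  "xiy t y = vb t y * deriv (vb t) y + wb t y * deriv (wb t) y - a * \<gamma> * Y t y * q1 t y"

lemma Y_t:
  assumes t: "t \<in> {0<..<T}"
  shows "((\<lambda>s. Y s y) has_real_derivative - ((\<gamma> - 1) * Y t y * (U t y * q1 t y + Uy t y))) (at t)"
proof -
  have r: "rb t y > 0" using t rb_pos[of t y] by auto
  have "((\<lambda>s. rb s y powr (\<gamma> - 1)) has_real_derivative ((\<gamma> - 1) * rb t y powr (\<gamma> - 1 - 1)) * - (rb t y * (U t y * q1 t y + Uy t y))) (at t)"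
    by (rule DERIV_chain2[OF has_real_derivative_powr[OF r] rb_t[OF t]])
  moreover have "rb t y powr (\<gamma> - 1) = rb t y * rb t y powr (\<gamma> - 1 - 1)"
    using powr_mult_base[of "rb t y" "\<gamma> - 1 - 1"] r by simp
  ultimately show ?thesis unfolding Y_def by (simp add: mult_ac)
qed

lemma C1_pr: "C1_slab T pr prt pry"
  unfolding C1_slab_def
proof (intro conjI ballI allI)
  show "periodic_slab T pr" "periodic_slab T prt" "periodic_slab T pry"
    unfolding pr_def[abs_def] prt_def[abs_def] pry_def[abs_def] by (intro periodic_slab_intros slabs)+
  fix t y assume t: "t \<in> {0<..<T}"
  show "((\<lambda>s. pr s y) has_real_derivative prt t y) (at t)"
    unfolding pr_def[abs_def] by (rule DERIV_cong[OF DERIV_cmult[OF DERIV_mult[OF rb_t[OF t] Y_t[OF t]]]]) (simp add: prt_def algebra_simps)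
  show "(pr t has_real_derivative pry t y) (at y)"
    unfolding pr_def[abs_def] by (rule DERIV_cong[OF DERIV_cmult[OF DERIV_mult[OF rb_y[OF t] y_derivs(4)[OF t]]]]) (simp add: pry_def algebra_simps)
qed

lemma C1_xi: "C1_slab T (xi e1) xit xiy"
  unfolding C1_slab_def
proof (intro conjI ballI allI)
  show "periodic_slab T (xi e1)" "periodic_slab T xit" "periodic_slab T xiy"
    unfolding xi_def[abs_def] xit_def[abs_def] xiy_def[abs_def] by (intro periodic_slab_intros slabs)+
  fix t y assume t: "t \<in> {0<..<T}"
  have g: "a / (\<gamma> - 1) * (\<gamma> * ((\<gamma> - 1) * x)) = a * \<gamma> * x" for x using \<gamma> by simp
  have vt: "((\<lambda>s. vb s y) has_real_derivative Vt t y) (at t)" and wt: "((\<lambda>s. wb s y) has_real_derivative Wt t y) (at t)"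
    using v_facts(2)[OF t] w_facts(2)[OF t] by (auto simp: Vt_def Wt_def)
  have A: "((\<lambda>s. xi e1 s y) has_real_derivative 1 / 2 * ((Vt t y * vb t y + Vt t y * vb t y) + (Wt t y * wb t y + Wt t y * wb t y))
     - a / (\<gamma> - 1) * (\<gamma> * - ((\<gamma> - 1) * Y t y * (U t y * q1 t y + Uy t y)) - 0) - 0) (at t)"
    unfolding xi_def by (intro DERIV_diff DERIV_cmult DERIV_add DERIV_mult DERIV_const vt wt Y_t t)
  show "((\<lambda>s. xi e1 s y) has_real_derivative xit t y) (at t)"
    by (rule DERIV_cong[OF A]) (use g[of "Y t y * (U t y * q1 t y + Uy t y)"] \<gamma> in \<open>simp add: xit_def mult_ac\<close>)
  have B: "(xi e1 t has_real_derivative 1 / 2 * ((deriv (vb t) y * vb t y + deriv (vb t) y * vb t y) + (deriv (wb t) y * wb t y + deriv (wb t) y * wb t y))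
     - a / (\<gamma> - 1) * (\<gamma> * ((\<gamma> - 1) * Y t y * q1 t y) - 0) - 0) (at y)"
    unfolding xi_def[abs_def] by (intro DERIV_diff DERIV_cmult DERIV_add DERIV_mult DERIV_const v_facts(3) w_facts(3) y_derivs(4) t)
  show "(xi e1 t has_real_derivative xiy t y) (at y)"
    by (rule DERIV_cong[OF B]) (use g[of "Y t y * q1 t y"] \<gamma> in \<open>simp add: xiy_def mult_ac\<close>)
qed

lemma slabs0:
  "periodic_slab0 T vb" "periodic_slab0 T wb" "periodic_slab0 T rb" "periodic_slab0 T (xi e1)" "periodic_slab0 T pr"
proof -
  show *: "periodic_slab0 T vb" "periodic_slab0 T wb" "periodic_slab0 T rb" by (rule v_facts(1), rule w_facts(1), rule r_facts(1))
  have Y0: "periodic_slab0 T Y" unfolding Y_def[abs_def] by (rule periodic_slab0_powr[OF *(3)]) (rule rb_pos)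
  show "periodic_slab0 T (xi e1)" "periodic_slab0 T pr"
    unfolding xi_def[abs_def] pr_def[abs_def] by (intro periodic_slab0_ops * Y0)+
qed

section \<open>Uniform bounds and the constant of the balance\<close>

lemma bounds: "\<exists>L. \<forall>t\<in>{0<..<T}. \<forall>y\<in>{0<..<1}. \<bar>Uy t y\<bar> \<le> L \<and> \<bar>q1 t y\<bar> \<le> L \<and> \<bar>q2 t y\<bar> \<le> L"
proof -
  let ?A = "{0<..<T} \<times> {0<..<1::real}"
  have op: "open ?A" by (intro open_Times) auto
  have b: "\<exists>C. \<forall>t\<in>{0<..<T}. \<forall>y\<in>{0<..<1}. \<bar>f t y\<bar> \<le> C"
    if L: "Linfty_on ?A (\<lambda>(t, y). g t y)" and eq: "\<And>t y. t \<in> {0<..<T} \<Longrightarrow> g t y = f t y" and sl: "periodic_slab T f" for f g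
  proof -
    obtain C where C: "AE z in lborel. z \<in> ?A \<longrightarrow> \<bar>(\<lambda>(t, y). g t y) z\<bar> \<le> C" using L by (auto simp: Linfty_on_def)
    have "AE z in lborel. z \<in> ?A \<longrightarrow> \<bar>(\<lambda>(t, y). f t y) z\<bar> \<le> C"
      using C by eventually_elim (auto simp: eq)
    moreover have "continuous_on ?A (\<lambda>(t, y). f t y)" using sl by (auto simp: periodic_slab_def elim!: continuous_on_subset)
    ultimately have "\<bar>(\<lambda>(t, y). f t y) z\<bar> \<le> C" if "z \<in> ?A" for z
      using AE_bound_imp_bound[OF op] that by blast
    then show ?thesis by (intro exI[of _ C]) force
  qed
  have e1: "deriv (velocity_1d \<kappa> vb wb t) y = Uy t y" if "t \<in> {0<..<T}" for t y
  proof -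
    have "velocity_1d \<kappa> vb wb t = U t" by (intro ext U_eq)
    then show ?thesis using DERIV_imp_deriv[OF y_derivs(1)[OF that]] by simp
  qed
  have e3: "deriv (deriv (\<lambda>z. ln (rb t z))) y = q2 t y" if "t \<in> {0<..<T}" for t y
  proof -
    have "deriv (\<lambda>z. ln (rb t z)) = q1 t" using ln_deriv[OF that] by (intro ext)
    then show ?thesis using DERIV_imp_deriv[OF y_derivs(3)[OF that]] by simp
  qed
  obtain C1 C2 C3 where C: "\<forall>t\<in>{0<..<T}. \<forall>y\<in>{0<..<1}. \<bar>Uy t y\<bar> \<le> C1" "\<forall>t\<in>{0<..<T}. \<forall>y\<in>{0<..<1}. \<bar>q1 t y\<bar> \<le> C2"
    "\<forall>t\<in>{0<..<T}. \<forall>y\<in>{0<..<1}. \<bar>q2 t y\<bar> \<le> C3"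
    using b[OF reg_u e1 slabs(9)] b[OF reg_rho1 ln_deriv slabs(11)] b[OF reg_rho2 e3 slabs(12)] by blast
  show ?thesis
    using C by (intro exI[of _ "max C1 (max C2 C3)"]) (auto simp: le_max_iff_disj)
qed

text \<open>The rate of change is the difference of the flux at the two ends, which vanishes by
  periodicity; the value is positive because the density is.\<close>

lemma mass_constant: "\<exists>M>0. \<forall>t\<in>{0<..<T}. integral {0..1} (rb t) = M"
proof -
  have rt: "deriv (\<lambda>s. rb s y) t = - (rb t y * (U t y * q1 t y + Uy t y))" if "t \<in> {0<..<T}" for t y
    by (rule DERIV_imp_deriv[OF rb_t[OF that]])
  have D: "((\<lambda>t. integral (cbox 0 1) (rb t)) has_field_derivative 0) (at t within {0<..<T})" if t: "t \<in> {0<..<T}" for t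
  proof -
    have "((\<lambda>t. integral (cbox 0 1) (rb t)) has_field_derivative integral (cbox 0 1) (\<lambda>y. deriv (\<lambda>s. rb s y) t)) (at t within {0<..<T})"
    proof (rule leibniz_rule_field_derivative)
      show "((\<lambda>x. rb x y) has_field_derivative deriv (\<lambda>s. rb s y) x) (at x within {0<..<T})" if "x \<in> {0<..<T}" for x y
        using r_facts(2)[OF that] by (rule has_field_derivative_at_within)
      show "rb x integrable_on cbox 0 1" if "x \<in> {0<..<T}" for x
        using periodic_slab_slice(1)[OF slabs(3) that] by (auto intro: integrable_continuous_interval)
      show "continuous_on ({0<..<T} \<times> cbox 0 1) (\<lambda>(x, y). deriv (\<lambda>s. rb s y) x)"
        using r_facts(5) by (auto simp: periodic_slab_def elim!: continuous_on_subset)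
    qed (use t in auto)
    moreover have "((\<lambda>y. deriv (\<lambda>s. rb s y) t) has_integral - (rb t 1 * U t 1) - - (rb t 0 * U t 0)) {0..1}"
    proof (rule fundamental_theorem_of_calculus)
      fix y :: real
      have "((\<lambda>y. - (rb t y * U t y)) has_real_derivative deriv (\<lambda>s. rb s y) t) (at y)"
        by (rule DERIV_cong[OF DERIV_minus[OF DERIV_mult[OF rb_y[OF t] y_derivs(1)[OF t]]]]) (simp add: rt[OF t] algebra_simps)
      then show "((\<lambda>y. - (rb t y * U t y)) has_vector_derivative deriv (\<lambda>s. rb s y) t) (at y within {0..1})"
        by (simp add: has_field_derivative_at_within has_real_derivative_iff_has_vector_derivative[symmetric])
    qed simp
    moreover have "rb t 1 = rb t 0" "U t 1 = U t 0"
      using periodic_slab_slice(2)[OF slabs(3) t, of 0] periodic_slab_slice(2)[OF slabs(8) t, of 0] by auto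
    ultimately show ?thesis by (simp add: integral_unique)
  qed
  obtain M where M: "\<And>t. t \<in> {0<..<T} \<Longrightarrow> integral (cbox 0 1) (rb t) = M"
    using has_field_derivative_zero_constant[OF _ D] by fastforce
  have t: "T / 2 \<in> {0<..<T}" using T by auto
  have "integral {0..1} (rb (T / 2)) \<noteq> 0"
  proof
    assume "integral {0..1} (rb (T / 2)) = 0"
    then have "rb (T / 2) 0 = 0"
      using integral_eq_0_iff[OF periodic_slab_slice(1)[OF slabs(3) t], of 0 1] rb_pos[of "T / 2"] T by (auto simp: less_imp_le)
    then show False using rb_pos[of "T / 2" 0] T by simp
  qed
  moreover have "integral {0..1} (rb (T / 2)) \<ge> 0"
    by (intro Henstock_Kurzweil_Integration.integral_nonneg integrable_continuous_interval periodic_slab_slice(1)[OF slabs(3) t])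
       (use rb_pos[of "T / 2"] T in \<open>auto simp: less_imp_le\<close>)
  ultimately have "M > 0" using M[OF t] by simp
  then show ?thesis using M by (intro exI[of _ M]) auto
qed

text \<open>The bound on the derivative of ln rb compares the density at any two points up to the
  factor exp L, as in a Harnack inequality. Integrating over one of the points and using the
  constant mass gives both bounds, uniformly in time.\<close>

lemma density_bounds: "\<exists>c1 c2. 0 < c1 \<and> c1 \<le> c2 \<and> (\<forall>t\<in>{0<..<T}. \<forall>y\<in>{0<..<1}. c1 \<le> rb t y \<and> rb t y \<le> c2)"
proof -
  obtain L where L: "\<And>t y. t \<in> {0<..<T} \<Longrightarrow> y \<in> {0<..<1} \<Longrightarrow> \<bar>q1 t y\<bar> \<le> L" using bounds by blast
  obtain M where M: "M > 0" "\<And>t. t \<in> {0<..<T} \<Longrightarrow> integral {0..1} (rb t) = M" using mass_constant by blast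
  have L0: "L \<ge> 0" using L[of "T / 2" "1/2"] T by force
  have cmp: "rb t y \<le> exp L * rb t y'" if t: "t \<in> {0<..<T}" and y: "y \<in> {0<..<1}" "y' \<in> {0<..<1}" for t y y'
  proof -
    have D: "((\<lambda>y. ln (rb t y)) has_real_derivative q1 t x) (at x)" for x
    proof -
      have r: "rb t x > 0" using t rb_pos[of t x] by auto
      show ?thesis by (rule DERIV_cong[OF DERIV_chain2[OF DERIV_ln[OF r] rb_y[OF t]]]) (use r in simp)
    qed
    have "norm (ln (rb t y) - ln (rb t y')) \<le> L * norm (y - y')"
      by (rule field_differentiable_bound[of "{0<..<1}" _ "q1 t"]) (use D L t y in \<open>auto intro: has_field_derivative_at_within\<close>)
    also have "\<dots> \<le> L * 1" using L0 y by (intro mult_left_mono) auto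
    finally have "ln (rb t y) \<le> L + ln (rb t y')" by simp
    then have "exp (ln (rb t y)) \<le> exp (L + ln (rb t y'))" by simp
    then show ?thesis using rb_pos[of t y] rb_pos[of t y'] t by (simp add: exp_add)
  qed
  have "exp (- L) * M \<le> rb t y \<and> rb t y \<le> exp L * M" if t: "t \<in> {0<..<T}" and y: "y \<in> {0<..<1}" for t y
  proof -
    have i: "rb t integrable_on {0<..<1}"
      using integrable_continuous_interval[OF periodic_slab_slice(1)[OF slabs(3) t], of 0 1] integrable_on_open_interval_real by blast
    have i': "(\<lambda>y'. k * rb t y') integrable_on {0<..<1}" for k using integrable_cmul[OF i, of k] by simp
    have I: "integral {0<..<1} (rb t) = M" using M(2)[OF t] integral_open_interval_real[of 0 1 "rb t"] by simp
    have k: "((\<lambda>_::real. k) has_integral k) {0<..<1}" for k :: real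
      using has_integral_const_real[of k 0 1] by (simp add: has_integral_Icc_iff_Ioo)
    have "integral {0<..<1::real} (\<lambda>_. rb t y) \<le> integral {0<..<1} (\<lambda>y'. exp L * rb t y')"
    proof (rule Henstock_Kurzweil_Integration.integral_le)
      show "(\<lambda>_. rb t y) integrable_on {0<..<1::real}" using k by (rule has_integral_integrable)
    qed (use i' cmp[OF t y] in auto)
    then have "rb t y \<le> exp L * M" unfolding integral_unique[OF k] using I by simp
    moreover have "integral {0<..<1} (rb t) \<le> integral {0<..<1::real} (\<lambda>_. exp L * rb t y)"
    proof (rule Henstock_Kurzweil_Integration.integral_le)
      show "(\<lambda>_. exp L * rb t y) integrable_on {0<..<1::real}" using k by (rule has_integral_integrable)
    qed (use i cmp[OF t _ y] in auto)
    then have "M \<le> exp L * rb t y" unfolding integral_unique[OF k] using I by simp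
    ultimately show ?thesis by (simp add: exp_minus field_simps)
  qed
  moreover have "exp (- L) * M \<le> exp L * M" using M L0 by simp
  ultimately show ?thesis using M by (intro exI[of _ "exp (- L) * M"] exI[of _ "exp L * M"]) auto
qed

text \<open>The constants of the local balance are uniform because only \<open>Uy\<close>, \<open>q1\<close>, \<open>q2\<close> and the upper bound of
  the density enter; second derivatives of the velocity occur only in terms that integrate to zero.\<close>

definition balance_lhs :: "real \<Rightarrow> real \<Rightarrow> real \<Rightarrow> real \<Rightarrow> real \<Rightarrow> real \<Rightarrow> real" where
  "balance_lhs t y \<rho> J g3 h = - J * Vt t y - 2 * \<kappa> * \<mu> * (g3 * Vt t y + h * deriv (vb t) y) - 2 * s * \<mu> * (g3 * Wt t y + h * deriv (wb t) y)
     + (\<rho> * xit t y + J * xiy t y) + prt t y"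

text \<open>If g3 and h are the vertical derivatives of \<rho> and J, the brackets are the vertical
  derivatives of J Uy, \<rho> U Uy, pr U, a \<gamma> \<rho> Y q1 and pr q1.\<close>

definition balance_null :: "real \<Rightarrow> real \<Rightarrow> real \<Rightarrow> real \<Rightarrow> real \<Rightarrow> real \<Rightarrow> real" where
  "balance_null t y \<rho> J g3 h = 2 * (1 - \<kappa>) * \<mu> * ((J * Uyy t y + h * Uy t y) - (\<rho> * (Uy t y * Uy t y + Uyy t y * U t y) + g3 * (U t y * Uy t y)))
     + (a * \<gamma> * Y t y * rb t y * q1 t y * U t y + Uy t y * pr t y)
     + 2 * \<kappa> * \<mu> * (\<rho> * (a * \<gamma> * ((\<gamma> - 1) * Y t y * q1 t y * q1 t y + q2 t y * Y t y)) + g3 * (a * \<gamma> * (Y t y * q1 t y)))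
     - 2 * \<kappa> * \<mu> * (\<gamma> - 1) * (a * \<gamma> * Y t y * rb t y * q1 t y * q1 t y + q2 t y * pr t y)"

text \<open>Numbers stand in place of the values of a three-dimensional solution, so one constant
  serves all \<epsilon>.\<close>

definition balance_const :: "real \<Rightarrow> bool" where
  "balance_const C \<longleftrightarrow> C \<ge> 0 \<and> (\<forall>t\<in>{0<..<T}. \<forall>y\<in>{0<..<1}. \<forall>\<rho>>0. \<forall>u n G.
    balance_lhs t y \<rho> (\<rho> * u) (\<rho> * n) (\<rho> * G + u * (\<rho> * n))
      - (\<rho> * u\<^sup>2 - 2 * (\<mu> * \<rho> * G) + a * \<rho> powr \<gamma>) * deriv (vb t) y
      - (2 * \<kappa> * \<mu> * a * \<gamma> * \<rho> powr (\<gamma> - 1) * \<rho> * n\<^sup>2 + 2 * (1 - \<kappa>) * \<mu> * \<rho> * G\<^sup>2)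
      + balance_null t y \<rho> (\<rho> * u) (\<rho> * n) (\<rho> * G + u * (\<rho> * n))
    \<le> C * (\<rho> * ((2 * s * \<mu> * n - wb t y)\<^sup>2 + (u + 2 * \<kappa> * \<mu> * n - vb t y)\<^sup>2) / 2 + relpot a \<gamma> \<rho> (rb t y)))"

lemma balance_const_exists: "\<exists>C. balance_const C"
proof -
  obtain L where L: "\<And>t y. t \<in> {0<..<T} \<Longrightarrow> y \<in> {0<..<1} \<Longrightarrow> \<bar>Uy t y\<bar> \<le> L \<and> \<bar>q1 t y\<bar> \<le> L \<and> \<bar>q2 t y\<bar> \<le> L"
    using bounds by blast
  obtain c1 R where R: "0 < c1" "c1 \<le> R" "\<And>t y. t \<in> {0<..<T} \<Longrightarrow> y \<in> {0<..<1} \<Longrightarrow> c1 \<le> rb t y \<and> rb t y \<le> R"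
    using density_bounds by blast
  have "R > 0" using R by simp
  from balance_integrand_bound[OF \<gamma> a \<kappa> \<mu> this, of L, folded s_def]
  obtain C where C: "C \<ge> 0" "\<And>\<rho> r u U G Uy n q1 q2 V W Vy Wy v w prel X Y.
    \<rho> > 0 \<Longrightarrow> 0 < r \<Longrightarrow> r \<le> R \<Longrightarrow> \<bar>Uy\<bar> \<le> L \<Longrightarrow> \<bar>q1\<bar> \<le> L \<Longrightarrow> \<bar>q2\<bar> \<le> L \<Longrightarrow>
    V = U + 2 * \<kappa> * \<mu> * q1 \<Longrightarrow> W = 2 * s * \<mu> * q1 \<Longrightarrow> Vy = Uy + 2 * \<kappa> * \<mu> * q2 \<Longrightarrow> Wy = 2 * s * \<mu> * q2 \<Longrightarrow>
    v = u + 2 * \<kappa> * \<mu> * n \<Longrightarrow> w = 2 * s * \<mu> * n \<Longrightarrow> X = \<rho> powr (\<gamma> - 1) \<Longrightarrow> Y = r powr (\<gamma> - 1) \<Longrightarrow>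
    prel = a * (\<rho> * X - r * Y - \<gamma> * Y * (\<rho> - r)) \<Longrightarrow>
    - \<rho> * (v - V) * (u - U) * Vy - \<rho> * (w - W) * (u - U) * Wy - 2 * (1 - \<kappa>) * \<mu> * \<rho> * (G - Uy)\<^sup>2
     + 2 * (1 - \<kappa>) * \<mu> * \<rho> * (u - U) * (n - q1) * Uy - prel * Uy - 2 * \<kappa> * \<mu> * prel * q2
     - 2 * \<kappa> * \<mu> * \<gamma> * (q1\<^sup>2 * prel + a * (2 * q1 * (n - q1) * \<rho> * (X - Y) + \<rho> * X * (n - q1)\<^sup>2))
    \<le> C * (\<rho> * ((w - W)\<^sup>2 + (v - V)\<^sup>2) / 2 + relpot a \<gamma> \<rho> r)"
    by blast
  show ?thesis
    unfolding balance_const_def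
  proof (intro exI[of _ C] conjI ballI allI impI)
    fix t y \<rho> u n G :: real assume t: "t \<in> {0<..<T}" and y: "y \<in> {0<..<1}" and \<rho>: "\<rho> > 0"
    define X where "X = \<rho> powr (\<gamma> - 1)"
    have \<rho>X: "\<rho> powr \<gamma> = \<rho> * X" using powr_mult_base[of \<rho> "\<gamma> - 1"] \<rho> by (simp add: X_def)
    define prel where "prel = a * (\<rho> * X - rb t y * Y t y - \<gamma> * Y t y * (\<rho> - rb t y))"
    note id = balance_integrand_identity[OF s(2) augmented_eqs(1)[of t y] augmented_eqs(2)[of t y] augmented_eqs(3)[of t y] augmented_eqs(4)[of t y]
        momentum_1d(2)[OF t, of y] momentum_1d(1)[OF t, of y] refl[of "u + 2 * \<kappa> * \<mu> * n"] refl[of "2 * s * \<mu> * n"] refl[of "\<rho> * G + u * (\<rho> * n)"]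
        prt_def[of t y] xit_def[of t y] xiy_def[of t y] prel_def]
    note bd = C(2)[OF \<rho> _ _ _ _ _ augmented_eqs(1)[of t y] augmented_eqs(2)[of t y] augmented_eqs(3)[of t y] augmented_eqs(4)[of t y]
        refl[of "u + 2 * \<kappa> * \<mu> * n"] refl[of "2 * s * \<mu> * n"] X_def Y_def[of t y] prel_def, of G]
    have "balance_lhs t y \<rho> (\<rho> * u) (\<rho> * n) (\<rho> * G + u * (\<rho> * n))
      - (\<rho> * u\<^sup>2 - 2 * (\<mu> * \<rho> * G) + a * \<rho> powr \<gamma>) * deriv (vb t) y
      - (2 * \<kappa> * \<mu> * a * \<gamma> * \<rho> powr (\<gamma> - 1) * \<rho> * n\<^sup>2 + 2 * (1 - \<kappa>) * \<mu> * \<rho> * G\<^sup>2)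
      + balance_null t y \<rho> (\<rho> * u) (\<rho> * n) (\<rho> * G + u * (\<rho> * n))
      = - (\<rho> * (u + 2 * \<kappa> * \<mu> * n) * Vt t y + (\<rho> * u * (u + 2 * \<kappa> * \<mu> * n) - 2 * (1 - \<kappa>) * \<mu> * \<rho> * G + a * \<rho> * X) * deriv (vb t) y)
     - (\<rho> * (2 * s * \<mu> * n) * Wt t y + (\<rho> * u * (2 * s * \<mu> * n) + 2 * s * \<mu> * \<rho> * G) * deriv (wb t) y) + \<rho> * xit t y + \<rho> * u * xiy t y + prt t y
     - (2 * \<kappa> * \<mu> * a * \<gamma> * X * \<rho> * n\<^sup>2 + 2 * (1 - \<kappa>) * \<mu> * \<rho> * G\<^sup>2)
     + (2 * (1 - \<kappa>) * \<mu> * ((\<rho> * u * Uyy t y + (\<rho> * G + u * (\<rho> * n)) * Uy t y) - (\<rho> * ((Uy t y)\<^sup>2 + U t y * Uyy t y) + \<rho> * n * (U t y * Uy t y)))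
     + (a * \<gamma> * Y t y * rb t y * q1 t y * U t y + a * rb t y * Y t y * Uy t y)
     + 2 * \<kappa> * \<mu> * (\<rho> * ((\<gamma> - 1) * a * \<gamma> * Y t y * (q1 t y)\<^sup>2 + a * \<gamma> * Y t y * q2 t y) + \<rho> * n * (a * \<gamma> * Y t y * q1 t y))
     - 2 * \<kappa> * \<mu> * (\<gamma> - 1) * (a * \<gamma> * Y t y * rb t y * (q1 t y)\<^sup>2 + a * rb t y * Y t y * q2 t y))"
      unfolding balance_lhs_def balance_null_def \<rho>X X_def[symmetric] pr_def power2_eq_square by (simp add: algebra_simps)
    also note id
    also note bd
    finally show "balance_lhs t y \<rho> (\<rho> * u) (\<rho> * n) (\<rho> * G + u * (\<rho> * n))
      - (\<rho> * u\<^sup>2 - 2 * (\<mu> * \<rho> * G) + a * \<rho> powr \<gamma>) * deriv (vb t) y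
      - (2 * \<kappa> * \<mu> * a * \<gamma> * \<rho> powr (\<gamma> - 1) * \<rho> * n\<^sup>2 + 2 * (1 - \<kappa>) * \<mu> * \<rho> * G\<^sup>2)
      + balance_null t y \<rho> (\<rho> * u) (\<rho> * n) (\<rho> * G + u * (\<rho> * n))
    \<le> C * (\<rho> * ((2 * s * \<mu> * n - wb t y)\<^sup>2 + (u + 2 * \<kappa> * \<mu> * n - vb t y)\<^sup>2) / 2 + relpot a \<gamma> \<rho> (rb t y))"
      using L[OF t y] R(3)[OF t y] R(1) by auto
  qed (rule C(1))
qed

end

section \<open>The relative entropy inequality\<close>

text \<open>The integral takes the default value 0 where integrability fails, so linear combinations
  are computed with integrability and value together.\<close>

definition set_int :: "'a measure \<Rightarrow> 'a set \<Rightarrow> ('a \<Rightarrow> real) \<Rightarrow> real \<Rightarrow> bool" where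
  "set_int M A f I \<longleftrightarrow> set_integrable M A f \<and> (LINT x:A|M. f x) = I"

lemma set_int_intros:
  "set_int M A f I \<Longrightarrow> set_int M A g K \<Longrightarrow> set_int M A (\<lambda>x. f x + g x) (I + K)"
  "set_int M A f I \<Longrightarrow> set_int M A g K \<Longrightarrow> set_int M A (\<lambda>x. f x - g x) (I - K)"
  "set_int M A f I \<Longrightarrow> set_int M A (\<lambda>x. r * f x) (r * I)"
  "set_int M A f I \<Longrightarrow> set_int M A (\<lambda>x. - f x) (- I)"
  by (auto simp: set_int_def set_integral_add set_integral_diff set_integral_uminus_real)
     (use set_integrable_mult_right[of "-1" M A f] in simp)

lemma set_int_base: "set_integrable M A f \<Longrightarrow> set_int M A f (LINT x:A|M. f x)"
  by (simp add: set_int_def)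

lemma set_integrable_bounded_linear:
  assumes "bounded_linear L" "set_integrable M A f" shows "set_integrable M A (\<lambda>x. L (f x))"
  using integrable_bounded_linear[OF assms(1) assms(2)[unfolded set_integrable_def]]
  by (simp add: set_integrable_def linear_simps[OF assms(1)])

lemma cyl_AE_slice:
  assumes "AE z in lborel. z \<in> cyl T \<epsilon> \<longrightarrow> P z"
  shows "AE t in lborel. t \<in> {0<..<T} \<longrightarrow> (AE x in lborel. x \<in> Omega \<epsilon> \<longrightarrow> P (t, x))"
proof -
  have "AE z in lborel \<Otimes>\<^sub>M lborel. z \<in> cyl T \<epsilon> \<longrightarrow> P z" using assms unfolding lborel_prod .
  from lborel_pair.AE_pair[OF this] show ?thesis by eventually_elim auto
qed

text \<open>The entropy estimate bounds the kinetic energy slice by slice at almost every time; this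
  turns such a bound into integrability on the cylinder.\<close>

lemma set_integrable_Tonelli:
  fixes f :: "real \<times> (real^3) \<Rightarrow> real"
  assumes m: "set_borel_measurable lborel (cyl T \<epsilon>) f" and nn: "AE z in lborel. z \<in> cyl T \<epsilon> \<longrightarrow> f z \<ge> 0"
    and b: "AE t in lborel. t \<in> {0<..<T} \<longrightarrow> set_integrable lborel (Omega \<epsilon>) (\<lambda>x. f (t, x)) \<and> (LINT x:Omega \<epsilon>|lborel. f (t, x)) \<le> K"
  shows "set_integrable lborel (cyl T \<epsilon>) f"
proof -
  define F where "F z = indicator (cyl T \<epsilon>) z *\<^sub>R f z" for z
  have Fm: "F \<in> borel_measurable (lborel \<Otimes>\<^sub>M lborel)"
    using m unfolding set_borel_measurable_def F_def[abs_def] lborel_prod .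
  have Fi: "F (t, x) = indicator {0<..<T} t * (indicator (Omega \<epsilon>) x * f (t, x))" for t x
    by (auto simp: F_def indicator_def)
  have "(\<integral>\<^sup>+z. ennreal (norm (F z)) \<partial>(lborel \<Otimes>\<^sub>M lborel)) = (\<integral>\<^sup>+t. \<integral>\<^sup>+x. ennreal (norm (F (t, x))) \<partial>lborel \<partial>lborel)"
    using Fm by (subst lborel.nn_integral_fst[symmetric]) auto
  also have "\<dots> \<le> (\<integral>\<^sup>+t. ennreal \<bar>K\<bar> * indicator {0<..<T} t \<partial>lborel)"
  proof (rule nn_integral_mono_AE)
    show "AE t in lborel. (\<integral>\<^sup>+x. ennreal (norm (F (t, x))) \<partial>lborel) \<le> ennreal \<bar>K\<bar> * indicator {0<..<T} t"
      using b cyl_AE_slice[OF nn]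
    proof eventually_elim
      case (elim t)
      show ?case
      proof (cases "t \<in> {0<..<T}")
        case True
        then have i: "set_integrable lborel (Omega \<epsilon>) (\<lambda>x. f (t, x))" and l: "(LINT x:Omega \<epsilon>|lborel. f (t, x)) \<le> K"
          and p: "AE x in lborel. x \<in> Omega \<epsilon> \<longrightarrow> f (t, x) \<ge> 0" using elim by auto
        have "(\<integral>\<^sup>+x. ennreal (norm (F (t, x))) \<partial>lborel) = (\<integral>\<^sup>+x. ennreal (indicator (Omega \<epsilon>) x *\<^sub>R f (t, x)) \<partial>lborel)"
          by (rule nn_integral_cong_AE) (use p in \<open>eventually_elim, use True in \<open>auto simp: Fi indicator_def\<close>\<close>)
        also have "\<dots> = ennreal (LINT x:Omega \<epsilon>|lborel. f (t, x))"
          unfolding set_lebesgue_integral_def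
        proof (rule nn_integral_eq_integral)
          show "AE x in lborel. 0 \<le> indicator (Omega \<epsilon>) x *\<^sub>R f (t, x)" using p by eventually_elim (auto simp: indicator_def)
        qed (use i in \<open>simp add: set_integrable_def\<close>)
        also have "\<dots> \<le> ennreal \<bar>K\<bar>" using l by (intro ennreal_leI) linarith
        finally show ?thesis using True by simp
      qed (auto simp: Fi)
    qed
  qed
  also have "\<dots> < \<infinity>"
    by (cases "0 \<le> T") (auto simp: nn_integral_cmult ennreal_mult_less_top)
  finally have "integrable (lborel \<Otimes>\<^sub>M lborel) F"
    using Fm by (intro integrableI_bounded) auto
  then show ?thesis unfolding set_integrable_def F_def[abs_def] lborel_prod .
qed

section \<open>Weak equations and energy of one three-dimensional solution\<close>

locale solution_pair = one_dim_solution +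
  fixes \<epsilon> :: real and e :: "real \<Rightarrow> real" and rho :: "real \<times> (real^3) \<Rightarrow> real" and u g :: "real \<times> (real^3) \<Rightarrow> real^3"
    and G :: "real \<times> (real^3) \<Rightarrow> real^3^3" and rho0 :: "real^3 \<Rightarrow> real" and u0 g0 :: "real^3 \<Rightarrow> real^3"
  assumes \<epsilon>: "\<epsilon> > 0" and e: "\<And>r. r > 0 \<Longrightarrow> (e has_real_derivative pressure a \<gamma> r / r\<^sup>2) (at r)"
    and ent: "entropy_solution T \<epsilon> \<kappa> (\<lambda>r. \<mu> * r) (\<lambda>r. 0) (\<lambda>r. \<mu> * ln r) (pressure a \<gamma>) e rho u g G rho0 u0 g0"
begin

text \<open>The product \<rho> u3, rather than u3 itself, has a weak gradient; \<open>h\<close>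
  below is its vertical derivative and \<open>kJ\<close> its vertical flux.\<close>

definition J where "J z = rho z * u z $ 3"
definition g3 where "g3 z = g z $ 3"
definition h where "h z = rho z * G z $ 3 $ 3 + u z $ 3 * g z $ 3"
definition kJ where "kJ z = rho z * (u z $ 3)\<^sup>2 - 2 * (\<mu> * rho z * G z $ 3 $ 3) + pressure a \<gamma> (rho z)"

lemma pos: "AE z in lborel. z \<in> cyl T \<epsilon> \<longrightarrow> rho z > 0" "AE x in lborel. x \<in> Omega \<epsilon> \<longrightarrow> rho0 x > 0"
  using ent by (auto simp: entropy_solution_def)

lemma gradient_facts:
  "set_integrable lborel (cyl T \<epsilon>) rho" "set_integrable lborel (cyl T \<epsilon>) (\<lambda>z. g z $ j)"
  "set_integrable lborel (cyl T \<epsilon>) (\<lambda>z. rho z * u z $ i)" "set_integrable lborel (cyl T \<epsilon>) (momentum_gradient_entry rho u g G i j)"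
  "set_integrable lborel (Omega \<epsilon>) rho0" "set_integrable lborel (Omega \<epsilon>) (\<lambda>x. g0 x $ j)"
  using ent unfolding entropy_solution_def gradients_def initial_gradient_def weak_deriv_def by blast+

lemma integrable_facts:
  "set_integrable lborel (cyl T \<epsilon>) (\<lambda>z. rho z * (norm (u z))\<^sup>2)"
  "set_integrable lborel (cyl T \<epsilon>) (\<lambda>z. (\<mu> * rho z) *\<^sub>R sym_part (G z))"
  "set_integrable lborel (cyl T \<epsilon>) (\<lambda>z. pressure a \<gamma> (rho z))"
  "set_integrable lborel (Omega \<epsilon>) (\<lambda>x. rho0 x *\<^sub>R u0 x)"
  using ent by (auto simp: entropy_solution_def)

lemma measurable_facts:
  "set_borel_measurable lborel (cyl T \<epsilon>) rho" "set_borel_measurable lborel (cyl T \<epsilon>) u" "set_borel_measurable lborel (cyl T \<epsilon>) (\<lambda>z. g z $ j)"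
  using ent gradient_facts(2)[of j] by (auto simp: entropy_solution_def set_integrable_def set_borel_measurable_def intro: borel_measurable_integrable)

lemma component_measurable: "set_borel_measurable lborel (cyl T \<epsilon>) (\<lambda>z. u z $ j)"
proof -
  have "(\<lambda>z. (indicator (cyl T \<epsilon>) z *\<^sub>R u z) $ j) \<in> borel_measurable lborel"
    using measurable_compose[OF measurable_facts(2)[unfolded set_borel_measurable_def] borel_measurable_continuous_onI[OF continuous_on_component[OF continuous_on_id]]]
    by simp
  then show ?thesis by (simp add: set_borel_measurable_def)
qed

lemma u3_integrable: "set_integrable lborel (cyl T \<epsilon>) (\<lambda>z. rho z * (u z $ 3)\<^sup>2)"
proof (rule set_integrable_bound[OF integrable_facts(1)])
  have "(\<lambda>z. (indicator (cyl T \<epsilon>) z *\<^sub>R rho z) * (indicator (cyl T \<epsilon>) z *\<^sub>R u z $ 3)\<^sup>2) \<in> borel_measurable lborel"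
    using measurable_facts(1) component_measurable[of 3] unfolding set_borel_measurable_def by measurable
  moreover have "(\<lambda>z. (indicator (cyl T \<epsilon>) z *\<^sub>R rho z) * (indicator (cyl T \<epsilon>) z *\<^sub>R u z $ 3)\<^sup>2) = (\<lambda>z. indicator (cyl T \<epsilon>) z *\<^sub>R (rho z * (u z $ 3)\<^sup>2))"
    by (auto simp: indicator_def)
  ultimately show "set_borel_measurable lborel (cyl T \<epsilon>) (\<lambda>z. rho z * (u z $ 3)\<^sup>2)" by (simp add: set_borel_measurable_def)
  have "(u z $ 3)\<^sup>2 \<le> (norm (u z))\<^sup>2" for z
    using power_mono[OF component_le_norm_cart[of "u z" 3], of 2] by simp
  then show "AE z in lborel. z \<in> cyl T \<epsilon> \<longrightarrow> norm (rho z * (u z $ 3)\<^sup>2) \<le> norm (rho z * (norm (u z))\<^sup>2)"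
    by (intro AE_I2) (auto simp: abs_mult intro!: mult_left_mono)
qed

lemma stress_integrable: "set_integrable lborel (cyl T \<epsilon>) (\<lambda>z. \<mu> * rho z * G z $ 3 $ 3)"
proof -
  have "bounded_linear (\<lambda>A::real^3^3. A $ 3 $ 3)"
    using bounded_linear_compose[OF bounded_linear_vec_nth bounded_linear_vec_nth] .
  from set_integrable_bounded_linear[OF this integrable_facts(2)]
  show ?thesis by (simp add: sym_part_def transpose_def mult.assoc)
qed

lemma J_evolves: "evolves T \<epsilon> J (\<lambda>x. rho0 x * u0 x $ 3) kJ"
proof -
  have "set_integrable lborel (Omega \<epsilon>) (\<lambda>x. rho0 x * u0 x $ 3)"
    using set_integrable_bounded_linear[OF bounded_linear_vec_nth[of 3] integrable_facts(4)] by simp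
  moreover have "momentum_identity T \<epsilon> (\<lambda>r. \<mu> * r) (\<lambda>r. 0) (pressure a \<gamma>) rho u G rho0 u0 \<phi>" if "\<phi> \<in> slip_tests T \<epsilon>" for \<phi>
    using ent that unfolding entropy_solution_def boundary_conditions_def by blast
  ultimately show ?thesis
    unfolding J_def[abs_def] kJ_def[abs_def]
    by (intro momentum_evolves T gradient_facts(3) u3_integrable stress_integrable integrable_facts(3))
qed

lemma rho_evolves: "evolves T \<epsilon> rho rho0 J"
  unfolding J_def[abs_def]
proof (rule mass_evolves[OF T \<epsilon>])
  show "continuity_identity T \<epsilon> rho u rho0 \<xi>" if "\<xi> \<in> Cc_infty ({..<T} \<times> Omega \<epsilon>)" for \<xi>
    using ent that unfolding entropy_solution_def by blast
  show "weak_deriv (Cc_infty (cyl T \<epsilon>)) (cyl T \<epsilon>) (dir j) (\<lambda>z. rho z * u z $ j) (momentum_gradient_entry rho u g G j j)" for j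
    using ent unfolding entropy_solution_def gradients_def by blast
  show "weak_deriv (per_tests T) (cyl T \<epsilon>) (dir j) (\<lambda>z. rho z * u z $ j) (momentum_gradient_entry rho u g G j j)" for j
  proof (cases "j = 3")
    case True
    then show ?thesis using ent unfolding entropy_solution_def boundary_conditions_def by blast
  next
    case False
    then have "j \<in> {1, 2}" using exhaust_3[of j] by auto
    then show ?thesis using ent unfolding entropy_solution_def boundary_conditions_def by blast
  qed
qed (rule gradient_facts)+

lemma rho_vertical_deriv: "vertical_deriv T \<epsilon> rho g3"
proof -
  have "weak_deriv (per_tests T) (cyl T \<epsilon>) (dir 3) rho (\<lambda>z. g z $ 3)"
    using ent unfolding entropy_solution_def boundary_conditions_def by blast
  then show ?thesis unfolding g3_def[abs_def] by (rule weak_deriv_vertical_deriv)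
qed

lemma J_vertical_deriv: "vertical_deriv T \<epsilon> J h"
proof -
  have "weak_deriv (per_tests T) (cyl T \<epsilon>) (dir 3) (\<lambda>z. rho z * u z $ 3) (momentum_gradient_entry rho u g G 3 3)"
    using ent unfolding entropy_solution_def boundary_conditions_def by blast
  moreover have "h = momentum_gradient_entry rho u g G 3 3" by (simp add: fun_eq_iff h_def momentum_gradient_entry_def)
  ultimately show ?thesis unfolding J_def[abs_def] by (simp add: weak_deriv_vertical_deriv)
qed

lemma g3_evolves: "evolves T \<epsilon> g3 (\<lambda>x. g0 x $ 3) h"
proof (rule density_gradient_evolves[OF rho_evolves rho_vertical_deriv J_vertical_deriv])
  show "weak_deriv per_space_tests (Omega \<epsilon>) (axis 3 1) rho0 (\<lambda>x. g0 x $ 3)"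
    using ent unfolding entropy_solution_def initial_gradient_def by blast
qed

definition vel :: "real \<Rightarrow> real^3 \<Rightarrow> real^3 \<Rightarrow> real^3" where
  "vel r x y = x + (2 * \<kappa> * \<mu>) *\<^sub>R ((1 / r) *\<^sub>R y)"
definition drift :: "real \<Rightarrow> real^3 \<Rightarrow> real^3" where
  "drift r y = (2 * s * \<mu>) *\<^sub>R ((1 / r) *\<^sub>R y)"
definition kin :: "real \<Rightarrow> real^3 \<Rightarrow> real^3 \<Rightarrow> real" where
  "kin r x y = r * ((norm (vel r x y))\<^sup>2 + (norm (drift r y))\<^sup>2) / 2"

lemma kinetic_density_eq: "r > 0 \<Longrightarrow> kinetic_density \<kappa> (\<lambda>r. \<mu> * ln r) r x y = kin r x y"
proof -
  assume r: "r > 0"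
  have "deriv (\<lambda>r. \<mu> * ln r) r = \<mu> / r"
    by (rule DERIV_imp_deriv) (use r in \<open>auto intro!: derivative_eq_intros\<close>)
  then show ?thesis
    by (simp add: kinetic_density_def kin_def vel_def drift_def s_def mult_ac add_divide_distrib)
qed

text \<open>The law \<rho>^2 e' = p determines e only up to a constant, kept as e(1). In
  \<open>erel_expand\<close> it cancels against the one in \<open>xi\<close>.\<close>

lemma internal_energy: "r > 0 \<Longrightarrow> r * e r = a / (\<gamma> - 1) * (r powr \<gamma> - r) + e 1 * r"
proof -
  assume r: "r > 0"
  have "\<exists>k. \<forall>x\<in>{0<..}. e x - a / (\<gamma> - 1) * x powr (\<gamma> - 1) = k"
  proof (rule has_field_derivative_zero_constant)
    fix x :: real assume "x \<in> {0<..}"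
    then have x: "x > 0" by simp
    have q: "a / (\<gamma> - 1) * ((\<gamma> - 1) * x powr (\<gamma> - 1 - 1)) = pressure a \<gamma> x / x\<^sup>2"
    proof -
      have "x powr (\<gamma> - 1 - 1) = x powr \<gamma> / x\<^sup>2"
        using x powr_diff[of x \<gamma> 2] by (simp add: powr_numeral)
      then show ?thesis using \<gamma> by (simp add: pressure_def)
    qed
    have "((\<lambda>x. e x - a / (\<gamma> - 1) * x powr (\<gamma> - 1)) has_real_derivative pressure a \<gamma> x / x\<^sup>2 - a / (\<gamma> - 1) * ((\<gamma> - 1) * x powr (\<gamma> - 1 - 1))) (at x)"
      by (intro DERIV_diff DERIV_cmult e has_real_derivative_powr x)
    then show "((\<lambda>x. e x - a / (\<gamma> - 1) * x powr (\<gamma> - 1)) has_field_derivative 0) (at x within {0<..})"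
      unfolding q by (simp add: has_field_derivative_at_within)
  qed (auto simp: convex_real_interval)
  then have "e r - a / (\<gamma> - 1) * r powr (\<gamma> - 1) = e 1 - a / (\<gamma> - 1) * 1 powr (\<gamma> - 1)"
    using r by (metis greaterThan_iff zero_less_one)
  then have E: "e r = a / (\<gamma> - 1) * (r powr (\<gamma> - 1) - 1) + e 1" by (simp add: right_diff_distrib)
  have P: "r powr \<gamma> = r * r powr (\<gamma> - 1)" using powr_mult_base[of r "\<gamma> - 1"] r by simp
  show ?thesis unfolding E P by (simp add: algebra_simps)
qed

text \<open>For a viscosity proportional to the density the divergence term vanishes. Of the other
  terms, all nonnegative, the vertical entries are kept, as the balance sees no others; a diagonal
  entry of A equals that of its symmetric part.\<close>

lemma dissipation_lower:
  assumes r: "r > 0"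
  shows "dissipation_density \<kappa> (\<lambda>r. \<mu> * r) (pressure a \<gamma>) r y A \<ge>
     2 * \<kappa> * \<mu> * a * \<gamma> * r powr (\<gamma> - 1) * r * (y $ 3 / r)\<^sup>2 + 2 * (1 - \<kappa>) * \<mu> * r * (A $ 3 $ 3)\<^sup>2"
    and "dissipation_density \<kappa> (\<lambda>r. \<mu> * r) (pressure a \<gamma>) r y A \<ge> 0"
proof -
  have d1: "deriv (\<lambda>r. \<mu> * r) r = \<mu>" by (rule DERIV_imp_deriv) (auto intro!: derivative_eq_intros)
  have d2: "deriv (pressure a \<gamma>) r = a * (\<gamma> * r powr (\<gamma> - 1))"
    unfolding pressure_def[abs_def] by (rule DERIV_imp_deriv) (intro DERIV_cmult has_real_derivative_powr r)
  have n1: "(y $ 3)\<^sup>2 \<le> (norm y)\<^sup>2" using power_mono[OF component_le_norm_cart[of y 3], of 2] by simp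
  have "\<bar>A $ 3 $ 3\<bar> = \<bar>sym_part A $ 3 $ 3\<bar>" by (simp add: sym_part_def transpose_def)
  also have "\<dots> \<le> norm (sym_part A $ 3)" by (rule component_le_norm_cart)
  also have "\<dots> \<le> norm (sym_part A)" by (rule Finite_Cartesian_Product.norm_nth_le)
  finally have n2: "(A $ 3 $ 3)\<^sup>2 \<le> (norm (sym_part A))\<^sup>2" using power_mono[of "\<bar>A $ 3 $ 3\<bar>" "norm (sym_part A)" 2] by simp
  have "2 * \<kappa> * \<mu> * a * \<gamma> * r powr (\<gamma> - 1) * r * (y $ 3 / r)\<^sup>2 = 2 * \<kappa> * (\<mu> * (a * (\<gamma> * r powr (\<gamma> - 1))) / r * (y $ 3)\<^sup>2)"
    using r by (simp add: power_divide power2_eq_square)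
  also have "\<dots> \<le> 2 * \<kappa> * (\<mu> * (a * (\<gamma> * r powr (\<gamma> - 1))) / r * (norm y)\<^sup>2)"
    using n1 r \<mu> a \<gamma> \<kappa> by (intro mult_left_mono) auto
  finally have 1: "2 * \<kappa> * \<mu> * a * \<gamma> * r powr (\<gamma> - 1) * r * (y $ 3 / r)\<^sup>2 \<le> 2 * \<kappa> * (\<mu> * (a * (\<gamma> * r powr (\<gamma> - 1))) / r * (norm y)\<^sup>2)" .
  have "2 * (1 - \<kappa>) * (\<mu> * r * (A $ 3 $ 3)\<^sup>2) \<le> 2 * (1 - \<kappa>) * (\<mu> * r * (norm (sym_part A))\<^sup>2)"
    using n2 r \<mu> \<kappa> by (intro mult_left_mono) auto
  then have 2: "2 * (1 - \<kappa>) * \<mu> * r * (A $ 3 $ 3)\<^sup>2 \<le> 2 * (1 - \<kappa>) * (\<mu> * r * (norm (sym_part A))\<^sup>2)" by (simp add: mult_ac)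
  have 3: "0 \<le> 2 * \<kappa> * (\<mu> * r * (norm (skew_part A))\<^sup>2)" using r \<mu> \<kappa> by simp
  have eq: "dissipation_density \<kappa> (\<lambda>r. \<mu> * r) (pressure a \<gamma>) r y A = 2 * \<kappa> * (\<mu> * r * (norm (skew_part A))\<^sup>2)
     + 2 * \<kappa> * (\<mu> * (a * (\<gamma> * r powr (\<gamma> - 1))) / r * (norm y)\<^sup>2) + 2 * (1 - \<kappa>) * (\<mu> * r * (norm (sym_part A))\<^sup>2)"
    unfolding dissipation_density_def d1 d2 by simp
  show "dissipation_density \<kappa> (\<lambda>r. \<mu> * r) (pressure a \<gamma>) r y A \<ge>
     2 * \<kappa> * \<mu> * a * \<gamma> * r powr (\<gamma> - 1) * r * (y $ 3 / r)\<^sup>2 + 2 * (1 - \<kappa>) * \<mu> * r * (A $ 3 $ 3)\<^sup>2"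
    unfolding eq using 1 2 3 by linarith
  moreover have "0 \<le> 2 * \<kappa> * \<mu> * a * \<gamma> * r powr (\<gamma> - 1) * r * (y $ 3 / r)\<^sup>2 + 2 * (1 - \<kappa>) * \<mu> * r * (A $ 3 $ 3)\<^sup>2"
    using r \<mu> a \<gamma> \<kappa> by simp
  ultimately show "dissipation_density \<kappa> (\<lambda>r. \<mu> * r) (pressure a \<gamma>) r y A \<ge> 0" by linarith
qed

text \<open>In \<open>kin\<close> and \<open>erel\<close>, the last three arguments are the density, the velocity and the density gradient.\<close>

definition erel :: "real \<Rightarrow> real \<Rightarrow> real \<Rightarrow> real^3 \<Rightarrow> real^3 \<Rightarrow> real" where
  "erel t yy r x y = r * ((norm (drift r y - vertical (wb t yy)))\<^sup>2 + (norm (vel r x y - vertical (vb t yy)))\<^sup>2) / 2 + relpot a \<gamma> r (rb t yy)"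

lemma norm_diff_vertical: "(norm (x - vertical r))\<^sup>2 = (norm x)\<^sup>2 - 2 * (x $ 3) * r + r\<^sup>2"
proof -
  have "(norm (x - vertical r))\<^sup>2 = (norm x)\<^sup>2 - 2 * (x \<bullet> vertical r) + (norm (vertical r))\<^sup>2"
    by (simp add: power2_norm_eq_inner inner_diff_left inner_diff_right inner_commute)
  moreover have "x \<bullet> vertical r = x $ 3 * r" "(norm (vertical r))\<^sup>2 = r\<^sup>2"
    by (simp_all add: vertical_def inner_axis)
  ultimately show ?thesis by simp
qed

lemma norm_diff_vertical_ge: "(x $ 3 - r)\<^sup>2 \<le> (norm (x - vertical r))\<^sup>2"
  using power_mono[OF component_le_norm_cart[of "x - vertical r" 3], of 2] by (simp add: vertical_def axis_def)

text \<open>The mixed terms of the squares are linear in the unknowns. The Bregman part contributes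
  P(\<rho>), the linear term - \<rho> P'(rb) and the pressure p(rb); passing from P(\<rho>) to
  \<rho> e(\<rho>) adds e(1) \<rho>, which \<open>xi\<close> subtracts again.\<close>

lemma erel_expand:
  assumes r: "r > 0" and t: "t \<in> {0..<T}"
  shows "erel t yy r x y = kin r x y + r * e r
     - (r * x $ 3) * vb t yy - 2 * \<kappa> * \<mu> * (y $ 3 * vb t yy) - 2 * s * \<mu> * (y $ 3 * wb t yy) + r * xi (e 1) t yy + pr t yy"
proof -
  have rb: "rb t yy > 0" by (rule rb_pos[OF t])
  have rb\<gamma>: "rb t yy powr \<gamma> = rb t yy * Y t yy" using powr_mult_base[of "rb t yy" "\<gamma> - 1"] rb by (simp add: Y_def)
  have k: "r * ((norm (drift r y - vertical (wb t yy)))\<^sup>2 + (norm (vel r x y - vertical (vb t yy)))\<^sup>2) / 2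
    = kin r x y - (r * x $ 3) * vb t yy - 2 * \<kappa> * \<mu> * (y $ 3 * vb t yy) - 2 * s * \<mu> * (y $ 3 * wb t yy) + r * (1/2 * (vb t yy * vb t yy + wb t yy * wb t yy))"
    unfolding norm_diff_vertical kin_def using r by (simp add: vel_def drift_def power2_eq_square field_simps)
  have p: "relpot a \<gamma> r (rb t yy) = r * e r + r * (- (a / (\<gamma> - 1) * (\<gamma> * Y t yy - 1)) - e 1) + pr t yy"
  proof -
    have "relpot a \<gamma> r (rb t yy) = a / (\<gamma> - 1) * (r powr \<gamma> - r) + r * (- (a / (\<gamma> - 1) * (\<gamma> * Y t yy - 1))) + a / (\<gamma> - 1) * ((\<gamma> - 1) * (rb t yy * Y t yy))"
      unfolding relpot_def rb\<gamma> Y_def[symmetric] by (simp add: algebra_simps diff_divide_distrib add_divide_distrib)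
    also have "a / (\<gamma> - 1) * ((\<gamma> - 1) * (rb t yy * Y t yy)) = pr t yy" using \<gamma> by (simp add: pr_def)
    finally show ?thesis unfolding internal_energy[OF r] by (simp add: algebra_simps)
  qed
  show ?thesis unfolding erel_def k p xi_def by (simp add: algebra_simps)
qed

lemma erel_nonneg: "r > 0 \<Longrightarrow> t \<in> {0..<T} \<Longrightarrow> erel t yy r x y \<ge> 0"
  unfolding erel_def using relpot_nonneg[OF a \<gamma> _ rb_pos] by (simp add: add_nonneg_nonneg)

end

lemma slice_measurable:
  fixes f :: "real \<times> (real^3) \<Rightarrow> 'b::{real_normed_vector, second_countable_topology}"
  assumes m: "set_borel_measurable lborel (cyl T \<epsilon>) f" and t: "t \<in> {0<..<T}"
  shows "set_borel_measurable lborel (Omega \<epsilon>) (\<lambda>x. f (t, x))"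
proof -
  have p: "(\<lambda>x. (t, x)) \<in> borel \<rightarrow>\<^sub>M (borel :: (real \<times> (real^3)) measure)"
    by (intro borel_measurable_continuous_onI continuous_intros)
  have "(\<lambda>x. indicator (cyl T \<epsilon>) (t, x) *\<^sub>R f (t, x)) \<in> borel_measurable borel"
    using measurable_compose[OF p, of "\<lambda>z. indicator (cyl T \<epsilon>) z *\<^sub>R f z" borel] m by (simp add: set_borel_measurable_def)
  moreover have "indicator (cyl T \<epsilon>) (t, x) *\<^sub>R f (t, x) = indicator (Omega \<epsilon>) x *\<^sub>R f (t, x)" for x
    using t by (simp add: indicator_def)
  ultimately show ?thesis by (simp add: set_borel_measurable_def)
qed

lemma set_integrable_AE_cong:
  fixes f g :: "'a \<Rightarrow> real"
  assumes "set_integrable M A f" "set_borel_measurable M A g" "AE x in M. x \<in> A \<longrightarrow> f x = g x"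
  shows "set_integrable M A g" "(LINT x:A|M. f x) = (LINT x:A|M. g x)"
proof -
  have e: "AE x in M. indicator A x *\<^sub>R f x = indicator A x *\<^sub>R g x"
    using assms(3) by eventually_elim (auto simp: indicator_def)
  show i: "set_integrable M A g"
    using integrable_cong_AE_imp[OF assms(1)[unfolded set_integrable_def] assms(2)[unfolded set_borel_measurable_def] e]
    by (simp add: set_integrable_def)
  show "(LINT x:A|M. f x) = (LINT x:A|M. g x)" by (rule set_integral_cong_AE_integrable[OF assms(1) i assms(3)])
qed

lemma set_integral_mono_AE':
  fixes f g :: "'a \<Rightarrow> real"
  assumes "set_integrable M A f" "set_integrable M A g" "AE x in M. x \<in> A \<longrightarrow> f x \<le> g x"
  shows "(LINT x:A|M. f x) \<le> (LINT x:A|M. g x)"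
  unfolding set_lebesgue_integral_def
proof (rule integral_mono_AE)
  show "AE x in M. indicator A x *\<^sub>R f x \<le> indicator A x *\<^sub>R g x"
    using assms(3) by eventually_elim (auto simp: indicator_def)
qed (use assms in \<open>auto simp: set_integrable_def\<close>)

lemma set_integral_mono_set:
  fixes f :: "'a \<Rightarrow> real"
  assumes "set_integrable M B f" "set_integrable M A f" "A \<subseteq> B" "AE x in M. x \<in> B \<longrightarrow> 0 \<le> f x"
  shows "(LINT x:A|M. f x) \<le> (LINT x:B|M. f x)"
  unfolding set_lebesgue_integral_def
proof (rule integral_mono_AE)
  show "AE x in M. indicator A x *\<^sub>R f x \<le> indicator B x *\<^sub>R f x"
    using assms(4) by eventually_elim (use assms(3) in \<open>auto simp: indicator_def\<close>)
qed (use assms in \<open>auto simp: set_integrable_def\<close>)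

text \<open>Continuity up to t = 0 bounds \<phi> on all of [0, \<tau>], so integrability reaches
  down to the initial time, in contrast to \<open>set_integrable_mult_vfun\<close>.\<close>

lemma set_integrable_mult_vfun0:
  assumes f: "set_integrable lborel (cyl T \<epsilon>) f" and \<phi>: "periodic_slab0 T \<phi>" and \<tau>: "\<tau> < T"
  shows "set_integrable lborel (cyl \<tau> \<epsilon>) (\<lambda>z. f z * vfun \<phi> z)"
proof -
  have c: "continuous_on ({0..\<tau>} \<times> {0..1}) (\<lambda>(t, y). \<phi> t y)"
    using \<phi> \<tau> by (auto simp: periodic_slab0_def elim!: continuous_on_subset)
  have "bounded ((\<lambda>(t, y). \<phi> t y) ` ({0..\<tau>} \<times> {0..1}))"
    by (intro compact_imp_bounded compact_continuous_image c compact_Times) auto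
  then obtain B where B: "\<And>t y. t \<in> {0..\<tau>} \<Longrightarrow> y \<in> {0..1} \<Longrightarrow> \<bar>\<phi> t y\<bar> \<le> B" unfolding bounded_iff by force
  have "set_integrable lborel (cyl \<tau> \<epsilon>) f"
    using f by (rule set_integrable_subset) (use \<tau> in \<open>auto simp: cyl_borel\<close>)
  moreover have "cyl \<tau> \<epsilon> \<subseteq> {0<..<T} \<times> UNIV" using \<tau> by auto
  ultimately show ?thesis
    using B by (intro set_integrable_mult_continuous[where B = B] cyl_borel vfun_continuous[OF periodic_slab0_imp[OF \<phi>]]) (auto simp: Omega_def)
qed

section \<open>Energies at almost every time\<close>

context solution_pair
begin

text \<open>The relative energy density \<open>er\<close> splits into the energy \<open>ekin + ie\<close>, controlled by the entropy estimate, and a part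
  \<open>lin\<close> that is linear in the unknowns, so that its evolution is given by the weak equations.\<close>

definition ekin where "ekin z = kin (rho z) (u z) (g z)"
text \<open>The closed form of \<rho> e(\<rho>) at positive density: a combination of p(\<rho>) and
  \<rho>, both integrable on the cylinder.\<close>

definition ie where "ie z = 1 / (\<gamma> - 1) * pressure a \<gamma> (rho z) + (e 1 - a / (\<gamma> - 1)) * rho z"
definition lin where "lin z = - (J z * vfun vb z) - 2 * \<kappa> * \<mu> * (g3 z * vfun vb z) - 2 * s * \<mu> * (g3 z * vfun wb z)
  + rho z * vfun (xi (e 1)) z + vfun pr z"
definition er where "er z = ekin z + ie z + lin z"
definition diss where "diss z = dissipation_density \<kappa> (\<lambda>r. \<mu> * r) (pressure a \<gamma>) (rho z) (g z) (G z)"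
definition energy0 where "energy0 = (LINT x:Omega \<epsilon>|lborel. kin (rho0 x) (u0 x) (g0 x)) + (LINT x:Omega \<epsilon>|lborel. rho0 x * e (rho0 x))"

text \<open>All conditions that hold at almost every time, gathered once. The equation with density
  1 and flux 0 is included so that \<open>pr\<close> is treated like the other test
  functions.\<close>

definition good :: "real \<Rightarrow> bool" where
  "good \<tau> \<longleftrightarrow> \<tau> \<in> {0<..<T} \<and> \<tau> \<in> good_times T \<epsilon> J (\<lambda>x. rho0 x * u0 x $ 3) kJ \<and> \<tau> \<in> good_times T \<epsilon> g3 (\<lambda>x. g0 x $ 3) h
     \<and> \<tau> \<in> good_times T \<epsilon> rho rho0 J \<and> \<tau> \<in> good_times T \<epsilon> (\<lambda>_. 1) (\<lambda>_. 1) (\<lambda>_. 0)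
     \<and> (AE x in lborel. x \<in> Omega \<epsilon> \<longrightarrow> rho (\<tau>, x) > 0)
     \<and> set_integrable lborel (Omega \<epsilon>) (\<lambda>x. ekin (\<tau>, x)) \<and> set_integrable lborel (Omega \<epsilon>) (\<lambda>x. ie (\<tau>, x))
     \<and> (LINT x:Omega \<epsilon>|lborel. ekin (\<tau>, x)) + (LINT x:Omega \<epsilon>|lborel. ie (\<tau>, x)) + (LINT z:cyl \<tau> \<epsilon>|lborel. diss z) \<le> energy0"

lemma kin_set_measurable:
  assumes "set_borel_measurable M A r" "set_borel_measurable M A x" "set_borel_measurable M A y"
  shows "set_borel_measurable M A (\<lambda>z. kin (r z) (x z) (y z))"
proof -
  have "(\<lambda>z. kin (indicator A z *\<^sub>R r z) (indicator A z *\<^sub>R x z) (indicator A z *\<^sub>R y z)) \<in> borel_measurable M"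
    unfolding kin_def vel_def drift_def using assms[unfolded set_borel_measurable_def] by measurable
  moreover have "(\<lambda>z. kin (indicator A z *\<^sub>R r z) (indicator A z *\<^sub>R x z) (indicator A z *\<^sub>R y z)) = (\<lambda>z. indicator A z *\<^sub>R kin (r z) (x z) (y z))"
    by (auto simp: indicator_def kin_def)
  ultimately show ?thesis by (simp add: set_borel_measurable_def)
qed

lemma vec_set_measurable:
  fixes f :: "'a \<Rightarrow> real^3"
  assumes "\<And>j. set_borel_measurable M A (\<lambda>z. f z $ j)" shows "set_borel_measurable M A f"
proof -
  have "(\<lambda>z. (indicator A z *\<^sub>R f z) \<bullet> b) \<in> borel_measurable M" if b: "b \<in> Basis" for b
  proof -
    obtain j where j: "b = axis j 1" using b by (auto simp: Basis_vec_def)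
    have "(\<lambda>z. (indicator A z *\<^sub>R f z) \<bullet> b) = (\<lambda>z. indicator A z *\<^sub>R f z $ j)"
      by (simp add: j inner_axis)
    then show ?thesis using assms[of j] by (simp add: set_borel_measurable_def)
  qed
  then show ?thesis unfolding set_borel_measurable_def by (subst borel_measurable_euclidean_space) auto
qed

lemma g_measurable: "set_borel_measurable lborel (cyl T \<epsilon>) g" "set_borel_measurable lborel (Omega \<epsilon>) g0"
proof -
  show "set_borel_measurable lborel (cyl T \<epsilon>) g" by (intro vec_set_measurable measurable_facts(3))
  show "set_borel_measurable lborel (Omega \<epsilon>) g0"
    using borel_measurable_integrable[OF gradient_facts(6)[unfolded set_integrable_def]]
    by (intro vec_set_measurable) (simp add: set_borel_measurable_def)
qed

lemma ekin_measurable: "set_borel_measurable lborel (cyl T \<epsilon>) ekin"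
  unfolding ekin_def[abs_def] by (intro kin_set_measurable measurable_facts(1,2) g_measurable)

lemma kin_nonneg: "r > 0 \<Longrightarrow> kin r x y \<ge> 0"
  by (simp add: kin_def)

lemma ie_integrable: "set_integrable lborel (cyl T \<epsilon>) ie"
  unfolding ie_def[abs_def] by (intro set_integral_add set_integrable_mult_right integrable_facts(3) gradient_facts(1))

lemma ie_eq: "rho z > 0 \<Longrightarrow> ie z = rho z * e (rho z)"
  by (subst internal_energy) (auto simp: ie_def pressure_def algebra_simps diff_divide_distrib)

text \<open>The internal energy may be negative, but at worst by a multiple of the density, whose
  integral is conserved.\<close>

lemma ie_ge: "rho z > 0 \<Longrightarrow> - \<bar>e 1 - a / (\<gamma> - 1)\<bar> * rho z \<le> ie z"
proof -
  assume r: "rho z > 0"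
  have "- \<bar>e 1 - a / (\<gamma> - 1)\<bar> * rho z \<le> (e 1 - a / (\<gamma> - 1)) * rho z"
    using r by (intro mult_right_mono) auto
  moreover have "0 \<le> 1 / (\<gamma> - 1) * pressure a \<gamma> (rho z)" using a \<gamma> by (simp add: pressure_def)
  ultimately show ?thesis unfolding ie_def by linarith
qed

lemma initial_facts:
  "set_integrable lborel (Omega \<epsilon>) (\<lambda>x. kin (rho0 x) (u0 x) (g0 x))" "set_integrable lborel (Omega \<epsilon>) (\<lambda>x. rho0 x * e (rho0 x))"
  "(LINT x:Omega \<epsilon>|lborel. kinetic_density \<kappa> (\<lambda>r. \<mu> * ln r) (rho0 x) (u0 x) (g0 x)) = (LINT x:Omega \<epsilon>|lborel. kin (rho0 x) (u0 x) (g0 x))"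
proof -
  have i: "set_integrable lborel (Omega \<epsilon>) (\<lambda>x. kinetic_density \<kappa> (\<lambda>r. \<mu> * ln r) (rho0 x) (u0 x) (g0 x))"
    "set_integrable lborel (Omega \<epsilon>) (\<lambda>x. rho0 x * e (rho0 x))" and m: "set_borel_measurable lborel (Omega \<epsilon>) rho0" "set_borel_measurable lborel (Omega \<epsilon>) u0"
    using ent unfolding entropy_solution_def entropy_estimate_def by blast+
  have eq: "AE x in lborel. x \<in> Omega \<epsilon> \<longrightarrow> kinetic_density \<kappa> (\<lambda>r. \<mu> * ln r) (rho0 x) (u0 x) (g0 x) = kin (rho0 x) (u0 x) (g0 x)"
    using pos(2) by eventually_elim (auto simp: kinetic_density_eq)
  note * = set_integrable_AE_cong[OF i(1) kin_set_measurable[OF m g_measurable(2)] eq]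
  show "set_integrable lborel (Omega \<epsilon>) (\<lambda>x. kin (rho0 x) (u0 x) (g0 x))" by (rule *(1))
  show "set_integrable lborel (Omega \<epsilon>) (\<lambda>x. rho0 x * e (rho0 x))" by (rule i(2))
  show "(LINT x:Omega \<epsilon>|lborel. kinetic_density \<kappa> (\<lambda>r. \<mu> * ln r) (rho0 x) (u0 x) (g0 x)) = (LINT x:Omega \<epsilon>|lborel. kin (rho0 x) (u0 x) (g0 x))"
    by (rule *(2))
qed

lemma diss_integrable: "set_integrable lborel (cyl T \<epsilon>) diss"
  unfolding diss_def[abs_def] using ent unfolding entropy_solution_def entropy_estimate_def by blast

lemma diss_nonneg: "AE z in lborel. z \<in> cyl T \<epsilon> \<longrightarrow> 0 \<le> diss z"
  using pos(1) by eventually_elim (auto simp: diss_def intro: dissipation_lower(2))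

lemma AE_good: "AE \<tau> in lborel. \<tau> \<in> {0<..<T} \<longrightarrow> good \<tau>"
proof -
  have est: "AE \<tau> in lborel. 0 < \<tau> \<and> \<tau> < T \<longrightarrow>
        set_integrable lborel (Omega \<epsilon>) (\<lambda>x. kinetic_density \<kappa> (\<lambda>r. \<mu> * ln r) (rho (\<tau>, x)) (u (\<tau>, x)) (g (\<tau>, x))) \<and>
        set_integrable lborel (Omega \<epsilon>) (\<lambda>x. rho (\<tau>, x) * e (rho (\<tau>, x))) \<and>
        (LINT x:Omega \<epsilon>|lborel. kinetic_density \<kappa> (\<lambda>r. \<mu> * ln r) (rho (\<tau>, x)) (u (\<tau>, x)) (g (\<tau>, x)))
        + (LINT x:Omega \<epsilon>|lborel. rho (\<tau>, x) * e (rho (\<tau>, x))) + (LINT z:cyl \<tau> \<epsilon>|lborel. diss z) \<le> energy0"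
    using ent unfolding entropy_solution_def entropy_estimate_def initial_facts(3) diss_def energy0_def by (elim conjE)
  show ?thesis
    using est AE_good_times[OF J_evolves] AE_good_times[OF g3_evolves] AE_good_times[OF rho_evolves] AE_good_times[OF evolves_one[OF \<epsilon>, of T]]
      cyl_AE_slice[OF pos(1)] set_integral_Fubini(1)[OF ie_integrable]
  proof eventually_elim
    case (elim \<tau>)
    show ?case
    proof
      assume t: "\<tau> \<in> {0<..<T}"
      have p: "AE x in lborel. x \<in> Omega \<epsilon> \<longrightarrow> rho (\<tau>, x) > 0" using elim t by blast
      have k: "set_integrable lborel (Omega \<epsilon>) (\<lambda>x. kinetic_density \<kappa> (\<lambda>r. \<mu> * ln r) (rho (\<tau>, x)) (u (\<tau>, x)) (g (\<tau>, x)))"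
        and r: "set_integrable lborel (Omega \<epsilon>) (\<lambda>x. rho (\<tau>, x) * e (rho (\<tau>, x)))"
        and le: "(LINT x:Omega \<epsilon>|lborel. kinetic_density \<kappa> (\<lambda>r. \<mu> * ln r) (rho (\<tau>, x)) (u (\<tau>, x)) (g (\<tau>, x)))
          + (LINT x:Omega \<epsilon>|lborel. rho (\<tau>, x) * e (rho (\<tau>, x))) + (LINT z:cyl \<tau> \<epsilon>|lborel. diss z) \<le> energy0"
        and i: "set_integrable lborel (Omega \<epsilon>) (\<lambda>x. ie (\<tau>, x))"
        using elim t by auto
      have keq: "AE x in lborel. x \<in> Omega \<epsilon> \<longrightarrow> kinetic_density \<kappa> (\<lambda>r. \<mu> * ln r) (rho (\<tau>, x)) (u (\<tau>, x)) (g (\<tau>, x)) = ekin (\<tau>, x)"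
        using p by eventually_elim (auto simp: kinetic_density_eq ekin_def)
      have req: "AE x in lborel. x \<in> Omega \<epsilon> \<longrightarrow> rho (\<tau>, x) * e (rho (\<tau>, x)) = ie (\<tau>, x)"
        using p by eventually_elim (auto simp: ie_eq)
      note K = set_integrable_AE_cong[OF k slice_measurable[OF ekin_measurable t] keq]
      have "(LINT x:Omega \<epsilon>|lborel. rho (\<tau>, x) * e (rho (\<tau>, x))) = (LINT x:Omega \<epsilon>|lborel. ie (\<tau>, x))"
        by (rule set_integral_cong_AE_integrable[OF r i req])
      then show "good \<tau>" unfolding good_def using elim t p i le K by (simp only: simp_thms)
    qed
  qed
qed

lemma good_integrals:
  assumes "good \<tau>" "continuous_on UNIV \<phi>"
  shows "set_integrable lborel (Omega \<epsilon>) (\<lambda>x. J (\<tau>, x) * \<phi> (x $ 3))" "set_integrable lborel (Omega \<epsilon>) (\<lambda>x. g3 (\<tau>, x) * \<phi> (x $ 3))"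
    "set_integrable lborel (Omega \<epsilon>) (\<lambda>x. rho (\<tau>, x) * \<phi> (x $ 3))" "set_integrable lborel (Omega \<epsilon>) (\<lambda>x. \<phi> (x $ 3))"
  using assms(1) slice_integrable_mult[OF _ assms(2)] slice_integrable_mult[OF set_integrable_const_Omega[OF \<epsilon>, of 1] assms(2)]
  by (auto simp: good_def good_times_def)

text \<open>The constant function is \<open>trig 0 0\<close>, so the mass equation may be tested
  with it at every good time.\<close>

lemma mass: "good \<tau> \<Longrightarrow> (LINT x:Omega \<epsilon>|lborel. rho (\<tau>, x)) = (LINT x:Omega \<epsilon>|lborel. rho0 x)"
proof -
  assume "good \<tau>"
  then have "(LINT x:Omega \<epsilon>|lborel. rho (\<tau>, x) * trig 0 0 (x $ 3))
      = (LINT x:Omega \<epsilon>|lborel. rho0 x * trig 0 0 (x $ 3)) + (LINT z:cyl \<tau> \<epsilon>|lborel. J z * deriv (trig 0 0) (snd z $ 3))"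
    unfolding good_def good_times_def by blast
  moreover have "trig 0 0 = (\<lambda>_. 1)" by (simp add: trig_def fun_eq_iff)
  ultimately show ?thesis by simp
qed

text \<open>The initial energy plus a bound for the negative part of the internal energy in terms of
  the conserved mass.\<close>

definition kbound where "kbound = energy0 + \<bar>e 1 - a / (\<gamma> - 1)\<bar> * (LINT x:Omega \<epsilon>|lborel. rho0 x)"

lemma ekin_slice_bound: assumes g: "good \<tau>" shows "(LINT x:Omega \<epsilon>|lborel. ekin (\<tau>, x)) \<le> kbound"
proof -
  let ?k = "\<bar>e 1 - a / (\<gamma> - 1)\<bar>"
  have t: "\<tau> \<in> {0<..<T}" and p: "AE x in lborel. x \<in> Omega \<epsilon> \<longrightarrow> rho (\<tau>, x) > 0" and i: "set_integrable lborel (Omega \<epsilon>) (\<lambda>x. ie (\<tau>, x))"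
    and le: "(LINT x:Omega \<epsilon>|lborel. ekin (\<tau>, x)) + (LINT x:Omega \<epsilon>|lborel. ie (\<tau>, x)) + (LINT z:cyl \<tau> \<epsilon>|lborel. diss z) \<le> energy0"
    using g by (auto simp: good_def)
  have r: "set_integrable lborel (Omega \<epsilon>) (\<lambda>x. rho (\<tau>, x))" using good_integrals(3)[OF g continuous_on_const, of 1] by simp
  have "(LINT x:Omega \<epsilon>|lborel. - ?k * rho (\<tau>, x)) \<le> (LINT x:Omega \<epsilon>|lborel. ie (\<tau>, x))"
  proof (rule set_integral_mono_AE'[OF _ i])
    show "set_integrable lborel (Omega \<epsilon>) (\<lambda>x. - ?k * rho (\<tau>, x))" by (intro set_integrable_mult_right r)
    show "AE x in lborel. x \<in> Omega \<epsilon> \<longrightarrow> - ?k * rho (\<tau>, x) \<le> ie (\<tau>, x)"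
      using p by eventually_elim (use ie_ge in blast)
  qed
  then have "- ?k * (LINT x:Omega \<epsilon>|lborel. rho0 x) \<le> (LINT x:Omega \<epsilon>|lborel. ie (\<tau>, x))"
    by (simp only: set_integral_mult_right mass[OF g])
  moreover have "0 \<le> (LINT z:cyl \<tau> \<epsilon>|lborel. diss z)"
    unfolding set_lebesgue_integral_def
  proof (rule integral_nonneg_AE)
    show "AE z in lborel. 0 \<le> indicator (cyl \<tau> \<epsilon>) z *\<^sub>R diss z"
      using diss_nonneg by eventually_elim (use t in \<open>auto simp: indicator_def\<close>)
  qed
  ultimately show ?thesis using le unfolding kbound_def by linarith
qed

lemma ekin_integrable: "set_integrable lborel (cyl T \<epsilon>) ekin"
proof (rule set_integrable_Tonelli[OF ekin_measurable, where K = kbound])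
  show "AE z in lborel. z \<in> cyl T \<epsilon> \<longrightarrow> 0 \<le> ekin z"
    using pos(1) by eventually_elim (auto simp: ekin_def kin_nonneg)
  show "AE t in lborel. t \<in> {0<..<T} \<longrightarrow> set_integrable lborel (Omega \<epsilon>) (\<lambda>x. ekin (t, x)) \<and> (LINT x:Omega \<epsilon>|lborel. ekin (t, x)) \<le> kbound"
    using AE_good by eventually_elim (use ekin_slice_bound in \<open>auto simp: good_def\<close>)
qed

lemma lin_integrable: assumes "T' < T" shows "set_integrable lborel (cyl T' \<epsilon>) lin"
  unfolding lin_def[abs_def]
proof (intro set_integral_add set_integral_diff set_integrable_mult_right)
  have "set_integrable lborel (cyl T' \<epsilon>) (\<lambda>z. - 1 * (J z * vfun vb z))"
    by (intro set_integrable_mult_right set_integrable_mult_vfun0[OF evolvesD(1)[OF J_evolves] slabs0(1) assms])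
  then show "set_integrable lborel (cyl T' \<epsilon>) (\<lambda>z. - (J z * vfun vb z))" by simp
  show "set_integrable lborel (cyl T' \<epsilon>) (\<lambda>z. g3 z * vfun vb z)" "set_integrable lborel (cyl T' \<epsilon>) (\<lambda>z. g3 z * vfun wb z)"
    by (intro set_integrable_mult_vfun0[OF evolvesD(1)[OF g3_evolves]] slabs0 assms)+
  show "set_integrable lborel (cyl T' \<epsilon>) (\<lambda>z. rho z * vfun (xi (e 1)) z)"
    by (intro set_integrable_mult_vfun0[OF gradient_facts(1)] slabs0 assms)
  show "set_integrable lborel (cyl T' \<epsilon>) (vfun pr)"
    using set_integrable_mult_vfun0[OF set_integrable_const_cyl[OF \<epsilon>, of 0 T 1] slabs0(5) assms] by simp
qed

lemma er_integrable: assumes "T' < T" shows "set_integrable lborel (cyl T' \<epsilon>) er"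
proof -
  have "set_integrable lborel (cyl T' \<epsilon>) ekin" "set_integrable lborel (cyl T' \<epsilon>) ie"
    by (rule set_integrable_subset[OF ekin_integrable], use assms in \<open>auto simp: cyl_borel\<close>)
       (rule set_integrable_subset[OF ie_integrable], use assms in \<open>auto simp: cyl_borel\<close>)
  then show ?thesis unfolding er_def[abs_def] by (intro set_integral_add lin_integrable assms)
qed

lemma er_eq: "rho z > 0 \<Longrightarrow> z \<in> cyl T \<epsilon> \<Longrightarrow> er z = erel (fst z) (snd z $ 3) (rho z) (u z) (g z)"
  using erel_expand[of "rho z" "fst z" "snd z $ 3" "u z" "g z"]
  by (auto simp: er_def ekin_def ie_eq lin_def J_def g3_def algebra_simps)

definition lin0 where "lin0 x = - (rho0 x * u0 x $ 3 * vb 0 (x $ 3)) - 2 * \<kappa> * \<mu> * (g0 x $ 3 * vb 0 (x $ 3)) - 2 * s * \<mu> * (g0 x $ 3 * wb 0 (x $ 3))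
  + rho0 x * xi (e 1) 0 (x $ 3) + pr 0 (x $ 3)"
definition er0 where "er0 x = kin (rho0 x) (u0 x) (g0 x) + rho0 x * e (rho0 x) + lin0 x"

lemma er0_eq: "rho0 x > 0 \<Longrightarrow> er0 x = erel 0 (x $ 3) (rho0 x) (u0 x) (g0 x)"
  using erel_expand[of "rho0 x" 0 "x $ 3" "u0 x" "g0 x"] T
  by (auto simp: er0_def lin0_def algebra_simps)

text \<open>Based on |b| \<le> (1 + b^2) / 2. The kinetic energy controls \<open>drift\<close>,
  which is a multiple of the density gradient divided by the density, and u is \<open>vel\<close>
  minus another multiple of that quotient.\<close>

lemma component_bounds:
  "\<exists>K\<ge>0. \<forall>r>0. \<forall>x y. \<bar>r * x $ 3\<bar> \<le> K * (r + kin r x y) \<and> \<bar>y $ 3\<bar> \<le> K * (r + kin r x y)"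
proof -
  define k where "k = 1 / (2 * s * \<mu>)\<^sup>2"
  have k: "k > 0" "k * (2 * s * \<mu>)\<^sup>2 = 1" using s(1) \<mu> by (auto simp: k_def)
  have "\<bar>r * x $ 3\<bar> \<le> (1 + 2 * \<kappa> * \<mu> * (1 + k)) * (r + kin r x y) \<and> \<bar>y $ 3\<bar> \<le> (1 + k) * (r + kin r x y)" if r: "r > 0" for r and x y :: "real^3"
  proof -
    define n where "n = y $ 3 / r"
    have n: "y $ 3 = r * n" using r by (simp add: n_def)
    have 1: "(vel r x y $ 3)\<^sup>2 \<le> (norm (vel r x y))\<^sup>2" "(drift r y $ 3)\<^sup>2 \<le> (norm (drift r y))\<^sup>2"
      using power_mono[OF component_le_norm_cart[of "vel r x y" 3], of 2] power_mono[OF component_le_norm_cart[of "drift r y" 3], of 2] by simp_all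
    have v: "vel r x y $ 3 = x $ 3 + 2 * \<kappa> * \<mu> * n" and d: "drift r y $ 3 = 2 * s * \<mu> * n"
      by (simp_all add: vel_def drift_def n_def)
    have "r * ((x $ 3 + 2 * \<kappa> * \<mu> * n)\<^sup>2 + (2 * s * \<mu> * n)\<^sup>2) \<le> r * ((norm (vel r x y))\<^sup>2 + (norm (drift r y))\<^sup>2)"
      using 1 r unfolding v d by (intro mult_left_mono add_mono) auto
    then have K: "r * (x $ 3 + 2 * \<kappa> * \<mu> * n)\<^sup>2 + r * (2 * s * \<mu> * n)\<^sup>2 \<le> 2 * kin r x y"
      by (simp add: kin_def distrib_left)
    have nn: "0 \<le> r * (x $ 3 + 2 * \<kappa> * \<mu> * n)\<^sup>2" "0 \<le> r * (2 * s * \<mu> * n)\<^sup>2" "0 \<le> kin r x y" using r kin_nonneg by simp_all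
    have am: "\<bar>b\<bar> \<le> (1 + b\<^sup>2) / 2" for b :: real
      using sum_squares_bound[of 1 "\<bar>b\<bar>"] by simp
    have "r * n\<^sup>2 = k * (r * (2 * s * \<mu> * n)\<^sup>2)" using k(2) by (simp add: power_mult_distrib algebra_simps)
    also have "\<dots> \<le> k * (2 * kin r x y)" using K nn k by (intro mult_left_mono) auto
    finally have n2: "r * n\<^sup>2 \<le> 2 * k * kin r x y" by simp
    have "\<bar>y $ 3\<bar> = r * \<bar>n\<bar>" using r by (simp add: n abs_mult)
    also have "\<dots> \<le> r * ((1 + n\<^sup>2) / 2)" using am r by (intro mult_left_mono) auto
    also have "\<dots> \<le> r / 2 + k * kin r x y" using n2 by (simp add: algebra_simps)
    finally have y: "\<bar>y $ 3\<bar> \<le> r / 2 + k * kin r x y" .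
    moreover have "0 \<le> k * r" using r k by simp
    moreover have "(1 + k) * (r + kin r x y) = r + kin r x y + k * r + k * kin r x y" by (simp add: algebra_simps)
    ultimately have Y: "\<bar>y $ 3\<bar> \<le> (1 + k) * (r + kin r x y)" using r nn(3) by linarith
    have "r * \<bar>x $ 3 + 2 * \<kappa> * \<mu> * n\<bar> \<le> r * ((1 + (x $ 3 + 2 * \<kappa> * \<mu> * n)\<^sup>2) / 2)" using am r by (intro mult_left_mono) auto
    also have "\<dots> = r / 2 + (r * (x $ 3 + 2 * \<kappa> * \<mu> * n)\<^sup>2) / 2" by (simp only: distrib_left add_divide_distrib times_divide_eq_right mult_1_right)
    also have "\<dots> \<le> r + kin r x y" using K nn r by linarith
    finally have x1: "r * \<bar>x $ 3 + 2 * \<kappa> * \<mu> * n\<bar> \<le> r + kin r x y" .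
    have "r * x $ 3 = r * (x $ 3 + 2 * \<kappa> * \<mu> * n) - 2 * \<kappa> * \<mu> * y $ 3" by (simp add: n algebra_simps)
    then have "\<bar>r * x $ 3\<bar> \<le> \<bar>r * (x $ 3 + 2 * \<kappa> * \<mu> * n)\<bar> + \<bar>2 * \<kappa> * \<mu> * y $ 3\<bar>" by linarith
    also have "\<dots> = r * \<bar>x $ 3 + 2 * \<kappa> * \<mu> * n\<bar> + 2 * \<kappa> * \<mu> * \<bar>y $ 3\<bar>" using r \<kappa> \<mu> by (simp add: abs_mult)
    also have "\<dots> \<le> (r + kin r x y) + 2 * \<kappa> * \<mu> * ((1 + k) * (r + kin r x y))"
      using x1 Y \<kappa> \<mu> by (intro add_mono mult_left_mono) auto
    finally show ?thesis using Y by (simp add: algebra_simps)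
  qed
  note * = this
  define K where "K = (1 + 2 * \<kappa> * \<mu> * (1 + k)) + (1 + k)"
  have p: "0 \<le> 1 + 2 * \<kappa> * \<mu> * (1 + k)" "0 \<le> 1 + k" using \<kappa> \<mu> k by auto
  have "\<bar>r * x $ 3\<bar> \<le> K * (r + kin r x y) \<and> \<bar>y $ 3\<bar> \<le> K * (r + kin r x y)" if r: "r > 0" for r and x y :: "real^3"
  proof -
    have "0 \<le> r + kin r x y" using r kin_nonneg[OF r] by (simp add: add_nonneg_nonneg)
    then have "(1 + 2 * \<kappa> * \<mu> * (1 + k)) * (r + kin r x y) \<le> K * (r + kin r x y)" "(1 + k) * (r + kin r x y) \<le> K * (r + kin r x y)"
      unfolding K_def using p by (intro mult_right_mono; simp)+
    then show ?thesis using *[OF r, of x y] by linarith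
  qed
  then show ?thesis using p by (intro exI[of _ K]) (auto simp: K_def)
qed

text \<open>The bound is the same for all good times, as \<open>evolves_initial\<close> requires
  along a sequence of them. It combines conservation of mass with the bound of the kinetic
  energy.\<close>

lemma L1_bounds:
  "\<exists>B. \<forall>\<tau>. good \<tau> \<longrightarrow> (LINT x:Omega \<epsilon>|lborel. \<bar>J (\<tau>, x)\<bar>) \<le> B \<and> (LINT x:Omega \<epsilon>|lborel. \<bar>g3 (\<tau>, x)\<bar>) \<le> B \<and> (LINT x:Omega \<epsilon>|lborel. \<bar>rho (\<tau>, x)\<bar>) \<le> B"
proof -
  obtain K where K: "K \<ge> 0" "\<And>r x y. r > 0 \<Longrightarrow> \<bar>r * x $ 3\<bar> \<le> K * (r + kin r x y) \<and> \<bar>y $ 3\<bar> \<le> K * (r + kin r x y)"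
    using component_bounds by blast
  define B where "B = (1 + K) * ((LINT x:Omega \<epsilon>|lborel. rho0 x) + kbound)"
  have key: "(LINT x:Omega \<epsilon>|lborel. \<bar>f x\<bar>) \<le> B" if g: "good \<tau>" and f: "set_integrable lborel (Omega \<epsilon>) f"
    and b: "AE x in lborel. x \<in> Omega \<epsilon> \<longrightarrow> \<bar>f x\<bar> \<le> (1 + K) * (rho (\<tau>, x) + ekin (\<tau>, x))" for f \<tau>
  proof -
    have r: "set_integrable lborel (Omega \<epsilon>) (\<lambda>x. rho (\<tau>, x))" using good_integrals(3)[OF g continuous_on_const, of 1] by simp
    have k: "set_integrable lborel (Omega \<epsilon>) (\<lambda>x. ekin (\<tau>, x))" using g by (simp add: good_def)
    have "(LINT x:Omega \<epsilon>|lborel. \<bar>f x\<bar>) \<le> (LINT x:Omega \<epsilon>|lborel. (1 + K) * (rho (\<tau>, x) + ekin (\<tau>, x)))"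
      by (rule set_integral_mono_AE'[OF set_integrable_abs[OF f] _ b]) (intro set_integrable_mult_right set_integral_add r k)
    also have "\<dots> = (1 + K) * ((LINT x:Omega \<epsilon>|lborel. rho0 x) + (LINT x:Omega \<epsilon>|lborel. ekin (\<tau>, x)))"
      by (simp only: set_integral_mult_right set_integral_add(2)[OF r k] mass[OF g])
    also have "\<dots> \<le> B" unfolding B_def using ekin_slice_bound[OF g] K(1) by (intro mult_left_mono) auto
    finally show ?thesis .
  qed
  have "(LINT x:Omega \<epsilon>|lborel. \<bar>J (\<tau>, x)\<bar>) \<le> B \<and> (LINT x:Omega \<epsilon>|lborel. \<bar>g3 (\<tau>, x)\<bar>) \<le> B \<and> (LINT x:Omega \<epsilon>|lborel. \<bar>rho (\<tau>, x)\<bar>) \<le> B" if g: "good \<tau>" for \<tau>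
  proof (intro conjI key[OF g])
    have pb: "\<bar>J (\<tau>, x)\<bar> \<le> (1 + K) * (rho (\<tau>, x) + ekin (\<tau>, x)) \<and> \<bar>g3 (\<tau>, x)\<bar> \<le> (1 + K) * (rho (\<tau>, x) + ekin (\<tau>, x))
        \<and> \<bar>rho (\<tau>, x)\<bar> \<le> (1 + K) * (rho (\<tau>, x) + ekin (\<tau>, x))" if r: "rho (\<tau>, x) > 0" for x
    proof -
      have k: "ekin (\<tau>, x) \<ge> 0" unfolding ekin_def by (rule kin_nonneg[OF r])
      have "0 \<le> K * (rho (\<tau>, x) + ekin (\<tau>, x))" using K(1) r k by simp
      moreover have "\<bar>J (\<tau>, x)\<bar> \<le> K * (rho (\<tau>, x) + ekin (\<tau>, x))" "\<bar>g3 (\<tau>, x)\<bar> \<le> K * (rho (\<tau>, x) + ekin (\<tau>, x))"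
        using K(2)[OF r, of "u (\<tau>, x)" "g (\<tau>, x)"] by (simp_all add: J_def g3_def ekin_def)
      moreover have "(1 + K) * (rho (\<tau>, x) + ekin (\<tau>, x)) = rho (\<tau>, x) + ekin (\<tau>, x) + K * (rho (\<tau>, x) + ekin (\<tau>, x))"
        by (simp only: distrib_right mult_1)
      ultimately show ?thesis using r k by auto
    qed
    have p: "AE x in lborel. x \<in> Omega \<epsilon> \<longrightarrow> rho (\<tau>, x) > 0" using g by (simp add: good_def)
    show "set_integrable lborel (Omega \<epsilon>) (\<lambda>x. J (\<tau>, x))" "set_integrable lborel (Omega \<epsilon>) (\<lambda>x. g3 (\<tau>, x))" "set_integrable lborel (Omega \<epsilon>) (\<lambda>x. rho (\<tau>, x))"
      using good_integrals[OF g continuous_on_const, of 1] by simp_all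
    show "AE x in lborel. x \<in> Omega \<epsilon> \<longrightarrow> \<bar>J (\<tau>, x)\<bar> \<le> (1 + K) * (rho (\<tau>, x) + ekin (\<tau>, x))"
      "AE x in lborel. x \<in> Omega \<epsilon> \<longrightarrow> \<bar>g3 (\<tau>, x)\<bar> \<le> (1 + K) * (rho (\<tau>, x) + ekin (\<tau>, x))"
      "AE x in lborel. x \<in> Omega \<epsilon> \<longrightarrow> \<bar>rho (\<tau>, x)\<bar> \<le> (1 + K) * (rho (\<tau>, x) + ekin (\<tau>, x))"
      using p by (eventually_elim, use pb in blast)+
  qed
  then show ?thesis by blast
qed

end

section \<open>The balance of the linear part\<close>

context solution_pair
begin

definition S where "S \<tau> = (LINT x:Omega \<epsilon>|lborel. lin (\<tau>, x))"
definition pairing where "pairing f \<phi> \<tau> = (LINT x:Omega \<epsilon>|lborel. f (\<tau>, x) * \<phi> \<tau> (x $ 3))"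

lemma set_int_lin:
  assumes g: "good \<tau>"
  shows "set_int lborel (Omega \<epsilon>) (\<lambda>x. lin (\<tau>, x)) (- pairing J vb \<tau> - 2 * \<kappa> * \<mu> * pairing g3 vb \<tau> - 2 * s * \<mu> * pairing g3 wb \<tau>
    + pairing rho (xi (e 1)) \<tau> + pairing (\<lambda>_. 1) pr \<tau>)"
proof -
  have t: "\<tau> \<in> {0<..<T}" using g by (simp add: good_def)
  have x: "periodic_slab T (xi (e 1))" by (rule periodic_slab0_imp[OF slabs0(4)])
  have p: "periodic_slab T pr" by (rule periodic_slab0_imp[OF slabs0(5)])
  note c = periodic_slab_slice(1)[OF _ t, of _ UNIV]
  have l: "set_int lborel (Omega \<epsilon>) (\<lambda>x. J (\<tau>, x) * vb \<tau> (x $ 3)) (pairing J vb \<tau>)"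
    "set_int lborel (Omega \<epsilon>) (\<lambda>x. g3 (\<tau>, x) * vb \<tau> (x $ 3)) (pairing g3 vb \<tau>)"
    "set_int lborel (Omega \<epsilon>) (\<lambda>x. g3 (\<tau>, x) * wb \<tau> (x $ 3)) (pairing g3 wb \<tau>)"
    "set_int lborel (Omega \<epsilon>) (\<lambda>x. rho (\<tau>, x) * xi (e 1) \<tau> (x $ 3)) (pairing rho (xi (e 1)) \<tau>)"
    "set_int lborel (Omega \<epsilon>) (\<lambda>x. pr \<tau> (x $ 3)) (pairing (\<lambda>_. 1) pr \<tau>)"
    using good_integrals[OF g c[OF slabs(1)]] good_integrals[OF g c[OF slabs(2)]] good_integrals[OF g c[OF x]] good_integrals[OF g c[OF p]]
    by (simp_all add: set_int_def pairing_def)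
  show ?thesis unfolding lin_def fst_conv snd_conv by (intro set_int_intros l)
qed

text \<open>Each of the five pairings in \<open>set_int_lin\<close> obeys a weak equation, which
  \<open>evolves_test\<close> integrates over (\<delta>, \<tau>); for \<open>pr\<close> the equation
  is the trivial one of the constant density 1.\<close>

lemma S_difference:
  assumes g: "good \<delta>" "good \<tau>" and d: "\<delta> < \<tau>"
  shows "set_int lborel (scyl \<delta> \<tau> \<epsilon>) (\<lambda>z. balance_lhs (fst z) (snd z $ 3) (rho z) (J z) (g3 z) (h z) - kJ z * deriv (vb (fst z)) (snd z $ 3)) (S \<tau> - S \<delta>)"
proof -
  let ?A = "\<lambda>f \<phi>. LINT z:scyl \<delta> \<tau> \<epsilon>|lborel. f z * vfun \<phi> z"
  have t: "0 < \<delta>" "\<tau> < T" using g by (auto simp: good_def)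
  have i: "set_int lborel (scyl \<delta> \<tau> \<epsilon>) (\<lambda>z. f z * vfun \<phi> z) (?A f \<phi>)" if "set_integrable lborel (cyl T \<epsilon>) f" "periodic_slab T \<phi>" for f \<phi>
    by (rule set_int_base[OF set_integrable_mult_vfun[OF that t]])
  have sx: "periodic_slab T xit" "periodic_slab T xiy" using C1_xi by (auto simp: C1_slab_def)
  have sp: "periodic_slab T prt" "periodic_slab T pry" using C1_pr by (auto simp: C1_slab_def)
  note Ji = evolvesD(1)[OF J_evolves] and ki = evolvesD(2)[OF J_evolves] and gi = evolvesD(1)[OF g3_evolves] and hi = evolvesD(2)[OF g3_evolves]
    and ri = gradient_facts(1) and oi = set_integrable_const_cyl[OF \<epsilon>, of 0 T 1] and zi = set_integrable_const_cyl[OF \<epsilon>, of 0 T 0]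
  note leaves = i[OF Ji slabs(4)] i[OF ki slabs(6)] i[OF gi slabs(4)] i[OF hi slabs(6)] i[OF gi slabs(5)] i[OF hi slabs(7)]
    i[OF ri sx(1)] i[OF Ji sx(2)] i[OF oi sp(1)] i[OF zi sp(2)]
  have "set_int lborel (scyl \<delta> \<tau> \<epsilon>) (\<lambda>z. - (J z * vfun Vt z + kJ z * vfun (\<lambda>t. deriv (vb t)) z)
      - 2 * \<kappa> * \<mu> * (g3 z * vfun Vt z + h z * vfun (\<lambda>t. deriv (vb t)) z) - 2 * s * \<mu> * (g3 z * vfun Wt z + h z * vfun (\<lambda>t. deriv (wb t)) z)
      + (rho z * vfun xit z + J z * vfun xiy z) + (1 * vfun prt z + 0 * vfun pry z))
    (- (?A J Vt + ?A kJ (\<lambda>t. deriv (vb t))) - 2 * \<kappa> * \<mu> * (?A g3 Vt + ?A h (\<lambda>t. deriv (vb t))) - 2 * s * \<mu> * (?A g3 Wt + ?A h (\<lambda>t. deriv (wb t)))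
      + (?A rho xit + ?A J xiy) + (?A (\<lambda>_. 1) prt + ?A (\<lambda>_. 0) pry))"
    by (intro set_int_intros(1,2,4) set_int_intros(3)[where r = "2 * \<kappa> * \<mu>"] set_int_intros(3)[where r = "2 * s * \<mu>"] leaves)
  moreover have "- (?A J Vt + ?A kJ (\<lambda>t. deriv (vb t))) - 2 * \<kappa> * \<mu> * (?A g3 Vt + ?A h (\<lambda>t. deriv (vb t))) - 2 * s * \<mu> * (?A g3 Wt + ?A h (\<lambda>t. deriv (wb t)))
      + (?A rho xit + ?A J xiy) + (?A (\<lambda>_. 1) prt + ?A (\<lambda>_. 0) pry) = S \<tau> - S \<delta>"
  proof -
    have S: "S r = - pairing J vb r - 2 * \<kappa> * \<mu> * pairing g3 vb r - 2 * s * \<mu> * pairing g3 wb r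
      + pairing rho (xi (e 1)) r + pairing (\<lambda>_. 1) pr r" if "good r" for r
      using set_int_lin[OF that] by (simp add: set_int_def S_def)
    have d1: "pairing J vb \<tau> - pairing J vb \<delta> = ?A J Vt + ?A kJ (\<lambda>t. deriv (vb t))"
      unfolding pairing_def by (rule evolves_test[OF J_evolves C1_vb _ _ d]) (use g in \<open>auto simp: good_def\<close>)
    have d2: "pairing g3 vb \<tau> - pairing g3 vb \<delta> = ?A g3 Vt + ?A h (\<lambda>t. deriv (vb t))"
      unfolding pairing_def by (rule evolves_test[OF g3_evolves C1_vb _ _ d]) (use g in \<open>auto simp: good_def\<close>)
    have d3: "pairing g3 wb \<tau> - pairing g3 wb \<delta> = ?A g3 Wt + ?A h (\<lambda>t. deriv (wb t))"
      unfolding pairing_def by (rule evolves_test[OF g3_evolves C1_wb _ _ d]) (use g in \<open>auto simp: good_def\<close>)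
    have d4: "pairing rho (xi (e 1)) \<tau> - pairing rho (xi (e 1)) \<delta> = ?A rho xit + ?A J xiy"
      unfolding pairing_def by (rule evolves_test[OF rho_evolves C1_xi _ _ d]) (use g in \<open>auto simp: good_def\<close>)
    have d5: "pairing (\<lambda>_. 1) pr \<tau> - pairing (\<lambda>_. 1) pr \<delta> = ?A (\<lambda>_. 1) prt + ?A (\<lambda>_. 0) pry"
      unfolding pairing_def by (rule evolves_test[OF evolves_one[OF \<epsilon>, of T] C1_pr _ _ d]) (use g in \<open>auto simp: good_def\<close>)
    show ?thesis unfolding S[OF g(1)] S[OF g(2)] d1[symmetric] d2[symmetric] d3[symmetric] d4[symmetric] d5[symmetric]
      by (simp add: algebra_simps)
  qed
  moreover have "(\<lambda>z. - (J z * vfun Vt z + kJ z * vfun (\<lambda>t. deriv (vb t)) z)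
      - 2 * \<kappa> * \<mu> * (g3 z * vfun Vt z + h z * vfun (\<lambda>t. deriv (vb t)) z) - 2 * s * \<mu> * (g3 z * vfun Wt z + h z * vfun (\<lambda>t. deriv (wb t)) z)
      + (rho z * vfun xit z + J z * vfun xiy z) + (1 * vfun prt z + 0 * vfun pry z))
    = (\<lambda>z. balance_lhs (fst z) (snd z $ 3) (rho z) (J z) (g3 z) (h z) - kJ z * deriv (vb (fst z)) (snd z $ 3))"
    by (simp add: balance_lhs_def fun_eq_iff)
  ultimately show ?thesis by simp
qed

text \<open>Integration by parts in x3, each product being split into an integrable factor and a
  test function. Products free of the unknowns use the factor 1 with derivative 0.\<close>

lemma null_integral:
  assumes t: "0 < \<delta>" "\<tau> < T"
  shows "set_int lborel (scyl \<delta> \<tau> \<epsilon>) (\<lambda>z. balance_null (fst z) (snd z $ 3) (rho z) (J z) (g3 z) (h z)) 0"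
proof -
  let ?A = "\<lambda>f \<phi>. LINT z:scyl \<delta> \<tau> \<epsilon>|lborel. f z * vfun \<phi> z"
  let ?c = "a * \<gamma>"
  define p1 where "p1 t y = Uy t y * Uy t y + Uyy t y * U t y" for t y
  define p2 where "p2 t y = U t y * Uy t y" for t y
  define p3 where "p3 t y = ?c * ((\<gamma> - 1) * Y t y * q1 t y * q1 t y + q2 t y * Y t y)" for t y
  define p4 where "p4 t y = ?c * (Y t y * q1 t y)" for t y
  define p5 where "p5 t y = a * \<gamma> * Y t y * rb t y * q1 t y * U t y + Uy t y * pr t y" for t y
  define p6 where "p6 t y = a * \<gamma> * Y t y * rb t y * q1 t y * q1 t y + q2 t y * pr t y" for t y
  have pr: "periodic_slab T pr" by (rule periodic_slab0_imp[OF slabs0(5)])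
  have sl: "periodic_slab T p1" "periodic_slab T p2" "periodic_slab T p3" "periodic_slab T p4" "periodic_slab T p5" "periodic_slab T p6"
    "periodic_slab T (\<lambda>t y. pr t y * U t y)" "periodic_slab T (\<lambda>t y. pr t y * q1 t y)"
    unfolding p1_def[abs_def] p2_def[abs_def] p3_def[abs_def] p4_def[abs_def] p5_def[abs_def] p6_def[abs_def]
    by (intro periodic_slab_intros slabs pr)+
  have i: "set_int lborel (scyl \<delta> \<tau> \<epsilon>) (\<lambda>z. f z * vfun \<phi> z) (?A f \<phi>)" if "set_integrable lborel (cyl T \<epsilon>) f" "periodic_slab T \<phi>" for f \<phi>
    by (rule set_int_base[OF set_integrable_mult_vfun[OF that t]])
  note Ji = evolvesD(1)[OF J_evolves] and gi = evolvesD(1)[OF g3_evolves] and hi = evolvesD(2)[OF g3_evolves]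
    and ri = gradient_facts(1) and oi = set_integrable_const_cyl[OF \<epsilon>, of 0 T 1]
  note leaves = i[OF Ji slabs(10)] i[OF hi slabs(9)] i[OF ri sl(1)] i[OF gi sl(2)] i[OF ri sl(3)] i[OF gi sl(4)] i[OF oi sl(5)] i[OF oi sl(6)]
  have "set_int lborel (scyl \<delta> \<tau> \<epsilon>) (\<lambda>z. 2 * (1 - \<kappa>) * \<mu> * ((J z * vfun Uyy z + h z * vfun Uy z) - (rho z * vfun p1 z + g3 z * vfun p2 z))
      + 1 * vfun p5 z + 2 * \<kappa> * \<mu> * (rho z * vfun p3 z + g3 z * vfun p4 z) - 2 * \<kappa> * \<mu> * (\<gamma> - 1) * (1 * vfun p6 z))
    (2 * (1 - \<kappa>) * \<mu> * ((?A J Uyy + ?A h Uy) - (?A rho p1 + ?A g3 p2)) + ?A (\<lambda>_. 1) p5 + 2 * \<kappa> * \<mu> * (?A rho p3 + ?A g3 p4) - 2 * \<kappa> * \<mu> * (\<gamma> - 1) * ?A (\<lambda>_. 1) p6)"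
    by (intro set_int_intros(1,2,4) set_int_intros(3)[where r = "2 * (1 - \<kappa>) * \<mu>"] set_int_intros(3)[where r = "2 * \<kappa> * \<mu>"]
        set_int_intros(3)[where r = "2 * \<kappa> * \<mu> * (\<gamma> - 1)"] leaves)
  moreover have "?A J Uyy = - ?A h Uy"
    by (rule vertical_deriv_test[OF J_vertical_deriv slabs(9,10) y_derivs(2) t])
  moreover have "?A rho p1 = - ?A g3 p2"
    by (rule vertical_deriv_test[OF rho_vertical_deriv sl(2,1) _ t])
       (unfold p1_def p2_def[abs_def], rule DERIV_mult[OF y_derivs(1,2)])
  moreover have "?A rho p3 = - ?A g3 p4"
    by (rule vertical_deriv_test[OF rho_vertical_deriv sl(4,3) _ t])
       (unfold p3_def p4_def[abs_def], rule DERIV_cmult[OF DERIV_mult[OF y_derivs(4,3)]])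
  moreover have pD: "(pr t has_real_derivative a * \<gamma> * Y t y * rb t y * q1 t y) (at y)" if "t \<in> {0<..<T}" for t y
    using C1_pr that unfolding C1_slab_def pry_def by blast
  have "?A (\<lambda>_. 1) p5 = - ?A (\<lambda>_. 0) (\<lambda>t y. pr t y * U t y)"
    by (rule vertical_deriv_test[OF vertical_deriv_one[OF \<epsilon>, of T] sl(7,5) _ t])
       (unfold p5_def, rule DERIV_mult[OF pD y_derivs(1)])
  moreover have "?A (\<lambda>_. 1) p6 = - ?A (\<lambda>_. 0) (\<lambda>t y. pr t y * q1 t y)"
    by (rule vertical_deriv_test[OF vertical_deriv_one[OF \<epsilon>, of T] sl(8,6) _ t])
       (unfold p6_def, rule DERIV_mult[OF pD y_derivs(3)])
  ultimately show ?thesis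
    by (simp add: balance_null_def p1_def p2_def p3_def p4_def p5_def p6_def)
qed

lemma er_nonneg: "AE z in lborel. z \<in> cyl T \<epsilon> \<longrightarrow> 0 \<le> er z"
  using pos(1)
proof eventually_elim
  case (elim z)
  show ?case using elim erel_nonneg[of "rho z" "fst z" "snd z $ 3" "u z" "g z"] by (auto simp: er_eq)
qed

text \<open>At each point this is \<open>balance_const\<close>: the dissipation dominates its
  vertical part, and the relative energy dominates the one formed with vertical components
  only.\<close>

lemma pointwise_balance:
  assumes C: "balance_const C"
  shows "AE z in lborel. z \<in> cyl T \<epsilon> \<longrightarrow> balance_lhs (fst z) (snd z $ 3) (rho z) (J z) (g3 z) (h z) - kJ z * deriv (vb (fst z)) (snd z $ 3)
    + balance_null (fst z) (snd z $ 3) (rho z) (J z) (g3 z) (h z) \<le> diss z + C * er z"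
  using pos(1)
proof eventually_elim
  case (elim z)
  show ?case
  proof
    assume z: "z \<in> cyl T \<epsilon>"
    then have r: "rho z > 0" using elim by blast
    define t where "t = fst z"
    define y where "y = snd z $ 3"
    define n where "n = g z $ 3 / rho z"
    have ty: "t \<in> {0<..<T}" "y \<in> {0<..<1}" using z by (auto simp: t_def y_def Omega_def)
    have e: "g3 z = rho z * n" "J z = rho z * u z $ 3" "h z = rho z * G z $ 3 $ 3 + u z $ 3 * (rho z * n)"
      "kJ z = rho z * (u z $ 3)\<^sup>2 - 2 * (\<mu> * rho z * G z $ 3 $ 3) + a * rho z powr \<gamma>"
      using r by (simp_all add: g3_def J_def h_def kJ_def n_def pressure_def)
    have b: "balance_lhs t y (rho z) (J z) (g3 z) (h z) - kJ z * deriv (vb t) y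
      - (2 * \<kappa> * \<mu> * a * \<gamma> * rho z powr (\<gamma> - 1) * rho z * n\<^sup>2 + 2 * (1 - \<kappa>) * \<mu> * rho z * (G z $ 3 $ 3)\<^sup>2)
      + balance_null t y (rho z) (J z) (g3 z) (h z)
      \<le> C * (rho z * ((2 * s * \<mu> * n - wb t y)\<^sup>2 + (u z $ 3 + 2 * \<kappa> * \<mu> * n - vb t y)\<^sup>2) / 2 + relpot a \<gamma> (rho z) (rb t y))"
      unfolding e by (rule C[unfolded balance_const_def, THEN conjunct2, rule_format, OF ty r])
    have d: "2 * \<kappa> * \<mu> * a * \<gamma> * rho z powr (\<gamma> - 1) * rho z * n\<^sup>2 + 2 * (1 - \<kappa>) * \<mu> * rho z * (G z $ 3 $ 3)\<^sup>2 \<le> diss z"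
      unfolding diss_def n_def by (rule dissipation_lower(1)[OF r])
    have v: "drift (rho z) (g z) $ 3 = 2 * s * \<mu> * n" "vel (rho z) (u z) (g z) $ 3 = u z $ 3 + 2 * \<kappa> * \<mu> * n"
      by (simp_all add: drift_def vel_def n_def)
    have "rho z * ((2 * s * \<mu> * n - wb t y)\<^sup>2 + (u z $ 3 + 2 * \<kappa> * \<mu> * n - vb t y)\<^sup>2)
      \<le> rho z * ((norm (drift (rho z) (g z) - vertical (wb t y)))\<^sup>2 + (norm (vel (rho z) (u z) (g z) - vertical (vb t y)))\<^sup>2)"
      unfolding v[symmetric] using r by (intro mult_left_mono add_mono norm_diff_vertical_ge) simp
    then have "rho z * ((2 * s * \<mu> * n - wb t y)\<^sup>2 + (u z $ 3 + 2 * \<kappa> * \<mu> * n - vb t y)\<^sup>2) / 2 + relpot a \<gamma> (rho z) (rb t y) \<le> er z"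
      unfolding er_eq[OF r z] erel_def t_def[symmetric] y_def[symmetric] by simp
    then have "C * (rho z * ((2 * s * \<mu> * n - wb t y)\<^sup>2 + (u z $ 3 + 2 * \<kappa> * \<mu> * n - vb t y)\<^sup>2) / 2 + relpot a \<gamma> (rho z) (rb t y)) \<le> C * er z"
      using C by (intro mult_left_mono) (auto simp: balance_const_def)
    then show "balance_lhs (fst z) (snd z $ 3) (rho z) (J z) (g3 z) (h z) - kJ z * deriv (vb (fst z)) (snd z $ 3)
      + balance_null (fst z) (snd z $ 3) (rho z) (J z) (g3 z) (h z) \<le> diss z + C * er z"
      using b d unfolding t_def[symmetric] y_def[symmetric] by linarith
  qed
qed

text \<open>Since dissipation and relative energy are nonnegative, their integrals may be enlarged
  from (\<delta>, \<tau>) to (0, \<tau>), which makes the right-hand side independent of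
  \<delta>.\<close>

lemma S_step:
  assumes C: "balance_const C" and g: "good \<delta>" "good \<tau>" and d: "\<delta> < \<tau>"
  shows "S \<tau> - S \<delta> \<le> (LINT z:cyl \<tau> \<epsilon>|lborel. diss z) + C * (LINT z:cyl \<tau> \<epsilon>|lborel. er z)"
proof -
  have t: "0 < \<delta>" "\<tau> < T" using g by (auto simp: good_def)
  have sub: "scyl \<delta> \<tau> \<epsilon> \<subseteq> cyl \<tau> \<epsilon>" "cyl \<tau> \<epsilon> \<subseteq> cyl T \<epsilon>" using t by auto
  have dt: "set_integrable lborel (cyl \<tau> \<epsilon>) diss" by (rule set_integrable_subset[OF diss_integrable _ sub(2)]) (simp add: cyl_borel)
  have et: "set_integrable lborel (cyl \<tau> \<epsilon>) er" by (rule er_integrable[OF t(2)])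
  have di: "set_integrable lborel (scyl \<delta> \<tau> \<epsilon>) diss" by (rule set_integrable_subset[OF dt _ sub(1)]) (simp add: cyl_borel)
  have ei: "set_integrable lborel (scyl \<delta> \<tau> \<epsilon>) er" by (rule set_integrable_subset[OF et _ sub(1)]) (simp add: cyl_borel)
  note f = set_int_intros(1)[OF S_difference[OF g d] null_integral[OF t]]
  have "S \<tau> - S \<delta> + 0 \<le> (LINT z:scyl \<delta> \<tau> \<epsilon>|lborel. diss z + C * er z)"
    unfolding f[unfolded set_int_def, THEN conjunct2, symmetric]
  proof (rule set_integral_mono_AE'[OF f[unfolded set_int_def, THEN conjunct1]])
    show "set_integrable lborel (scyl \<delta> \<tau> \<epsilon>) (\<lambda>z. diss z + C * er z)"
      by (intro set_integral_add set_integrable_mult_right di ei)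
    show "AE z in lborel. z \<in> scyl \<delta> \<tau> \<epsilon> \<longrightarrow> balance_lhs (fst z) (snd z $ 3) (rho z) (J z) (g3 z) (h z) - kJ z * deriv (vb (fst z)) (snd z $ 3)
      + balance_null (fst z) (snd z $ 3) (rho z) (J z) (g3 z) (h z) \<le> diss z + C * er z"
      using pointwise_balance[OF C] by eventually_elim (use sub in blast)
  qed
  also have "\<dots> = (LINT z:scyl \<delta> \<tau> \<epsilon>|lborel. diss z) + C * (LINT z:scyl \<delta> \<tau> \<epsilon>|lborel. er z)"
    by (simp only: set_integral_add(2)[OF di set_integrable_mult_right[OF ei]] set_integral_mult_right)
  also have "\<dots> \<le> (LINT z:cyl \<tau> \<epsilon>|lborel. diss z) + C * (LINT z:cyl \<tau> \<epsilon>|lborel. er z)"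
  proof (intro add_mono mult_left_mono set_integral_mono_set[OF dt di sub(1)] set_integral_mono_set[OF et ei sub(1)])
    show "AE x in lborel. x \<in> cyl \<tau> \<epsilon> \<longrightarrow> 0 \<le> diss x" using diss_nonneg by eventually_elim (use sub in blast)
    show "AE x in lborel. x \<in> cyl \<tau> \<epsilon> \<longrightarrow> 0 \<le> er x" using er_nonneg by eventually_elim (use sub in blast)
    show "0 \<le> C" using C by (simp add: balance_const_def)
  qed
  finally show ?thesis by simp
qed

lemma set_int_er: "good \<tau> \<Longrightarrow> set_int lborel (Omega \<epsilon>) (\<lambda>x. er (\<tau>, x)) ((LINT x:Omega \<epsilon>|lborel. ekin (\<tau>, x)) + (LINT x:Omega \<epsilon>|lborel. ie (\<tau>, x)) + S \<tau>)"
  unfolding er_def S_def using set_int_lin by (intro set_int_intros set_int_base) (auto simp: good_def set_int_def)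

lemma set_int_lin0:
  "set_int lborel (Omega \<epsilon>) lin0 (- (LINT x:Omega \<epsilon>|lborel. rho0 x * u0 x $ 3 * vb 0 (x $ 3))
    - 2 * \<kappa> * \<mu> * (LINT x:Omega \<epsilon>|lborel. g0 x $ 3 * vb 0 (x $ 3)) - 2 * s * \<mu> * (LINT x:Omega \<epsilon>|lborel. g0 x $ 3 * wb 0 (x $ 3))
    + (LINT x:Omega \<epsilon>|lborel. rho0 x * xi (e 1) 0 (x $ 3)) + (LINT x:Omega \<epsilon>|lborel. 1 * pr 0 (x $ 3)))"
proof -
  have 0: "0 \<in> {0..<T}" using T by simp
  note c = periodic_slab0_slice(1)[OF _ 0, of _ UNIV]
  note i = set_int_base[OF slice_integrable_mult]
  have eq: "lin0 = (\<lambda>x. - (rho0 x * u0 x $ 3 * vb 0 (x $ 3)) - 2 * \<kappa> * \<mu> * (g0 x $ 3 * vb 0 (x $ 3)) - 2 * s * \<mu> * (g0 x $ 3 * wb 0 (x $ 3))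
    + rho0 x * xi (e 1) 0 (x $ 3) + 1 * pr 0 (x $ 3))"
    by (simp add: fun_eq_iff lin0_def)
  show ?thesis unfolding eq
    by (intro set_int_intros(1,2,4) set_int_intros(3)[where r = "2 * \<kappa> * \<mu>"] set_int_intros(3)[where r = "2 * s * \<mu>"]
        i[OF evolvesD(3)[OF J_evolves] c[OF slabs0(1)]] i[OF evolvesD(3)[OF g3_evolves] c[OF slabs0(1)]] i[OF evolvesD(3)[OF g3_evolves] c[OF slabs0(2)]]
        i[OF evolvesD(3)[OF rho_evolves] c[OF slabs0(4)]] i[OF set_integrable_const_Omega[OF \<epsilon>] c[OF slabs0(5)]])
qed

lemma er0_integral:
  "set_integrable lborel (Omega \<epsilon>) er0" "(LINT x:Omega \<epsilon>|lborel. er0 x) = energy0 + (LINT x:Omega \<epsilon>|lborel. lin0 x)"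
proof -
  have l: "set_integrable lborel (Omega \<epsilon>) lin0" using set_int_lin0 by (simp add: set_int_def)
  have "set_int lborel (Omega \<epsilon>) er0 (energy0 + (LINT x:Omega \<epsilon>|lborel. lin0 x))"
    unfolding er0_def[abs_def] energy0_def by (intro set_int_intros set_int_base initial_facts l)
  then show "set_integrable lborel (Omega \<epsilon>) er0" "(LINT x:Omega \<epsilon>|lborel. er0 x) = energy0 + (LINT x:Omega \<epsilon>|lborel. lin0 x)"
    by (simp_all add: set_int_def)
qed

lemma S_initial:
  assumes \<delta>: "\<And>n. good (\<delta> n)" "\<delta> \<longlonglongrightarrow> 0"
  shows "(\<lambda>n. S (\<delta> n)) \<longlonglongrightarrow> (LINT x:Omega \<epsilon>|lborel. lin0 x)"
proof -
  obtain B where B: "\<And>n. (LINT x:Omega \<epsilon>|lborel. \<bar>J (\<delta> n, x)\<bar>) \<le> B" "\<And>n. (LINT x:Omega \<epsilon>|lborel. \<bar>g3 (\<delta> n, x)\<bar>) \<le> B"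
    "\<And>n. (LINT x:Omega \<epsilon>|lborel. \<bar>rho (\<delta> n, x)\<bar>) \<le> B"
    using L1_bounds \<delta>(1) by blast
  have gt: "\<delta> n \<in> good_times T \<epsilon> J (\<lambda>x. rho0 x * u0 x $ 3) kJ" "\<delta> n \<in> good_times T \<epsilon> g3 (\<lambda>x. g0 x $ 3) h"
    "\<delta> n \<in> good_times T \<epsilon> rho rho0 J" "\<delta> n \<in> good_times T \<epsilon> (\<lambda>_. 1) (\<lambda>_. 1) (\<lambda>_. 0)" for n
    using \<delta>(1)[of n] by (auto simp: good_def)
  have S: "S (\<delta> n) = - pairing J vb (\<delta> n) - 2 * \<kappa> * \<mu> * pairing g3 vb (\<delta> n) - 2 * s * \<mu> * pairing g3 wb (\<delta> n)
      + pairing rho (xi (e 1)) (\<delta> n) + pairing (\<lambda>_. 1) pr (\<delta> n)" for n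
    using set_int_lin[OF \<delta>(1)] by (simp add: set_int_def S_def)
  have L: "(LINT x:Omega \<epsilon>|lborel. lin0 x) = - (LINT x:Omega \<epsilon>|lborel. rho0 x * u0 x $ 3 * vb 0 (x $ 3))
    - 2 * \<kappa> * \<mu> * (LINT x:Omega \<epsilon>|lborel. g0 x $ 3 * vb 0 (x $ 3)) - 2 * s * \<mu> * (LINT x:Omega \<epsilon>|lborel. g0 x $ 3 * wb 0 (x $ 3))
    + (LINT x:Omega \<epsilon>|lborel. rho0 x * xi (e 1) 0 (x $ 3)) + (LINT x:Omega \<epsilon>|lborel. 1 * pr 0 (x $ 3))"
    using set_int_lin0 by (simp add: set_int_def)
  show ?thesis unfolding S L pairing_def
    by (intro tendsto_add tendsto_diff tendsto_minus tendsto_mult tendsto_const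
        evolves_initial[OF J_evolves slabs0(1) T gt(1) \<delta>(2) B(1)] evolves_initial[OF g3_evolves slabs0(1) T gt(2) \<delta>(2) B(2)]
        evolves_initial[OF g3_evolves slabs0(2) T gt(2) \<delta>(2) B(2)] evolves_initial[OF rho_evolves slabs0(4) T gt(3) \<delta>(2) B(3)]
        evolves_initial[OF evolves_one[OF \<epsilon>, of T] slabs0(5) T gt(4) \<delta>(2) order.refl])
qed

text \<open>The entropy estimate bounds energy plus dissipation at time \<tau>, and
  \<open>S_step\<close> bounds the growth of the linear part by the same dissipation, which
  therefore cancels in the sum. The initial value is reached by letting \<delta> tend to 0 along
  good times.\<close>

lemma relative_entropy_inequality:
  assumes C: "balance_const C" and g: "good \<tau>"
  shows "(LINT x:Omega \<epsilon>|lborel. er (\<tau>, x)) \<le> (LINT x:Omega \<epsilon>|lborel. er0 x) + C * (LINT z:cyl \<tau> \<epsilon>|lborel. er z)"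
proof -
  obtain \<delta> :: "nat \<Rightarrow> real" where \<delta>: "\<And>n. good (\<delta> n)" "\<delta> \<longlonglongrightarrow> 0" using AE_sequence_to_0[OF T AE_good] by blast
  have "(\<lambda>n. energy0 + S (\<delta> n) + C * (LINT z:cyl \<tau> \<epsilon>|lborel. er z)) \<longlonglongrightarrow> energy0 + (LINT x:Omega \<epsilon>|lborel. lin0 x) + C * (LINT z:cyl \<tau> \<epsilon>|lborel. er z)"
    by (intro tendsto_add tendsto_const S_initial \<delta>)
  moreover have "\<forall>\<^sub>F n in sequentially. \<delta> n < \<tau>"
    using \<delta>(2) g by (intro order_tendstoD(2)) (auto simp: good_def)
  then have "\<forall>\<^sub>F n in sequentially. (LINT x:Omega \<epsilon>|lborel. er (\<tau>, x)) \<le> energy0 + S (\<delta> n) + C * (LINT z:cyl \<tau> \<epsilon>|lborel. er z)"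
  proof eventually_elim
    case (elim n)
    have "(LINT x:Omega \<epsilon>|lborel. ekin (\<tau>, x)) + (LINT x:Omega \<epsilon>|lborel. ie (\<tau>, x)) + (LINT z:cyl \<tau> \<epsilon>|lborel. diss z) \<le> energy0"
      using g by (simp add: good_def)
    then show ?case using S_step[OF C \<delta>(1) g elim] set_int_er[OF g] unfolding set_int_def by linarith
  qed
  ultimately have "(LINT x:Omega \<epsilon>|lborel. er (\<tau>, x)) \<le> energy0 + (LINT x:Omega \<epsilon>|lborel. lin0 x) + C * (LINT z:cyl \<tau> \<epsilon>|lborel. er z)"
    by (rule tendsto_lowerbound) simp
  then show ?thesis unfolding er0_integral(2) .
qed

lemma er0_nonneg: "AE x in lborel. x \<in> Omega \<epsilon> \<longrightarrow> 0 \<le> er0 x"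
  using pos(2)
proof eventually_elim
  case (elim x)
  show ?case using elim T erel_nonneg[of "rho0 x" 0 "x $ 3" "u0 x" "g0 x"] by (auto simp: er0_eq)
qed

lemma er0_integral_nonneg: "0 \<le> (LINT x:Omega \<epsilon>|lborel. er0 x)"
  unfolding set_lebesgue_integral_def
proof (rule integral_nonneg_AE)
  show "AE x in lborel. 0 \<le> indicator (Omega \<epsilon>) x *\<^sub>R er0 x"
    using er0_nonneg by eventually_elim (auto simp: indicator_def)
qed

lemma relative_entropy_bound:
  assumes C: "balance_const C"
  shows "AE \<tau> in lborel. \<tau> \<in> {0<..<T} \<longrightarrow> set_integrable lborel (Omega \<epsilon>) (\<lambda>x. er (\<tau>, x))
    \<and> (LINT x:Omega \<epsilon>|lborel. er (\<tau>, x)) \<le> (LINT x:Omega \<epsilon>|lborel. er0 x) * exp (C * T)"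
proof -
  have C0: "C \<ge> 0" using C by (simp add: balance_const_def)
  \<comment> \<open>The denominators n + 2 keep every such time positive; the countable family
    exhausts (0, T).\<close>
  define T' where "T' n = T - T / real (n + 2)" for n
  have T': "T' n < T" for n using T by (simp add: T'_def)
  have "AE \<tau> in lborel. \<forall>n. \<tau> \<in> {0<..<T' n} \<longrightarrow> (LINT x:Omega \<epsilon>|lborel. er (\<tau>, x)) \<le> (LINT x:Omega \<epsilon>|lborel. er0 x) * exp (C * \<tau>)"
    unfolding AE_all_countable
  proof
    fix n
    show "AE \<tau> in lborel. \<tau> \<in> {0<..<T' n} \<longrightarrow> (LINT x:Omega \<epsilon>|lborel. er (\<tau>, x)) \<le> (LINT x:Omega \<epsilon>|lborel. er0 x) * exp (C * \<tau>)"
    proof (rule gronwall_integrable[OF set_integral_Fubini(2)[OF er_integrable[OF T'[of n]]] C0])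
      show "AE t in lborel. t \<in> {0<..<T' n} \<longrightarrow> (LINT x:Omega \<epsilon>|lborel. er (t, x))
        \<le> (LINT x:Omega \<epsilon>|lborel. er0 x) + C * (LINT s:{0<..<t}|lborel. LINT x:Omega \<epsilon>|lborel. er (s, x))"
        using AE_good
      proof eventually_elim
        case (elim t)
        show ?case
        proof
          assume t: "t \<in> {0<..<T' n}"
          then have tT: "t < T" using T'[of n] by auto
          show "(LINT x:Omega \<epsilon>|lborel. er (t, x)) \<le> (LINT x:Omega \<epsilon>|lborel. er0 x) + C * (LINT s:{0<..<t}|lborel. LINT x:Omega \<epsilon>|lborel. er (s, x))"
            using relative_entropy_inequality[OF C, of t] elim t tT unfolding set_integral_Fubini(3)[OF er_integrable[OF tT]] by auto
        qed
      qed
    qed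
  qed
  then show ?thesis using AE_good
  proof eventually_elim
    case (elim \<tau>)
    show ?case
    proof
      assume t: "\<tau> \<in> {0<..<T}"
      then have g: "good \<tau>" using elim by blast
      have "(\<lambda>n. T - T / real (n + 2)) \<longlonglongrightarrow> T - 0"
        by (intro tendsto_diff tendsto_const LIMSEQ_ignore_initial_segment[where f = "\<lambda>n. T / real n"] lim_const_over_n)
      from order_tendstoD(1)[OF this, of \<tau>] obtain n where n: "\<tau> < T' n"
        using t unfolding T'_def eventually_sequentially by auto
      have "(LINT x:Omega \<epsilon>|lborel. er (\<tau>, x)) \<le> (LINT x:Omega \<epsilon>|lborel. er0 x) * exp (C * \<tau>)" using elim(1) n t by auto
      also have "\<dots> \<le> (LINT x:Omega \<epsilon>|lborel. er0 x) * exp (C * T)"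
        using er0_integral_nonneg C0 t by (intro mult_left_mono) (auto intro: mult_left_mono)
      finally show "set_integrable lborel (Omega \<epsilon>) (\<lambda>x. er (\<tau>, x)) \<and> (LINT x:Omega \<epsilon>|lborel. er (\<tau>, x)) \<le> (LINT x:Omega \<epsilon>|lborel. er0 x) * exp (C * T)"
        using set_int_er[OF g] by (simp add: set_int_def)
    qed
  qed
qed

end

section \<open>Convergence\<close>

lemma pressure_potential_eq:
  assumes \<gamma>: "\<gamma> > 1" and r: "r > 0"
  shows "pressure_potential (pressure a \<gamma>) r = a / (\<gamma> - 1) * (r powr \<gamma> - r)"
proof -
  have E: "(LBINT s=ereal 1..ereal r. pressure a \<gamma> s / s\<^sup>2) = a / (\<gamma> - 1) * r powr (\<gamma> - 1) - a / (\<gamma> - 1) * 1 powr (\<gamma> - 1)"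
  proof (rule interval_integral_FTC_finite)
    show "continuous_on {min 1 r..max 1 r} (\<lambda>s. pressure a \<gamma> s / s\<^sup>2)"
      unfolding pressure_def using r by (intro continuous_intros) auto
    fix x assume "min 1 r \<le> x"
    then have x: "x > 0" using r by auto
    have "a / (\<gamma> - 1) * ((\<gamma> - 1) * x powr (\<gamma> - 1 - 1)) = pressure a \<gamma> x / x\<^sup>2"
      using x powr_diff[of x \<gamma> 2] \<gamma> by (simp add: powr_numeral pressure_def)
    then have "((\<lambda>x. a / (\<gamma> - 1) * x powr (\<gamma> - 1)) has_real_derivative pressure a \<gamma> x / x\<^sup>2) (at x)"
      using DERIV_cmult[OF has_real_derivative_powr[OF x, of "\<gamma> - 1"], of "a / (\<gamma> - 1)"] by simp
    then show "((\<lambda>x. a / (\<gamma> - 1) * x powr (\<gamma> - 1)) has_vector_derivative pressure a \<gamma> x / x\<^sup>2) (at x within {min 1 r..max 1 r})"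
      using has_real_derivative_iff_has_vector_derivative has_vector_derivative_at_within by blast
  qed
  have "r powr \<gamma> = r * r powr (\<gamma> - 1)" using powr_mult_base[of r "\<gamma> - 1"] r by simp
  then show ?thesis unfolding pressure_potential_def E by (simp add: algebra_simps)
qed

lemma pressure_potential_deriv:
  assumes \<gamma>: "\<gamma> > 1" and r: "r > 0"
  shows "deriv (pressure_potential (pressure a \<gamma>)) r = a / (\<gamma> - 1) * (\<gamma> * r powr (\<gamma> - 1) - 1)"
proof (rule DERIV_imp_deriv)
  have "((\<lambda>r. a / (\<gamma> - 1) * (r powr \<gamma> - r)) has_real_derivative a / (\<gamma> - 1) * (\<gamma> * r powr (\<gamma> - 1) - 1)) (at r)"
    by (intro DERIV_cmult DERIV_diff has_real_derivative_powr[OF r] DERIV_ident)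
  then show "(pressure_potential (pressure a \<gamma>) has_real_derivative a / (\<gamma> - 1) * (\<gamma> * r powr (\<gamma> - 1) - 1)) (at r)"
    by (rule has_field_derivative_transform_within_open[where S = "{0<..}"]) (use r pressure_potential_eq[OF \<gamma>] in auto)
qed

text \<open>At positive arguments P differs from a r^\<gamma> / (\<gamma> - 1) by a linear function,
  which the Bregman divergence does not see.\<close>

lemma pressure_potential_bregman:
  assumes \<gamma>: "\<gamma> > 1" and r: "r > 0" and \<rho>: "\<rho> > 0"
  shows "pressure_potential (pressure a \<gamma>) \<rho> - pressure_potential (pressure a \<gamma>) r - deriv (pressure_potential (pressure a \<gamma>)) r * (\<rho> - r)
    = relpot a \<gamma> \<rho> r"
  unfolding pressure_potential_deriv[OF \<gamma> r] pressure_potential_eq[OF \<gamma> r] pressure_potential_eq[OF \<gamma> \<rho>] relpot_def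
  by (simp add: algebra_simps diff_divide_distrib add_divide_distrib)

text \<open>The closed form describes the potential only at positive arguments; on the whole line
  measurability is that of a parameter integral.\<close>

lemma pressure_potential_measurable: "pressure_potential (pressure a \<gamma>) \<in> borel_measurable borel"
proof -
  let ?f = "\<lambda>s. pressure a \<gamma> s / s\<^sup>2"
  have f: "?f \<in> borel_measurable borel" unfolding pressure_def by measurable
  have m: "(\<lambda>r. LINT s|lborel. (if P r s then ?f s else 0)) \<in> borel_measurable borel"
    if "Measurable.pred (borel \<Otimes>\<^sub>M borel) (\<lambda>(r, s). P r s)" for P :: "real \<Rightarrow> real \<Rightarrow> bool"
  proof (rule lborel.borel_measurable_lebesgue_integral)
    have "(\<lambda>z. if P (fst z) (snd z) then ?f (snd z) else 0) \<in> borel_measurable (borel \<Otimes>\<^sub>M borel)"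
      using that measurable_compose[OF measurable_snd f] by (intro measurable_If_restrict_space_iff[THEN iffD2] measurable_If) (auto simp: split_beta')
    then show "(\<lambda>(r, s). if P r s then ?f s else 0) \<in> borel_measurable (borel \<Otimes>\<^sub>M lborel)"
      by (simp add: split_beta' measurable_cong_sets[OF sets_pair_measure_cong[OF refl sets_lborel] refl])
  qed
  have ind: "indicat_real A s *\<^sub>R x = (if s \<in> A then x else 0)" for A :: "real set" and s x :: real by simp
  have eq: "pressure_potential (pressure a \<gamma>) = (\<lambda>r. r * (if 1 \<le> r then LINT s|lborel. (if 1 < s \<and> s < r then ?f s else 0)
      else - (LINT s|lborel. (if r < s \<and> s < 1 then ?f s else 0))))"
    unfolding pressure_potential_def interval_lebesgue_integral_def set_lebesgue_integral_def ind
    by (auto simp: fun_eq_iff)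
  show ?thesis unfolding eq by (intro borel_measurable_times measurable_If borel_measurable_uminus m) measurable
qed

text \<open>L may depend on \<delta>: the density error is bounded by an arbitrarily small constant
  plus a large multiple of the relative energy.\<close>

lemma tendsto_ennreal_0:
  fixes f :: "real \<Rightarrow> ennreal" and I :: "real \<Rightarrow> real"
  assumes I: "(I \<longlongrightarrow> 0) F" and b: "\<And>\<delta>. \<delta> > 0 \<Longrightarrow> \<exists>L. \<forall>\<^sub>F x in F. f x \<le> ennreal (\<delta> + L * I x)"
  shows "(f \<longlongrightarrow> 0) F"
proof (rule order_tendstoI)
  fix y :: ennreal assume "0 < y"
  then obtain c where c: "0 < c" "ennreal c < y"
    by (metis dense ennreal_cases ennreal_less_zero_iff less_top order.strict_trans2 top_greatest)
  obtain L where L: "\<forall>\<^sub>F x in F. f x \<le> ennreal (c / 2 + L * I x)" using b[of "c / 2"] c(1) by auto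
  have "((\<lambda>x. c / 2 + L * I x) \<longlongrightarrow> c / 2 + L * 0) F" by (intro tendsto_intros I)
  from order_tendstoD(2)[OF this, of c] have "\<forall>\<^sub>F x in F. c / 2 + L * I x < c" using c(1) by simp
  then show "\<forall>\<^sub>F x in F. f x < y"
    using L
  proof eventually_elim
    case (elim x)
    have "ennreal (c / 2 + L * I x) \<le> ennreal c" using elim by (intro ennreal_leI) simp
    then show ?case using elim(2) c(2) by (meson order.strict_trans1 order.trans)
  qed
qed simp

section \<open>Errors and initial energy in terms of the relative energy\<close>

context solution_pair
begin

lemma esssup_slice_le:
  assumes F: "set_borel_measurable lborel (cyl T \<epsilon>) F" and b: "AE z in lborel. z \<in> cyl T \<epsilon> \<longrightarrow> F z \<le> \<delta> + K * er z"
    and \<delta>: "\<delta> \<ge> 0" and K: "K \<ge> 0" and C: "balance_const C"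
  shows "esssup (restrict_space lborel {0<..<T}) (\<lambda>t. (\<integral>\<^sup>+x\<in>Omega \<epsilon>. ennreal (F (t, x)) \<partial>lborel) / emeasure lborel (Omega \<epsilon>))
    \<le> ennreal (\<delta> + K * exp (C * T) * (1 / measure lborel (Omega \<epsilon>) * (LINT x:Omega \<epsilon>|lborel. er0 x)))"
proof (rule esssup_I)
  let ?m = "measure lborel (Omega \<epsilon>)"
  \<comment> \<open>Cutting off outside the cylinder gives a function measurable on the whole
    product, with the same slice integrals for t in (0, T).\<close>
  define H where "H z = indicator (cyl T \<epsilon>) z *\<^sub>R F z" for z
  have "H \<in> borel_measurable (lborel \<Otimes>\<^sub>M lborel)"
    using F unfolding set_borel_measurable_def H_def[abs_def] lborel_prod .
  then have "(\<lambda>t. \<integral>\<^sup>+x. ennreal (H (t, x)) \<partial>lborel) \<in> borel_measurable lborel"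
    by (intro lborel.borel_measurable_nn_integral) simp
  then have "(\<lambda>t. (\<integral>\<^sup>+x. ennreal (H (t, x)) \<partial>lborel) / emeasure lborel (Omega \<epsilon>)) \<in> borel_measurable (restrict_space lborel {0<..<T})"
    by (intro measurable_restrict_space1 borel_measurable_divide_ennreal borel_measurable_const)
  moreover have "(\<integral>\<^sup>+x. ennreal (H (t, x)) \<partial>lborel) = (\<integral>\<^sup>+x\<in>Omega \<epsilon>. ennreal (F (t, x)) \<partial>lborel)" if "t \<in> {0<..<T}" for t
    by (intro nn_integral_cong) (use that in \<open>auto simp: H_def indicator_def\<close>)
  ultimately show "(\<lambda>t. (\<integral>\<^sup>+x\<in>Omega \<epsilon>. ennreal (F (t, x)) \<partial>lborel) / emeasure lborel (Omega \<epsilon>)) \<in> borel_measurable (restrict_space lborel {0<..<T})"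
    by (subst measurable_cong[where g = "\<lambda>t. (\<integral>\<^sup>+x. ennreal (H (t, x)) \<partial>lborel) / emeasure lborel (Omega \<epsilon>)"]) (auto simp: space_restrict_space)
  have m: "?m > 0" "emeasure lborel (Omega \<epsilon>) = ennreal ?m"
    using emeasure_Omega[OF \<epsilon>] by (auto simp: emeasure_eq_ennreal_measure)
  have "AE t in lborel. t \<in> {0<..<T} \<longrightarrow> (\<integral>\<^sup>+x\<in>Omega \<epsilon>. ennreal (F (t, x)) \<partial>lborel) / emeasure lborel (Omega \<epsilon>)
    \<le> ennreal (\<delta> + K * exp (C * T) * (1 / ?m * (LINT x:Omega \<epsilon>|lborel. er0 x)))"
    using relative_entropy_bound[OF C] cyl_AE_slice[OF b] cyl_AE_slice[OF er_nonneg]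
  proof eventually_elim
    case (elim t)
    show ?case
    proof
      assume t: "t \<in> {0<..<T}"
      then have e: "set_integrable lborel (Omega \<epsilon>) (\<lambda>x. er (t, x))"
        and eb: "(LINT x:Omega \<epsilon>|lborel. er (t, x)) \<le> (LINT x:Omega \<epsilon>|lborel. er0 x) * exp (C * T)"
        and Fb: "AE x in lborel. x \<in> Omega \<epsilon> \<longrightarrow> F (t, x) \<le> \<delta> + K * er (t, x)"
        and nn: "AE x in lborel. x \<in> Omega \<epsilon> \<longrightarrow> 0 \<le> er (t, x)"
        using elim by blast+
      have e0: "0 \<le> (LINT x:Omega \<epsilon>|lborel. er (t, x))"
        unfolding set_lebesgue_integral_def
        by (rule integral_nonneg_AE) (use nn in \<open>eventually_elim, auto simp: indicator_def\<close>)
      have "set_int lborel (Omega \<epsilon>) (\<lambda>x. \<delta>) (\<delta> * ?m)"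
        using set_integrable_const_Omega[OF \<epsilon>, of \<delta>] by (simp add: set_int_def set_lebesgue_integral_def)
      from set_int_intros(1)[OF this set_int_intros(3)[OF set_int_base[OF e], of K]]
      have si: "set_int lborel (Omega \<epsilon>) (\<lambda>x. \<delta> + K * er (t, x)) (\<delta> * ?m + K * (LINT x:Omega \<epsilon>|lborel. er (t, x)))" .
      have "(\<integral>\<^sup>+x\<in>Omega \<epsilon>. ennreal (F (t, x)) \<partial>lborel) \<le> (\<integral>\<^sup>+x. ennreal (indicator (Omega \<epsilon>) x *\<^sub>R (\<delta> + K * er (t, x))) \<partial>lborel)"
        by (rule nn_integral_mono_AE) (use Fb in \<open>eventually_elim, auto simp: indicator_def intro: ennreal_leI\<close>)
      also have "\<dots> = ennreal (\<delta> * ?m + K * (LINT x:Omega \<epsilon>|lborel. er (t, x)))"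
        unfolding si[unfolded set_int_def, THEN conjunct2, symmetric] unfolding set_lebesgue_integral_def
      proof (rule nn_integral_eq_integral)
        show "integrable lborel (\<lambda>x. indicat_real (Omega \<epsilon>) x *\<^sub>R (\<delta> + K * er (t, x)))"
          using si unfolding set_int_def set_integrable_def by blast
        show "AE x in lborel. 0 \<le> indicat_real (Omega \<epsilon>) x *\<^sub>R (\<delta> + K * er (t, x))"
          using nn by eventually_elim (use \<delta> K in \<open>auto simp: indicator_def\<close>)
      qed
      finally have "(\<integral>\<^sup>+x\<in>Omega \<epsilon>. ennreal (F (t, x)) \<partial>lborel) / emeasure lborel (Omega \<epsilon>)
        \<le> ennreal (\<delta> * ?m + K * (LINT x:Omega \<epsilon>|lborel. er (t, x))) / ennreal ?m"
        unfolding m(2) by (rule divide_right_mono_ennreal)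
      also have "\<dots> = ennreal ((\<delta> * ?m + K * (LINT x:Omega \<epsilon>|lborel. er (t, x))) / ?m)"
        using \<delta> K e0 m(1) by (intro divide_ennreal) auto
      also have "\<dots> \<le> ennreal (\<delta> + K * exp (C * T) * (1 / ?m * (LINT x:Omega \<epsilon>|lborel. er0 x)))"
      proof (rule ennreal_leI)
        have "K * (LINT x:Omega \<epsilon>|lborel. er (t, x)) \<le> K * ((LINT x:Omega \<epsilon>|lborel. er0 x) * exp (C * T))"
          using eb K by (rule mult_left_mono)
        then have "K * (LINT x:Omega \<epsilon>|lborel. er (t, x)) / ?m \<le> K * ((LINT x:Omega \<epsilon>|lborel. er0 x) * exp (C * T)) / ?m"
          using m(1) by (intro divide_right_mono) auto
        then show "(\<delta> * ?m + K * (LINT x:Omega \<epsilon>|lborel. er (t, x))) / ?m \<le> \<delta> + K * exp (C * T) * (1 / ?m * (LINT x:Omega \<epsilon>|lborel. er0 x))"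
          using m(1) by (simp add: add_divide_distrib mult_ac)
      qed
      finally show "(\<integral>\<^sup>+x\<in>Omega \<epsilon>. ennreal (F (t, x)) \<partial>lborel) / emeasure lborel (Omega \<epsilon>)
        \<le> ennreal (\<delta> + K * exp (C * T) * (1 / ?m * (LINT x:Omega \<epsilon>|lborel. er0 x)))" .
    qed
  qed
  then show "AE t in restrict_space lborel {0<..<T}. (\<integral>\<^sup>+x\<in>Omega \<epsilon>. ennreal (F (t, x)) \<partial>lborel) / emeasure lborel (Omega \<epsilon>)
    \<le> ennreal (\<delta> + K * exp (C * T) * (1 / ?m * (LINT x:Omega \<epsilon>|lborel. er0 x)))"
    by (subst AE_restrict_space_iff) auto
qed

lemma vfun_measurable: "periodic_slab T \<phi> \<Longrightarrow> set_borel_measurable lborel (cyl T \<epsilon>) (vfun \<phi>)"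
  using borel_measurable_continuous_on_indicator[OF cyl_borel vfun_continuous[of T \<phi> "cyl T \<epsilon>"]]
  by (auto simp: set_borel_measurable_def)

lemma density_error:
  assumes C: "balance_const C" and \<delta>: "\<delta> \<ge> 0" and K: "K \<ge> 0" and m: "m > 0"
    and b: "\<And>t y \<rho>. t \<in> {0<..<T} \<Longrightarrow> y \<in> {0<..<1} \<Longrightarrow> \<rho> > 0 \<Longrightarrow> \<bar>\<rho> - rb t y\<bar> powr m \<le> \<delta> + K * relpot a \<gamma> \<rho> (rb t y)"
  shows "esssup (restrict_space lborel {0<..<T}) (\<lambda>t. (\<integral>\<^sup>+x\<in>Omega \<epsilon>. ennreal (\<bar>rho (t, x) - rb t (x $ 3)\<bar> powr m) \<partial>lborel) / emeasure lborel (Omega \<epsilon>))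
    \<le> ennreal (\<delta> + K * exp (C * T) * (1 / measure lborel (Omega \<epsilon>) * (LINT x:Omega \<epsilon>|lborel. er0 x)))"
proof -
  have "(\<lambda>z. \<bar>indicator (cyl T \<epsilon>) z *\<^sub>R rho z - indicator (cyl T \<epsilon>) z *\<^sub>R vfun rb z\<bar> powr m) \<in> borel_measurable lborel"
    using measurable_facts(1) vfun_measurable[OF slabs(3)] unfolding set_borel_measurable_def by measurable
  moreover have "(\<lambda>z. \<bar>indicator (cyl T \<epsilon>) z *\<^sub>R rho z - indicator (cyl T \<epsilon>) z *\<^sub>R vfun rb z\<bar> powr m) = (\<lambda>z. indicator (cyl T \<epsilon>) z *\<^sub>R (\<bar>rho z - vfun rb z\<bar> powr m))"
    by (auto simp: indicator_def)
  ultimately have M: "set_borel_measurable lborel (cyl T \<epsilon>) (\<lambda>z. \<bar>rho z - vfun rb z\<bar> powr m)" by (simp add: set_borel_measurable_def)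
  have "AE z in lborel. z \<in> cyl T \<epsilon> \<longrightarrow> \<bar>rho z - vfun rb z\<bar> powr m \<le> \<delta> + K * er z"
    using pos(1)
  proof eventually_elim
    case (elim z)
    show ?case
    proof
      assume z: "z \<in> cyl T \<epsilon>"
      then have r: "rho z > 0" using elim by blast
      have ty: "fst z \<in> {0<..<T}" "snd z $ 3 \<in> {0<..<1}" using z by (auto simp: Omega_def)
      have "relpot a \<gamma> (rho z) (vfun rb z) \<le> er z"
        unfolding er_eq[OF r z] erel_def using r by simp
      then have "K * relpot a \<gamma> (rho z) (vfun rb z) \<le> K * er z" using K by (rule mult_left_mono)
      then show "\<bar>rho z - vfun rb z\<bar> powr m \<le> \<delta> + K * er z" using b[OF ty r] by linarith
    qed
  qed
  from esssup_slice_le[OF M this \<delta> K C] show ?thesis by simp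
qed

lemma velocity_error:
  assumes C: "balance_const C" and vw: "set_borel_measurable lborel (cyl T \<epsilon>) v" "set_borel_measurable lborel (cyl T \<epsilon>) w"
    and eq: "AE z in lborel. z \<in> cyl T \<epsilon> \<longrightarrow> v z = vel (rho z) (u z) (g z) \<and> w z = drift (rho z) (g z)"
  shows "esssup (restrict_space lborel {0<..<T}) (\<lambda>t. (\<integral>\<^sup>+x\<in>Omega \<epsilon>. ennreal (rho (t, x) *
       ((norm (w (t, x) - vertical (wb t (x $ 3))))\<^sup>2 + (norm (v (t, x) - vertical (vb t (x $ 3))))\<^sup>2)) \<partial>lborel) / emeasure lborel (Omega \<epsilon>))
    \<le> ennreal (0 + 2 * exp (C * T) * (1 / measure lborel (Omega \<epsilon>) * (LINT x:Omega \<epsilon>|lborel. er0 x)))"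
proof -
  define F where "F z = rho z * ((norm (w z - vertical (vfun wb z)))\<^sup>2 + (norm (v z - vertical (vfun vb z)))\<^sup>2)" for z
  let ?i = "indicator (cyl T \<epsilon>) :: _ \<Rightarrow> real"
  have "(\<lambda>z. (?i z *\<^sub>R rho z) * ((norm (?i z *\<^sub>R w z - (?i z *\<^sub>R vfun wb z) *\<^sub>R axis 3 1))\<^sup>2 + (norm (?i z *\<^sub>R v z - (?i z *\<^sub>R vfun vb z) *\<^sub>R axis 3 1))\<^sup>2)) \<in> borel_measurable lborel"
    using measurable_facts(1) vfun_measurable[OF slabs(1)] vfun_measurable[OF slabs(2)] vw unfolding set_borel_measurable_def by measurable
  moreover have "(\<lambda>z. (?i z *\<^sub>R rho z) * ((norm (?i z *\<^sub>R w z - (?i z *\<^sub>R vfun wb z) *\<^sub>R axis 3 1))\<^sup>2 + (norm (?i z *\<^sub>R v z - (?i z *\<^sub>R vfun vb z) *\<^sub>R axis 3 1))\<^sup>2)) = (\<lambda>z. ?i z *\<^sub>R F z)"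
    by (auto simp: indicator_def F_def vertical_def)
  ultimately have M: "set_borel_measurable lborel (cyl T \<epsilon>) F" by (simp add: set_borel_measurable_def)
  have "AE z in lborel. z \<in> cyl T \<epsilon> \<longrightarrow> F z \<le> 0 + 2 * er z"
    using pos(1) eq
  proof eventually_elim
    case (elim z)
    show ?case
    proof
      assume z: "z \<in> cyl T \<epsilon>"
      then have r: "rho z > 0" and e: "v z = vel (rho z) (u z) (g z)" "w z = drift (rho z) (g z)" using elim by blast+
      have "0 < vfun rb z" using z by (intro rb_pos) auto
      then have "0 \<le> relpot a \<gamma> (rho z) (vfun rb z)" using relpot_nonneg[OF a \<gamma> r] by simp
      then show "F z \<le> 0 + 2 * er z" unfolding er_eq[OF r z] erel_def F_def e by simp
    qed
  qed
  from esssup_slice_le[OF M this _ _ C] show ?thesis by (simp add: F_def)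
qed

text \<open>The two integrals may be added because both integrands are nonnegative almost everywhere
  and their sum is the integrable function \<open>er0\<close>.\<close>

lemma initial_energy:
  assumes vw: "set_borel_measurable lborel (Omega \<epsilon>) v0" "set_borel_measurable lborel (Omega \<epsilon>) w0"
    and eq: "AE x in lborel. x \<in> Omega \<epsilon> \<longrightarrow> v0 x = vel (rho0 x) (u0 x) (g0 x) \<and> w0 x = drift (rho0 x) (g0 x)"
    and P: "P = pressure_potential (pressure a \<gamma>)"
  shows "1 / measure lborel (Omega \<epsilon>) * (LINT x:Omega \<epsilon>|lborel. 1 / 2 * rho0 x *
             ((norm (w0 x - vertical (wb0 (x $ 3))))\<^sup>2 + (norm (v0 x - vertical (vb0 (x $ 3))))\<^sup>2))
      + 1 / measure lborel (Omega \<epsilon>) * (LINT x:Omega \<epsilon>|lborel. P (rho0 x) - P (rb0 (x $ 3)) - deriv P (rb0 (x $ 3)) * (rho0 x - rb0 (x $ 3)))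
    = 1 / measure lborel (Omega \<epsilon>) * (LINT x:Omega \<epsilon>|lborel. er0 x)"
proof -
  let ?i = "indicator (Omega \<epsilon>) :: _ \<Rightarrow> real"
  define A where "A x = 1 / 2 * rho0 x * ((norm (w0 x - vertical (wb0 (x $ 3))))\<^sup>2 + (norm (v0 x - vertical (vb0 (x $ 3))))\<^sup>2)" for x
  define B where "B x = P (rho0 x) - P (rb0 (x $ 3)) - deriv P (rb0 (x $ 3)) * (rho0 x - rb0 (x $ 3))" for x
  have 0: "0 \<in> {0..<T}" using T by simp
  have y: "x $ 3 \<in> {0<..<1}" if "x \<in> Omega \<epsilon>" for x using that by (simp add: Omega_def)
  have rm: "set_borel_measurable lborel (Omega \<epsilon>) rho0" using ent unfolding entropy_solution_def by blast
  have m3: "(\<lambda>x::real^3. h (x $ 3)) \<in> borel_measurable borel" if "continuous_on UNIV h" for h :: "real \<Rightarrow> real"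
    by (intro borel_measurable_continuous_onI vertical_continuous that)
  note c = periodic_slab0_slice(1)[OF _ 0, of _ UNIV]
  \<comment> \<open>The initial functions rb0, vb0, wb0 are prescribed only on (0, 1), so
    measurability is taken from the continuous values of the solution at t = 0.\<close>
  have "(\<lambda>x. ?i x * (1 / 2 * (?i x *\<^sub>R rho0 x) * ((norm (?i x *\<^sub>R w0 x - (wb 0 (x $ 3)) *\<^sub>R axis 3 1))\<^sup>2 + (norm (?i x *\<^sub>R v0 x - (vb 0 (x $ 3)) *\<^sub>R axis 3 1))\<^sup>2))) \<in> borel_measurable lborel"
    using rm vw m3[OF c[OF slabs0(1)]] m3[OF c[OF slabs0(2)]] unfolding set_borel_measurable_def by measurable
  moreover have "(\<lambda>x. ?i x * (1 / 2 * (?i x *\<^sub>R rho0 x) * ((norm (?i x *\<^sub>R w0 x - (wb 0 (x $ 3)) *\<^sub>R axis 3 1))\<^sup>2 + (norm (?i x *\<^sub>R v0 x - (vb 0 (x $ 3)) *\<^sub>R axis 3 1))\<^sup>2))) = (\<lambda>x. ?i x *\<^sub>R A x)" (is "?l = ?r")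
  proof
    fix x show "?l x = ?r x" by (cases "x \<in> Omega \<epsilon>") (use init[OF y[of x]] in \<open>auto simp: A_def vertical_def\<close>)
  qed
  ultimately have Am: "set_borel_measurable lborel (Omega \<epsilon>) A" by (simp add: set_borel_measurable_def)
  have Pm: "P \<in> borel_measurable borel" unfolding P by (rule pressure_potential_measurable)
  note dP = pressure_potential_deriv[OF \<gamma>, of _ a, folded P]
  have r3: "(\<lambda>x::real^3. rb 0 (x $ 3)) \<in> borel_measurable borel" by (rule m3[OF c[OF slabs0(3)]])
  have "(\<lambda>x. ?i x * (P (?i x *\<^sub>R rho0 x) - P (rb 0 (x $ 3)) - a / (\<gamma> - 1) * (\<gamma> * rb 0 (x $ 3) powr (\<gamma> - 1) - 1) * (?i x *\<^sub>R rho0 x - rb 0 (x $ 3)))) \<in> borel_measurable lborel"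
    using rm r3 measurable_compose[OF rm[unfolded set_borel_measurable_def] Pm] measurable_compose[OF r3 Pm] unfolding set_borel_measurable_def by measurable
  moreover have "(\<lambda>x. ?i x * (P (?i x *\<^sub>R rho0 x) - P (rb 0 (x $ 3)) - a / (\<gamma> - 1) * (\<gamma> * rb 0 (x $ 3) powr (\<gamma> - 1) - 1) * (?i x *\<^sub>R rho0 x - rb 0 (x $ 3)))) = (\<lambda>x. ?i x *\<^sub>R B x)" (is "?l = ?r")
  proof
    fix x show "?l x = ?r x" by (cases "x \<in> Omega \<epsilon>") (use init[OF y[of x]] dP[OF rb_pos[OF 0, of "x $ 3"]] in \<open>auto simp: B_def\<close>)
  qed
  ultimately have Bm: "set_borel_measurable lborel (Omega \<epsilon>) B" by (simp add: set_borel_measurable_def)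
  have AB: "AE x in lborel. x \<in> Omega \<epsilon> \<longrightarrow> 0 \<le> A x \<and> 0 \<le> B x \<and> A x + B x = er0 x"
    using pos(2) eq
  proof eventually_elim
    case (elim x)
    show ?case
    proof
      assume x: "x \<in> Omega \<epsilon>"
      then have r: "rho0 x > 0" and e: "v0 x = vel (rho0 x) (u0 x) (g0 x)" "w0 x = drift (rho0 x) (g0 x)" using elim by blast+
      have i: "rb0 (x $ 3) = rb 0 (x $ 3)" "vb0 (x $ 3) = vb 0 (x $ 3)" "wb0 (x $ 3) = wb 0 (x $ 3)" using init[OF y[OF x]] by auto
      have Bx: "B x = relpot a \<gamma> (rho0 x) (rb 0 (x $ 3))" unfolding B_def i P by (rule pressure_potential_bregman[OF \<gamma> rb_pos[OF 0] r])
      moreover have "0 \<le> relpot a \<gamma> (rho0 x) (rb 0 (x $ 3))" by (rule relpot_nonneg[OF a \<gamma> r rb_pos[OF 0]])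
      moreover have "0 \<le> A x" unfolding A_def using r by simp
      ultimately show "0 \<le> A x \<and> 0 \<le> B x \<and> A x + B x = er0 x" unfolding er0_eq[OF r] erel_def A_def i e by simp
    qed
  qed
  have Ai: "set_integrable lborel (Omega \<epsilon>) A"
    by (rule set_integrable_bound[OF er0_integral(1) Am]) (use AB in \<open>eventually_elim, auto\<close>)
  have Bi: "set_integrable lborel (Omega \<epsilon>) B"
    by (rule set_integrable_bound[OF er0_integral(1) Bm]) (use AB in \<open>eventually_elim, auto\<close>)
  have "(LINT x:Omega \<epsilon>|lborel. A x) + (LINT x:Omega \<epsilon>|lborel. B x) = (LINT x:Omega \<epsilon>|lborel. A x + B x)"
    using set_integral_add(2)[OF Ai Bi] by simp
  also have "\<dots> = (LINT x:Omega \<epsilon>|lborel. er0 x)"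
    by (rule set_integral_cong_AE_integrable[OF set_integral_add(1)[OF Ai Bi] er0_integral(1)]) (use AB in \<open>eventually_elim, auto\<close>)
  finally show ?thesis unfolding A_def[symmetric] B_def[symmetric] distrib_left[symmetric] by simp
qed

end

theorem theorem3:
  fixes T \<mu> a \<gamma> \<kappa> :: real
    and p P e :: "real \<Rightarrow> real"
    and rb vb wb :: "real \<Rightarrow> real \<Rightarrow> real"
    and rb0 vb0 wb0 :: "real \<Rightarrow> real"
    and rho :: "real \<Rightarrow> real \<times> (real^3) \<Rightarrow> real"
    and v w :: "real \<Rightarrow> real \<times> (real^3) \<Rightarrow> real^3"
    and rho0 :: "real \<Rightarrow> real^3 \<Rightarrow> real"
    and v0 w0 :: "real \<Rightarrow> real^3 \<Rightarrow> real^3"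
  assumes "T > 0" "\<mu> > 0" "a > 0" "\<gamma> > 1" "0 < \<kappa>" "\<kappa> < 1"
    and p_def: "p = pressure a \<gamma>"
    and P_def: "P = pressure_potential p"
    and e: "\<forall>r>0. (e has_real_derivative p r / r\<^sup>2) (at r)"
    and sol_1d: "augmented_solution_1d T \<kappa> \<mu> p rb vb wb rb0 vb0 wb0"
    and reg_u: "Linfty_on ({0<..<T} \<times> {0<..<1}) (\<lambda>(t, y). deriv (velocity_1d \<kappa> vb wb t) y)"
    and reg_rho1: "Linfty_on ({0<..<T} \<times> {0<..<1}) (\<lambda>(t, y). deriv (\<lambda>z. ln (rb t z)) y)"
    and reg_rho2: "Linfty_on ({0<..<T} \<times> {0<..<1}) (\<lambda>(t, y). deriv (deriv (\<lambda>z. ln (rb t z))) y)"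
    and sol_3d: "\<forall>\<epsilon>>0. augmented_solution_3d T \<epsilon> \<kappa> \<mu> p e
                   (rho \<epsilon>) (v \<epsilon>) (w \<epsilon>) (rho0 \<epsilon>) (v0 \<epsilon>) (w0 \<epsilon>)"
    and initial: "((\<lambda>\<epsilon>.
        1 / measure lborel (Omega \<epsilon>) *
          (LINT x:Omega \<epsilon>|lborel. 1 / 2 * rho0 \<epsilon> x *
             ((norm (w0 \<epsilon> x - vertical (wb0 (x $ 3))))\<^sup>2
            + (norm (v0 \<epsilon> x - vertical (vb0 (x $ 3))))\<^sup>2))
      + 1 / measure lborel (Omega \<epsilon>) *
          (LINT x:Omega \<epsilon>|lborel. P (rho0 \<epsilon> x) - P (rb0 (x $ 3))
             - deriv P (rb0 (x $ 3)) * (rho0 \<epsilon> x - rb0 (x $ 3))))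
      \<longlongrightarrow> 0) (at_right 0)"
  shows "((\<lambda>\<epsilon>. esssup (restrict_space lborel {0<..<T}) (\<lambda>t.
            (\<integral>\<^sup>+x\<in>Omega \<epsilon>. ennreal (\<bar>rho \<epsilon> (t, x) - rb t (x $ 3)\<bar> powr min 2 \<gamma>) \<partial>lborel)
              / emeasure lborel (Omega \<epsilon>)))
          \<longlongrightarrow> 0) (at_right 0) \<and>
         ((\<lambda>\<epsilon>. esssup (restrict_space lborel {0<..<T}) (\<lambda>t.
            (\<integral>\<^sup>+x\<in>Omega \<epsilon>. ennreal (rho \<epsilon> (t, x) *
               ((norm (w \<epsilon> (t, x) - vertical (wb t (x $ 3))))\<^sup>2
              + (norm (v \<epsilon> (t, x) - vertical (vb t (x $ 3))))\<^sup>2)) \<partial>lborel)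
              / emeasure lborel (Omega \<epsilon>)))
          \<longlongrightarrow> 0) (at_right 0)"
    (is "((\<lambda>\<epsilon>. ?D \<epsilon>) \<longlongrightarrow> 0) _ \<and> ((\<lambda>\<epsilon>. ?W \<epsilon>) \<longlongrightarrow> 0) _")
proof -
  interpret D: one_dim_solution T \<mu> a \<gamma> \<kappa> rb vb wb rb0 vb0 wb0
    by (rule one_dim_solution.intro[OF assms(1-6) sol_1d[unfolded p_def] reg_u reg_rho1 reg_rho2])
  define I where "I \<epsilon> = 1 / measure lborel (Omega \<epsilon>) *
          (LINT x:Omega \<epsilon>|lborel. 1 / 2 * rho0 \<epsilon> x * ((norm (w0 \<epsilon> x - vertical (wb0 (x $ 3))))\<^sup>2 + (norm (v0 \<epsilon> x - vertical (vb0 (x $ 3))))\<^sup>2))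
      + 1 / measure lborel (Omega \<epsilon>) *
          (LINT x:Omega \<epsilon>|lborel. P (rho0 \<epsilon> x) - P (rb0 (x $ 3)) - deriv P (rb0 (x $ 3)) * (rho0 \<epsilon> x - rb0 (x $ 3)))" for \<epsilon>
  have I: "(I \<longlongrightarrow> 0) (at_right 0)" using initial unfolding I_def[abs_def] .
  \<comment> \<open>C comes from the one-dimensional solution alone and is fixed before
    \<epsilon>.\<close>
  obtain C where C: "D.balance_const C" using D.balance_const_exists by blast
  \<comment> \<open>The fields u, g, G, u0, g0 exist for each \<epsilon> separately, so both errors
    are estimated for one \<epsilon> at a time, in terms of quantities that do not mention
    them.\<close>
  have bounds: "(\<delta> \<ge> 0 \<longrightarrow> K \<ge> 0 \<longrightarrow> (\<forall>t\<in>{0<..<T}. \<forall>y\<in>{0<..<1}. \<forall>\<rho>>0. \<bar>\<rho> - rb t y\<bar> powr min 2 \<gamma> \<le> \<delta> + K * relpot a \<gamma> \<rho> (rb t y))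
      \<longrightarrow> ?D \<epsilon> \<le> ennreal (\<delta> + K * exp (C * T) * I \<epsilon>)) \<and> ?W \<epsilon> \<le> ennreal (0 + 2 * exp (C * T) * I \<epsilon>)" if \<epsilon>: "\<epsilon> > 0" for \<epsilon> \<delta> K
  proof -
    have "augmented_solution_3d T \<epsilon> \<kappa> \<mu> (pressure a \<gamma>) e (rho \<epsilon>) (v \<epsilon>) (w \<epsilon>) (rho0 \<epsilon>) (v0 \<epsilon>) (w0 \<epsilon>)"
      using sol_3d \<epsilon> p_def by simp
    then obtain u g G u0 g0 where
      ent: "entropy_solution T \<epsilon> \<kappa> (\<lambda>r. \<mu> * r) (\<lambda>r. 0) (\<lambda>r. \<mu> * ln r) (pressure a \<gamma>) e (rho \<epsilon>) u g G (rho0 \<epsilon>) u0 g0"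
      and m: "set_borel_measurable lborel (cyl T \<epsilon>) (v \<epsilon>)" "set_borel_measurable lborel (cyl T \<epsilon>) (w \<epsilon>)"
        "set_borel_measurable lborel (Omega \<epsilon>) (v0 \<epsilon>)" "set_borel_measurable lborel (Omega \<epsilon>) (w0 \<epsilon>)"
      and eq: "AE z in lborel. z \<in> cyl T \<epsilon> \<longrightarrow> v \<epsilon> z = u z + (2 * \<kappa> * \<mu>) *\<^sub>R ((1 / rho \<epsilon> z) *\<^sub>R g z) \<and>
           w \<epsilon> z = (2 * sqrt (\<kappa> * (1 - \<kappa>)) * \<mu>) *\<^sub>R ((1 / rho \<epsilon> z) *\<^sub>R g z)"
      and eq0: "AE x in lborel. x \<in> Omega \<epsilon> \<longrightarrow> v0 \<epsilon> x = u0 x + (2 * \<kappa> * \<mu>) *\<^sub>R ((1 / rho0 \<epsilon> x) *\<^sub>R g0 x) \<and>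
           w0 \<epsilon> x = (2 * sqrt (\<kappa> * (1 - \<kappa>)) * \<mu>) *\<^sub>R ((1 / rho0 \<epsilon> x) *\<^sub>R g0 x)"
      unfolding augmented_solution_3d_def by blast
    interpret P: solution_pair T \<mu> a \<gamma> \<kappa> rb vb wb rb0 vb0 wb0 \<epsilon> e "rho \<epsilon>" u g G "rho0 \<epsilon>" u0 g0
      by (rule solution_pair.intro[OF D.one_dim_solution_axioms solution_pair_axioms.intro[OF \<epsilon> _ ent]]) (use e p_def in simp)
    have Ie: "I \<epsilon> = 1 / measure lborel (Omega \<epsilon>) * (LINT x:Omega \<epsilon>|lborel. P.er0 x)"
      unfolding I_def by (rule P.initial_energy[OF m(3,4)]) (use eq0 P_def p_def in \<open>simp_all add: P.vel_def P.drift_def D.s_def\<close>)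
    have "?W \<epsilon> \<le> ennreal (0 + 2 * exp (C * T) * I \<epsilon>)"
      unfolding Ie by (rule P.velocity_error[OF C m(1,2)]) (use eq in \<open>simp add: P.vel_def P.drift_def D.s_def\<close>)
    moreover have "?D \<epsilon> \<le> ennreal (\<delta> + K * exp (C * T) * I \<epsilon>)" if "\<delta> \<ge> 0" "K \<ge> 0"
      "\<forall>t\<in>{0<..<T}. \<forall>y\<in>{0<..<1}. \<forall>\<rho>>0. \<bar>\<rho> - rb t y\<bar> powr min 2 \<gamma> \<le> \<delta> + K * relpot a \<gamma> \<rho> (rb t y)"
      unfolding Ie by (rule P.density_error[OF C that(1,2)]) (use that(3) \<open>\<gamma> > 1\<close> in auto)
    ultimately show ?thesis by (intro conjI impI)
  qed
  have ev: "\<forall>\<^sub>F \<epsilon>::real in at_right 0. \<epsilon> > 0" by (simp add: eventually_at_right_less)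
  have "((\<lambda>\<epsilon>. ?D \<epsilon>) \<longlongrightarrow> 0) (at_right 0)"
  proof (rule tendsto_ennreal_0[OF I])
    fix \<delta> :: real assume \<delta>: "\<delta> > 0"
    obtain c1 c2 where c: "0 < c1" "c1 \<le> c2" "\<forall>t\<in>{0<..<T}. \<forall>y\<in>{0<..<1}. c1 \<le> rb t y \<and> rb t y \<le> c2"
      using D.density_bounds by blast
    \<comment> \<open>As c1 and c2 bound the density at all times, K depends only on \<delta> and on
      the one-dimensional problem, not on \<epsilon>.\<close>
    obtain K where K: "K > 0" "\<forall>\<rho>>0. \<forall>r\<in>{c1..c2}. \<bar>\<rho> - r\<bar> powr min 2 \<gamma> \<le> \<delta> + K * relpot a \<gamma> \<rho> r"
      using relpot_distance[OF \<open>a > 0\<close> \<open>\<gamma> > 1\<close> c(1,2) _ _ \<delta>, of "min 2 \<gamma>"] \<open>\<gamma> > 1\<close> by auto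
    have "\<forall>t\<in>{0<..<T}. \<forall>y\<in>{0<..<1}. \<forall>\<rho>>0. \<bar>\<rho> - rb t y\<bar> powr min 2 \<gamma> \<le> \<delta> + K * relpot a \<gamma> \<rho> (rb t y)"
      using K(2) c(3) by simp
    then have "?D \<epsilon> \<le> ennreal (\<delta> + K * exp (C * T) * I \<epsilon>)" if "\<epsilon> > 0" for \<epsilon>
      using bounds[OF that, of \<delta> K] \<delta> K(1) by simp
    then show "\<exists>L. \<forall>\<^sub>F \<epsilon> in at_right 0. ?D \<epsilon> \<le> ennreal (\<delta> + L * I \<epsilon>)"
      by (intro exI[of _ "K * exp (C * T)"] eventually_mono[OF ev])
  qed
  moreover have "((\<lambda>\<epsilon>. ?W \<epsilon>) \<longlongrightarrow> 0) (at_right 0)"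
  proof (rule tendsto_ennreal_0[OF I])
    fix \<delta> :: real assume \<delta>: "\<delta> > 0"
    have "?W \<epsilon> \<le> ennreal (\<delta> + 2 * exp (C * T) * I \<epsilon>)" if "\<epsilon> > 0" for \<epsilon>
      using order.trans[OF bounds[OF that, of 0 0, THEN conjunct2]] \<delta> by (simp add: ennreal_leI)
    then show "\<exists>L. \<forall>\<^sub>F \<epsilon> in at_right 0. ?W \<epsilon> \<le> ennreal (\<delta> + L * I \<epsilon>)"
      by (intro exI[of _ "2 * exp (C * T)"] eventually_mono[OF ev])
  qed
  ultimately show ?thesis by blast
qed

end
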